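(* Let $R$ be a commutative noetherian local ring and let $M$ and $N$ be non-acyclic complexes in $\mathsf{D}^{\mathrm{f}}_{b}(R)$. Consider the conditions: (1) $M$ is perfect. (2) $N$ is perfect. (3) $\operatorname{pd}_R \mathbf{R}\mathrm{Hom}_R(M,N)$ is finite. If two of the conditions (1)–(3) are satisfied, then so is the third condition, and $\mathbf{R}\mathrm{Hom}_R(M,N)$ is a perfect complex with $$\operatorname{pd}_R \mathbf{R}\mathrm{Hom}_R(M,N) = \operatorname{pd}_R N - \inf M .$$
   Context: Complexes are indexed homologically. $\mathsf{D}(R)$ is the (unbounded) derived category of $R$-modules; $\mathsf{D}^{\mathrm{f}}_{b}(R)$ is its full subcategory of complexes whose total homology is bounded and finitely generated in each degree. For an arbitrary complex $X$ in $\mathsf{D}(R)$ (no boundedness of homology is required), $\operatorname{pd}_R X$ is the infimum of the integers $n$ such that $X$ is isomorphic in $\mathsf{D}(R)$ to a semi-projective (K-projective with projective components) complex $P$ with $P_v=0$ for all $v>n$. It is called finite if it is $<\infty$. $\inf X=\inf\{v\mid H_v(X)\neq 0\}$. A complex in $\mathsf{D}^{\mathrm{f}}_{b}(R)$ is perfect if it is isomorphic in $\mathsf{D}(R)$ to a bounded complex of finitely generated free $R$-modules (equivalently, its projective dimension is finite). *)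

theory Defs
  imports
    "HOL-Algebra.Module"
    "HOL-Algebra.Ring_Divisibility"
    "HOL-Algebra.AbelCoset"
    "HOL-Library.Extended_Real"
begin

text \<open>
  Homological algebra over a commutative ring, in the carrier-based style of HOL-Algebra.
  Complexes are indexed homologically and need not be bounded.

  A definition that quantifies over all modules or complexes has to say in which type their
  elements live. Let the ring have elements in \<open>'a\<close> and let \<open>X\<close> be a module or complex with elements
  in \<open>'x\<close>. Auxiliary objects attached to \<open>X\<close> then have elements in \<open>('a, 'x) univ\<close>, a type into which
  every set of cardinality at most \<open>max(|'a|, |'x|, \<aleph>\<^sub>0)\<close> embeds. Hence it contains, up to isomorphism,
  the free module on the elements of a module \<open>X\<close>, a semi-free resolution of a complex \<open>X\<close>, all
  submodules and quotients of these, and the cones of maps between them; this is why none of the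
  definitions below depends on the choice of this type.
  For instance, projectivity is detected by lifting \<open>id\<close> along the free module on the elements of \<open>X\<close>.
  If \<open>F \<rightarrow> X\<close> is a surjective semi-free resolution then its kernel \<open>K\<close> is acyclic, and if
  \<open>Hom(X, K)\<close> is acyclic then \<open>id\<close> lifts to \<open>F\<close> up to homotopy; so K-projectivity is also detected.
  If \<open>X\<close> is isomorphic in the derived category to a semi-projective complex, of whatever size, that
  vanishes above degree \<open>n\<close>, then it is also isomorphic to the quotient of \<open>F\<close> that is the cokernel of
  \<open>F\<^sub>n\<^sub>+\<^sub>1 \<rightarrow> F\<^sub>n\<close> in degree \<open>n\<close> and \<open>0\<close> above, and this quotient is again semi-projective.
\<close>

type_synonym ('a, 'x) univ = "('a + 'x) list"


section \<open>Rings and modules\<close>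

definition local_ring :: "('a, 'r) ring_scheme \<Rightarrow> bool" where
  "local_ring R \<longleftrightarrow> cring R \<and> (\<exists>!\<mm>. maximalideal \<mm> R)"

definition zero_module :: "('a, 'x) module \<Rightarrow> bool" where
  "zero_module M \<longleftrightarrow> carrier M = {\<zero>\<^bsub>M\<^esub>}"

definition lin_map ::
    "('a, 'r) ring_scheme \<Rightarrow> ('a, 'x) module \<Rightarrow> ('a, 'y) module \<Rightarrow> ('x \<Rightarrow> 'y) \<Rightarrow> bool" where
  "lin_map R M N f \<longleftrightarrow>
     f \<in> carrier M \<rightarrow> carrier N \<and>
     (\<forall>x\<in>carrier M. \<forall>y\<in>carrier M. f (x \<oplus>\<^bsub>M\<^esub> y) = f x \<oplus>\<^bsub>N\<^esub> f y) \<and>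
     (\<forall>r\<in>carrier R. \<forall>x\<in>carrier M. f (r \<odot>\<^bsub>M\<^esub> x) = r \<odot>\<^bsub>N\<^esub> f x)"

definition fin_gen :: "('a, 'r) ring_scheme \<Rightarrow> ('a, 'x) module \<Rightarrow> bool" where
  "fin_gen R M \<longleftrightarrow>
     (\<exists>S. finite S \<and> S \<subseteq> carrier M \<and> (\<forall>H. submodule H R M \<and> S \<subseteq> H \<longrightarrow> H = carrier M))"

definition fin_gen_free :: "('a, 'r) ring_scheme \<Rightarrow> ('a, 'x) module \<Rightarrow> bool" where
  "fin_gen_free R M \<longleftrightarrow> Module.module R M \<and>
     (\<exists>B. finite B \<and> B \<subseteq> carrier M \<and>
        (\<forall>x\<in>carrier M. \<exists>!c. c \<in> B \<rightarrow>\<^sub>E carrier R \<and> x = (\<Oplus>\<^bsub>M\<^esub>b\<in>B. c b \<odot>\<^bsub>M\<^esub> b)))"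

definition projective :: "('a, 'r) ring_scheme \<Rightarrow> ('a, 'x) module \<Rightarrow> bool" where
  "projective R P \<longleftrightarrow> Module.module R P \<and>
     (\<forall>(A :: ('a, ('a, 'x) univ) module) (B :: ('a, ('a, 'x) univ) module) g f.
        Module.module R A \<and> Module.module R B \<and>
        lin_map R A B g \<and> g ` carrier A = carrier B \<and> lin_map R P B f \<longrightarrow>
        (\<exists>h. lin_map R P A h \<and> (\<forall>x\<in>carrier P. g (h x) = f x)))"


section \<open>Complexes and homology\<close>

text \<open>\<open>cx_d X n\<close> is the differential from degree \<open>n\<close> to degree \<open>n - 1\<close>; its values outside the carrier
  are irrelevant.\<close>

record ('a, 'x) chain_cx =
  cx_mod :: "int \<Rightarrow> ('a, 'x) module"
  cx_d :: "int \<Rightarrow> 'x \<Rightarrow> 'x"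

definition chain_complex :: "('a, 'r) ring_scheme \<Rightarrow> ('a, 'x) chain_cx \<Rightarrow> bool" where
  "chain_complex R X \<longleftrightarrow>
     (\<forall>n. Module.module R (cx_mod X n)) \<and>
     (\<forall>n. lin_map R (cx_mod X n) (cx_mod X (n - 1)) (cx_d X n)) \<and>
     (\<forall>n. \<forall>x\<in>carrier (cx_mod X n). cx_d X (n - 1) (cx_d X n x) = \<zero>\<^bsub>cx_mod X (n - 1 - 1)\<^esub>)"

definition cycles :: "('a, 'x) chain_cx \<Rightarrow> int \<Rightarrow> 'x set" where
  "cycles X n = {x \<in> carrier (cx_mod X n). cx_d X n x = \<zero>\<^bsub>cx_mod X (n - 1)\<^esub>}"

definition boundaries :: "('a, 'x) chain_cx \<Rightarrow> int \<Rightarrow> 'x set" where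
  "boundaries X n = cx_d X (n + 1) ` carrier (cx_mod X (n + 1))"

definition hclass :: "('a, 'x) chain_cx \<Rightarrow> int \<Rightarrow> 'x \<Rightarrow> 'x set" where
  "hclass X n z = boundaries X n +>\<^bsub>cx_mod X n\<^esub> z"

text \<open>The elements of homology are cosets of the boundaries; the ring multiplication of the record is
  not part of a module structure. In the scalar multiplication and in the induced map, the union
  runs over a family of sets all of which are the same coset.\<close>

definition homology :: "('a, 'x) chain_cx \<Rightarrow> int \<Rightarrow> ('a, 'x set) module" where
  "homology X n =
     \<lparr>carrier = hclass X n ` cycles X n,
      mult = undefined,
      one = undefined,
      zero = boundaries X n,
      add = (\<lambda>C D. C <+>\<^bsub>cx_mod X n\<^esub> D),
      smult = (\<lambda>r C. \<Union>z\<in>C. hclass X n (r \<odot>\<^bsub>cx_mod X n\<^esub> z))\<rparr>"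

definition acyclic_cx :: "('a, 'x) chain_cx \<Rightarrow> bool" where
  "acyclic_cx X \<longleftrightarrow> (\<forall>n. zero_module (homology X n))"

definition chain_map ::
    "('a, 'r) ring_scheme \<Rightarrow> ('a, 'x) chain_cx \<Rightarrow> ('a, 'y) chain_cx \<Rightarrow> (int \<Rightarrow> 'x \<Rightarrow> 'y) \<Rightarrow> bool" where
  "chain_map R X Y f \<longleftrightarrow>
     (\<forall>n. lin_map R (cx_mod X n) (cx_mod Y n) (f n)) \<and>
     (\<forall>n. \<forall>x\<in>carrier (cx_mod X n). f (n - 1) (cx_d X n x) = cx_d Y n (f n x))"

definition homology_map :: "('a, 'y) chain_cx \<Rightarrow> (int \<Rightarrow> 'x \<Rightarrow> 'y) \<Rightarrow> int \<Rightarrow> 'x set \<Rightarrow> 'y set" where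
  "homology_map Y f n C = (\<Union>z\<in>C. hclass Y n (f n z))"

definition quasi_iso ::
    "('a, 'r) ring_scheme \<Rightarrow> ('a, 'x) chain_cx \<Rightarrow> ('a, 'y) chain_cx \<Rightarrow> (int \<Rightarrow> 'x \<Rightarrow> 'y) \<Rightarrow> bool" where
  "quasi_iso R X Y f \<longleftrightarrow> chain_map R X Y f \<and>
     (\<forall>n. bij_betw (homology_map Y f n) (carrier (homology X n)) (carrier (homology Y n)))"


section \<open>The derived category\<close>

text \<open>A morphism from \<open>X\<close> to \<open>Y\<close> in the derived category is represented by a roof \<open>X \<leftarrow> Z \<rightarrow> Y\<close> whose
  first leg is a quasi-isomorphism, and it is invertible iff the second leg is one as well.\<close>

definition derived_iso ::
    "('a, 'r) ring_scheme \<Rightarrow> ('a, 'x) chain_cx \<Rightarrow> ('a, 'y) chain_cx \<Rightarrow> bool" where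
  "derived_iso R X Y \<longleftrightarrow>
     (\<exists>(Z :: ('a, ('a, 'x + 'y) univ) chain_cx) f g.
        chain_complex R Z \<and> quasi_iso R Z X f \<and> quasi_iso R Z Y g)"

definition Dfb :: "('a, 'r) ring_scheme \<Rightarrow> ('a, 'x) chain_cx \<Rightarrow> bool" where
  "Dfb R X \<longleftrightarrow> chain_complex R X \<and>
     (\<exists>a b. \<forall>n. n < a \<or> b < n \<longrightarrow> zero_module (homology X n)) \<and>
     (\<forall>n. fin_gen R (homology X n))"

definition hinf :: "('a, 'x) chain_cx \<Rightarrow> ereal" where
  "hinf X = Inf {ereal (real_of_int v) | v. \<not> zero_module (homology X v)}"

definition perfect :: "('a, 'r) ring_scheme \<Rightarrow> ('a, 'x) chain_cx \<Rightarrow> bool" where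
  "perfect R X \<longleftrightarrow> Dfb R X \<and>
     (\<exists>F :: ('a, ('a, 'x) univ) chain_cx.
        chain_complex R F \<and>
        (\<forall>n. fin_gen_free R (cx_mod F n)) \<and>
        (\<exists>a b. \<forall>n. n < a \<or> b < n \<longrightarrow> zero_module (cx_mod F n)) \<and>
        derived_iso R X F)"

text \<open>An element of degree \<open>n\<close> of \<open>Hom(P, N)\<close> is a family of linear maps \<open>f i : P\<^sub>i \<rightarrow> N\<^sub>i\<^sub>+\<^sub>n\<close>, made
  unique as a HOL function by requiring it to be undefined outside the carriers. The differential is
  \<open>f \<mapsto> d\<^sup>N f - (-1)\<^sup>n f d\<^sup>P\<close>.\<close>

definition Hom_cx ::
    "('a, 'r) ring_scheme \<Rightarrow> ('a, 'p) chain_cx \<Rightarrow> ('a, 'n) chain_cx \<Rightarrow>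
     ('a, int \<Rightarrow> 'p \<Rightarrow> 'n) chain_cx" where
  "Hom_cx R P N =
     \<lparr>cx_mod = (\<lambda>n.
        \<lparr>carrier = {f. \<forall>i. f i \<in> extensional (carrier (cx_mod P i)) \<and>
                           lin_map R (cx_mod P i) (cx_mod N (i + n)) (f i)},
         mult = undefined,
         one = undefined,
         zero = (\<lambda>i. \<lambda>x\<in>carrier (cx_mod P i). \<zero>\<^bsub>cx_mod N (i + n)\<^esub>),
         add = (\<lambda>f g i. \<lambda>x\<in>carrier (cx_mod P i). f i x \<oplus>\<^bsub>cx_mod N (i + n)\<^esub> g i x),
         smult = (\<lambda>r f i. \<lambda>x\<in>carrier (cx_mod P i). r \<odot>\<^bsub>cx_mod N (i + n)\<^esub> f i x)\<rparr>),
      cx_d = (\<lambda>n f i. \<lambda>x\<in>carrier (cx_mod P i).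
         if even n
         then cx_d N (i + n) (f i x) \<ominus>\<^bsub>cx_mod N (i + n - 1)\<^esub> f (i - 1) (cx_d P i x)
         else cx_d N (i + n) (f i x) \<oplus>\<^bsub>cx_mod N (i + n - 1)\<^esub> f (i - 1) (cx_d P i x))\<rparr>"

definition K_projective :: "('a, 'r) ring_scheme \<Rightarrow> ('a, 'x) chain_cx \<Rightarrow> bool" where
  "K_projective R P \<longleftrightarrow> chain_complex R P \<and>
     (\<forall>A :: ('a, ('a, 'x) univ) chain_cx.
        chain_complex R A \<and> acyclic_cx A \<longrightarrow> acyclic_cx (Hom_cx R P A))"

definition semi_projective :: "('a, 'r) ring_scheme \<Rightarrow> ('a, 'x) chain_cx \<Rightarrow> bool" where
  "semi_projective R P \<longleftrightarrow> K_projective R P \<and> (\<forall>n. projective R (cx_mod P n))"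

text \<open>The infimum is taken in the extended reals: it is \<open>\<infinity>\<close> if there is no such \<open>n\<close>, and \<open>-\<infinity>\<close> if
  \<open>X\<close> is acyclic.\<close>

definition pd :: "('a, 'r) ring_scheme \<Rightarrow> ('a, 'x) chain_cx \<Rightarrow> ereal" where
  "pd R X = Inf {ereal (real_of_int n) | n.
     \<exists>P :: ('a, ('a, 'x) univ) chain_cx.
       semi_projective R P \<and> derived_iso R X P \<and> (\<forall>v>n. zero_module (cx_mod P v))}"

definition semiproj_resolution ::
    "('a, 'r) ring_scheme \<Rightarrow> ('a, 'x) chain_cx \<Rightarrow> ('a, ('a, 'x) univ) chain_cx" where
  "semiproj_resolution R X = (SOME P. semi_projective R P \<and> (\<exists>f. quasi_iso R P X f))"

definition RHom ::
    "('a, 'r) ring_scheme \<Rightarrow> ('a, 'm) chain_cx \<Rightarrow> ('a, 'n) chain_cx \<Rightarrow>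
     ('a, int \<Rightarrow> ('a, 'm) univ \<Rightarrow> 'n) chain_cx" where
  "RHom R M N = Hom_cx R (semiproj_resolution R M) N"

end

theory Submission
 imports Defs
begin

text \<open>Let \<open>F\<close> and \<open>G\<close> be the minimal free resolutions of \<open>M\<close> and \<open>N\<close>. Perfection of \<open>M\<close> means that \<open>F\<close>
is bounded, and whenever \<open>L = Hom(F, G)\<close> consists of finitely generated modules it is a minimal complex of free
modules isomorphic to \<open>RHom(M, N)\<close>. The projective dimension of a minimal complex that is bounded above is the largest degree in
which it is nonzero; this settles the case of a perfect \<open>M\<close> and gives the formula.

Let \<open>N\<close> be perfect and \<open>pd RHom(M, N)\<close> finite. Then \<open>L\<close> is bounded above, but possibly unbounded below and not
semi-free. On a semi-free resolution \<open>S\<close> of \<open>L\<close> the identity is homotopic to a map that vanishes in high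
degrees. The cone \<open>C\<close> of \<open>S \<rightarrow> L\<close> is an acyclic complex of free modules, and \<open>C \<otimes> Q\<close> is exact in
high degrees for every module \<open>Q\<close>; an argument with associated primes shows that \<open>C \<otimes> Q\<close> is exact everywhere for finitely
generated \<open>Q\<close>. The dual of \<open>L\<close> is exact in high degrees because \<open>G\<close> and the homology of \<open>M\<close> are bounded. A zigzag through \<open>C\<close> and
tensor products with the dual of \<open>L\<close> then produces an endomorphism of that dual, homotopic to the identity and zero in high
degrees. By minimality the dual of \<open>L\<close> vanishes in high degrees, and hence so does \<open>F\<close>.\<close>

text \<open>The obstacle is the case that N is perfect and RHom(M, N) has finite projective
  dimension. The Hom complex L of the minimal resolutions may then be unbounded below and need not
  be semi-free: S \<rightarrow> L may have no homotopy inverse, and the relation dh + hd = 1 in high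
  degrees is available on S only, where minimality is not. It reaches the dual V of L as follows.
  Let V be exact above degree s and let U be the module of boundaries in degree s. The identity of
  the finite free module V_s, read as an element of L \<otimes> V_s, is a cycle modulo U. Exactness
  of C \<otimes> (V_s/U) makes it a boundary. The component of the primitive in S \<otimes> V_s can
  be lifted along V step by step, and this ends after finitely many steps: only finitely many
  generators of S occur, and the differential lowers their heights. A second concern is size: the
  definitions test K-projectivity on complexes of one element type, whereas the cones that occur
  here have others.\<close>

abbreviation cx_at :: "('a, 'x) chain_cx \<Rightarrow> int \<Rightarrow> ('a, 'x) module" (infixl "$" 999) where "X$n \<equiv> cx_mod X n"
abbreviation cx_el :: "('a, 'x) chain_cx \<Rightarrow> int \<Rightarrow> 'x set" (infixl "$$" 999) where "X$$n \<equiv> carrier (X$n)"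

section \<open>Modules and linear maps\<close>

context abelian_group
begin

text \<open>After AC normalisation \<open>x\<close> and its inverse can be separated by other
  summands. The rules cancel such pairs across the distances that occur in the sums below.\<close>

lemma grp_cancel:
 assumes "x \<in> carrier G"
 shows "x \<oplus> \<ominus> x = \<zero>"
  and "b \<in> carrier G \<Longrightarrow> x \<oplus> (\<ominus> x \<oplus> b) = b"
  and "a \<in> carrier G \<Longrightarrow> x \<oplus> (a \<oplus> \<ominus> x) = a"
  and "a \<in> carrier G \<Longrightarrow> b \<in> carrier G \<Longrightarrow> x \<oplus> (a \<oplus> (\<ominus> x \<oplus> b)) = a \<oplus> b"
  and "a \<in> carrier G \<Longrightarrow> b \<in> carrier G \<Longrightarrow> x \<oplus> (a \<oplus> (b \<oplus> \<ominus> x)) = a \<oplus> b"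
  and "a \<in> carrier G \<Longrightarrow> b \<in> carrier G \<Longrightarrow> c \<in> carrier G \<Longrightarrow>
   x \<oplus> (a \<oplus> (b \<oplus> (\<ominus> x \<oplus> c))) = a \<oplus> (b \<oplus> c)"
  and "a \<in> carrier G \<Longrightarrow> b \<in> carrier G \<Longrightarrow> c \<in> carrier G \<Longrightarrow>
   x \<oplus> (a \<oplus> (b \<oplus> (c \<oplus> \<ominus> x))) = a \<oplus> (b \<oplus> c)"
  and "a \<in> carrier G \<Longrightarrow> b \<in> carrier G \<Longrightarrow> c \<in> carrier G \<Longrightarrow> d \<in> carrier G \<Longrightarrow>
   x \<oplus> (a \<oplus> (b \<oplus> (c \<oplus> (\<ominus> x \<oplus> d)))) = a \<oplus> (b \<oplus> (c \<oplus> d))"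
 using assms by (simp_all add: r_neg r_neg1 r_neg2 a_assoc[symmetric])
  (simp_all add: a_comm a_lcomm r_neg r_neg1 r_neg2 a_assoc)

lemmas grp_simps = a_minus_def a_ac minus_add grp_cancel

end

lemma lin_mapI:
 assumes "\<And>x. x \<in> carrier M \<Longrightarrow> f x \<in> carrier N"
  and "\<And>x y. x \<in> carrier M \<Longrightarrow> y \<in> carrier M \<Longrightarrow> f (x \<oplus>\<^bsub>M\<^esub> y) = f x \<oplus>\<^bsub>N\<^esub> f y"
  and "\<And>r x. r \<in> carrier R \<Longrightarrow> x \<in> carrier M \<Longrightarrow> f (r \<odot>\<^bsub>M\<^esub> x) = r \<odot>\<^bsub>N\<^esub> f x"
 shows "lin_map R M N f"
 using assms unfolding lin_map_def by auto

lemma lin_closed: "lin_map R M N f \<Longrightarrow> x \<in> carrier M \<Longrightarrow> f x \<in> carrier N"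
 unfolding lin_map_def by auto

lemma lin_add:
 "lin_map R M N f \<Longrightarrow> x \<in> carrier M \<Longrightarrow> y \<in> carrier M \<Longrightarrow> f (x \<oplus>\<^bsub>M\<^esub> y) = f x \<oplus>\<^bsub>N\<^esub> f y"
 unfolding lin_map_def by auto

lemma lin_smult:
 "lin_map R M N f \<Longrightarrow> r \<in> carrier R \<Longrightarrow> x \<in> carrier M \<Longrightarrow> f (r \<odot>\<^bsub>M\<^esub> x) = r \<odot>\<^bsub>N\<^esub> f x"
 unfolding lin_map_def by auto

lemma lin_cong:
 assumes "lin_map R M N f" "\<And>x. x \<in> carrier M \<Longrightarrow> g x = f x" "Module.module R M"
 shows "lin_map R M N g"
proof -
 interpret M: Module.module R M by fact
 show ?thesis
  by (rule lin_mapI) (use assms(1,2) in \<open>auto simp: lin_closed lin_add lin_smult\<close>)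
qed

lemma lin_comp:
 "lin_map R M N f \<Longrightarrow> lin_map R N K g \<Longrightarrow> lin_map R M K (\<lambda>x. g (f x))"
 by (rule lin_mapI) (auto simp: lin_closed lin_add lin_smult)

lemma lin_id: "lin_map R M M (\<lambda>x. x)"
 by (rule lin_mapI) auto

lemma lin_zero:
 assumes "lin_map R M N f" "Module.module R M" "Module.module R N"
 shows "f \<zero>\<^bsub>M\<^esub> = \<zero>\<^bsub>N\<^esub>"
proof -
 interpret M: Module.module R M by fact
 interpret N: Module.module R N by fact
 have "f (\<zero>\<^bsub>R\<^esub> \<odot>\<^bsub>M\<^esub> \<zero>\<^bsub>M\<^esub>) = \<zero>\<^bsub>R\<^esub> \<odot>\<^bsub>N\<^esub> f \<zero>\<^bsub>M\<^esub>"
  by (rule lin_smult[OF assms(1)]) auto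
 thus ?thesis using lin_closed[OF assms(1)] by simp
qed

lemma minus_one_smult:
 assumes "Module.module R M" "x \<in> carrier M"
 shows "\<ominus>\<^bsub>M\<^esub> x = (\<ominus>\<^bsub>R\<^esub> \<one>\<^bsub>R\<^esub>) \<odot>\<^bsub>M\<^esub> x"
proof -
 interpret M: Module.module R M by fact
 show ?thesis using assms(2) by (simp add: M.smult_l_minus)
qed

lemma lin_inv:
 assumes "lin_map R M N f" "Module.module R M" "Module.module R N" "x \<in> carrier M"
 shows "f (\<ominus>\<^bsub>M\<^esub> x) = \<ominus>\<^bsub>N\<^esub> f x"
proof -
 interpret M: Module.module R M by fact
 interpret N: Module.module R N by fact
 show ?thesis
  using assms(4) lin_closed[OF assms(1)]
  by (simp add: minus_one_smult[OF assms(2)] minus_one_smult[OF assms(3)] lin_smult[OF assms(1)])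
qed

lemma lin_diff:
 assumes "lin_map R M N f" "Module.module R M" "Module.module R N" "x \<in> carrier M" "y \<in> carrier M"
 shows "f (x \<ominus>\<^bsub>M\<^esub> y) = f x \<ominus>\<^bsub>N\<^esub> f y"
proof -
 interpret M: Module.module R M by fact
 interpret N: Module.module R N by fact
 show ?thesis using assms
  by (simp add: a_minus_def lin_add[OF assms(1)] lin_inv[OF assms(1)])
qed

lemma lin_zero_map:
 assumes "Module.module R N" shows "lin_map R M N (\<lambda>x. \<zero>\<^bsub>N\<^esub>)"
proof -
 interpret N: Module.module R N by fact
 show ?thesis by (rule lin_mapI) auto
qed

lemma lin_plus:
 assumes "lin_map R M N f" "lin_map R M N g" "Module.module R N"
 shows "lin_map R M N (\<lambda>x. f x \<oplus>\<^bsub>N\<^esub> g x)"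
proof -
 interpret N: Module.module R N by fact
 show ?thesis
  by (rule lin_mapI)
   (use assms(1,2) in \<open>auto simp: lin_closed lin_add lin_smult N.smult_r_distr N.M.a_ac\<close>)
qed

lemma lin_uminus:
 assumes "lin_map R M N f" "Module.module R N"
 shows "lin_map R M N (\<lambda>x. \<ominus>\<^bsub>N\<^esub> f x)"
proof -
 interpret N: Module.module R N by fact
 show ?thesis
  by (rule lin_mapI)
   (use assms(1) in \<open>auto simp: lin_closed lin_add lin_smult N.smult_r_minus N.M.minus_add\<close>)
qed

lemma lin_minus:
 assumes "lin_map R M N f" "lin_map R M N g" "Module.module R N"
 shows "lin_map R M N (\<lambda>x. f x \<ominus>\<^bsub>N\<^esub> g x)"
 unfolding a_minus_def by (intro lin_plus lin_uminus assms)

lemma module_diff_eq_iff: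
 assumes "Module.module R M" "x \<in> carrier M" "y \<in> carrier M" "z \<in> carrier M"
 shows "x \<ominus>\<^bsub>M\<^esub> y = z \<longleftrightarrow> x = y \<oplus>\<^bsub>M\<^esub> z"
proof -
 interpret M: Module.module R M by fact
 show ?thesis using assms(2-)
  by (metis M.M.add.inv_closed M.M.add.m_assoc M.M.add.m_comm M.M.l_neg M.M.r_zero a_minus_def)
qed

lemma module_diff_zero_iff:
 assumes "Module.module R M" "x \<in> carrier M" "y \<in> carrier M"
 shows "x \<ominus>\<^bsub>M\<^esub> y = \<zero>\<^bsub>M\<^esub> \<longleftrightarrow> x = y"
proof -
 interpret M: Module.module R M by fact
 show ?thesis using assms(2-) by (simp add: module_diff_eq_iff[OF assms(1)])
qed

text \<open>Multiplication by (-1)^m. Keeping the sign as an operator that commutes with linear maps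
  postpones the distinction of parities to the end of a calculation.\<close>

definition sg :: "('a, 'x) module \<Rightarrow> int \<Rightarrow> 'x \<Rightarrow> 'x" where
 "sg M m x = (if even m then x else \<ominus>\<^bsub>M\<^esub> x)"

lemma sg_closed:
 assumes "Module.module R M" "x \<in> carrier M" shows "sg M m x \<in> carrier M"
proof -
 interpret M: Module.module R M by fact
 show ?thesis using assms(2) by (simp add: sg_def)
qed

lemma lin_sg:
 assumes "lin_map R M N f" "Module.module R M" "Module.module R N" "x \<in> carrier M"
 shows "f (sg M m x) = sg N m (f x)"
 using assms by (simp add: sg_def lin_inv)

lemma lin_sg_map:
 assumes "lin_map R M N f" "Module.module R N"
 shows "lin_map R M N (\<lambda>x. sg N m (f x))"
 using lin_uminus[OF assms] assms(1) by (cases "even m") (simp_all add: sg_def)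

lemma sg_sg:
 assumes "Module.module R M" "x \<in> carrier M"
 shows "sg M m (sg M n x) = sg M (m + n) x"
proof -
 interpret M: Module.module R M by fact
 show ?thesis using assms(2) by (simp add: sg_def)
qed

lemma sg_zero: assumes "Module.module R M" shows "sg M m \<zero>\<^bsub>M\<^esub> = \<zero>\<^bsub>M\<^esub>"
proof -
 interpret M: Module.module R M by fact
 show ?thesis by (simp add: sg_def)
qed

lemma sg_Suc:
 assumes "Module.module R M" "x \<in> carrier M"
 shows "sg M (m + 1) x = \<ominus>\<^bsub>M\<^esub> sg M m x"
proof -
 interpret M: Module.module R M by fact
 show ?thesis using assms(2) by (simp add: sg_def)
qed

lemma sg_inv:
 assumes "Module.module R M" "x \<in> carrier M"
 shows "sg M m (\<ominus>\<^bsub>M\<^esub> x) = \<ominus>\<^bsub>M\<^esub> sg M m x"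
proof -
 interpret M: Module.module R M by fact
 show ?thesis using assms(2) by (simp add: sg_def)
qed

lemma sg_cancel:
 assumes "Module.module R M" "x \<in> carrier M"
 shows "sg M m (sg M m x) = x"
 using sg_sg[OF assms] by (simp add: sg_def)

section \<open>Complexes\<close>

lemma cxM: "chain_complex R X \<Longrightarrow> Module.module R (X$n)"
 unfolding chain_complex_def by auto

lemma cx_lin: "chain_complex R X \<Longrightarrow> lin_map R (X$n) (X$(n - 1)) (cx_d X n)"
 unfolding chain_complex_def by auto

lemma cx_lin': "chain_complex R X \<Longrightarrow> m = n - 1 \<Longrightarrow> lin_map R (X$n) (X$m) (cx_d X n)"
 unfolding chain_complex_def by auto

lemma cx_closed: "chain_complex R X \<Longrightarrow> x \<in> X$$n \<Longrightarrow> m = n - 1 \<Longrightarrow> cx_d X n x \<in> X$$m"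
 using cx_lin lin_closed by metis

lemma cx_dd:
 assumes "chain_complex R X" "x \<in> X$$n" "m = n - 1" "k = n - 2"
 shows "cx_d X m (cx_d X n x) = \<zero>\<^bsub>X$k\<^esub>"
proof -
 have "n - 1 - 1 = k" using assms by simp
 thus ?thesis using assms unfolding chain_complex_def by metis
qed

section \<open>Exactness and homology in terms of elements\<close>

definition cx_exact :: "('a, 'x) chain_cx \<Rightarrow> int \<Rightarrow> bool" where
 "cx_exact X n \<longleftrightarrow> (\<forall>z\<in>cycles X n. \<exists>w\<in>X$$(n + 1). cx_d X (n + 1) w = z)"

lemma cyclesI: "x \<in> X$$n \<Longrightarrow> cx_d X n x = \<zero>\<^bsub>X$(n - 1)\<^esub> \<Longrightarrow> x \<in> cycles X n"
 unfolding cycles_def by auto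

lemma cyclesD: "x \<in> cycles X n \<Longrightarrow> x \<in> X$$n"
 "x \<in> cycles X n \<Longrightarrow> m = n - 1 \<Longrightarrow> cx_d X n x = \<zero>\<^bsub>X$m\<^esub>"
 unfolding cycles_def by auto

lemma cx_exactD:
 "cx_exact X n \<Longrightarrow> x \<in> X$$n \<Longrightarrow> cx_d X n x = \<zero>\<^bsub>X$(n - 1)\<^esub> \<Longrightarrow> m = n + 1 \<Longrightarrow>
  \<exists>w\<in>X$$m. cx_d X m w = x"
 unfolding cx_exact_def cycles_def by auto

lemma boundaries_iff: "x \<in> boundaries X n \<longleftrightarrow> (\<exists>w\<in>X$$(n + 1). x = cx_d X (n + 1) w)"
 unfolding boundaries_def by auto

context
 fixes R :: "('a, 'r) ring_scheme" and X :: "('a, 'x) chain_cx" and n :: int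
 assumes X: "chain_complex R X"
begin

interpretation M: Module.module R "X$n" by (rule cxM[OF X])

lemma bd_sub: "submodule (boundaries X n) R (X$n)"
proof -
 interpret M1: Module.module R "X$(n + 1)" by (rule cxM[OF X])
 have l: "lin_map R (X$(n + 1)) (X$n) (cx_d X (n + 1))" by (rule cx_lin'[OF X]) simp
 show ?thesis
 proof (rule M.submoduleI)
  show "boundaries X n \<subseteq> X$$n"
   using lin_closed[OF l] by (auto simp: boundaries_def)
  show "\<zero>\<^bsub>X$n\<^esub> \<in> boundaries X n"
   using lin_zero[OF l cxM[OF X] cxM[OF X]] M1.M.zero_closed unfolding boundaries_iff by metis
  show "\<ominus>\<^bsub>X$n\<^esub> a \<in> boundaries X n" if "a \<in> boundaries X n" for a
   using that lin_inv[OF l cxM[OF X] cxM[OF X]] M1.M.a_inv_closed unfolding boundaries_iff by metis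
  show "a \<oplus>\<^bsub>X$n\<^esub> b \<in> boundaries X n" if "a \<in> boundaries X n" "b \<in> boundaries X n" for a b
   using that lin_add[OF l] M1.M.a_closed unfolding boundaries_iff by metis
  show "r \<odot>\<^bsub>X$n\<^esub> a \<in> boundaries X n" if "r \<in> carrier R" "a \<in> boundaries X n" for r a
   using that lin_smult[OF l] M1.smult_closed unfolding boundaries_iff by metis
 qed
qed

lemma cyc_sub: "submodule (cycles X n) R (X$n)"
proof -
 interpret M1: Module.module R "X$(n - 1)" by (rule cxM[OF X])
 have l: "lin_map R (X$n) (X$(n - 1)) (cx_d X n)" by (rule cx_lin[OF X])
 show ?thesis
  by (rule M.submoduleI)
   (auto simp: cycles_def lin_add[OF l] lin_smult[OF l] lin_inv[OF l cxM[OF X] cxM[OF X]]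
    lin_zero[OF l cxM[OF X] cxM[OF X]])
qed

lemma boundaries_cycles: "boundaries X n \<subseteq> cycles X n"
proof
 fix x assume "x \<in> boundaries X n"
 then obtain w where w: "w \<in> X$$(n + 1)" "x = cx_d X (n + 1) w" unfolding boundaries_iff by auto
 show "x \<in> cycles X n"
  using w cx_closed[OF X w(1)] cx_dd[OF X w(1), of n "n - 1"] by (intro cyclesI) auto
qed

lemma hclass_eq_iff:
 assumes "x \<in> X$$n" "y \<in> X$$n"
 shows "hclass X n x = hclass X n y \<longleftrightarrow> x \<ominus>\<^bsub>X$n\<^esub> y \<in> boundaries X n"
proof -
 note sm = M.submoduleE[OF bd_sub]
 have mem: "u \<in> hclass X n v \<longleftrightarrow> u \<ominus>\<^bsub>X$n\<^esub> v \<in> boundaries X n"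
  if "u \<in> X$$n" "v \<in> X$$n" for u v
 proof
  assume "u \<in> hclass X n v"
  then obtain b where b: "b \<in> boundaries X n" "u = b \<oplus>\<^bsub>X$n\<^esub> v"
   unfolding hclass_def a_r_coset_def r_coset_def by auto
  hence "b \<in> X$$n" using sm(1) by auto
  hence "u \<ominus>\<^bsub>X$n\<^esub> v = b" using b that by (simp add: a_minus_def M.M.a_ac M.M.r_neg)
  thus "u \<ominus>\<^bsub>X$n\<^esub> v \<in> boundaries X n" using b by simp
 next
  assume b: "u \<ominus>\<^bsub>X$n\<^esub> v \<in> boundaries X n"
  have "u = (u \<ominus>\<^bsub>X$n\<^esub> v) \<oplus>\<^bsub>X$n\<^esub> v"
   using that by (simp add: a_minus_def M.M.a_ac M.M.r_neg M.M.l_neg)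
  thus "u \<in> hclass X n v"
   using b unfolding hclass_def a_r_coset_def r_coset_def by auto
 qed
 have sub: "u \<in> X$$n" if "u \<in> hclass X n v" "v \<in> X$$n" for u v
  using that sm(1) unfolding hclass_def a_r_coset_def r_coset_def by auto
 show ?thesis
 proof
  assume eq: "hclass X n x = hclass X n y"
  have "x \<in> hclass X n x"
   using mem[OF assms(1) assms(1)] assms bd_sub sm(1)
   by (simp add: a_minus_def M.M.r_neg) (metis M.M.r_neg M.submoduleE(2,3,5) bd_sub ex_in_conv subsetD)
  thus "x \<ominus>\<^bsub>X$n\<^esub> y \<in> boundaries X n" using eq mem[OF assms] by simp
 next
  assume b: "x \<ominus>\<^bsub>X$n\<^esub> y \<in> boundaries X n"
  have 1: "u \<ominus>\<^bsub>X$n\<^esub> y = (u \<ominus>\<^bsub>X$n\<^esub> x) \<oplus>\<^bsub>X$n\<^esub> (x \<ominus>\<^bsub>X$n\<^esub> y)"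
   "u \<ominus>\<^bsub>X$n\<^esub> x = (u \<ominus>\<^bsub>X$n\<^esub> y) \<oplus>\<^bsub>X$n\<^esub> \<ominus>\<^bsub>X$n\<^esub> (x \<ominus>\<^bsub>X$n\<^esub> y)"
   if "u \<in> X$$n" for u
   using that assms
   by (simp_all add: M.M.grp_simps)
  show "hclass X n x = hclass X n y"
  proof (rule Set.set_eqI)
   fix u
   show "u \<in> hclass X n x \<longleftrightarrow> u \<in> hclass X n y"
   proof (cases "u \<in> X$$n")
    case True
    thus ?thesis using mem assms 1[OF True] b sm(3,5) by metis
   qed (use sub assms in auto)
  qed
 qed
qed

lemma hclass_mem:
 assumes "u \<in> hclass X n v" "v \<in> X$$n"
 shows "u \<in> X$$n" "hclass X n u = hclass X n v"
proof -
 note sm = M.submoduleE[OF bd_sub]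
 obtain b where b: "b \<in> boundaries X n" "u = b \<oplus>\<^bsub>X$n\<^esub> v"
  using assms unfolding hclass_def a_r_coset_def r_coset_def by auto
 hence bc: "b \<in> X$$n" using sm(1) by auto
 thus u: "u \<in> X$$n" using b assms(2) by simp
 have "u \<ominus>\<^bsub>X$n\<^esub> v = b" using b bc assms(2) by (simp add: a_minus_def M.M.a_ac M.M.r_neg)
 thus "hclass X n u = hclass X n v" using b hclass_eq_iff[OF u assms(2)] by simp
qed

lemma hclass_self: assumes "v \<in> X$$n" shows "v \<in> hclass X n v"
proof -
 have z: "\<zero>\<^bsub>X$n\<^esub> \<in> boundaries X n"
  using bd_sub by (metis M.M.r_neg M.submoduleE(1,2,3,5) ex_in_conv subsetD)
 have "\<zero>\<^bsub>X$n\<^esub> \<oplus>\<^bsub>X$n\<^esub> v = v" using assms by simp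
 thus ?thesis unfolding hclass_def a_r_coset_def r_coset_def using z by force
qed

end

lemma submodule_zero: "submodule H R M \<Longrightarrow> \<zero>\<^bsub>M\<^esub> \<in> H"
 using subgroup.one_closed[of H "add_monoid M"] unfolding submodule_def by simp

lemma module_diff_zero:
 assumes "Module.module R M" "x \<in> carrier M" shows "x \<ominus>\<^bsub>M\<^esub> \<zero>\<^bsub>M\<^esub> = x"
proof -
 interpret M: Module.module R M by fact
 show ?thesis using assms(2) by (simp add: module_diff_eq_iff[OF assms(1)])
qed

context
 fixes R :: "('a, 'r) ring_scheme" and X :: "('a, 'x) chain_cx" and n :: int
 assumes X: "chain_complex R X"
begin

interpretation M: Module.module R "X$n" by (rule cxM[OF X])

lemmas bsub = M.submoduleE[OF bd_sub[OF X]]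
lemmas csub = M.submoduleE[OF cyc_sub[OF X]]

lemma hclass_zero: "hclass X n \<zero>\<^bsub>X$n\<^esub> = boundaries X n"
 using bsub(1) unfolding hclass_def a_r_coset_def r_coset_def by force

lemma hclass_eq_boundaries_iff:
 "x \<in> X$$n \<Longrightarrow> hclass X n x = boundaries X n \<longleftrightarrow> x \<in> boundaries X n"
 using hclass_eq_iff[OF X, of x n "\<zero>\<^bsub>X$n\<^esub>"] by (simp add: hclass_zero module_diff_zero[OF cxM[OF X]])

lemma carrier_homology: "carrier (homology X n) = hclass X n ` cycles X n"
 by (simp add: homology_def)

lemma cx_exact_iff: "cx_exact X n \<longleftrightarrow> cycles X n \<subseteq> boundaries X n"
 unfolding cx_exact_def boundaries_def by auto

lemma zero_homology_iff: "zero_module (homology X n) \<longleftrightarrow> cx_exact X n"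
proof -
 have z: "\<zero>\<^bsub>X$n\<^esub> \<in> cycles X n" by (rule submodule_zero[OF cyc_sub[OF X]])
 have "zero_module (homology X n) \<longleftrightarrow> hclass X n ` cycles X n = {boundaries X n}"
  by (simp add: zero_module_def homology_def)
 also have "\<dots> \<longleftrightarrow> (\<forall>x\<in>cycles X n. hclass X n x = boundaries X n)"
  using z by auto
 also have "\<dots> \<longleftrightarrow> cycles X n \<subseteq> boundaries X n"
  using hclass_eq_boundaries_iff[OF cyclesD(1)] by (simp add: subset_eq)
 finally show ?thesis by (simp add: cx_exact_iff)
qed

lemma abelian_subgroup_boundaries: "abelian_subgroup (boundaries X n) (X$n)"
 using bd_sub[OF X, of n] M.abelian_group_axioms
 by (intro abelian_subgroupI3 additive_subgroup.intro) (auto simp: submodule_def)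

lemma hclass_add:
 "x \<in> X$$n \<Longrightarrow> y \<in> X$$n \<Longrightarrow>
  hclass X n x <+>\<^bsub>X$n\<^esub> hclass X n y = hclass X n (x \<oplus>\<^bsub>X$n\<^esub> y)"
 unfolding hclass_def by (rule abelian_subgroup.a_rcos_sum[OF abelian_subgroup_boundaries])

lemma hclass_smult:
 assumes "r \<in> carrier R" "x \<in> X$$n"
 shows "(\<Union>z\<in>hclass X n x. hclass X n (r \<odot>\<^bsub>X$n\<^esub> z)) = hclass X n (r \<odot>\<^bsub>X$n\<^esub> x)"
proof -
 have "hclass X n (r \<odot>\<^bsub>X$n\<^esub> z) = hclass X n (r \<odot>\<^bsub>X$n\<^esub> x)" if "z \<in> hclass X n x" for z
 proof -
  note z = hclass_mem[OF X that assms(2)]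
  have "z \<ominus>\<^bsub>X$n\<^esub> x \<in> boundaries X n" using z assms hclass_eq_iff[OF X] by blast
  hence "r \<odot>\<^bsub>X$n\<^esub> (z \<ominus>\<^bsub>X$n\<^esub> x) \<in> boundaries X n" using bsub(4) assms(1) by blast
  moreover have "r \<odot>\<^bsub>X$n\<^esub> (z \<ominus>\<^bsub>X$n\<^esub> x) = r \<odot>\<^bsub>X$n\<^esub> z \<ominus>\<^bsub>X$n\<^esub> r \<odot>\<^bsub>X$n\<^esub> x"
   using z assms by (simp add: a_minus_def M.smult_r_distr M.smult_r_minus)
  ultimately show ?thesis using z assms hclass_eq_iff[OF X] by simp
 qed
 thus ?thesis using hclass_self[OF X assms(2)] by blast
qed

lemma homology_module: "Module.module R (homology X n)"
proof -
 have C: "carrier (homology X n) = hclass X n ` cycles X n" by (rule carrier_homology)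
 have cc: "z \<in> X$$n" if "z \<in> cycles X n" for z using that csub(1) by auto
 have A: "hclass X n x \<oplus>\<^bsub>homology X n\<^esub> hclass X n y = hclass X n (x \<oplus>\<^bsub>X$n\<^esub> y)"
  if "x \<in> cycles X n" "y \<in> cycles X n" for x y using hclass_add cc that by (simp add: homology_def)
 have S: "r \<odot>\<^bsub>homology X n\<^esub> hclass X n x = hclass X n (r \<odot>\<^bsub>X$n\<^esub> x)"
  if "r \<in> carrier R" "x \<in> cycles X n" for r x using hclass_smult cc that by (simp add: homology_def)
 have Z: "\<zero>\<^bsub>homology X n\<^esub> = hclass X n \<zero>\<^bsub>X$n\<^esub>" by (simp add: homology_def hclass_zero)
 have z0: "\<zero>\<^bsub>X$n\<^esub> \<in> cycles X n" by (rule submodule_zero[OF cyc_sub[OF X]])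
 show ?thesis
 proof (rule moduleI)
  show "cring R" by (rule M.R.is_cring)
  show "abelian_group (homology X n)"
  proof (rule abelian_groupI)
   show "\<exists>y\<in>carrier (homology X n). y \<oplus>\<^bsub>homology X n\<^esub> x = \<zero>\<^bsub>homology X n\<^esub>"
    if "x \<in> carrier (homology X n)" for x
   proof -
    from that obtain u where u: "u \<in> cycles X n" "x = hclass X n u" unfolding C by auto
    have "hclass X n (\<ominus>\<^bsub>X$n\<^esub> u) \<oplus>\<^bsub>homology X n\<^esub> x = \<zero>\<^bsub>homology X n\<^esub>"
     using u csub(3)[OF u(1)] cc[OF u(1)] by (simp add: A Z M.M.l_neg)
    thus ?thesis using csub(3)[OF u(1)] unfolding C by blast
   qed
  qed (auto simp: C A Z csub(5) z0 cc M.M.a_ac)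
 qed (auto simp: C A S csub(4,5) cc M.smult_l_distr M.smult_r_distr M.smult_assoc1)
qed

text \<open>Submodules of the homology correspond to submodules between boundaries and cycles, and
  \<open>hclass\<close> translates generating sets from one side to the other. The construction of
  resolutions needs generators that are cycles.\<close>

lemma fin_gen_homology_iff:
 "fin_gen R (homology X n) \<longleftrightarrow>
  (\<exists>S. finite S \<and> S \<subseteq> cycles X n \<and>
   (\<forall>H. submodule H R (X$n) \<and> S \<subseteq> H \<and> boundaries X n \<subseteq> H \<longrightarrow> cycles X n \<subseteq> H))" (is "?L \<longleftrightarrow> ?Q")
proof
 interpret HM: Module.module R "homology X n" by (rule homology_module)
 have C: "carrier (homology X n) = hclass X n ` cycles X n" by (rule carrier_homology)
 have cc: "z \<in> X$$n" if "z \<in> cycles X n" for z using that csub(1) by auto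
 have A: "hclass X n x \<oplus>\<^bsub>homology X n\<^esub> hclass X n y = hclass X n (x \<oplus>\<^bsub>X$n\<^esub> y)"
  if "x \<in> cycles X n" "y \<in> cycles X n" for x y using hclass_add cc that by (simp add: homology_def)
 have S: "r \<odot>\<^bsub>homology X n\<^esub> hclass X n x = hclass X n (r \<odot>\<^bsub>X$n\<^esub> x)"
  if "r \<in> carrier R" "x \<in> cycles X n" for r x using hclass_smult cc that by (simp add: homology_def)
 have Z: "\<zero>\<^bsub>homology X n\<^esub> = hclass X n \<zero>\<^bsub>X$n\<^esub>" by (simp add: homology_def hclass_zero)
 have I: "\<ominus>\<^bsub>homology X n\<^esub> hclass X n x = hclass X n (\<ominus>\<^bsub>X$n\<^esub> x)" if "x \<in> cycles X n" for x
  using that by (simp add: minus_one_smult[OF homology_module] minus_one_smult[OF cxM[OF X]] cc C S)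
 have z0: "\<zero>\<^bsub>X$n\<^esub> \<in> cycles X n" by (rule submodule_zero[OF cyc_sub[OF X]])
 {
  assume ?L
  then obtain T where T: "finite T" "T \<subseteq> carrier (homology X n)"
   "\<And>H. submodule H R (homology X n) \<Longrightarrow> T \<subseteq> H \<Longrightarrow> H = carrier (homology X n)"
   unfolding fin_gen_def by blast
  obtain S where S': "S \<subseteq> cycles X n" "finite S" "T = hclass X n ` S"
   using finite_subset_image[OF T(1) T(2)[unfolded C]] by blast
  show ?Q
  proof (intro exI conjI allI impI)
   show "finite S" "S \<subseteq> cycles X n" by fact+
   fix H assume H: "submodule H R (X$n) \<and> S \<subseteq> H \<and> boundaries X n \<subseteq> H"
   note h = M.submoduleE[of H, OF conjunct1[OF H]]
   have "submodule (hclass X n ` (H \<inter> cycles X n)) R (homology X n)"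
   proof (rule HM.submoduleI)
    show "\<zero>\<^bsub>homology X n\<^esub> \<in> hclass X n ` (H \<inter> cycles X n)"
     using z0 submodule_zero[OF conjunct1[OF H]] Z by auto
    show "\<ominus>\<^bsub>homology X n\<^esub> a \<in> hclass X n ` (H \<inter> cycles X n)" if "a \<in> hclass X n ` (H \<inter> cycles X n)" for a
     using that I h(3) csub(3) by auto
    show "a \<oplus>\<^bsub>homology X n\<^esub> b \<in> hclass X n ` (H \<inter> cycles X n)"
     if "a \<in> hclass X n ` (H \<inter> cycles X n)" "b \<in> hclass X n ` (H \<inter> cycles X n)" for a b
     using that A h(5) csub(5) by auto
    show "r \<odot>\<^bsub>homology X n\<^esub> a \<in> hclass X n ` (H \<inter> cycles X n)"
     if "r \<in> carrier R" "a \<in> hclass X n ` (H \<inter> cycles X n)" for r a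
     using that S h(4) csub(4) by auto
   qed (auto simp: C)
   moreover have "T \<subseteq> hclass X n ` (H \<inter> cycles X n)" using S' H by auto
   ultimately have eq: "hclass X n ` (H \<inter> cycles X n) = hclass X n ` cycles X n" using T(3) C by auto
   show "cycles X n \<subseteq> H"
   proof
    fix z assume z: "z \<in> cycles X n"
    have "hclass X n z \<in> hclass X n ` (H \<inter> cycles X n)" unfolding eq using z by (rule imageI)
    then obtain u where u: "u \<in> H" "u \<in> cycles X n" "hclass X n z = hclass X n u" by blast
    hence "z \<ominus>\<^bsub>X$n\<^esub> u \<in> boundaries X n" using hclass_eq_iff[OF X cc[OF z] cc[OF u(2)]] by simp
    hence "z \<ominus>\<^bsub>X$n\<^esub> u \<in> H" using H by blast
    hence "(z \<ominus>\<^bsub>X$n\<^esub> u) \<oplus>\<^bsub>X$n\<^esub> u \<in> H" using u h(5) by auto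
    moreover have "(z \<ominus>\<^bsub>X$n\<^esub> u) \<oplus>\<^bsub>X$n\<^esub> u = z" using cc z u by (simp add: M.M.grp_simps M.M.l_neg)
    ultimately show "z \<in> H" by simp
   qed
  qed
 next
  assume ?Q
  then obtain S where S0: "finite S \<and> S \<subseteq> cycles X n \<and>
   (\<forall>H. submodule H R (X$n) \<and> S \<subseteq> H \<and> boundaries X n \<subseteq> H \<longrightarrow> cycles X n \<subseteq> H)" by (rule exE)
  hence S': "finite S" "S \<subseteq> cycles X n"
   "\<And>H. submodule H R (X$n) \<Longrightarrow> S \<subseteq> H \<Longrightarrow> boundaries X n \<subseteq> H \<Longrightarrow> cycles X n \<subseteq> H" by simp_all
  show ?L unfolding fin_gen_def
  proof (intro exI conjI allI impI)
   show "finite (hclass X n ` S)" "hclass X n ` S \<subseteq> carrier (homology X n)" using S' C by auto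
   fix H assume H: "submodule H R (homology X n) \<and> hclass X n ` S \<subseteq> H"
   note h = HM.submoduleE[of H, OF conjunct1[OF H]]
   have "submodule {z \<in> cycles X n. hclass X n z \<in> H} R (X$n)"
    by (rule M.submoduleI)
     (use csub h submodule_zero[OF conjunct1[OF H]] z0 in \<open>auto simp: cc A[symmetric] S[symmetric] I[symmetric] Z\<close>)
   moreover have "S \<subseteq> {z \<in> cycles X n. hclass X n z \<in> H}" using S' H by auto
   moreover have "boundaries X n \<subseteq> {z \<in> cycles X n. hclass X n z \<in> H}"
    using boundaries_cycles[OF X, of n] submodule_zero[OF conjunct1[OF H]] hclass_eq_boundaries_iff[OF cc]
    by (simp add: Z hclass_zero subset_iff) metis
   ultimately have "cycles X n \<subseteq> {z \<in> cycles X n. hclass X n z \<in> H}" by (rule S'(3))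
   thus "H = carrier (homology X n)" using h(1) C by auto
  qed
 }
qed

end

lemma acyclic_cx_iff: "chain_complex R X \<Longrightarrow> acyclic_cx X \<longleftrightarrow> (\<forall>n. cx_exact X n)"
 unfolding acyclic_cx_def by (simp add: zero_homology_iff)

section \<open>Chain maps\<close>

lemma cm_lin: "chain_map R X Y f \<Longrightarrow> lin_map R (X$n) (Y$n) (f n)"
 unfolding chain_map_def by auto

lemma cm_d:
 "chain_map R X Y f \<Longrightarrow> x \<in> X$$n \<Longrightarrow> m = n - 1 \<Longrightarrow> f m (cx_d X n x) = cx_d Y n (f n x)"
 unfolding chain_map_def by auto

lemma cm_closed: "chain_map R X Y f \<Longrightarrow> x \<in> X$$n \<Longrightarrow> f n x \<in> Y$$n"
 using cm_lin lin_closed by metis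

lemma cm_id: "chain_map R X X (\<lambda>n x. x)"
 unfolding chain_map_def using lin_id by auto

lemma cm_comp:
 assumes "chain_map R X Y f" "chain_map R Y Z g" shows "chain_map R X Z (\<lambda>n x. g n (f n x))"
 unfolding chain_map_def
 using assms cm_d[OF assms(1)] cm_d[OF assms(2)] cm_closed[OF assms(1)]
  lin_comp[OF cm_lin[OF assms(1)] cm_lin[OF assms(2)]] by auto

lemma cm_cycles:
 assumes "chain_complex R X" "chain_complex R Y" "chain_map R X Y f" "z \<in> cycles X n"
 shows "f n z \<in> cycles Y n"
proof (rule cyclesI)
 have z: "z \<in> X$$n" "cx_d X n z = \<zero>\<^bsub>X$(n - 1)\<^esub>" using assms(4) by (auto simp: cycles_def)
 show "f n z \<in> Y$$n" using cm_closed[OF assms(3) z(1)] .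
 show "cx_d Y n (f n z) = \<zero>\<^bsub>Y$(n - 1)\<^esub>"
  using cm_d[OF assms(3) z(1), of "n - 1"] z lin_zero[OF cm_lin[OF assms(3)] cxM[OF assms(1)] cxM[OF assms(2)]]
  by simp
qed

lemma cm_boundaries:
 assumes "chain_map R X Y f" "z \<in> boundaries X n"
 shows "f n z \<in> boundaries Y n"
proof -
 obtain w where w: "w \<in> X$$(n + 1)" "z = cx_d X (n + 1) w" using assms(2) unfolding boundaries_iff by auto
 have "f n z = cx_d Y (n + 1) (f (n + 1) w)" using cm_d[OF assms(1) w(1), of n] w by simp
 thus ?thesis using cm_closed[OF assms(1) w(1)] unfolding boundaries_iff by auto
qed

text \<open>Injectivity on homology means that boundaries are reflected, surjectivity that every
  cycle is hit up to a boundary. In this form quasi-isomorphisms can be handled without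
  cosets.\<close>

lemma quasi_iso_iff:
 fixes X :: "('a, 'c) chain_cx" and Y :: "('a, 'd) chain_cx"
 assumes X: "chain_complex R X" and Y: "chain_complex R Y"
 shows "quasi_iso R X Y f \<longleftrightarrow> chain_map R X Y f \<and>
  (\<forall>n. \<forall>z\<in>cycles X n. f n z \<in> boundaries Y n \<longrightarrow> z \<in> boundaries X n) \<and>
  (\<forall>n. \<forall>y\<in>cycles Y n. \<exists>z\<in>cycles X n. y \<ominus>\<^bsub>Y$n\<^esub> f n z \<in> boundaries Y n)"
proof (cases "chain_map R X Y f")
 case True
 note f = True
 have key: "bij_betw (homology_map Y f n) (carrier (homology X n)) (carrier (homology Y n)) \<longleftrightarrow>
  (\<forall>z\<in>cycles X n. f n z \<in> boundaries Y n \<longrightarrow> z \<in> boundaries X n) \<and>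
  (\<forall>y\<in>cycles Y n. \<exists>z\<in>cycles X n. y \<ominus>\<^bsub>Y$n\<^esub> f n z \<in> boundaries Y n)" (is "?L \<longleftrightarrow> ?A \<and> ?B") for n
 proof -
  interpret M: Module.module R "X$n" by (rule cxM[OF X])
  interpret N: Module.module R "Y$n" by (rule cxM[OF Y])
  note l = cm_lin[OF f, of n]
  note sX = M.submoduleE[OF cyc_sub[OF X]] and sY = N.submoduleE[OF cyc_sub[OF Y]]
  have cX: "z \<in> X$$n" if "z \<in> cycles X n" for z using that by (rule cyclesD(1))
  have cY: "z \<in> Y$$n" if "z \<in> cycles Y n" for z using that by (rule cyclesD(1))
  have fc: "f n z \<in> cycles Y n" if "z \<in> cycles X n" for z using cm_cycles[OF X Y f that] .
  have hm: "homology_map Y f n (hclass X n z) = hclass Y n (f n z)" if "z \<in> cycles X n" for z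
  proof -
   have "hclass Y n (f n u) = hclass Y n (f n z)" if u: "u \<in> hclass X n z" for u
   proof -
    note u' = hclass_mem[OF X u cX[OF \<open>z \<in> cycles X n\<close>]]
    have "u \<ominus>\<^bsub>X$n\<^esub> z \<in> boundaries X n" using u' hclass_eq_iff[OF X u'(1) cX] \<open>z \<in> cycles X n\<close> by simp
    hence "f n (u \<ominus>\<^bsub>X$n\<^esub> z) \<in> boundaries Y n" by (rule cm_boundaries[OF f])
    thus ?thesis
     using hclass_eq_iff[OF Y] lin_diff[OF l cxM[OF X] cxM[OF Y]] u' cX \<open>z \<in> cycles X n\<close>
      lin_closed[OF l] by simp
   qed
   thus ?thesis unfolding homology_map_def using hclass_self[OF X cX[OF that]] by blast
  qed
  have inj: "inj_on (homology_map Y f n) (carrier (homology X n)) \<longleftrightarrow> ?A"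
  proof
   assume i: "inj_on (homology_map Y f n) (carrier (homology X n))"
   show ?A
   proof (intro ballI impI)
    fix z assume z: "z \<in> cycles X n" "f n z \<in> boundaries Y n"
    have z0: "\<zero>\<^bsub>X$n\<^esub> \<in> cycles X n" by (rule submodule_zero[OF cyc_sub[OF X]])
    have "hclass Y n (f n z) = hclass Y n (f n \<zero>\<^bsub>X$n\<^esub>)"
     using z hclass_eq_boundaries_iff[OF Y] cY fc lin_zero[OF l cxM[OF X] cxM[OF Y]] hclass_zero[OF Y] by auto
    hence "homology_map Y f n (hclass X n z) = homology_map Y f n (hclass X n \<zero>\<^bsub>X$n\<^esub>)"
     by (simp add: hm[OF z(1)] hm[OF z0])
    hence "hclass X n z = hclass X n \<zero>\<^bsub>X$n\<^esub>"
     by (rule inj_onD[OF i]) (use z(1) z0 in \<open>simp_all add: carrier_homology[OF X]\<close>)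
    thus "z \<in> boundaries X n" using hclass_zero[OF X] hclass_eq_boundaries_iff[OF X] cX z by metis
   qed
  next
   assume a: ?A
   show "inj_on (homology_map Y f n) (carrier (homology X n))"
   proof (rule inj_onI)
    fix C D assume "C \<in> carrier (homology X n)" "D \<in> carrier (homology X n)"
     and eq: "homology_map Y f n C = homology_map Y f n D"
    then obtain u v where uv: "u \<in> cycles X n" "C = hclass X n u" "v \<in> cycles X n" "D = hclass X n v"
     unfolding carrier_homology[OF X] by auto
    have "f n u \<ominus>\<^bsub>Y$n\<^esub> f n v \<in> boundaries Y n" using eq uv hm hclass_eq_iff[OF Y] cY fc by auto
    hence "f n (u \<ominus>\<^bsub>X$n\<^esub> v) \<in> boundaries Y n"
     using lin_diff[OF l cxM[OF X] cxM[OF Y]] cX uv by simp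
    moreover have "u \<ominus>\<^bsub>X$n\<^esub> v \<in> cycles X n" using uv sX(3,5) by (simp add: a_minus_def)
    ultimately have "u \<ominus>\<^bsub>X$n\<^esub> v \<in> boundaries X n" using a by blast
    thus "C = D" using uv hclass_eq_iff[OF X] cX by simp
   qed
  qed
  have im: "homology_map Y f n ` carrier (homology X n) = (\<lambda>z. hclass Y n (f n z)) ` cycles X n"
   unfolding carrier_homology[OF X] image_image using hm by (rule image_cong[OF refl])
  have "(\<lambda>z. hclass Y n (f n z)) ` cycles X n \<subseteq> hclass Y n ` cycles Y n" using fc by blast
  moreover have "A \<subseteq> B \<Longrightarrow> (A = B) = (\<forall>b\<in>B. b \<in> A)" for A B :: "'d set set" by blast
  ultimately have "homology_map Y f n ` carrier (homology X n) = carrier (homology Y n) \<longleftrightarrow>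
   (\<forall>y\<in>cycles Y n. \<exists>z\<in>cycles X n. hclass Y n y = hclass Y n (f n z))"
   unfolding im carrier_homology[OF Y] by (simp only: ball_simps image_iff)
  also have "\<dots> \<longleftrightarrow> ?B" using hclass_eq_iff[OF Y cY cm_closed[OF f cX]] by simp
  finally show ?thesis using inj unfolding bij_betw_def by blast
 qed
 show ?thesis unfolding quasi_iso_def using f key by blast
qed (simp add: quasi_iso_def)

section \<open>Homogeneous maps between complexes and their homotopies\<close>

definition hcyc ::
  "('a, 'r) ring_scheme \<Rightarrow> ('a, 'p) chain_cx \<Rightarrow> ('a, 'y) chain_cx \<Rightarrow> int \<Rightarrow> (int \<Rightarrow> 'p \<Rightarrow> 'y) \<Rightarrow> bool" where
 "hcyc R P Y m \<alpha> \<longleftrightarrow> (\<forall>i. lin_map R (P$i) (Y$(i + m)) (\<alpha> i)) \<and>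
  (\<forall>i. \<forall>x\<in>P$$i.
   cx_d Y (i + m) (\<alpha> i x) = sg (Y$(i + m - 1)) m (\<alpha> (i - 1) (cx_d P i x)))"

text \<open>A homotopy for a map of degree \<open>m\<close> is a homomorphism of degree
  \<open>m + 1\<close>, so the sign of its second term is -(-1)^(m + 1) = (-1)^m. Together with
  \<open>hcyc\<close> this describes the cycles and boundaries of \<open>Hom_cx\<close> by families
  of maps whose values off the carriers are free.\<close>

definition htpy ::
  "('a, 'r) ring_scheme \<Rightarrow> ('a, 'p) chain_cx \<Rightarrow> ('a, 'y) chain_cx \<Rightarrow> int \<Rightarrow> (int \<Rightarrow> 'p \<Rightarrow> 'y) \<Rightarrow> (int \<Rightarrow> 'p \<Rightarrow> 'y) \<Rightarrow> bool" where
 "htpy R P Y m h \<alpha> \<longleftrightarrow> (\<forall>i. lin_map R (P$i) (Y$(i + m + 1)) (h i)) \<and>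
  (\<forall>i. \<forall>x\<in>P$$i.
   \<alpha> i x = cx_d Y (i + m + 1) (h i x) \<oplus>\<^bsub>Y$(i + m)\<^esub> sg (Y$(i + m)) m (h (i - 1) (cx_d P i x)))"

definition hnull ::
  "('a, 'r) ring_scheme \<Rightarrow> ('a, 'p) chain_cx \<Rightarrow> ('a, 'y) chain_cx \<Rightarrow> int \<Rightarrow> (int \<Rightarrow> 'p \<Rightarrow> 'y) \<Rightarrow> bool" where
 "hnull R P Y m \<alpha> \<longleftrightarrow> (\<exists>h. htpy R P Y m h \<alpha>)"

lemma hcyc_lin: "hcyc R P Y m \<alpha> \<Longrightarrow> k = i + m \<Longrightarrow> lin_map R (P$i) (Y$k) (\<alpha> i)"
 unfolding hcyc_def by auto

lemma hcyc_closed: "hcyc R P Y m \<alpha> \<Longrightarrow> x \<in> P$$i \<Longrightarrow> k = i + m \<Longrightarrow> \<alpha> i x \<in> Y$$k"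
 using hcyc_lin lin_closed by metis

lemma hcyc_d:
 "hcyc R P Y m \<alpha> \<Longrightarrow> x \<in> P$$i \<Longrightarrow> k = i + m \<Longrightarrow> j = i - 1 \<Longrightarrow> l = i + m - 1 \<Longrightarrow>
  cx_d Y k (\<alpha> i x) = sg (Y$l) m (\<alpha> j (cx_d P i x))"
 unfolding hcyc_def by auto

lemma htpy_lin: "htpy R P Y m h \<alpha> \<Longrightarrow> k = i + m + 1 \<Longrightarrow> lin_map R (P$i) (Y$k) (h i)"
 unfolding htpy_def by auto

lemma htpy_closed: "htpy R P Y m h \<alpha> \<Longrightarrow> x \<in> P$$i \<Longrightarrow> k = i + m + 1 \<Longrightarrow> h i x \<in> Y$$k"
 using htpy_lin lin_closed by metis

lemma htpy_eq:
 "htpy R P Y m h \<alpha> \<Longrightarrow> x \<in> P$$i \<Longrightarrow> k = i + m \<Longrightarrow> j = i - 1 \<Longrightarrow> l = i + m + 1 \<Longrightarrow>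
  \<alpha> i x = cx_d Y l (h i x) \<oplus>\<^bsub>Y$k\<^esub> sg (Y$k) m (h j (cx_d P i x))"
 unfolding htpy_def by auto

lemma cm_hcyc: "chain_map R P Y f \<longleftrightarrow> hcyc R P Y 0 f"
 unfolding chain_map_def hcyc_def sg_def by auto

lemma htpy_cong:
 assumes "htpy R P Y m h \<alpha>" "\<And>i x. x \<in> P$$i \<Longrightarrow> \<beta> i x = \<alpha> i x"
 shows "htpy R P Y m h \<beta>"
 using assms unfolding htpy_def by auto

lemma hnull_cong:
 assumes "hnull R P Y m \<alpha>" "\<And>i x. x \<in> P$$i \<Longrightarrow> \<beta> i x = \<alpha> i x"
 shows "hnull R P Y m \<beta>"
 using assms htpy_cong unfolding hnull_def by blast

context
 fixes R :: "('a, 'r) ring_scheme" and P :: "('a, 'p) chain_cx" and Y :: "('a, 'y) chain_cx" and m :: int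
 assumes P: "chain_complex R P" and Y: "chain_complex R Y"
begin

lemma hcyc_minus:
 assumes a: "hcyc R P Y m \<alpha>" and b: "hcyc R P Y m \<beta>"
 shows "hcyc R P Y m (\<lambda>i x. \<alpha> i x \<ominus>\<^bsub>Y$(i + m)\<^esub> \<beta> i x)"
 unfolding hcyc_def
proof (intro conjI allI ballI)
 fix i
 show "lin_map R (P$i) (Y$(i + m)) (\<lambda>x. \<alpha> i x \<ominus>\<^bsub>Y$(i + m)\<^esub> \<beta> i x)"
  by (intro lin_minus cxM[OF Y] hcyc_lin[OF a] hcyc_lin[OF b] refl)
 fix x assume x: "x \<in> P$$i"
 have dx: "cx_d P i x \<in> P$$(i - 1)" by (rule cx_closed[OF P x]) simp
 have c: "i - 1 + m = i + m - 1" by simp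
 interpret M: Module.module R "Y$(i + m - 1)" by (rule cxM[OF Y])
 have e: "\<alpha> (i - 1) (cx_d P i x) \<in> Y$$(i + m - 1)" "\<beta> (i - 1) (cx_d P i x) \<in> Y$$(i + m - 1)"
  by (rule hcyc_closed[OF a dx], simp, rule hcyc_closed[OF b dx], simp)
 have "cx_d Y (i + m) (\<alpha> i x \<ominus>\<^bsub>Y$(i + m)\<^esub> \<beta> i x) =
   cx_d Y (i + m) (\<alpha> i x) \<ominus>\<^bsub>Y$(i + m - 1)\<^esub> cx_d Y (i + m) (\<beta> i x)"
  by (rule lin_diff[OF cx_lin[OF Y] cxM[OF Y] cxM[OF Y] hcyc_closed[OF a x] hcyc_closed[OF b x]]) auto
 also have "\<dots> = sg (Y$(i + m - 1)) m (\<alpha> (i - 1) (cx_d P i x) \<ominus>\<^bsub>Y$(i - 1 + m)\<^esub> \<beta> (i - 1) (cx_d P i x))"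
  using hcyc_d[OF a x refl refl refl] hcyc_d[OF b x refl refl refl] e
  unfolding c by (auto simp: sg_def M.M.grp_simps)
 finally show "cx_d Y (i + m) (\<alpha> i x \<ominus>\<^bsub>Y$(i + m)\<^esub> \<beta> i x) =
   sg (Y$(i + m - 1)) m (\<alpha> (i - 1) (cx_d P i x) \<ominus>\<^bsub>Y$(i - 1 + m)\<^esub> \<beta> (i - 1) (cx_d P i x))" .
qed

lemma htpy_minus:
 assumes a: "htpy R P Y m h \<alpha>" and b: "htpy R P Y m k \<beta>"
 shows "htpy R P Y m (\<lambda>i x. h i x \<ominus>\<^bsub>Y$(i + m + 1)\<^esub> k i x) (\<lambda>i x. \<alpha> i x \<ominus>\<^bsub>Y$(i + m)\<^esub> \<beta> i x)"
 unfolding htpy_def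
proof (intro conjI allI ballI)
 fix i
 show "lin_map R (P$i) (Y$(i + m + 1)) (\<lambda>x. h i x \<ominus>\<^bsub>Y$(i + m + 1)\<^esub> k i x)"
  by (intro lin_minus cxM[OF Y] htpy_lin[OF a] htpy_lin[OF b] refl)
 fix x assume x: "x \<in> P$$i"
 have dx: "cx_d P i x \<in> P$$(i - 1)" by (rule cx_closed[OF P x]) simp
 have c: "i - 1 + m + 1 = i + m" by simp
 interpret M: Module.module R "Y$(i + m)" by (rule cxM[OF Y])
 have e: "h (i - 1) (cx_d P i x) \<in> Y$$(i + m)" "k (i - 1) (cx_d P i x) \<in> Y$$(i + m)"
  by (rule htpy_closed[OF a dx], simp, rule htpy_closed[OF b dx], simp)
 have f: "h i x \<in> Y$$(i + m + 1)" "k i x \<in> Y$$(i + m + 1)"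
  by (rule htpy_closed[OF a x], simp, rule htpy_closed[OF b x], simp)
 have g: "cx_d Y (i + m + 1) (h i x) \<in> Y$$(i + m)" "cx_d Y (i + m + 1) (k i x) \<in> Y$$(i + m)"
  by (rule cx_closed[OF Y f(1)], simp, rule cx_closed[OF Y f(2)], simp)
 have "cx_d Y (i + m + 1) (h i x \<ominus>\<^bsub>Y$(i + m + 1)\<^esub> k i x) =
   cx_d Y (i + m + 1) (h i x) \<ominus>\<^bsub>Y$(i + m)\<^esub> cx_d Y (i + m + 1) (k i x)"
  by (rule lin_diff[OF cx_lin'[OF Y] cxM[OF Y] cxM[OF Y] f]) auto
 thus "\<alpha> i x \<ominus>\<^bsub>Y$(i + m)\<^esub> \<beta> i x =
   cx_d Y (i + m + 1) (h i x \<ominus>\<^bsub>Y$(i + m + 1)\<^esub> k i x) \<oplus>\<^bsub>Y$(i + m)\<^esub>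
   sg (Y$(i + m)) m (h (i - 1) (cx_d P i x) \<ominus>\<^bsub>Y$(i - 1 + m + 1)\<^esub> k (i - 1) (cx_d P i x))"
  using htpy_eq[OF a x refl refl refl] htpy_eq[OF b x refl refl refl] e g
  unfolding c by (auto simp: sg_def M.M.grp_simps)
qed

lemma hnull_minus:
 "hnull R P Y m \<alpha> \<Longrightarrow> hnull R P Y m \<beta> \<Longrightarrow> hnull R P Y m (\<lambda>i x. \<alpha> i x \<ominus>\<^bsub>Y$(i + m)\<^esub> \<beta> i x)"
 using htpy_minus unfolding hnull_def by blast

lemma hnull_zero: "hnull R P Y m (\<lambda>i x. \<zero>\<^bsub>Y$(i + m)\<^esub>)"
 unfolding hnull_def
proof (rule exI, unfold htpy_def, intro conjI allI ballI)
 fix i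
 interpret M: Module.module R "Y$(i + m)" by (rule cxM[OF Y])
 show "lin_map R (P$i) (Y$(i + m + 1)) (\<lambda>x. \<zero>\<^bsub>Y$(i + m + 1)\<^esub>)"
  by (rule lin_zero_map[OF cxM[OF Y]])
 fix x assume x: "x \<in> P$$i"
 have c: "i - 1 + m + 1 = i + m" by simp
 have "cx_d Y (i + m + 1) \<zero>\<^bsub>Y$(i + m + 1)\<^esub> = \<zero>\<^bsub>Y$(i + m)\<^esub>"
  by (rule lin_zero[OF cx_lin'[OF Y] cxM[OF Y] cxM[OF Y]]) simp
 thus "\<zero>\<^bsub>Y$(i + m)\<^esub> = cx_d Y (i + m + 1) \<zero>\<^bsub>Y$(i + m + 1)\<^esub> \<oplus>\<^bsub>Y$(i + m)\<^esub>
    sg (Y$(i + m)) m \<zero>\<^bsub>Y$(i - 1 + m + 1)\<^esub>"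
  unfolding c by (simp add: sg_zero[OF cxM[OF Y]])
qed

lemma hnull_sym:
 assumes "hnull R P Y m (\<lambda>i x. \<alpha> i x \<ominus>\<^bsub>Y$(i + m)\<^esub> \<beta> i x)" "hcyc R P Y m \<alpha>" "hcyc R P Y m \<beta>"
 shows "hnull R P Y m (\<lambda>i x. \<beta> i x \<ominus>\<^bsub>Y$(i + m)\<^esub> \<alpha> i x)"
proof (rule hnull_cong[OF hnull_minus[OF hnull_zero assms(1)]])
 fix i x assume x: "x \<in> P$$i"
 interpret M: Module.module R "Y$(i + m)" by (rule cxM[OF Y])
 show "\<beta> i x \<ominus>\<^bsub>Y$(i + m)\<^esub> \<alpha> i x = \<zero>\<^bsub>Y$(i + m)\<^esub> \<ominus>\<^bsub>Y$(i + m)\<^esub> (\<alpha> i x \<ominus>\<^bsub>Y$(i + m)\<^esub> \<beta> i x)"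
  using hcyc_closed[OF assms(2) x refl] hcyc_closed[OF assms(3) x refl]
  by (simp add: M.M.grp_simps)
qed

lemma hcyc_post:
 assumes Z: "chain_complex R Z" and q: "chain_map R Y Z q" and a: "hcyc R P Y m \<alpha>"
 shows "hcyc R P Z m (\<lambda>i x. q (i + m) (\<alpha> i x))"
 unfolding hcyc_def
proof (intro conjI allI ballI)
 fix i
 show "lin_map R (P$i) (Z$(i + m)) (\<lambda>x. q (i + m) (\<alpha> i x))"
  by (rule lin_comp[OF hcyc_lin[OF a refl] cm_lin[OF q]])
 fix x assume x: "x \<in> P$$i"
 have dx: "cx_d P i x \<in> P$$(i - 1)" by (rule cx_closed[OF P x]) simp
 have c: "i - 1 + m = i + m - 1" by simp
 have "cx_d Z (i + m) (q (i + m) (\<alpha> i x)) = q (i + m - 1) (cx_d Y (i + m) (\<alpha> i x))"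
  by (rule cm_d[OF q hcyc_closed[OF a x], symmetric]) auto
 also have "\<dots> = q (i + m - 1) (sg (Y$(i + m - 1)) m (\<alpha> (i - 1) (cx_d P i x)))"
  by (simp add: hcyc_d[OF a x refl refl refl])
 also have "\<dots> = sg (Z$(i + m - 1)) m (q (i + m - 1) (\<alpha> (i - 1) (cx_d P i x)))"
  by (rule lin_sg[OF cm_lin[OF q] cxM[OF Y] cxM[OF Z]]) (rule hcyc_closed[OF a dx], simp)
 finally show "cx_d Z (i + m) (q (i + m) (\<alpha> i x)) = sg (Z$(i + m - 1)) m (q (i - 1 + m) (\<alpha> (i - 1) (cx_d P i x)))"
  unfolding c .
qed

lemma hnull_post:
 assumes Z: "chain_complex R Z" and q: "chain_map R Y Z q" and a: "hnull R P Y m \<alpha>"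
 shows "hnull R P Z m (\<lambda>i x. q (i + m) (\<alpha> i x))"
proof -
 obtain h where h: "htpy R P Y m h \<alpha>" using a unfolding hnull_def by auto
 have "htpy R P Z m (\<lambda>i x. q (i + m + 1) (h i x)) (\<lambda>i x. q (i + m) (\<alpha> i x))"
  unfolding htpy_def
 proof (intro conjI allI ballI)
  fix i
  show "lin_map R (P$i) (Z$(i + m + 1)) (\<lambda>x. q (i + m + 1) (h i x))"
   by (rule lin_comp[OF htpy_lin[OF h refl] cm_lin[OF q]])
  fix x assume x: "x \<in> P$$i"
  have dx: "cx_d P i x \<in> P$$(i - 1)" by (rule cx_closed[OF P x]) simp
  have c: "i - 1 + m + 1 = i + m" by simp
  have e: "h (i - 1) (cx_d P i x) \<in> Y$$(i + m)" by (rule htpy_closed[OF h dx]) simp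
  have f: "h i x \<in> Y$$(i + m + 1)" by (rule htpy_closed[OF h x]) simp
  have g: "cx_d Y (i + m + 1) (h i x) \<in> Y$$(i + m)" by (rule cx_closed[OF Y f]) simp
  have "q (i + m) (\<alpha> i x) = q (i + m) (cx_d Y (i + m + 1) (h i x)) \<oplus>\<^bsub>Z$(i + m)\<^esub>
    q (i + m) (sg (Y$(i + m)) m (h (i - 1) (cx_d P i x)))"
   using lin_add[OF cm_lin[OF q] g sg_closed[OF cxM[OF Y] e]] htpy_eq[OF h x refl refl refl] by simp
  also have "\<dots> = cx_d Z (i + m + 1) (q (i + m + 1) (h i x)) \<oplus>\<^bsub>Z$(i + m)\<^esub>
    sg (Z$(i + m)) m (q (i + m) (h (i - 1) (cx_d P i x)))"
   using cm_d[OF q f, of "i + m"] lin_sg[OF cm_lin[OF q] cxM[OF Y] cxM[OF Z] e] by simp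
  finally show "q (i + m) (\<alpha> i x) = cx_d Z (i + m + 1) (q (i + m + 1) (h i x)) \<oplus>\<^bsub>Z$(i + m)\<^esub>
    sg (Z$(i + m)) m (q (i - 1 + m + 1) (h (i - 1) (cx_d P i x)))"
   unfolding c .
 qed
 thus ?thesis unfolding hnull_def by blast
qed

lemma hcyc_pre:
 assumes "chain_complex R K" and u: "chain_map R K P u" and a: "hcyc R P Y m \<alpha>"
 shows "hcyc R K Y m (\<lambda>i x. \<alpha> i (u i x))"
 unfolding hcyc_def
proof (intro conjI allI ballI)
 fix i
 show "lin_map R (K$i) (Y$(i + m)) (\<lambda>x. \<alpha> i (u i x))"
  by (rule lin_comp[OF cm_lin[OF u] hcyc_lin[OF a refl]])
 fix x assume x: "x \<in> K$$i"
 show "cx_d Y (i + m) (\<alpha> i (u i x)) = sg (Y$(i + m - 1)) m (\<alpha> (i - 1) (u (i - 1) (cx_d K i x)))"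
  using hcyc_d[OF a cm_closed[OF u x] refl refl refl] cm_d[OF u x refl] by simp
qed

lemma hnull_pre:
 assumes "chain_complex R K" and u: "chain_map R K P u" and a: "hnull R P Y m \<alpha>"
 shows "hnull R K Y m (\<lambda>i x. \<alpha> i (u i x))"
proof -
 obtain h where h: "htpy R P Y m h \<alpha>" using a unfolding hnull_def by auto
 have "htpy R K Y m (\<lambda>i x. h i (u i x)) (\<lambda>i x. \<alpha> i (u i x))"
  unfolding htpy_def
  using lin_comp[OF cm_lin[OF u] htpy_lin[OF h refl]]
   htpy_eq[OF h cm_closed[OF u] refl refl refl] cm_d[OF u _ refl] by auto
 thus ?thesis unfolding hnull_def by blast
qed

end

lemma hnull_boundaries:
 assumes P: "chain_complex R P" and Y: "chain_complex R Y"
  and a: "hnull R P Y 0 \<alpha>" and z: "z \<in> cycles P n"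
 shows "\<alpha> n z \<in> boundaries Y n"
proof -
 interpret M: Module.module R "Y$n" by (rule cxM[OF Y])
 obtain h where h: "htpy R P Y 0 h \<alpha>" using a unfolding hnull_def by auto
 note z' = cyclesD(1)[OF z] cyclesD(2)[OF z refl]
 have hz: "h n z \<in> Y$$(n + 1)" by (rule htpy_closed[OF h z'(1)]) simp
 have "h (n - 1) \<zero>\<^bsub>P$(n - 1)\<^esub> = \<zero>\<^bsub>Y$n\<^esub>"
  by (rule lin_zero[OF htpy_lin[OF h] cxM[OF P] cxM[OF Y]]) simp
 hence "\<alpha> n z = cx_d Y (n + 1) (h n z)"
  using htpy_eq[OF h z'(1), of n "n - 1" "n + 1"] z'(2) cx_closed[OF Y hz, of n] by (simp add: sg_zero[OF cxM[OF Y]])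
 thus ?thesis using hz unfolding boundaries_iff by auto
qed

lemma submodule_diffI:
 assumes "Module.module R M" "submodule H R M" "x \<in> H" "y \<in> H" shows "x \<ominus>\<^bsub>M\<^esub> y \<in> H"
 using Module.module.submoduleE(3,5)[OF assms(1,2)] assms(3,4) by (simp add: a_minus_def)

lemma submodule_addI:
 assumes "Module.module R M" "submodule H R M" "x \<in> H" "y \<in> H" shows "x \<oplus>\<^bsub>M\<^esub> y \<in> H"
 using Module.module.submoduleE(5)[OF assms(1,2)] assms(3,4) by simp

section \<open>Composition and cancellation of quasi-isomorphisms\<close>

lemma quasi_iso_comp:
 assumes X: "chain_complex R X" and Y: "chain_complex R Y" and Z: "chain_complex R Z"
  and f: "quasi_iso R X Y f" and g: "quasi_iso R Y Z g"
 shows "quasi_iso R X Z (\<lambda>n x. g n (f n x))"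
 unfolding quasi_iso_iff[OF X Z]
proof (intro conjI allI ballI impI)
 note f' = f[unfolded quasi_iso_iff[OF X Y]] and g' = g[unfolded quasi_iso_iff[OF Y Z]]
 hence fc: "chain_map R X Y f" and gc: "chain_map R Y Z g" by auto
 show "chain_map R X Z (\<lambda>n x. g n (f n x))" by (rule cm_comp[OF fc gc])
 show "z \<in> boundaries X n" if "z \<in> cycles X n" "g n (f n z) \<in> boundaries Z n" for n z
  using that f' g' cm_cycles[OF X Y fc that(1)] by blast
 show "\<exists>z\<in>cycles X n. y \<ominus>\<^bsub>Z$n\<^esub> g n (f n z) \<in> boundaries Z n" if y: "y \<in> cycles Z n" for n y
 proof -
  interpret M: Module.module R "Z$n" by (rule cxM[OF Z])
  obtain w where w: "w \<in> cycles Y n" "y \<ominus>\<^bsub>Z$n\<^esub> g n w \<in> boundaries Z n" using g' y by blast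
  obtain z where z: "z \<in> cycles X n" "w \<ominus>\<^bsub>Y$n\<^esub> f n z \<in> boundaries Y n" using f' w by blast
  have c: "w \<in> Y$$n" "f n z \<in> Y$$n" "g n w \<in> Z$$n"
   "g n (f n z) \<in> Z$$n" "y \<in> Z$$n"
   using cyclesD(1)[OF w(1)] cyclesD(1)[OF y] cm_closed[OF fc cyclesD(1)[OF z(1)]]
   by (simp_all add: cm_closed[OF gc])
  have "g n w \<ominus>\<^bsub>Z$n\<^esub> g n (f n z) \<in> boundaries Z n"
   using cm_boundaries[OF gc z(2)] lin_diff[OF cm_lin[OF gc] cxM[OF Y] cxM[OF Z] c(1,2)] by simp
  hence "(y \<ominus>\<^bsub>Z$n\<^esub> g n w) \<oplus>\<^bsub>Z$n\<^esub> (g n w \<ominus>\<^bsub>Z$n\<^esub> g n (f n z)) \<in> boundaries Z n"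
   by (rule submodule_addI[OF cxM[OF Z] bd_sub[OF Z] w(2)])
  moreover have "(y \<ominus>\<^bsub>Z$n\<^esub> g n w) \<oplus>\<^bsub>Z$n\<^esub> (g n w \<ominus>\<^bsub>Z$n\<^esub> g n (f n z)) = y \<ominus>\<^bsub>Z$n\<^esub> g n (f n z)"
   using c by (simp add: M.M.grp_simps)
  ultimately show ?thesis using z(1) by auto
 qed
qed

text \<open>A null-homotopic map sends cycles to boundaries (\<open>hnull_boundaries\<close>). So g
  f and \<open>p\<close> agree on homology, and there \<open>f\<close> is the bijection
  \<open>p\<close> followed by the inverse of \<open>g\<close>.\<close>

lemma quasi_iso_cancel:
 assumes X: "chain_complex R X" and Y: "chain_complex R Y" and Z: "chain_complex R Z"
  and p: "quasi_iso R X Z p" and g: "quasi_iso R Y Z g" and f: "chain_map R X Y f"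
  and n: "hnull R X Z 0 (\<lambda>i x. g i (f i x) \<ominus>\<^bsub>Z$(i + 0)\<^esub> p i x)"
 shows "quasi_iso R X Y f"
 unfolding quasi_iso_iff[OF X Y]
proof (intro conjI allI ballI impI)
 note p' = p[unfolded quasi_iso_iff[OF X Z]] and g' = g[unfolded quasi_iso_iff[OF Y Z]]
 hence pc: "chain_map R X Z p" and gc: "chain_map R Y Z g" by auto
 have nb: "g i (f i z) \<ominus>\<^bsub>Z$i\<^esub> p i z \<in> boundaries Z i" if "z \<in> cycles X i" for i z
  using hnull_boundaries[OF X Z n that] by simp
 note sm = submodule_addI[OF cxM[OF Z] bd_sub[OF Z]]
  submodule_diffI[OF cxM[OF Z] bd_sub[OF Z]]
 show "chain_map R X Y f" by fact
 show "z \<in> boundaries X n" if z: "z \<in> cycles X n" "f n z \<in> boundaries Y n" for n z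
 proof -
  interpret M: Module.module R "Z$n" by (rule cxM[OF Z])
  have c: "z \<in> X$$n" using cyclesD(1)[OF z(1)] .
  have c': "p n z \<in> Z$$n" "g n (f n z) \<in> Z$$n"
   using c cm_closed[OF f] cm_closed[OF gc] cm_closed[OF pc] by blast+
  have "g n (f n z) \<ominus>\<^bsub>Z$n\<^esub> (g n (f n z) \<ominus>\<^bsub>Z$n\<^esub> p n z) \<in> boundaries Z n"
   by (intro sm cm_boundaries[OF gc] z nb)
  hence "p n z \<in> boundaries Z n" using c' by (simp add: M.M.grp_simps)
  thus ?thesis using p' z by blast
 qed
 show "\<exists>z\<in>cycles X n. y \<ominus>\<^bsub>Y$n\<^esub> f n z \<in> boundaries Y n" if y: "y \<in> cycles Y n" for n y
 proof -
  interpret M: Module.module R "Z$n" by (rule cxM[OF Z])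
  have gy: "g n y \<in> cycles Z n" by (rule cm_cycles[OF Y Z gc y])
  obtain z where z: "z \<in> cycles X n" "g n y \<ominus>\<^bsub>Z$n\<^esub> p n z \<in> boundaries Z n" using p' gy by blast
  have c: "z \<in> X$$n" "y \<in> Y$$n" "f n z \<in> Y$$n"
   using cyclesD(1)[OF z(1)] cyclesD(1)[OF y] cm_closed[OF f] by blast+
  have c': "p n z \<in> Z$$n" "g n (f n z) \<in> Z$$n" "g n y \<in> Z$$n"
   using c cm_closed[OF gc] cm_closed[OF pc] by blast+
  have "(g n y \<ominus>\<^bsub>Z$n\<^esub> p n z) \<ominus>\<^bsub>Z$n\<^esub> (g n (f n z) \<ominus>\<^bsub>Z$n\<^esub> p n z) \<in> boundaries Z n"
   by (intro sm nb z)
  moreover have "(g n y \<ominus>\<^bsub>Z$n\<^esub> p n z) \<ominus>\<^bsub>Z$n\<^esub> (g n (f n z) \<ominus>\<^bsub>Z$n\<^esub> p n z) = g n (y \<ominus>\<^bsub>Y$n\<^esub> f n z)"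
   unfolding lin_diff[OF cm_lin[OF gc] cxM[OF Y] cxM[OF Z] c(2,3)]
   using c' by (simp add: M.M.grp_simps)
  moreover have "y \<ominus>\<^bsub>Y$n\<^esub> f n z \<in> cycles Y n"
   by (rule submodule_diffI[OF cxM[OF Y] cyc_sub[OF Y] y cm_cycles[OF X Y f z(1)]])
  ultimately have "y \<ominus>\<^bsub>Y$n\<^esub> f n z \<in> boundaries Y n" using g' by auto
  thus ?thesis using z(1) by blast
 qed
qed

section \<open>The complex of homomorphisms\<close>

context
 fixes R :: "('a, 'r) ring_scheme" and P :: "('a, 'p) chain_cx" and Y :: "('a, 'y) chain_cx"
 assumes P: "chain_complex R P" and Y: "chain_complex R Y"
begin

lemma Hom_carrier: "f \<in> (Hom_cx R P Y)$$n \<longleftrightarrow>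
  (\<forall>i. f i \<in> extensional (P$$i) \<and> lin_map R (P$i) (Y$(i + n)) (f i))"
 by (simp add: Hom_cx_def)

lemma Hom_lin: "f \<in> (Hom_cx R P Y)$$n \<Longrightarrow> k = i + n \<Longrightarrow> lin_map R (P$i) (Y$k) (f i)"
 by (simp add: Hom_carrier)

lemma Hom_closed:
 "f \<in> (Hom_cx R P Y)$$n \<Longrightarrow> x \<in> P$$i \<Longrightarrow> k = i + n \<Longrightarrow> f i x \<in> Y$$k"
 using Hom_lin lin_closed by metis

lemma Hom_eqI:
 assumes "f \<in> (Hom_cx R P Y)$$n" "g \<in> (Hom_cx R P Y)$$n"
  "\<And>i x. x \<in> P$$i \<Longrightarrow> f i x = g i x"
 shows "f = g"
proof
 fix i show "f i = g i"
  by (rule extensionalityI[of _ "P$$i"]) (use assms in \<open>auto simp: Hom_carrier\<close>)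
qed

lemma Hom_simps:
 assumes "x \<in> P$$i"
 shows "(f \<oplus>\<^bsub>(Hom_cx R P Y)$n\<^esub> g) i x = f i x \<oplus>\<^bsub>Y$(i + n)\<^esub> g i x"
  "(r \<odot>\<^bsub>(Hom_cx R P Y)$n\<^esub> g) i x = r \<odot>\<^bsub>Y$(i + n)\<^esub> g i x"
  "\<zero>\<^bsub>(Hom_cx R P Y)$n\<^esub> i x = \<zero>\<^bsub>Y$(i + n)\<^esub>"
 using assms by (simp_all add: Hom_cx_def)

lemma Hom_mem_restrict:
 assumes "\<And>i. lin_map R (P$i) (Y$(i + n)) (f i)"
 shows "(\<lambda>i. \<lambda>x\<in>P$$i. f i x) \<in> (Hom_cx R P Y)$$n"
 unfolding Hom_carrier using lin_cong[OF assms _ cxM[OF P]] by (simp add: extensional_def)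

lemma Hom_add_mem:
 assumes "f \<in> (Hom_cx R P Y)$$n" "g \<in> (Hom_cx R P Y)$$n"
 shows "f \<oplus>\<^bsub>(Hom_cx R P Y)$n\<^esub> g \<in> (Hom_cx R P Y)$$n"
 using Hom_mem_restrict[OF lin_plus[OF Hom_lin[OF assms(1) refl] Hom_lin[OF assms(2) refl] cxM[OF Y]]]
 by (simp add: Hom_cx_def)

lemma Hom_smult_mem:
 assumes "r \<in> carrier R" "f \<in> (Hom_cx R P Y)$$n"
 shows "r \<odot>\<^bsub>(Hom_cx R P Y)$n\<^esub> f \<in> (Hom_cx R P Y)$$n"
proof -
 have "lin_map R (P$i) (Y$(i + n)) (\<lambda>x. r \<odot>\<^bsub>Y$(i + n)\<^esub> f i x)" for i
 proof -
  interpret M: Module.module R "Y$(i + n)" by (rule cxM[OF Y])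
  note l = Hom_lin[OF assms(2) refl, of i]
  show ?thesis
   by (rule lin_mapI) (auto simp: lin_closed[OF l] lin_add[OF l] lin_smult[OF l] assms(1)
    M.smult_r_distr M.smult_assoc1[symmetric] M.R.m_comm)
 qed
 from Hom_mem_restrict[OF this] show ?thesis by (simp add: Hom_cx_def)
qed

lemma Hom_zero_mem: "\<zero>\<^bsub>(Hom_cx R P Y)$n\<^esub> \<in> (Hom_cx R P Y)$$n"
 using Hom_mem_restrict[OF lin_zero_map[OF cxM[OF Y]]] by (simp add: Hom_cx_def)

lemma Hom_module: "Module.module R ((Hom_cx R P Y)$n)"
proof -
 have MY: "Module.module R (Y$i)" for i by (rule cxM[OF Y])
 have AG: "abelian_group (Y$i)" for i using MY unfolding Module.module_def by auto
 have AM: "abelian_monoid (Y$i)" for i using AG unfolding abelian_group_def by auto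
 note mem = Hom_add_mem Hom_smult_mem Hom_zero_mem
 show ?thesis
 proof (rule moduleI)
  show "cring R" using MY[of 0] unfolding Module.module_def by auto
  show "abelian_group ((Hom_cx R P Y)$n)"
  proof (rule abelian_groupI)
   fix f assume f: "f \<in> (Hom_cx R P Y)$$n"
   let ?g = "\<lambda>i. \<lambda>x\<in>P$$i. \<ominus>\<^bsub>Y$(i + n)\<^esub> f i x"
   have g: "?g \<in> (Hom_cx R P Y)$$n"
    by (rule Hom_mem_restrict[OF lin_uminus[OF Hom_lin[OF f refl] MY]])
   have "?g \<oplus>\<^bsub>(Hom_cx R P Y)$n\<^esub> f = \<zero>\<^bsub>(Hom_cx R P Y)$n\<^esub>"
    by (rule Hom_eqI[OF mem(1)[OF g f] mem(3)])
     (simp add: Hom_simps abelian_group.l_neg[OF AG] Hom_closed[OF f])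
   thus "\<exists>g\<in>(Hom_cx R P Y)$$n. g \<oplus>\<^bsub>(Hom_cx R P Y)$n\<^esub> f = \<zero>\<^bsub>(Hom_cx R P Y)$n\<^esub>"
    using g by blast
  next
   fix f assume f: "f \<in> (Hom_cx R P Y)$$n"
   show "\<zero>\<^bsub>(Hom_cx R P Y)$n\<^esub> \<oplus>\<^bsub>(Hom_cx R P Y)$n\<^esub> f = f"
    by (rule Hom_eqI[of _ n]) (use f in \<open>simp_all add: mem Hom_simps abelian_monoid.l_zero[OF AM] Hom_closed[OF f]\<close>)
   fix g assume g: "g \<in> (Hom_cx R P Y)$$n"
   show "f \<oplus>\<^bsub>(Hom_cx R P Y)$n\<^esub> g = g \<oplus>\<^bsub>(Hom_cx R P Y)$n\<^esub> f"
    by (rule Hom_eqI[of _ n])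
     (use f g in \<open>simp_all add: mem Hom_simps abelian_monoid.a_comm[OF AM] Hom_closed[OF f] Hom_closed[OF g]\<close>)
   fix h assume h: "h \<in> (Hom_cx R P Y)$$n"
   show "f \<oplus>\<^bsub>(Hom_cx R P Y)$n\<^esub> g \<oplus>\<^bsub>(Hom_cx R P Y)$n\<^esub> h =
     f \<oplus>\<^bsub>(Hom_cx R P Y)$n\<^esub> (g \<oplus>\<^bsub>(Hom_cx R P Y)$n\<^esub> h)"
    by (rule Hom_eqI[of _ n])
     (use f g h in \<open>simp_all add: mem Hom_simps abelian_monoid.a_assoc[OF AM] Hom_closed[OF f] Hom_closed[OF g] Hom_closed[OF h]\<close>)
  qed (fact mem)+
 next
  fix a b f assume f: "f \<in> (Hom_cx R P Y)$$n" and a: "a \<in> carrier R"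
  thus "a \<odot>\<^bsub>(Hom_cx R P Y)$n\<^esub> f \<in> (Hom_cx R P Y)$$n" by (intro mem)
  interpret M0: Module.module R "Y$0" by (rule MY)
  assume b: "b \<in> carrier R"
  show "(a \<oplus>\<^bsub>R\<^esub> b) \<odot>\<^bsub>(Hom_cx R P Y)$n\<^esub> f =
    a \<odot>\<^bsub>(Hom_cx R P Y)$n\<^esub> f \<oplus>\<^bsub>(Hom_cx R P Y)$n\<^esub> b \<odot>\<^bsub>(Hom_cx R P Y)$n\<^esub> f"
   by (rule Hom_eqI[of _ n])
    (use f a b in \<open>simp_all add: mem Hom_simps Module.module.smult_l_distr[OF MY] Hom_closed[OF f]\<close>)
  show "a \<otimes>\<^bsub>R\<^esub> b \<odot>\<^bsub>(Hom_cx R P Y)$n\<^esub> f = a \<odot>\<^bsub>(Hom_cx R P Y)$n\<^esub> (b \<odot>\<^bsub>(Hom_cx R P Y)$n\<^esub> f)"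
   by (rule Hom_eqI[of _ n])
    (use f a b in \<open>simp_all add: mem Hom_simps Module.module.smult_assoc1[OF MY] Hom_closed[OF f]\<close>)
 next
  fix a f g assume f: "f \<in> (Hom_cx R P Y)$$n" and a: "a \<in> carrier R"
   and g: "g \<in> (Hom_cx R P Y)$$n"
  show "a \<odot>\<^bsub>(Hom_cx R P Y)$n\<^esub> (f \<oplus>\<^bsub>(Hom_cx R P Y)$n\<^esub> g) =
    a \<odot>\<^bsub>(Hom_cx R P Y)$n\<^esub> f \<oplus>\<^bsub>(Hom_cx R P Y)$n\<^esub> a \<odot>\<^bsub>(Hom_cx R P Y)$n\<^esub> g"
   by (rule Hom_eqI[of _ n])
    (use f g a in \<open>simp_all add: mem Hom_simps Module.module.smult_r_distr[OF MY] Hom_closed[OF f] Hom_closed[OF g]\<close>)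
 next
  fix f assume f: "f \<in> (Hom_cx R P Y)$$n"
  interpret M0: Module.module R "Y$0" by (rule MY)
  show "\<one>\<^bsub>R\<^esub> \<odot>\<^bsub>(Hom_cx R P Y)$n\<^esub> f = f"
   by (rule Hom_eqI[of _ n]) (use f in \<open>simp_all add: mem Hom_simps Module.module.smult_one[OF MY] Hom_closed[OF f]\<close>)
 qed
qed

lemma Hom_d_apply:
 assumes f: "f \<in> (Hom_cx R P Y)$$n" and x: "x \<in> P$$i"
 shows "cx_d (Hom_cx R P Y) n f i x =
  cx_d Y (i + n) (f i x) \<ominus>\<^bsub>Y$(i + n - 1)\<^esub> sg (Y$(i + n - 1)) n (f (i - 1) (cx_d P i x))"
proof -
 interpret M: Module.module R "Y$(i + n - 1)" by (rule cxM[OF Y])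
 have "f (i - 1) (cx_d P i x) \<in> Y$$(i + n - 1)"
  by (rule Hom_closed[OF f cx_closed[OF P x refl]]) simp
 thus ?thesis using x by (simp add: Hom_cx_def sg_def a_minus_def)
qed

lemma Hom_d_lin:
 assumes f: "f \<in> (Hom_cx R P Y)$$n"
 shows "lin_map R (P$i) (Y$(i + n - 1)) (\<lambda>x.
  cx_d Y (i + n) (f i x) \<ominus>\<^bsub>Y$(i + n - 1)\<^esub> sg (Y$(i + n - 1)) n (f (i - 1) (cx_d P i x)))"
 by (intro lin_minus lin_sg_map lin_comp[OF Hom_lin[OF f refl] cx_lin[OF Y]] cxM[OF Y]
   lin_comp[OF cx_lin[OF P] Hom_lin[OF f]]) simp

lemma Hom_d_mem:
 assumes f: "f \<in> (Hom_cx R P Y)$$n"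
 shows "cx_d (Hom_cx R P Y) n f \<in> (Hom_cx R P Y)$$(n - 1)"
proof -
 have c: "i + n - 1 = i + (n - 1)" for i :: int by simp
 have "cx_d (Hom_cx R P Y) n f = (\<lambda>i. \<lambda>x\<in>P$$i. cx_d Y (i + n) (f i x) \<ominus>\<^bsub>Y$(i + n - 1)\<^esub>
   sg (Y$(i + n - 1)) n (f (i - 1) (cx_d P i x)))"
 proof (intro ext)
  fix i x
  show "cx_d (Hom_cx R P Y) n f i x = (\<lambda>x\<in>P$$i. cx_d Y (i + n) (f i x) \<ominus>\<^bsub>Y$(i + n - 1)\<^esub>
   sg (Y$(i + n - 1)) n (f (i - 1) (cx_d P i x))) x"
   using Hom_d_apply[OF f, of x i] by (cases "x \<in> P$$i") (simp, simp add: Hom_cx_def)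
 qed
 also have "\<dots> \<in> (Hom_cx R P Y)$$(n - 1)"
  by (rule Hom_mem_restrict) (simp only: c[symmetric] Hom_d_lin[OF f])
 finally show ?thesis .
qed

lemma Hom_chain_complex: "chain_complex R (Hom_cx R P Y)"
 unfolding chain_complex_def
proof (intro conjI allI ballI Hom_module)
 fix n
 note mem = Hom_add_mem Hom_smult_mem Hom_zero_mem Hom_d_mem
 show "lin_map R ((Hom_cx R P Y)$n) ((Hom_cx R P Y)$(n - 1)) (cx_d (Hom_cx R P Y) n)"
 proof (rule lin_mapI)
  fix f assume f: "f \<in> (Hom_cx R P Y)$$n"
  thus "cx_d (Hom_cx R P Y) n f \<in> (Hom_cx R P Y)$$(n - 1)" by (rule Hom_d_mem)
  {
   fix g assume g: "g \<in> (Hom_cx R P Y)$$n"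
   show "cx_d (Hom_cx R P Y) n (f \<oplus>\<^bsub>(Hom_cx R P Y)$n\<^esub> g) =
    cx_d (Hom_cx R P Y) n f \<oplus>\<^bsub>(Hom_cx R P Y)$(n - 1)\<^esub> cx_d (Hom_cx R P Y) n g"
   proof (rule Hom_eqI[of _ "n - 1"])
    fix i x assume x: "x \<in> P$$i"
    interpret M: Module.module R "Y$(i + n - 1)" by (rule cxM[OF Y])
    have c: "i + (n - 1) = i + n - 1" "i - 1 + n = i + n - 1" by simp_all
    have dx: "cx_d P i x \<in> P$$(i - 1)" by (rule cx_closed[OF P x refl])
    have e: "f (i - 1) (cx_d P i x) \<in> Y$$(i + n - 1)" "g (i - 1) (cx_d P i x) \<in> Y$$(i + n - 1)"
     by (rule Hom_closed[OF f dx], simp, rule Hom_closed[OF g dx], simp)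
    have e': "f i x \<in> Y$$(i + n)" "g i x \<in> Y$$(i + n)"
     using Hom_closed[OF f x] Hom_closed[OF g x] by auto
    have e'': "cx_d Y (i + n) (f i x) \<in> Y$$(i + n - 1)" "cx_d Y (i + n) (g i x) \<in> Y$$(i + n - 1)"
     using cx_closed[OF Y e'(1)] cx_closed[OF Y e'(2)] by auto
    show "cx_d (Hom_cx R P Y) n (f \<oplus>\<^bsub>(Hom_cx R P Y)$n\<^esub> g) i x =
      (cx_d (Hom_cx R P Y) n f \<oplus>\<^bsub>(Hom_cx R P Y)$(n - 1)\<^esub> cx_d (Hom_cx R P Y) n g) i x"
     using e e' e'' lin_add[OF cx_lin[OF Y] e']
     by (simp add: Hom_d_apply mem f g x Hom_simps dx c) (auto simp: sg_def M.M.grp_simps)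
   qed (use mem f g in auto)
  next
   fix r assume r: "r \<in> carrier R"
   show "cx_d (Hom_cx R P Y) n (r \<odot>\<^bsub>(Hom_cx R P Y)$n\<^esub> f) =
    r \<odot>\<^bsub>(Hom_cx R P Y)$(n - 1)\<^esub> cx_d (Hom_cx R P Y) n f"
   proof (rule Hom_eqI[of _ "n - 1"])
    fix i x assume x: "x \<in> P$$i"
    interpret M: Module.module R "Y$(i + n - 1)" by (rule cxM[OF Y])
    have c: "i + (n - 1) = i + n - 1" "i - 1 + n = i + n - 1" by simp_all
    have dx: "cx_d P i x \<in> P$$(i - 1)" by (rule cx_closed[OF P x refl])
    have e: "f (i - 1) (cx_d P i x) \<in> Y$$(i + n - 1)"
     by (rule Hom_closed[OF f dx], simp)
    have e': "f i x \<in> Y$$(i + n)" using Hom_closed[OF f x] by auto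
    have e'': "cx_d Y (i + n) (f i x) \<in> Y$$(i + n - 1)" using cx_closed[OF Y e'(1)] by auto
    show "cx_d (Hom_cx R P Y) n (r \<odot>\<^bsub>(Hom_cx R P Y)$n\<^esub> f) i x =
      (r \<odot>\<^bsub>(Hom_cx R P Y)$(n - 1)\<^esub> cx_d (Hom_cx R P Y) n f) i x"
     using e e' e'' r lin_smult[OF cx_lin[OF Y] r e']
     by (simp add: Hom_d_apply mem f x Hom_simps dx c) (auto simp: sg_def M.M.grp_simps M.smult_r_distr M.smult_r_minus)
   qed (use mem f r in auto)
  }
 qed
 fix f assume f: "f \<in> (Hom_cx R P Y)$$n"
 show "cx_d (Hom_cx R P Y) (n - 1) (cx_d (Hom_cx R P Y) n f) = \<zero>\<^bsub>(Hom_cx R P Y)$(n - 1 - 1)\<^esub>"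
 proof (rule Hom_eqI[of _ "n - 1 - 1"])
  fix i x assume x: "x \<in> P$$i"
  interpret M: Module.module R "Y$(i + n - 2)" by (rule cxM[OF Y])
  interpret M1: Module.module R "Y$(i + n - 1)" by (rule cxM[OF Y])
  have c: "i + (n - 1) = i + n - 1" "i - 1 + n = i + n - 1" "i + n - 1 - 1 = i + n - 2" "i - 1 - 1 = i - 2" "i + (n - 2) = i + n - 2" by simp_all
  have dx: "cx_d P i x \<in> P$$(i - 1)" by (rule cx_closed[OF P x refl])
  have ddx: "cx_d P (i - 1) (cx_d P i x) = \<zero>\<^bsub>P$(i - 2)\<^esub>" by (rule cx_dd[OF P x]) auto
  have z: "f (i - 2) \<zero>\<^bsub>P$(i - 2)\<^esub> = \<zero>\<^bsub>Y$(i + n - 2)\<^esub>"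
   by (rule lin_zero[OF Hom_lin[OF f] cxM[OF P] cxM[OF Y]]) simp
  have e: "f (i - 1) (cx_d P i x) \<in> Y$$(i + n - 1)" by (rule Hom_closed[OF f dx], simp)
  have e': "f i x \<in> Y$$(i + n)" using Hom_closed[OF f x] by auto
  have e'': "cx_d Y (i + n) (f i x) \<in> Y$$(i + n - 1)" using cx_closed[OF Y e'(1)] by auto
  have k: "cx_d Y (i + n - 1) (f (i - 1) (cx_d P i x)) \<in> Y$$(i + n - 2)"
   by (rule cx_closed[OF Y e]) simp
  have "cx_d Y (i + n - 1) (cx_d Y (i + n) (f i x) \<ominus>\<^bsub>Y$(i + n - 1)\<^esub> sg (Y$(i + n - 1)) n (f (i - 1) (cx_d P i x)))
   = cx_d Y (i + n - 1) (cx_d Y (i + n) (f i x)) \<ominus>\<^bsub>Y$(i + n - 2)\<^esub> sg (Y$(i + n - 2)) n (cx_d Y (i + n - 1) (f (i - 1) (cx_d P i x)))"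
   using lin_diff[OF cx_lin' cxM cxM e'' sg_closed[OF cxM e], OF Y _ Y Y Y, of "i + n - 2" n]
    lin_sg[OF cx_lin' cxM cxM e, OF Y _ Y Y, of "i + n - 2" n] by simp
  also have "\<dots> = \<ominus>\<^bsub>Y$(i + n - 2)\<^esub> sg (Y$(i + n - 2)) n (cx_d Y (i + n - 1) (f (i - 1) (cx_d P i x)))"
   using cx_dd[OF Y e', of "i + n - 1" "i + n - 2"] k sg_closed[OF cxM[OF Y] k] by (simp add: a_minus_def)
  finally have "cx_d (Hom_cx R P Y) (n - 1) (cx_d (Hom_cx R P Y) n f) i x =
    \<ominus>\<^bsub>Y$(i + n - 2)\<^esub> sg (Y$(i + n - 2)) n (cx_d Y (i + n - 1) (f (i - 1) (cx_d P i x))) \<ominus>\<^bsub>Y$(i + n - 2)\<^esub>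
    sg (Y$(i + n - 2)) (n - 1) (cx_d Y (i + n - 1) (f (i - 1) (cx_d P i x)))"
   using z k by (simp add: Hom_d_apply mem f x dx c ddx sg_zero[OF cxM[OF Y]] module_diff_zero[OF cxM[OF Y]])
  also have "\<dots> = \<zero>\<^bsub>Y$(i + n - 2)\<^esub>"
   using k by (auto simp: sg_def M.M.grp_simps M.M.l_neg)
  finally show "cx_d (Hom_cx R P Y) (n - 1) (cx_d (Hom_cx R P Y) n f) i x = \<zero>\<^bsub>(Hom_cx R P Y)$(n - 1 - 1)\<^esub> i x"
   using x by (simp add: Hom_simps c)
 qed (use Hom_d_mem[OF Hom_d_mem[OF f]] mem f in auto)
qed

lemma Hom_cycles: "f \<in> cycles (Hom_cx R P Y) n \<longleftrightarrow> f \<in> (Hom_cx R P Y)$$n \<and> hcyc R P Y n f"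
proof (cases "f \<in> (Hom_cx R P Y)$$n")
 case True
 note f = this
 have c: "i + (n - 1) = i + n - 1" for i :: int by simp
 have "cx_d (Hom_cx R P Y) n f = \<zero>\<^bsub>(Hom_cx R P Y)$(n - 1)\<^esub> \<longleftrightarrow>
   (\<forall>i. \<forall>x\<in>P$$i. cx_d (Hom_cx R P Y) n f i x = \<zero>\<^bsub>Y$(i + n - 1)\<^esub>)"
  using Hom_eqI[OF Hom_d_mem[OF f] Hom_zero_mem] by (auto simp: Hom_simps c)
 also have "\<dots> \<longleftrightarrow> (\<forall>i. \<forall>x\<in>P$$i. cx_d Y (i + n) (f i x) = sg (Y$(i + n - 1)) n (f (i - 1) (cx_d P i x)))"
 proof -
  have "cx_d (Hom_cx R P Y) n f i x = \<zero>\<^bsub>Y$(i + n - 1)\<^esub> \<longleftrightarrow>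
    cx_d Y (i + n) (f i x) = sg (Y$(i + n - 1)) n (f (i - 1) (cx_d P i x))"
   if x: "x \<in> P$$i" for i x
   unfolding Hom_d_apply[OF f x]
   by (rule module_diff_zero_iff[OF cxM[OF Y]])
    (auto intro!: sg_closed[OF cxM[OF Y]] cx_closed[OF Y] Hom_closed[OF f] cx_closed[OF P] x)
  thus ?thesis by blast
 qed
 finally show ?thesis using f by (simp add: cycles_def hcyc_def Hom_carrier)
qed (simp add: cycles_def)

lemma Hom_boundaries: "f \<in> boundaries (Hom_cx R P Y) n \<longleftrightarrow> f \<in> (Hom_cx R P Y)$$n \<and> hnull R P Y n f"
proof
 have c: "i + (n + 1) - 1 = i + n" "i + (n + 1) = i + n + 1" "i - 1 + n + 1 = i + n" for i :: int by simp_all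
 have d: "cx_d (Hom_cx R P Y) (n + 1) h i x = cx_d Y (i + n + 1) (h i x) \<oplus>\<^bsub>Y$(i + n)\<^esub> sg (Y$(i + n)) n (h (i - 1) (cx_d P i x))"
  if h: "h \<in> (Hom_cx R P Y)$$(n + 1)" and x: "x \<in> P$$i" for h i x
 proof -
  interpret M: Module.module R "Y$(i + n)" by (rule cxM[OF Y])
  have e: "h (i - 1) (cx_d P i x) \<in> Y$$(i + n)"
   by (rule Hom_closed[OF h cx_closed[OF P x refl]]) simp
  thus ?thesis unfolding Hom_d_apply[OF h x] c
   by (simp add: sg_Suc[OF cxM[OF Y] e] a_minus_def sg_closed[OF cxM[OF Y]])
 qed
 {
  assume "f \<in> boundaries (Hom_cx R P Y) n"
  then obtain h where h: "h \<in> (Hom_cx R P Y)$$(n + 1)" "f = cx_d (Hom_cx R P Y) (n + 1) h"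
   unfolding boundaries_iff by auto
  have "htpy R P Y n h f" unfolding htpy_def
   using Hom_lin[OF h(1)] d[OF h(1)] h(2) by (simp add: c)
  thus "f \<in> (Hom_cx R P Y)$$n \<and> hnull R P Y n f"
   using Hom_d_mem[OF h(1)] h(2) unfolding hnull_def by auto
 next
  assume "f \<in> (Hom_cx R P Y)$$n \<and> hnull R P Y n f"
  then obtain h where f: "f \<in> (Hom_cx R P Y)$$n" and h: "htpy R P Y n h f" unfolding hnull_def by auto
  let ?h = "\<lambda>i. \<lambda>x\<in>P$$i. h i x"
  have h': "?h \<in> (Hom_cx R P Y)$$(n + 1)"
   by (rule Hom_mem_restrict) (rule htpy_lin[OF h], simp)
  have "f = cx_d (Hom_cx R P Y) (n + 1) ?h"
  proof (rule Hom_eqI[OF f])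
   show "cx_d (Hom_cx R P Y) (n + 1) ?h \<in> (Hom_cx R P Y)$$n" using Hom_d_mem[OF h'] by simp
   fix i x assume x: "x \<in> P$$i"
   show "f i x = cx_d (Hom_cx R P Y) (n + 1) ?h i x"
    unfolding d[OF h' x] using htpy_eq[OF h x refl refl refl] x cx_closed[OF P x refl] by simp
  qed
  thus "f \<in> boundaries (Hom_cx R P Y) n" using h' unfolding boundaries_iff by blast
 }
qed

text \<open>The gap between the two sides is extensionality: a family satisfying \<open>hcyc\<close>
  is first restricted to the carriers.\<close>

lemma Hom_exact_iff: "cx_exact (Hom_cx R P Y) n \<longleftrightarrow> (\<forall>\<alpha>. hcyc R P Y n \<alpha> \<longrightarrow> hnull R P Y n \<alpha>)"
proof
 assume e: "cx_exact (Hom_cx R P Y) n"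
 show "\<forall>\<alpha>. hcyc R P Y n \<alpha> \<longrightarrow> hnull R P Y n \<alpha>"
 proof (intro allI impI)
  fix \<alpha> assume a: "hcyc R P Y n \<alpha>"
  let ?a = "\<lambda>i. \<lambda>x\<in>P$$i. \<alpha> i x"
  have "?a \<in> (Hom_cx R P Y)$$n" by (rule Hom_mem_restrict[OF hcyc_lin[OF a refl]])
  moreover from this have "hcyc R P Y n ?a"
   using a unfolding hcyc_def Hom_carrier by (auto simp: cx_closed[OF P])
  ultimately have "?a \<in> boundaries (Hom_cx R P Y) n"
   using e Hom_cycles unfolding cx_exact_iff[OF Hom_chain_complex] by blast
  thus "hnull R P Y n \<alpha>" unfolding Hom_boundaries by (auto intro: hnull_cong)
 qed
qed (use Hom_cycles Hom_boundaries in \<open>auto simp: cx_exact_iff[OF Hom_chain_complex]\<close>)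

end

text \<open>Acyclicity of Hom(P, Y) for one fixed target, with arbitrary element types on both
  sides. K-projectivity and semi-freeness both enter the lifting arguments in this form.\<close>

definition hexact :: "('a, 'r) ring_scheme \<Rightarrow> ('a, 'p) chain_cx \<Rightarrow> ('a, 'y) chain_cx \<Rightarrow> bool" where
 "hexact R P Y \<longleftrightarrow> (\<forall>m \<alpha>. hcyc R P Y m \<alpha> \<longrightarrow> hnull R P Y m \<alpha>)"

lemma hexactD: "hexact R P Y \<Longrightarrow> hcyc R P Y m \<alpha> \<Longrightarrow> hnull R P Y m \<alpha>"
 unfolding hexact_def by blast

lemma acyclic_Hom_iff:
 assumes P: "chain_complex R P" and Y: "chain_complex R Y"
 shows "acyclic_cx (Hom_cx R P Y) \<longleftrightarrow> hexact R P Y"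
 unfolding hexact_def acyclic_cx_iff[OF Hom_chain_complex[OF P Y]] using Hom_exact_iff[OF P Y] by blast

section \<open>Mapping cones and lifting along quasi-isomorphisms\<close>

text \<open>Degree \<open>n\<close> is Y in degree \<open>n - 1\<close> plus Z in degree
  \<open>n\<close>; the sign on the shifted summand lets the cross terms of the squared differential
  cancel.\<close>

definition cone :: "('a, 'r) ring_scheme \<Rightarrow> ('a, 'y) chain_cx \<Rightarrow> ('a, 'z) chain_cx \<Rightarrow> (int \<Rightarrow> 'y \<Rightarrow> 'z) \<Rightarrow> ('a, 'y \<times> 'z) chain_cx" where
 "cone R Y Z q = \<lparr>cx_mod = (\<lambda>n. \<lparr>carrier = Y$$(n - 1) \<times> Z$$n,
   mult = undefined, one = undefined,
   zero = (\<zero>\<^bsub>Y$(n - 1)\<^esub>, \<zero>\<^bsub>Z$n\<^esub>),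
   add = (\<lambda>u v. (fst u \<oplus>\<^bsub>Y$(n - 1)\<^esub> fst v, snd u \<oplus>\<^bsub>Z$n\<^esub> snd v)),
   smult = (\<lambda>r u. (r \<odot>\<^bsub>Y$(n - 1)\<^esub> fst u, r \<odot>\<^bsub>Z$n\<^esub> snd u))\<rparr>),
   cx_d = (\<lambda>n u. (\<ominus>\<^bsub>Y$(n - 2)\<^esub> cx_d Y (n - 1) (fst u), cx_d Z n (snd u) \<oplus>\<^bsub>Z$(n - 1)\<^esub> q (n - 1) (fst u)))\<rparr>"

context
 fixes R :: "('a, 'r) ring_scheme" and Y :: "('a, 'y) chain_cx" and Z :: "('a, 'z) chain_cx" and q
 assumes Y: "chain_complex R Y" and Z: "chain_complex R Z" and q: "chain_map R Y Z q"
begin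

lemma cone_simps:
 "u \<in> (cone R Y Z q)$$n \<longleftrightarrow> fst u \<in> Y$$(n - 1) \<and> snd u \<in> Z$$n"
 "u \<oplus>\<^bsub>(cone R Y Z q)$n\<^esub> v = (fst u \<oplus>\<^bsub>Y$(n - 1)\<^esub> fst v, snd u \<oplus>\<^bsub>Z$n\<^esub> snd v)"
 "r \<odot>\<^bsub>(cone R Y Z q)$n\<^esub> v = (r \<odot>\<^bsub>Y$(n - 1)\<^esub> fst v, r \<odot>\<^bsub>Z$n\<^esub> snd v)"
 "\<zero>\<^bsub>(cone R Y Z q)$n\<^esub> = (\<zero>\<^bsub>Y$(n - 1)\<^esub>, \<zero>\<^bsub>Z$n\<^esub>)"
 "cx_d (cone R Y Z q) n u = (\<ominus>\<^bsub>Y$(n - 2)\<^esub> cx_d Y (n - 1) (fst u), cx_d Z n (snd u) \<oplus>\<^bsub>Z$(n - 1)\<^esub> q (n - 1) (fst u))"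
 by (auto simp: cone_def mem_Times_iff)

lemma cone_module: "Module.module R ((cone R Y Z q)$n)"
proof -
 interpret A: Module.module R "Y$(n - 1)" by (rule cxM[OF Y])
 interpret B: Module.module R "Z$n" by (rule cxM[OF Z])
 show ?thesis
 proof (rule moduleI)
  show "abelian_group ((cone R Y Z q)$n)"
  proof (rule abelian_groupI)
   fix u assume "u \<in> (cone R Y Z q)$$n"
   thus "\<exists>v\<in>(cone R Y Z q)$$n. v \<oplus>\<^bsub>(cone R Y Z q)$n\<^esub> u = \<zero>\<^bsub>(cone R Y Z q)$n\<^esub>"
    by (intro bexI[of _ "(\<ominus>\<^bsub>Y$(n - 1)\<^esub> fst u, \<ominus>\<^bsub>Z$n\<^esub> snd u)"]) (auto simp: cone_simps A.M.l_neg B.M.l_neg)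
  qed (auto simp: cone_simps A.M.a_ac B.M.a_ac)
 qed (auto simp: cone_simps A.smult_l_distr B.smult_l_distr A.smult_r_distr B.smult_r_distr
   A.smult_assoc1 B.smult_assoc1 A.R.is_cring)
qed

lemma cone_inv:
 assumes "u \<in> (cone R Y Z q)$$n"
 shows "\<ominus>\<^bsub>(cone R Y Z q)$n\<^esub> u = (\<ominus>\<^bsub>Y$(n - 1)\<^esub> fst u, \<ominus>\<^bsub>Z$n\<^esub> snd u)"
 using assms
 by (simp add: minus_one_smult[OF cone_module] minus_one_smult[OF cxM[OF Y]] minus_one_smult[OF cxM[OF Z]] cone_simps)

lemma cone_chain_complex: "chain_complex R (cone R Y Z q)"
 unfolding chain_complex_def
proof (intro conjI allI ballI cone_module)
 fix n
 interpret A1: Module.module R "Y$(n - 2)" by (rule cxM[OF Y])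
 interpret B1: Module.module R "Z$(n - 1)" by (rule cxM[OF Z])
 note la = cx_lin'[OF Y, of "n - 2" "n - 1", simplified] and lb = cx_lin[OF Z, of n] and lq = cm_lin[OF q, of "n - 1"]
 have c: "n - 1 - 1 = n - 2" "n - 2 - 1 = n - 3" by simp_all
 show "lin_map R ((cone R Y Z q)$n) ((cone R Y Z q)$(n - 1)) (cx_d (cone R Y Z q) n)"
  by (rule lin_mapI)
   (auto simp: cone_simps lin_closed[OF la] lin_closed[OF lb] lin_closed[OF lq]
    lin_add[OF la] lin_add[OF lb] lin_add[OF lq] lin_smult[OF la] lin_smult[OF lb] lin_smult[OF lq]
    A1.M.minus_add A1.M.a_ac B1.M.a_ac A1.smult_r_distr B1.smult_r_distr A1.smult_r_minus)
 fix u assume "u \<in> (cone R Y Z q)$$n"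
 hence u: "fst u \<in> Y$$(n - 1)" "snd u \<in> Z$$n" by (auto simp: cone_simps)
 note lq' = cm_lin[OF q, of "n - 2"] and lb' = cx_lin'[OF Z, of "n - 2" "n - 1", simplified]
 have 1: "cx_d Y (n - 2) (\<ominus>\<^bsub>Y$(n - 2)\<^esub> cx_d Y (n - 1) (fst u)) = \<zero>\<^bsub>Y$(n - 3)\<^esub>"
  using lin_inv[OF cx_lin'[OF Y, of "n - 3" "n - 2"] cxM[OF Y] cxM[OF Y] lin_closed[OF la u(1)]]
   cx_dd[OF Y u(1), of "n - 2" "n - 3"] minus_one_smult[OF cxM[OF Y]]
   sg_zero[OF cxM[OF Y], of "n - 3" 1] by (simp add: sg_def)
 interpret B2: Module.module R "Z$(n - 2)" by (rule cxM[OF Z])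
 have "cx_d Z (n - 1) (cx_d Z n (snd u) \<oplus>\<^bsub>Z$(n - 1)\<^esub> q (n - 1) (fst u)) = q (n - 2) (cx_d Y (n - 1) (fst u))"
  using lin_add[OF lb' lin_closed[OF lb u(2)] lin_closed[OF lq u(1)]] cx_dd[OF Z u(2), of "n - 1" "n - 2"]
   cm_d[OF q u(1), of "n - 2"] lin_closed[OF lb' lin_closed[OF lq u(1)]] by simp
 moreover have "q (n - 2) (\<ominus>\<^bsub>Y$(n - 2)\<^esub> cx_d Y (n - 1) (fst u)) = \<ominus>\<^bsub>Z$(n - 2)\<^esub> q (n - 2) (cx_d Y (n - 1) (fst u))"
  by (rule lin_inv[OF lq' cxM[OF Y] cxM[OF Z] lin_closed[OF la u(1)]])
 moreover have "q (n - 2) (cx_d Y (n - 1) (fst u)) \<in> Z$$(n - 2)"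
  by (rule lin_closed[OF lq' lin_closed[OF la u(1)]])
 ultimately show "cx_d (cone R Y Z q) (n - 1) (cx_d (cone R Y Z q) n u) = \<zero>\<^bsub>(cone R Y Z q)$(n - 1 - 1)\<^esub>"
  using 1 sg_zero[OF cxM[OF Y], of "n - 3" 1] by (simp add: cone_simps c sg_def B2.M.r_neg)
qed

text \<open>Injectivity of \<open>q\<close> on homology in degree \<open>n - 1\<close> provides a
  primitive of the first component of a cycle. Surjectivity in degree \<open>n\<close> then absorbs
  the cycle of \<open>Z\<close> that is left in the second component.\<close>

lemma cone_exact:
 assumes qi: "quasi_iso R Y Z q"
 shows "cx_exact (cone R Y Z q) n"
 unfolding cx_exact_def
proof
 fix u assume "u \<in> cycles (cone R Y Z q) n"
 hence u: "fst u \<in> Y$$(n - 1)" "snd u \<in> Z$$n"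
  "\<ominus>\<^bsub>Y$(n - 2)\<^esub> cx_d Y (n - 1) (fst u) = \<zero>\<^bsub>Y$(n - 2)\<^esub>"
  "cx_d Z n (snd u) \<oplus>\<^bsub>Z$(n - 1)\<^esub> q (n - 1) (fst u) = \<zero>\<^bsub>Z$(n - 1)\<^esub>"
  by (auto simp: cycles_def cone_simps)
 note qi' = qi[unfolded quasi_iso_iff[OF Y Z]]
 interpret A0: Module.module R "Y$n" by (rule cxM[OF Y])
 interpret A: Module.module R "Y$(n - 1)" by (rule cxM[OF Y])
 interpret A1: Module.module R "Y$(n - 2)" by (rule cxM[OF Y])
 interpret B: Module.module R "Z$n" by (rule cxM[OF Z])
 interpret B1: Module.module R "Z$(n - 1)" by (rule cxM[OF Z])
 note la = cx_lin[OF Y, of n] and lb = cx_lin[OF Z, of n]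
 have "cx_d Y (n - 1) (fst u) \<in> Y$$(n - 2)" by (rule cx_closed[OF Y u(1)]) simp
 hence "cx_d Y (n - 1) (fst u) = \<zero>\<^bsub>Y$(n - 2)\<^esub>" using u(3) A1.M.r_neg[of "cx_d Y (n - 1) (fst u)"] by simp
 hence c1: "fst u \<in> cycles Y (n - 1)" using u(1) by (intro cyclesI) auto
 have dz: "cx_d Z n (snd u) \<in> Z$$(n - 1)" by (rule lin_closed[OF lb u(2)])
 have qy: "q (n - 1) (fst u) \<in> Z$$(n - 1)" by (rule cm_closed[OF q u(1)])
 have qe: "q (n - 1) (fst u) = \<ominus>\<^bsub>Z$(n - 1)\<^esub> cx_d Z n (snd u)"
  using u(4) dz qy by (metis B1.M.add.inv_solve_left B1.M.r_zero B1.M.zero_closed B1.M.add.inv_closed)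
 also have "\<dots> = cx_d Z n (\<ominus>\<^bsub>Z$n\<^esub> snd u)" by (rule lin_inv[OF lb cxM[OF Z] cxM[OF Z] u(2), symmetric])
 finally have "q (n - 1) (fst u) \<in> boundaries Z (n - 1)" using u(2) unfolding boundaries_iff by auto
 then obtain y' where y': "y' \<in> Y$$n" "fst u = cx_d Y n y'"
  using qi' c1 unfolding boundaries_iff by (metis diff_add_cancel)
 have qy': "q n y' \<in> Z$$n" by (rule cm_closed[OF q y'(1)])
 have cz: "snd u \<oplus>\<^bsub>Z$n\<^esub> q n y' \<in> cycles Z n"
  using u(4) qy' u(2) lin_add[OF lb u(2) qy'] cm_d[OF q y'(1) refl] y'(2) by (intro cyclesI) auto
 obtain y2 where y2: "y2 \<in> cycles Y n" "(snd u \<oplus>\<^bsub>Z$n\<^esub> q n y') \<ominus>\<^bsub>Z$n\<^esub> q n y2 \<in> boundaries Z n"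
  using qi' cz by blast
 then obtain w where w: "w \<in> Z$$(n + 1)"
  "(snd u \<oplus>\<^bsub>Z$n\<^esub> q n y') \<ominus>\<^bsub>Z$n\<^esub> q n y2 = cx_d Z (n + 1) w" unfolding boundaries_iff by auto
 have y2c: "y2 \<in> Y$$n" by (rule cyclesD(1)[OF y2(1)])
 have qy2: "q n y2 \<in> Z$$n" by (rule cm_closed[OF q y2c])
 have "cx_d Y n (y2 \<ominus>\<^bsub>Y$n\<^esub> y') = \<ominus>\<^bsub>Y$(n - 1)\<^esub> fst u"
  using lin_diff[OF la cxM[OF Y] cxM[OF Y] y2c y'(1)] y'(2) cyclesD(2)[OF y2(1) refl] u(1)
  by (simp add: a_minus_def)
 hence 1: "\<ominus>\<^bsub>Y$(n - 1)\<^esub> cx_d Y n (y2 \<ominus>\<^bsub>Y$n\<^esub> y') = fst u" using u(1) by simp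
 have 2: "cx_d Z (n + 1) w \<oplus>\<^bsub>Z$n\<^esub> q n (y2 \<ominus>\<^bsub>Y$n\<^esub> y') = snd u"
  unfolding w(2)[symmetric] lin_diff[OF cm_lin[OF q] cxM[OF Y] cxM[OF Z] y2c y'(1)]
  using qy2 qy' u(2) by (simp add: B.M.grp_simps)
 show "\<exists>w\<in>(cone R Y Z q)$$(n + 1). cx_d (cone R Y Z q) (n + 1) w = u"
  by (rule bexI[of _ "(y2 \<ominus>\<^bsub>Y$n\<^esub> y', w)"]) (use 1 2 y2c y'(1) w(1) in \<open>auto simp: cone_simps\<close>)
qed

context
 fixes P :: "('a, 'p) chain_cx" and m :: int
 assumes P: "chain_complex R P" and ex: "hexact R P (cone R Y Z q)"
begin

text \<open>The pair (0, \<alpha>) is a cycle of Hom(P, cone). A null homotopy of it has two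
  components: the first is the lift, the second is, up to sign, a homotopy between q \<beta> and
  \<alpha>.\<close>

lemma lift_cycle:
 assumes a: "hcyc R P Z m \<alpha>"
 shows "\<exists>\<beta>. hcyc R P Y m \<beta> \<and> hnull R P Z m (\<lambda>i x. q (i + m) (\<beta> i x) \<ominus>\<^bsub>Z$(i + m)\<^esub> \<alpha> i x)"
proof -
 have "hcyc R P (cone R Y Z q) m (\<lambda>i x. (\<zero>\<^bsub>Y$(i + m - 1)\<^esub>, \<alpha> i x))"
  unfolding hcyc_def
 proof (intro conjI allI ballI)
  fix i
  interpret A: Module.module R "Y$(i + m - 1)" by (rule cxM[OF Y])
  note l = hcyc_lin[OF a refl, of i]
  show "lin_map R (P$i) ((cone R Y Z q)$(i + m)) (\<lambda>x. (\<zero>\<^bsub>Y$(i + m - 1)\<^esub>, \<alpha> i x))"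
   by (rule lin_mapI) (auto simp: cone_simps lin_closed[OF l] lin_add[OF l] lin_smult[OF l])
  fix x assume x: "x \<in> P$$i"
  interpret B: Module.module R "Z$(i + m - 1)" by (rule cxM[OF Z])
  have c: "i + m - 1 - 1 = i + m - 2" "i - 1 + m - 1 = i + m - 2" by simp_all
  have z: "cx_d Y (i + m - 1) \<zero>\<^bsub>Y$(i + m - 1)\<^esub> = \<zero>\<^bsub>Y$(i + m - 2)\<^esub>"
   by (rule lin_zero[OF cx_lin'[OF Y] cxM[OF Y] cxM[OF Y]]) simp
  have z': "\<ominus>\<^bsub>Y$(i + m - 2)\<^esub> \<zero>\<^bsub>Y$(i + m - 2)\<^esub> = \<zero>\<^bsub>Y$(i + m - 2)\<^esub>"
   using sg_zero[OF cxM[OF Y], of "i + m - 2" 1] by (simp add: sg_def)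
  have e: "\<alpha> (i - 1) (cx_d P i x) \<in> Z$$(i + m - 1)"
   by (rule hcyc_closed[OF a cx_closed[OF P x refl]]) simp
  have e': "cx_d Z (i + m) (\<alpha> i x) \<in> Z$$(i + m - 1)"
   by (rule cx_closed[OF Z hcyc_closed[OF a x refl]]) simp
  have y: "q (i + m - 1) \<zero>\<^bsub>Y$(i + m - 1)\<^esub> = \<zero>\<^bsub>Z$(i + m - 1)\<^esub>"
   by (rule lin_zero[OF cm_lin[OF q] cxM[OF Y] cxM[OF Z]])
  have "(\<zero>\<^bsub>Y$(i + m - 2)\<^esub>, \<alpha> (i - 1) (cx_d P i x)) \<in> (cone R Y Z q)$$(i + m - 1)"
   using e by (simp add: cone_simps c submodule_zero[OF cyc_sub[OF Y], THEN cyclesD(1)])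
  thus "cx_d (cone R Y Z q) (i + m) (\<zero>\<^bsub>Y$(i + m - 1)\<^esub>, \<alpha> i x) =
    sg ((cone R Y Z q)$(i + m - 1)) m (\<zero>\<^bsub>Y$(i - 1 + m - 1)\<^esub>, \<alpha> (i - 1) (cx_d P i x))"
   using hcyc_d[OF a x refl refl refl] e e' unfolding sg_def c
   by (simp add: cone_inv) (simp add: cone_simps z z' y c)
 qed
 then obtain h where h: "htpy R P (cone R Y Z q) m h (\<lambda>i x. (\<zero>\<^bsub>Y$(i + m - 1)\<^esub>, \<alpha> i x))"
  using hexactD[OF ex] unfolding hnull_def by blast
 have hc: "fst (h i x) \<in> Y$$(i + m)" "snd (h i x) \<in> Z$$(i + m + 1)"
  if "x \<in> P$$i" for i x
  using htpy_closed[OF h that refl] by (auto simp: cone_simps)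
 have hl: "lin_map R (P$i) (Y$(i + m)) (\<lambda>x. fst (h i x))"
  "lin_map R (P$i) (Z$(i + m + 1)) (\<lambda>x. snd (h i x))" for i
 proof -
  note l = htpy_lin[OF h refl, of i]
  show "lin_map R (P$i) (Y$(i + m)) (\<lambda>x. fst (h i x))"
   by (rule lin_mapI) (use hc in \<open>auto simp: lin_add[OF l] lin_smult[OF l] cone_simps\<close>)
  show "lin_map R (P$i) (Z$(i + m + 1)) (\<lambda>x. snd (h i x))"
   by (rule lin_mapI) (use hc in \<open>auto simp: lin_add[OF l] lin_smult[OF l] cone_simps\<close>)
 qed
 have eqs: "cx_d Y (i + m) (fst (h i x)) = sg (Y$(i + m - 1)) m (fst (h (i - 1) (cx_d P i x)))"
  "\<alpha> i x = cx_d Z (i + m + 1) (snd (h i x)) \<oplus>\<^bsub>Z$(i + m)\<^esub> q (i + m) (fst (h i x)) \<oplus>\<^bsub>Z$(i + m)\<^esub> sg (Z$(i + m)) m (snd (h (i - 1) (cx_d P i x)))"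
  if x: "x \<in> P$$i" for i x
 proof -
  interpret A: Module.module R "Y$(i + m - 1)" by (rule cxM[OF Y])
  have dx: "cx_d P i x \<in> P$$(i - 1)" by (rule cx_closed[OF P x refl])
  have c: "i + m + 1 - 1 = i + m" "i + m + 1 - 2 = i + m - 1" by simp_all
  have k: "fst (h (i - 1) (cx_d P i x)) \<in> Y$$(i + m - 1)" "snd (h (i - 1) (cx_d P i x)) \<in> Z$$(i + m)"
   using hc[OF dx] by (auto simp: algebra_simps)
  hence k': "h (i - 1) (cx_d P i x) \<in> (cone R Y Z q)$$(i + m)" by (simp add: cone_simps)
  have e: "(\<zero>\<^bsub>Y$(i + m - 1)\<^esub>, \<alpha> i x) = cx_d (cone R Y Z q) (i + m + 1) (h i x) \<oplus>\<^bsub>(cone R Y Z q)$(i + m)\<^esub>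
    sg ((cone R Y Z q)$(i + m)) m (h (i - 1) (cx_d P i x))"
   by (rule htpy_eq[OF h x refl refl refl])
  have s: "sg ((cone R Y Z q)$(i + m)) m (h (i - 1) (cx_d P i x)) =
    (sg (Y$(i + m - 1)) m (fst (h (i - 1) (cx_d P i x))), sg (Z$(i + m)) m (snd (h (i - 1) (cx_d P i x))))"
   by (simp add: sg_def cone_inv[OF k'])
  have 1: "\<zero>\<^bsub>Y$(i + m - 1)\<^esub> = \<ominus>\<^bsub>Y$(i + m - 1)\<^esub> cx_d Y (i + m) (fst (h i x)) \<oplus>\<^bsub>Y$(i + m - 1)\<^esub> sg (Y$(i + m - 1)) m (fst (h (i - 1) (cx_d P i x)))"
   and 2: "\<alpha> i x = cx_d Z (i + m + 1) (snd (h i x)) \<oplus>\<^bsub>Z$(i + m)\<^esub> q (i + m) (fst (h i x)) \<oplus>\<^bsub>Z$(i + m)\<^esub> sg (Z$(i + m)) m (snd (h (i - 1) (cx_d P i x)))"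
   using e unfolding s by (simp_all add: cone_simps c)
  show "\<alpha> i x = cx_d Z (i + m + 1) (snd (h i x)) \<oplus>\<^bsub>Z$(i + m)\<^esub> q (i + m) (fst (h i x)) \<oplus>\<^bsub>Z$(i + m)\<^esub> sg (Z$(i + m)) m (snd (h (i - 1) (cx_d P i x)))"
   by (rule 2)
  show "cx_d Y (i + m) (fst (h i x)) = sg (Y$(i + m - 1)) m (fst (h (i - 1) (cx_d P i x)))"
   using 1 sg_closed[OF cxM[OF Y] k(1)] cx_closed[OF Y hc(1)[OF x] refl]
   by (metis A.M.add.inv_closed A.M.add.inv_solve_left A.M.add.inv_inv A.M.r_zero A.M.zero_closed)
 qed
 have b: "hcyc R P Y m (\<lambda>i x. fst (h i x))" unfolding hcyc_def using hl eqs by simp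
 have "htpy R P Z m (\<lambda>i x. \<ominus>\<^bsub>Z$(i + m + 1)\<^esub> snd (h i x)) (\<lambda>i x. q (i + m) (fst (h i x)) \<ominus>\<^bsub>Z$(i + m)\<^esub> \<alpha> i x)"
  unfolding htpy_def
 proof (intro conjI allI ballI lin_uminus hl cxM[OF Z])
  fix i x assume x: "x \<in> P$$i"
  interpret B: Module.module R "Z$(i + m)" by (rule cxM[OF Z])
  have dx: "cx_d P i x \<in> P$$(i - 1)" by (rule cx_closed[OF P x refl])
  have c: "i - 1 + m + 1 = i + m" by simp
  have k: "snd (h (i - 1) (cx_d P i x)) \<in> Z$$(i + m)" using hc[OF dx] by (auto simp: algebra_simps)
  have "cx_d Z (i + m + 1) (snd (h i x)) \<in> Z$$(i + m)" by (rule cx_closed[OF Z hc(2)[OF x]]) simp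
  moreover have "cx_d Z (i + m + 1) (\<ominus>\<^bsub>Z$(i + m + 1)\<^esub> snd (h i x)) = \<ominus>\<^bsub>Z$(i + m)\<^esub> cx_d Z (i + m + 1) (snd (h i x))"
   by (rule lin_inv[OF cx_lin'[OF Z] cxM[OF Z] cxM[OF Z] hc(2)[OF x]]) simp
  moreover have "q (i + m) (fst (h i x)) \<in> Z$$(i + m)" by (rule cm_closed[OF q hc(1)[OF x]])
  ultimately show "q (i + m) (fst (h i x)) \<ominus>\<^bsub>Z$(i + m)\<^esub> \<alpha> i x = cx_d Z (i + m + 1) (\<ominus>\<^bsub>Z$(i + m + 1)\<^esub> snd (h i x))
    \<oplus>\<^bsub>Z$(i + m)\<^esub> sg (Z$(i + m)) m (\<ominus>\<^bsub>Z$(i - 1 + m + 1)\<^esub> snd (h (i - 1) (cx_d P i x)))"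
   unfolding c eqs(2)[OF x] using k sg_closed[OF cxM[OF Z] k]
   by (simp add: sg_inv[OF cxM[OF Z] k]) (simp add: B.M.grp_simps)
 qed
 thus ?thesis using b unfolding hnull_def by blast
qed

text \<open>If \<open>k\<close> contracts q \<beta>, then (\<beta>, -k) is a cycle of degree
  \<open>m + 1\<close> in Hom(P, cone), because the first component of the cone is shifted by one.
  The first component of a null homotopy of it contracts \<beta> up to sign.\<close>

lemma lift_null:
 assumes b: "hcyc R P Y m \<beta>" and n: "hnull R P Z m (\<lambda>i x. q (i + m) (\<beta> i x))"
 shows "hnull R P Y m \<beta>"
proof -
 obtain k where k: "htpy R P Z m k (\<lambda>i x. q (i + m) (\<beta> i x))" using n unfolding hnull_def by blast
 let ?g = "\<lambda>i x. (\<beta> i x, \<ominus>\<^bsub>Z$(i + m + 1)\<^esub> k i x)"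
 have "hcyc R P (cone R Y Z q) (m + 1) ?g"
  unfolding hcyc_def
 proof (intro conjI allI ballI)
  fix i
  interpret B: Module.module R "Z$(i + m + 1)" by (rule cxM[OF Z])
  interpret B0: Module.module R "Z$(i + m)" by (rule cxM[OF Z])
  note l = hcyc_lin[OF b refl, of i] and l' = htpy_lin[OF k refl, of i]
  have c: "i + (m + 1) = i + m + 1" "i + m + 1 - 1 = i + m" "i + m + 1 - 2 = i + m - 1" "i - 1 + m + 1 = i + m" by simp_all
  show "lin_map R (P$i) ((cone R Y Z q)$(i + (m + 1))) (?g i)"
   by (rule lin_mapI) (auto simp: cone_simps c lin_closed[OF l] lin_add[OF l] lin_smult[OF l]
     lin_closed[OF l'] lin_add[OF l'] lin_smult[OF l'] B.M.minus_add B.smult_r_minus)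
  fix x assume x: "x \<in> P$$i"
  have dx: "cx_d P i x \<in> P$$(i - 1)" by (rule cx_closed[OF P x refl])
  have e: "\<beta> (i - 1) (cx_d P i x) \<in> Y$$(i + m - 1)" "k (i - 1) (cx_d P i x) \<in> Z$$(i + m)"
   by (rule hcyc_closed[OF b dx], simp, rule htpy_closed[OF k dx], simp)
  have e': "k i x \<in> Z$$(i + m + 1)" by (rule htpy_closed[OF k x]) simp
  have e'': "cx_d Z (i + m + 1) (k i x) \<in> Z$$(i + m)" by (rule cx_closed[OF Z e']) simp
  interpret A: Module.module R "Y$(i + m - 1)" by (rule cxM[OF Y])
  have g': "(\<beta> (i - 1) (cx_d P i x), \<ominus>\<^bsub>Z$(i + m)\<^esub> k (i - 1) (cx_d P i x)) \<in> (cone R Y Z q)$$(i + m)"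
   using e by (simp add: cone_simps)
  have d1: "cx_d Z (i + m + 1) (\<ominus>\<^bsub>Z$(i + m + 1)\<^esub> k i x) = \<ominus>\<^bsub>Z$(i + m)\<^esub> cx_d Z (i + m + 1) (k i x)"
   by (rule lin_inv[OF cx_lin'[OF Z] cxM[OF Z] cxM[OF Z] e']) simp
  have d2: "cx_d Y (i + m) (\<beta> i x) = sg (Y$(i + m - 1)) m (\<beta> (i - 1) (cx_d P i x))" by (rule hcyc_d[OF b x refl refl refl])
  have d3: "\<ominus>\<^bsub>Z$(i + m)\<^esub> cx_d Z (i + m + 1) (k i x) \<oplus>\<^bsub>Z$(i + m)\<^esub> q (i + m) (\<beta> i x) = sg (Z$(i + m)) m (k (i - 1) (cx_d P i x))"
   using htpy_eq[OF k x refl refl refl] e'' sg_closed[OF cxM[OF Z] e(2), of m] by (simp add: B0.M.grp_simps B0.M.r_neg1)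
  show "cx_d (cone R Y Z q) (i + (m + 1)) (?g i x) = sg ((cone R Y Z q)$(i + (m + 1) - 1)) (m + 1) (?g (i - 1) (cx_d P i x))"
   unfolding c sg_def using d1 d2 d3 e g' unfolding sg_def
   by (simp add: cone_inv cone_simps c)
 qed
 then obtain h where h: "htpy R P (cone R Y Z q) (m + 1) h ?g" using hexactD[OF ex] unfolding hnull_def by blast
 have hc: "fst (h i x) \<in> Y$$(i + m + 1)" if "x \<in> P$$i" for i x
  using htpy_closed[OF h that refl] by (auto simp: cone_simps algebra_simps)
 have hl: "lin_map R (P$i) (Y$(i + m + 1)) (\<lambda>x. fst (h i x))" for i
 proof -
  have c: "i + (m + 1) + 1 - 1 = i + m + 1" "1 + (i + m) = i + m + 1" by simp_all
  note l = htpy_lin[OF h refl, of i]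
  show ?thesis by (rule lin_mapI) (use hc in \<open>auto simp: lin_add[OF l] lin_smult[OF l] cone_simps c\<close>)
 qed
 have "htpy R P Y m (\<lambda>i x. \<ominus>\<^bsub>Y$(i + m + 1)\<^esub> fst (h i x)) \<beta>"
  unfolding htpy_def
 proof (intro conjI allI ballI lin_uminus hl cxM[OF Y])
  fix i x assume x: "x \<in> P$$i"
  interpret A: Module.module R "Y$(i + m)" by (rule cxM[OF Y])
  have dx: "cx_d P i x \<in> P$$(i - 1)" by (rule cx_closed[OF P x refl])
  have c: "i - 1 + m + 1 = i + m" "i + (m + 1) = i + m + 1" "i + m + 1 - 1 = i + m" "i + m + 1 + 1 - 1 = i + m + 1" "i + m + 1 + 1 - 2 = i + m" "1 + (i + m) = i + m + 1" by simp_all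
  have e: "fst (h (i - 1) (cx_d P i x)) \<in> Y$$(i + m)" using hc[OF dx] by (simp add: c)
  have e': "cx_d Y (i + m + 1) (fst (h i x)) \<in> Y$$(i + m)" by (rule cx_closed[OF Y hc[OF x]]) simp
  have kc: "h (i - 1) (cx_d P i x) \<in> (cone R Y Z q)$$(i + m + 1)" by (rule htpy_closed[OF h dx]) simp
  have "?g i x = cx_d (cone R Y Z q) (i + m + 1 + 1) (h i x) \<oplus>\<^bsub>(cone R Y Z q)$(i + m + 1)\<^esub>
    sg ((cone R Y Z q)$(i + m + 1)) (m + 1) (h (i - 1) (cx_d P i x))"
   by (rule htpy_eq[OF h x]) auto
  hence "fst (?g i x) = \<ominus>\<^bsub>Y$(i + m)\<^esub> cx_d Y (i + m + 1) (fst (h i x)) \<oplus>\<^bsub>Y$(i + m)\<^esub>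
    sg (Y$(i + m)) (m + 1) (fst (h (i - 1) (cx_d P i x)))"
   using kc unfolding sg_def by (simp add: cone_inv cone_simps c)
  moreover have "cx_d Y (i + m + 1) (\<ominus>\<^bsub>Y$(i + m + 1)\<^esub> fst (h i x)) = \<ominus>\<^bsub>Y$(i + m)\<^esub> cx_d Y (i + m + 1) (fst (h i x))"
   by (rule lin_inv[OF cx_lin'[OF Y] cxM[OF Y] cxM[OF Y] hc[OF x]]) simp
  ultimately show "\<beta> i x = cx_d Y (i + m + 1) (\<ominus>\<^bsub>Y$(i + m + 1)\<^esub> fst (h i x)) \<oplus>\<^bsub>Y$(i + m)\<^esub>
    sg (Y$(i + m)) m (\<ominus>\<^bsub>Y$(i - 1 + m + 1)\<^esub> fst (h (i - 1) (cx_d P i x)))"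
   unfolding c using e by (simp add: sg_Suc[OF cxM[OF Y]] sg_inv[OF cxM[OF Y]])
 qed
 thus ?thesis unfolding hnull_def by blast
qed

end

end

section \<open>Free modules\<close>

text \<open>Elements are total functions of finite support that vanish off \<open>B\<close>.
  Enlarging the basis makes the module literally larger, so linear maps restrict to smaller bases
  without inclusion maps.\<close>

definition Fr :: "('a, 'r) ring_scheme \<Rightarrow> 'b set \<Rightarrow> ('a, 'b \<Rightarrow> 'a) module" where
 "Fr R B = \<lparr>carrier = {f. (\<forall>b. f b \<in> carrier R) \<and> (\<forall>b. b \<notin> B \<longrightarrow> f b = \<zero>\<^bsub>R\<^esub>) \<and> finite {b. f b \<noteq> \<zero>\<^bsub>R\<^esub>}},
  mult = undefined, one = undefined, zero = (\<lambda>_. \<zero>\<^bsub>R\<^esub>),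
  add = (\<lambda>f g b. f b \<oplus>\<^bsub>R\<^esub> g b), smult = (\<lambda>r f b. r \<otimes>\<^bsub>R\<^esub> f b)\<rparr>"

definition dl :: "('a, 'r) ring_scheme \<Rightarrow> 'b \<Rightarrow> 'b \<Rightarrow> 'a" where
 "dl R b = (\<lambda>c. if c = b then \<one>\<^bsub>R\<^esub> else \<zero>\<^bsub>R\<^esub>)"

definition supp :: "('a, 'r) ring_scheme \<Rightarrow> ('b \<Rightarrow> 'a) \<Rightarrow> 'b set" where
 "supp R f = {b. f b \<noteq> \<zero>\<^bsub>R\<^esub>}"

text \<open>The sum runs over the support of the argument, so the value is the same for all bases
  that contain this support.\<close>

definition lin_ext :: "('a, 'r) ring_scheme \<Rightarrow> ('a, 'x) module \<Rightarrow> ('b \<Rightarrow> 'x) \<Rightarrow> ('b \<Rightarrow> 'a) \<Rightarrow> 'x" where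
 "lin_ext R M g f = finsum M (\<lambda>b. f b \<odot>\<^bsub>M\<^esub> g b) (supp R f)"

abbreviation Vec :: "('a, 'r) ring_scheme \<Rightarrow> 'b set \<Rightarrow> ('b \<Rightarrow> 'a) set" where "Vec R B \<equiv> carrier (Fr R B)"

lemma Fr_simps:
 "f \<oplus>\<^bsub>Fr R B\<^esub> g = (\<lambda>b. f b \<oplus>\<^bsub>R\<^esub> g b)"
 "r \<odot>\<^bsub>Fr R B\<^esub> f = (\<lambda>b. r \<otimes>\<^bsub>R\<^esub> f b)"
 "\<zero>\<^bsub>Fr R B\<^esub> = (\<lambda>b. \<zero>\<^bsub>R\<^esub>)"
 by (simp_all add: Fr_def)

lemma Fr_carrier:
 "f \<in> Vec R B \<longleftrightarrow> (\<forall>b. f b \<in> carrier R) \<and> supp R f \<subseteq> B \<and> finite (supp R f)"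
 by (auto simp: Fr_def supp_def)

lemma FrD:
 "f \<in> Vec R B \<Longrightarrow> f b \<in> carrier R"
 "f \<in> Vec R B \<Longrightarrow> b \<notin> B \<Longrightarrow> f b = \<zero>\<^bsub>R\<^esub>"
 "f \<in> Vec R B \<Longrightarrow> finite (supp R f)"
 "f \<in> Vec R B \<Longrightarrow> supp R f \<subseteq> B"
 by (auto simp: Fr_def supp_def)

lemma Fr_fin:
 "finite B \<Longrightarrow> f \<in> Vec R B \<longleftrightarrow> (\<forall>b. f b \<in> carrier R) \<and> (\<forall>b. b \<notin> B \<longrightarrow> f b = \<zero>\<^bsub>R\<^esub>)"
 unfolding Fr_def by (auto intro: finite_subset[of "{b. f b \<noteq> \<zero>\<^bsub>R\<^esub>}" B])

lemma Fr_mono: "f \<in> Vec R B \<Longrightarrow> B \<subseteq> B' \<Longrightarrow> f \<in> Vec R B'"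
 unfolding Fr_carrier by auto

lemma Fr_mem_supp: "f \<in> Vec R B \<Longrightarrow> supp R f \<subseteq> B' \<Longrightarrow> f \<in> Vec R B'"
 unfolding Fr_carrier by auto

lemma lin_Fr_mono: "lin_map R (Fr R B) M f \<Longrightarrow> B' \<subseteq> B \<Longrightarrow> lin_map R (Fr R B') M f"
 unfolding lin_map_def Fr_simps by (auto simp: Fr_mono[of _ R B' B])

lemma lin_Fr_target: "lin_map R M (Fr R B) f \<Longrightarrow> (\<And>x. x \<in> carrier M \<Longrightarrow> f x \<in> Vec R B') \<Longrightarrow> lin_map R M (Fr R B') f"
 unfolding lin_map_def by (auto simp: Fr_simps)

abbreviation (in cring) zero_vec :: "'x \<Rightarrow> 'a" ("\<o>") where "\<o> \<equiv> \<lambda>_. \<zero>"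

context cring
begin

lemma FrM: "Module.module R (Fr R B)"
proof (rule moduleI[OF is_cring])
 show "abelian_group (Fr R B)"
 proof (rule abelian_groupI)
  fix x assume x: "x \<in> Vec R B"
  thus "\<exists>y\<in>Vec R B. y \<oplus>\<^bsub>Fr R B\<^esub> x = \<zero>\<^bsub>Fr R B\<^esub>"
   by (intro bexI[of _ "\<lambda>b. \<ominus> x b"])
    (auto simp: Fr_def l_neg elim!: finite_subset[rotated])
  fix y assume y: "y \<in> Vec R B"
  have "finite ({b. x b \<noteq> \<zero>} \<union> {b. y b \<noteq> \<zero>})" using x y by (auto simp: Fr_def)
  hence "finite {b. x b \<oplus> y b \<noteq> \<zero>}" by (rule finite_subset[rotated]) auto
  thus "x \<oplus>\<^bsub>Fr R B\<^esub> y \<in> Vec R B" using x y by (auto simp: Fr_def)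
 qed (auto simp: Fr_def a_ac)
 fix a x assume a: "a \<in> carrier R" and x: "x \<in> Vec R B"
 have "finite {b. a \<otimes> x b \<noteq> \<zero>}" by (rule finite_subset[of _ "{b. x b \<noteq> \<zero>}"]) (use a x in \<open>auto simp: Fr_def\<close>)
 thus "a \<odot>\<^bsub>Fr R B\<^esub> x \<in> Vec R B" using a x by (auto simp: Fr_def)
qed (auto simp: Fr_def l_distr r_distr m_assoc)

lemma Fr_inv: "f \<in> Vec R B \<Longrightarrow> \<ominus>\<^bsub>Fr R B\<^esub> f = (\<lambda>b. \<ominus> f b)"
 unfolding minus_one_smult[OF FrM] by (rule ext) (simp add: Fr_simps l_minus FrD(1)[of f R B])

lemma Fr_minus:
 "f \<in> Vec R B \<Longrightarrow> g \<in> Vec R B \<Longrightarrow> f \<ominus>\<^bsub>Fr R B\<^esub> g = (\<lambda>b. f b \<ominus> g b)"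
 by (simp add: a_minus_def Fr_inv Fr_simps)

lemma Fr_add:
 assumes "f \<in> Vec R B" "g \<in> Vec R B" shows "(\<lambda>b. f b \<oplus> g b) \<in> Vec R B"
proof -
 interpret F: Module.module R "Fr R B" by (rule FrM)
 show ?thesis using F.M.a_closed[OF assms] by (simp add: Fr_simps)
qed

lemma Fr_smult:
 assumes "r \<in> carrier R" "f \<in> Vec R B" shows "(\<lambda>b. r \<otimes> f b) \<in> Vec R B"
 using Module.module.smult_closed[OF FrM assms] by (simp add: Fr_simps)

lemma Fr_inv_mem: "f \<in> Vec R B \<Longrightarrow> (\<lambda>b. \<ominus> f b) \<in> Vec R B"
 using Fr_inv[of f B] abelian_group.a_inv_closed[OF Module.module.axioms(2)[OF FrM], of f B] by simp

lemma Fr_minus_mem: "f \<in> Vec R B \<Longrightarrow> g \<in> Vec R B \<Longrightarrow> (\<lambda>b. f b \<ominus> g b) \<in> Vec R B"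
 unfolding a_minus_def by (intro Fr_add Fr_inv_mem)

lemma Fr_zero: "(\<lambda>b. \<zero>) \<in> Vec R B"
 by (simp add: Fr_carrier supp_def)

lemma dl_mem: "b \<in> B \<Longrightarrow> dl R b \<in> Vec R B"
proof -
 assume b: "b \<in> B"
 have "supp R (dl R b) \<subseteq> {b}" by (auto simp: supp_def dl_def)
 thus ?thesis using b by (auto simp: Fr_carrier dl_def dest: finite_subset)
qed

lemma Fr_split:
 assumes "f \<in> Vec R B" "b \<in> B"
 shows "f(b := \<zero>) \<in> Vec R B" "f = f(b := \<zero>) \<oplus>\<^bsub>Fr R B\<^esub> f b \<odot>\<^bsub>Fr R B\<^esub> dl R b"
  "supp R (f(b := \<zero>)) = supp R f - {b}"
proof -
 show s: "supp R (f(b := \<zero>)) = supp R f - {b}" by (auto simp: supp_def)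
 show "f(b := \<zero>) \<in> Vec R B" using assms unfolding Fr_carrier s by auto
 show "f = f(b := \<zero>) \<oplus>\<^bsub>Fr R B\<^esub> f b \<odot>\<^bsub>Fr R B\<^esub> dl R b"
  using FrD(1)[OF assms(1)] by (auto simp: Fr_simps dl_def)
qed

lemma Fr_induct [consumes 1, case_names zero step]:
 assumes "f \<in> Vec R B"
  and "P \<o>"
  and "\<And>f b r. f \<in> Vec R B \<Longrightarrow> b \<in> B \<Longrightarrow> r \<in> carrier R \<Longrightarrow> P f \<Longrightarrow> f b = \<zero> \<Longrightarrow>
   P (f \<oplus>\<^bsub>Fr R B\<^esub> r \<odot>\<^bsub>Fr R B\<^esub> dl R b)"
 shows "P f"
proof -
 have "\<forall>f\<in>Vec R B. supp R f = A \<longrightarrow> P f" if "finite A" for A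
  using that
 proof (induction A rule: finite_induct)
  case empty
  show ?case
  proof (intro ballI impI)
   fix f assume "f \<in> Vec R B" "supp R f = {}"
   hence "f = \<o>" by (auto simp: supp_def)
   thus "P f" using assms(2) by simp
  qed
 next
  case (insert b A)
  show ?case
  proof (intro ballI impI)
   fix f assume f: "f \<in> Vec R B" "supp R f = insert b A"
   hence b: "b \<in> B" using FrD(4)[OF f(1)] by auto
   have "P (f(b := \<zero>))" using insert Fr_split[OF f(1) b] f(2) by auto
   thus "P f" using assms(3)[OF Fr_split(1)[OF f(1) b] b FrD(1)[OF f(1)], of b] Fr_split(2)[OF f(1) b] by (simp del: fun_upd_apply) (simp add: Fr_simps)
  qed
 qed
 thus ?thesis using assms(1) FrD(3)[OF assms(1)] by blast
qed

lemma lin_Fr_eq: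
 assumes f: "lin_map R (Fr R B) M f" and g: "lin_map R (Fr R B) M g"
  and M: "Module.module R M" and eq: "\<And>b. b \<in> B \<Longrightarrow> f (dl R b) = g (dl R b)" and x: "x \<in> Vec R B"
 shows "f x = g x"
 using x
proof (induction rule: Fr_induct)
 case zero
 show ?case using lin_zero[OF f FrM M] lin_zero[OF g FrM M] by (simp add: Fr_simps)
next
 case (step x b r)
 have s: "r \<odot>\<^bsub>Fr R B\<^esub> dl R b \<in> Vec R B" by (rule Module.module.smult_closed[OF FrM step(3) dl_mem[OF step(2)]])
 show ?case
  using step eq s by (simp add: lin_add[OF f] lin_add[OF g] lin_smult[OF f] lin_smult[OF g] dl_mem)
qed

lemma lin_Fr_eq_supp:
 assumes f: "lin_map R (Fr R B) M f" and g: "lin_map R (Fr R B) M g"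
  and M: "Module.module R M" and x: "x \<in> Vec R B"
  and eq: "\<And>b. b \<in> supp R x \<Longrightarrow> f (dl R b) = g (dl R b)"
 shows "f x = g x"
 by (rule lin_Fr_eq[of "supp R x", OF lin_Fr_mono[OF f] lin_Fr_mono[OF g] M eq])
  (use FrD(4)[OF x] Fr_mem_supp[OF x] in auto)

context
 fixes M :: "('a, 'x) module" and g :: "'c \<Rightarrow> 'x" and B :: "'c set"
 assumes M: "Module.module R M" and g: "g \<in> B \<rightarrow> carrier M"
begin

interpretation M: Module.module R M by (rule M)

lemma lin_ext_superset:
 assumes "f \<in> Vec R B" "finite A" "supp R f \<subseteq> A" "A \<subseteq> B"
 shows "lin_ext R M g f = finsum M (\<lambda>b. f b \<odot>\<^bsub>M\<^esub> g b) A"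
 unfolding lin_ext_def
 by (rule M.M.add.finprod_mono_neutral_cong_left)
  (use assms g FrD(1)[OF assms(1)] in \<open>auto simp: supp_def Pi_def subset_iff\<close>)

lemma lin_ext_lin: "lin_map R (Fr R B) M (lin_ext R M g)"
proof (rule lin_mapI)
 fix f assume f: "f \<in> Vec R B"
 note f' = FrD[OF f]
 show "lin_ext R M g f \<in> carrier M" unfolding lin_ext_def using f' g by (intro M.M.finsum_closed) (auto simp: Pi_def subset_iff)
 {
  fix h assume h: "h \<in> Vec R B"
  note h' = FrD[OF h]
  let ?A = "supp R f \<union> supp R h"
  have A: "finite ?A" "?A \<subseteq> B" using f' h' by auto
  have "supp R (f \<oplus>\<^bsub>Fr R B\<^esub> h) \<subseteq> ?A" by (auto simp: supp_def Fr_simps)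
  moreover have "f \<oplus>\<^bsub>Fr R B\<^esub> h \<in> Vec R B" using Fr_add[OF f h] by (simp add: Fr_simps)
  ultimately have "lin_ext R M g (f \<oplus>\<^bsub>Fr R B\<^esub> h) = finsum M (\<lambda>b. (f \<oplus>\<^bsub>Fr R B\<^esub> h) b \<odot>\<^bsub>M\<^esub> g b) ?A"
   using A by (intro lin_ext_superset) auto
  also have "\<dots> = finsum M (\<lambda>b. f b \<odot>\<^bsub>M\<^esub> g b \<oplus>\<^bsub>M\<^esub> h b \<odot>\<^bsub>M\<^esub> g b) ?A"
   by (rule M.M.finsum_cong') (use A g f' h' in \<open>auto simp: Fr_simps M.smult_l_distr Pi_def subset_iff\<close>)
  also have "\<dots> = finsum M (\<lambda>b. f b \<odot>\<^bsub>M\<^esub> g b) ?A \<oplus>\<^bsub>M\<^esub> finsum M (\<lambda>b. h b \<odot>\<^bsub>M\<^esub> g b) ?A"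
   by (rule M.M.finsum_addf) (use A g f' h' in \<open>auto simp: Pi_def subset_iff\<close>)
  also have "\<dots> = lin_ext R M g f \<oplus>\<^bsub>M\<^esub> lin_ext R M g h"
   using lin_ext_superset[OF f A(1) _ A(2)] lin_ext_superset[OF h A(1) _ A(2)] by simp
  finally show "lin_ext R M g (f \<oplus>\<^bsub>Fr R B\<^esub> h) = lin_ext R M g f \<oplus>\<^bsub>M\<^esub> lin_ext R M g h" .
 next
  fix r assume r: "r \<in> carrier R"
  have "supp R (r \<odot>\<^bsub>Fr R B\<^esub> f) \<subseteq> supp R f" using r by (auto simp: supp_def Fr_simps)
  moreover have "r \<odot>\<^bsub>Fr R B\<^esub> f \<in> Vec R B" using Fr_smult[OF r f] by (simp add: Fr_simps)
  ultimately have "lin_ext R M g (r \<odot>\<^bsub>Fr R B\<^esub> f) = finsum M (\<lambda>b. (r \<odot>\<^bsub>Fr R B\<^esub> f) b \<odot>\<^bsub>M\<^esub> g b) (supp R f)"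
   using f' by (intro lin_ext_superset) auto
  also have "\<dots> = finsum M (\<lambda>b. r \<odot>\<^bsub>M\<^esub> (f b \<odot>\<^bsub>M\<^esub> g b)) (supp R f)"
   by (rule M.M.finsum_cong') (use g f' r in \<open>auto simp: Fr_simps M.smult_assoc1 Pi_def subset_iff\<close>)
  also have "\<dots> = r \<odot>\<^bsub>M\<^esub> lin_ext R M g f"
   unfolding lin_ext_def by (rule M.finsum_smult_ldistr[symmetric]) (use g f' r in \<open>auto simp: Pi_def subset_iff\<close>)
  finally show "lin_ext R M g (r \<odot>\<^bsub>Fr R B\<^esub> f) = r \<odot>\<^bsub>M\<^esub> lin_ext R M g f" .
 }
qed

lemma lin_ext_dl: "b \<in> B \<Longrightarrow> lin_ext R M g (dl R b) = g b"
proof -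
 assume b: "b \<in> B"
 have "lin_ext R M g (dl R b) = finsum M (\<lambda>c. dl R b c \<odot>\<^bsub>M\<^esub> g c) {b}"
  by (rule lin_ext_superset[OF dl_mem[OF b]]) (use b in \<open>auto simp: supp_def dl_def\<close>)
 also have "\<dots> = g b" using b g by (simp add: dl_def Pi_def)
 finally show ?thesis .
qed

lemma lin_ext_unique:
 assumes "lin_map R (Fr R B) M f" "\<And>b. b \<in> B \<Longrightarrow> f (dl R b) = g b" "x \<in> Vec R B"
 shows "f x = lin_ext R M g x"
 by (rule lin_Fr_eq[OF assms(1) lin_ext_lin M _ assms(3)]) (use assms lin_ext_dl in auto)

end

end

section \<open>Free complexes and semi-freeness\<close>

definition Rm :: "('a, 'r) ring_scheme \<Rightarrow> ('a, 'a) module" where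
 "Rm R = \<lparr>carrier = carrier R, mult = undefined, one = undefined, zero = \<zero>\<^bsub>R\<^esub>,
  add = (\<lambda>x y. x \<oplus>\<^bsub>R\<^esub> y), smult = (\<lambda>x y. x \<otimes>\<^bsub>R\<^esub> y)\<rparr>"

lemma Rm_simps: "carrier (Rm R) = carrier R" "x \<oplus>\<^bsub>Rm R\<^esub> y = x \<oplus>\<^bsub>R\<^esub> y" "x \<odot>\<^bsub>Rm R\<^esub> y = x \<otimes>\<^bsub>R\<^esub> y" "\<zero>\<^bsub>Rm R\<^esub> = \<zero>\<^bsub>R\<^esub>"
 by (simp_all add: Rm_def)

definition free_cx :: "('a, 'r) ring_scheme \<Rightarrow> ('a, 'b \<Rightarrow> 'a) chain_cx \<Rightarrow> (int \<Rightarrow> 'b set) \<Rightarrow> bool" where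
 "free_cx R X B \<longleftrightarrow> chain_complex R X \<and> (\<forall>n. X$n = Fr R (B n))"

text \<open>A natural-number height that the differential strictly lowers on basis elements encodes
  the filtration of a semi-free complex: the generators of height below \<open>k\<close> span a
  subcomplex.\<close>

definition lowers :: "('a, 'r) ring_scheme \<Rightarrow> ('a, 'b \<Rightarrow> 'a) chain_cx \<Rightarrow> (int \<Rightarrow> 'b set) \<Rightarrow> (int \<Rightarrow> 'b \<Rightarrow> nat) \<Rightarrow> bool" where
 "lowers R X B ht \<longleftrightarrow> (\<forall>n. \<forall>b\<in>B n. \<forall>c\<in>supp R (cx_d X n (dl R b)). ht (n - 1) c < ht n b)"

context cring
begin

lemma fcD:
 assumes "free_cx R X B"
 shows "chain_complex R X" "X$n = Fr R (B n)"
 using assms unfolding free_cx_def by auto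

lemma free_cx_d:
 assumes "free_cx R X B" "m = n - 1"
 shows "lin_map R (Fr R (B n)) (Fr R (B m)) (cx_d X n)"
 using cx_lin[OF fcD(1)[OF assms(1)], of n] fcD(2)[OF assms(1)] assms(2) by simp

lemma Rm_module: "Module.module R (Rm R)"
 by (rule moduleI[OF is_cring], rule abelian_groupI)
  (auto simp: Rm_simps a_ac l_distr r_distr m_assoc intro: bexI[of _ "\<ominus> _"] l_neg)

lemma supp_lin_map:
 assumes \<phi>: "lin_map R (Fr R B) (Fr R C) \<phi>" and f: "f \<in> Vec R B" and c: "\<phi> f c \<noteq> \<zero>"
 shows "\<exists>b\<in>supp R f. \<phi> (dl R b) c \<noteq> \<zero>"
proof (rule ccontr)
 assume a: "\<not> ?thesis"
 have l: "lin_map R (Fr R B) (Rm R) (\<lambda>f. \<phi> f c)"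
  by (rule lin_mapI)
   (use FrD(1)[OF lin_closed[OF \<phi>]] in \<open>auto simp: lin_add[OF \<phi>, unfolded Fr_simps] lin_smult[OF \<phi>, unfolded Fr_simps] Fr_simps Rm_simps\<close>)
 have "\<phi> f c = \<zero>\<^bsub>Rm R\<^esub>"
  by (rule lin_Fr_eq_supp[OF l lin_zero_map[OF Rm_module] Rm_module f]) (use a in \<open>auto simp: Rm_simps\<close>)
 thus False using c by (simp add: Rm_simps)
qed

text \<open>The homotopy is extended over the subcomplexes spanned by the generators of height below
  \<open>k\<close>. Exactness is assumed only in the degrees reached from existing generators,
  because in \<open>dual_hcx_exact\<close> the target is known to be exact in high degrees
  only.\<close>

lemma semifree_hnull:
 assumes X: "free_cx R X B" and ht: "lowers R X B ht"
  and A: "chain_complex R A" and ex: "\<And>n. B n \<noteq> {} \<Longrightarrow> cx_exact A (n + m)" and a: "hcyc R X A m \<alpha>"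
 shows "hnull R X A m \<alpha>"
proof -
 note Xc = fcD(1)[OF X] and Xm = fcD(2)[OF X] and AM = cxM[OF A]
 have c: "n - 1 + m + 1 = n + m" for n by simp
 let ?M = "\<lambda>n. A$(n + m + 1)"
 let ?rhs = "\<lambda>h n x. cx_d A (n + m + 1) (h n x) \<oplus>\<^bsub>A$(n + m)\<^esub> sg (A$(n + m)) m (h (n - 1) (cx_d X n x))"
 define C where "C k n = {b \<in> B n. ht n b < k}" for k n
 have CB: "C k n \<subseteq> B n" for k n by (auto simp: C_def)
 have al: "lin_map R (Fr R (B n)) (A$(n + m)) (\<alpha> n)" for n using hcyc_lin[OF a refl, of n] by (simp add: Xm)
 have dC: "cx_d X n x \<in> Vec R (C k (n - 1))" if x: "x \<in> Vec R (C (Suc k) n)" for n k x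
 proof (rule Fr_mem_supp)
  have xB: "x \<in> Vec R (B n)" by (rule Fr_mono[OF x CB])
  show dx: "cx_d X n x \<in> Vec R (B (n - 1))" by (rule lin_closed[OF free_cx_d[OF X refl] xB])
  show "supp R (cx_d X n x) \<subseteq> C k (n - 1)"
  proof
   fix y assume y: "y \<in> supp R (cx_d X n x)"
   then obtain b where b: "b \<in> supp R x" "cx_d X n (dl R b) y \<noteq> \<zero>" using supp_lin_map[OF free_cx_d[OF X refl] xB] by (auto simp: supp_def)
   hence "b \<in> B n" "ht n b \<le> k" using FrD(4)[OF x] by (auto simp: C_def)
   thus "y \<in> C k (n - 1)" using ht b(2) y FrD(4)[OF dx] unfolding lowers_def by (fastforce simp: C_def supp_def)
  qed
 qed
 have dCl: "lin_map R (Fr R (C (Suc k) n)) (Fr R (C k (n - 1))) (cx_d X n)" for k n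
  by (rule lin_Fr_target[OF lin_Fr_mono[OF free_cx_d[OF X refl] CB] dC])
 have C1: "C k n \<subseteq> C (Suc k) n" for k n by (auto simp: C_def)
 have rhs_lin: "lin_map R (Fr R D) (A$(n + m)) (?rhs h n)"
  if "lin_map R (Fr R D) (?M n) (h n)" "lin_map R (Fr R D) (Fr R D') (cx_d X n)" "lin_map R (Fr R D') (?M (n - 1)) (h (n - 1))" for D D' h n
  using that c[of n] by (intro lin_plus lin_sg_map AM lin_comp[OF _ cx_lin'[OF A]] lin_comp[OF that(2)]) simp_all
 let ?P = "\<lambda>k h. (\<forall>n. lin_map R (Fr R (C k n)) (?M n) (h n)) \<and> (\<forall>n. \<forall>x\<in>Vec R (C k n). \<alpha> n x = ?rhs h n x)"
 let ?Q = "\<lambda>k h h'. \<forall>n. \<forall>x\<in>Vec R (C k n). h' n x = h n x"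
 have base: "\<exists>h. ?P 0 h"
 proof (intro exI[of _ "\<lambda>n x. \<zero>\<^bsub>?M n\<^esub>"] conjI allI ballI lin_zero_map AM)
  fix n x assume "x \<in> Vec R (C 0 n)"
  hence x: "x = \<zero>\<^bsub>Fr R (B n)\<^esub>" using FrD(2) by (force simp: C_def Fr_simps)
  interpret M: Module.module R "A$(n + m)" by (rule AM)
  show "\<alpha> n x = ?rhs (\<lambda>n x. \<zero>\<^bsub>?M n\<^esub>) n x"
   using lin_zero[OF al FrM AM] lin_zero[OF cx_lin'[OF A, of "n + m" "n + m + 1"] AM AM] by (simp add: x c sg_zero[OF AM])
 qed
 have step: "\<exists>h'. ?P (Suc k) h' \<and> ?Q k h h'" if P: "?P k h" for k h
 proof -
  have hl: "lin_map R (Fr R (C k n)) (?M n) (h n)" and he: "x \<in> Vec R (C k n) \<Longrightarrow> \<alpha> n x = ?rhs h n x" for n x using P by auto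
  let ?R = "\<lambda>n b y. y \<in> carrier (?M n) \<and> (b \<in> C k n \<longrightarrow> y = h n (dl R b)) \<and>
    \<alpha> n (dl R b) = cx_d A (n + m + 1) y \<oplus>\<^bsub>A$(n + m)\<^esub> sg (A$(n + m)) m (h (n - 1) (cx_d X n (dl R b)))"
  have Rex: "\<exists>y. ?R n b y"
   if b: "b \<in> C (Suc k) n" for n b
  proof (cases "b \<in> C k n")
   case True
   thus ?thesis using he[OF dl_mem[OF True]] lin_closed[OF hl dl_mem[OF True]] by blast
  next
   case False
   have bB: "b \<in> B n" using b CB by blast
   interpret M: Module.module R "A$(n + m)" by (rule AM)
   let ?x = "cx_d X n (dl R b)"
   let ?e = "h (n - 1) ?x"
   have x: "?x \<in> Vec R (C k (n - 1))" by (rule dC[OF dl_mem[OF b]])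
   have e: "?e \<in> A$$(n + m)" using lin_closed[OF hl x] by (simp add: c)
   have ab: "\<alpha> n (dl R b) \<in> A$$(n + m)" by (rule lin_closed[OF al dl_mem[OF bB]])
   have de: "cx_d A (n + m) ?e \<in> A$$(n + m - 1)" by (rule cx_closed[OF A e refl])
   have "cx_d X (n - 1) ?x = \<zero>\<^bsub>Fr R (C k (n - 1 - 1))\<^esub>"
    using cx_dd[OF Xc, of "dl R b" n "n - 1" "n - 2"] dl_mem[OF bB] by (simp add: Xm Fr_simps)
   hence "\<alpha> (n - 1) ?x = cx_d A (n + m) ?e"
    using he[OF x] lin_zero[OF hl FrM AM, of "n - 1 - 1"] abelian_monoid.r_zero[OF abelian_group.axioms(1)[OF Module.module.axioms(2)[OF AM]] de]
    by (simp add: c sg_zero[OF AM] algebra_simps)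
   hence "cx_d A (n + m) (\<alpha> n (dl R b)) = sg (A$(n + m - 1)) m (cx_d A (n + m) ?e)"
    using hcyc_d[OF a _ refl refl refl, of "dl R b" n] dl_mem[OF bB] by (simp add: Xm)
   \<comment> \<open>The obstruction to choosing the value at \<open>b\<close> is a cycle, because
     \<open>h\<close> already is a homotopy on the boundary of \<open>b\<close>. A primitive of it
     is the required value.\<close>
   hence "cx_d A (n + m) (\<alpha> n (dl R b) \<ominus>\<^bsub>A$(n + m)\<^esub> sg (A$(n + m)) m ?e) = \<zero>\<^bsub>A$(n + m - 1)\<^esub>"
    using lin_diff[OF cx_lin[OF A] AM AM ab sg_closed[OF AM e]] lin_sg[OF cx_lin[OF A] AM AM e]
     module_diff_zero_iff[OF AM] sg_closed[OF AM de] by simp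
   moreover have "cx_exact A (n + m)" using ex bB by blast
   ultimately obtain y where "y \<in> carrier (?M n)" "cx_d A (n + m + 1) y = \<alpha> n (dl R b) \<ominus>\<^bsub>A$(n + m)\<^esub> sg (A$(n + m)) m ?e"
    using cx_exactD[of A "n + m"] ab sg_closed[OF AM e] M.M.minus_closed by blast
   thus ?thesis using ab sg_closed[OF AM e] False by (intro exI[of _ y]) (simp add: M.M.grp_simps M.M.l_neg)
  qed
  define Y where "Y n b = (SOME y. ?R n b y)" for n b
  have Y: "?R n b (Y n b)" if "b \<in> C (Suc k) n" for n b unfolding Y_def by (rule someI_ex[OF Rex[OF that]])
  let ?h = "\<lambda>n. lin_ext R (?M n) (Y n)"
  have Yc: "Y n \<in> C (Suc k) n \<rightarrow> carrier (?M n)" for n using Y by blast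
  note h'l = lin_ext_lin[OF AM Yc] and h'd = lin_ext_dl[OF AM Yc]
  have Q: "?h n x = h n x" if "x \<in> Vec R (C k n)" for n x
   by (rule lin_Fr_eq[OF lin_Fr_mono[OF h'l C1] hl AM _ that]) (use h'd subsetD[OF C1] Y in metis)
  have "\<alpha> n x = ?rhs ?h n x" if x: "x \<in> Vec R (C (Suc k) n)" for n x
  proof (rule lin_Fr_eq[OF lin_Fr_mono[OF al CB] rhs_lin[OF h'l dCl lin_Fr_mono[OF h'l C1]] AM _ x])
   fix b assume b: "b \<in> C (Suc k) n"
   show "\<alpha> n (dl R b) = ?rhs ?h n (dl R b)" unfolding h'd[OF b] Q[OF dC[OF dl_mem[OF b]]] using Y[OF b] by blast
  qed
  thus ?thesis using h'l Q by (intro exI[of _ ?h]) blast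
 qed
 from dependent_nat_choice[of ?P ?Q, OF base step] obtain h where h0: "\<forall>k. ?P k (h k) \<and> ?Q k (h k) (h (Suc k))" by (rule exE)
 have hl: "lin_map R (Fr R (C k n)) (?M n) (h k n)" and he: "x \<in> Vec R (C k n) \<Longrightarrow> \<alpha> n x = ?rhs (h k) n x"
  and hS: "x \<in> Vec R (C k n) \<Longrightarrow> h (Suc k) n x = h k n x" for k n x using h0 by blast+
 have hmono: "h l n x = h k n x" if "k \<le> l" and x: "x \<in> Vec R (C k n)" for k l n x
  using that(1)
 proof (induction rule: dec_induct)
  case (step l)
  hence "x \<in> Vec R (C l n)" by (intro Fr_mono[OF x]) (auto simp: C_def)
  thus ?case using hS step by simp
 qed simp
 \<comment> \<open>\<open>Suc (ht n b)\<close> is the first stage whose subcomplex contains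
   \<open>b\<close>; later stages keep the value at \<open>b\<close>.\<close>
 let ?H = "\<lambda>n. lin_ext R (?M n) (\<lambda>b. h (Suc (ht n b)) n (dl R b))"
 have bC: "b \<in> C (Suc (ht n b)) n" if "b \<in> B n" for b n using that by (simp add: C_def)
 have Hc: "(\<lambda>b. h (Suc (ht n b)) n (dl R b)) \<in> B n \<rightarrow> carrier (?M n)" for n using lin_closed[OF hl dl_mem[OF bC]] by auto
 note Hl = lin_ext_lin[OF AM Hc] and Hd = lin_ext_dl[OF AM Hc]
 have HC: "?H n x = h k n x" if x: "x \<in> Vec R (C k n)" for k n x
 proof (rule lin_Fr_eq[OF lin_Fr_mono[OF Hl CB] hl AM _ x])
  fix b assume "b \<in> C k n"
  hence b: "b \<in> B n" "Suc (ht n b) \<le> k" by (auto simp: C_def)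
  show "?H n (dl R b) = h k n (dl R b)" by (simp only: Hd[OF b(1)] hmono[OF b(2) dl_mem[OF bC[OF b(1)]]])
 qed
 have "\<alpha> n x = ?rhs ?H n x" if x: "x \<in> Vec R (B n)" for n x
 proof (rule lin_Fr_eq[OF al rhs_lin[OF Hl free_cx_d[OF X refl] Hl] AM _ x])
  fix b assume b: "b \<in> B n"
  note d = dl_mem[OF bC[OF b]]
  show "\<alpha> n (dl R b) = ?rhs ?H n (dl R b)" unfolding HC[OF d] HC[OF Fr_mono[OF dC[OF d] C1]] by (rule he[OF d])
 qed
 hence "htpy R X A m ?H \<alpha>" unfolding htpy_def Xm using Hl by simp
 thus ?thesis unfolding hnull_def by blast
qed

lemma semifree_hexact:
 "free_cx R X B \<Longrightarrow> lowers R X B ht \<Longrightarrow> chain_complex R A \<Longrightarrow> (\<And>n. cx_exact A n) \<Longrightarrow> hexact R X A"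
 unfolding hexact_def using semifree_hnull by blast

end

section \<open>Isomorphic complexes\<close>

definition cx_iso :: "('a, 'r) ring_scheme \<Rightarrow> ('a, 'x) chain_cx \<Rightarrow> ('a, 'y) chain_cx \<Rightarrow> (int \<Rightarrow> 'x \<Rightarrow> 'y) \<Rightarrow> (int \<Rightarrow> 'y \<Rightarrow> 'x) \<Rightarrow> bool" where
 "cx_iso R X Y e g \<longleftrightarrow> chain_complex R X \<and> chain_complex R Y \<and> chain_map R X Y e \<and> chain_map R Y X g \<and>
  (\<forall>n. \<forall>x\<in>X$$n. g n (e n x) = x) \<and> (\<forall>n. \<forall>y\<in>Y$$n. e n (g n y) = y)"

lemma cx_isoD:
 assumes "cx_iso R X Y e g"
 shows "chain_complex R X" "chain_complex R Y" "chain_map R X Y e" "chain_map R Y X g"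
  "\<And>n x. x \<in> X$$n \<Longrightarrow> g n (e n x) = x" "\<And>n y. y \<in> Y$$n \<Longrightarrow> e n (g n y) = y"
 using assms unfolding cx_iso_def by auto

lemma cx_iso_sym: "cx_iso R X Y e g \<Longrightarrow> cx_iso R Y X g e"
 unfolding cx_iso_def by auto

lemma cx_iso_quasi_iso:
 assumes "cx_iso R X Y e g" shows "quasi_iso R X Y e"
proof -
 note i = cx_isoD[OF assms]
 show ?thesis unfolding quasi_iso_iff[OF i(1,2)]
 proof (intro conjI allI ballI impI)
  fix n z assume z: "z \<in> cycles X n" "e n z \<in> boundaries Y n"
  hence "g n (e n z) \<in> boundaries X n" by (intro cm_boundaries[OF i(4)])
  thus "z \<in> boundaries X n" using i(5)[OF cyclesD(1)[OF z(1)]] by simp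
 next
  fix n y assume y: "y \<in> cycles Y n"
  have "y \<ominus>\<^bsub>Y$n\<^esub> e n (g n y) = \<zero>\<^bsub>Y$n\<^esub>"
   using i(6)[OF cyclesD(1)[OF y]] module_diff_zero_iff[OF cxM[OF i(2)]] cyclesD(1)[OF y] by simp
  thus "\<exists>z\<in>cycles X n. y \<ominus>\<^bsub>Y$n\<^esub> e n z \<in> boundaries Y n"
   using cm_cycles[OF i(2,1,4) y] submodule_zero[OF bd_sub[OF i(2)]] by (intro bexI[of _ "g n y"]) auto
 qed (fact i)
qed

lemma cx_iso_exact:
 assumes i: "cx_iso R X Y e g" and "cx_exact X n" shows "cx_exact Y n"
proof -
 note i = cx_isoD[OF i]
 show ?thesis unfolding cx_exact_iff[OF i(2)]
 proof
  fix y assume y: "y \<in> cycles Y n"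
  hence "g n y \<in> boundaries X n" using cm_cycles[OF i(2,1,4)] assms(2)[unfolded cx_exact_iff[OF i(1)]] by blast
  hence "e n (g n y) \<in> boundaries Y n" by (rule cm_boundaries[OF i(3)])
  thus "y \<in> boundaries Y n" using i(6)[OF cyclesD(1)[OF y]] by simp
 qed
qed

lemma cx_iso_hexact:
 assumes i: "cx_iso R X Y e g" and A: "chain_complex R A" and h: "hexact R X A" shows "hexact R Y A"
 unfolding hexact_def
proof (intro allI impI)
 note i = cx_isoD[OF i]
 fix m \<alpha> assume a: "hcyc R Y A m \<alpha>"
 have "hnull R X A m (\<lambda>i x. \<alpha> i (e i x))" by (rule hexactD[OF h hcyc_pre[OF i(2) A i(1,3) a]])
 from hnull_pre[OF i(1) A i(2,4) this] have "hnull R Y A m (\<lambda>j x. \<alpha> j (e j (g j x)))" .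
 thus "hnull R Y A m \<alpha>" by (rule hnull_cong) (simp add: i)
qed

text \<open>Transport of structure along injections. It moves complexes into the element types over
  which the definitions quantify.\<close>

definition transport :: "('a, 'x) chain_cx \<Rightarrow> (int \<Rightarrow> 'x \<Rightarrow> 'y) \<Rightarrow> ('a, 'y) chain_cx" where
 "transport X e = (let g = (\<lambda>n. inv_into (X$$n) (e n)) in
  \<lparr>cx_mod = (\<lambda>n. \<lparr>carrier = e n ` X$$n, mult = undefined, one = undefined, zero = e n \<zero>\<^bsub>X$n\<^esub>,
    add = (\<lambda>u v. e n (g n u \<oplus>\<^bsub>X$n\<^esub> g n v)), smult = (\<lambda>r u. e n (r \<odot>\<^bsub>X$n\<^esub> g n u))\<rparr>),
   cx_d = (\<lambda>n u. e (n - 1) (cx_d X n (g n u)))\<rparr>)"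

lemma transport_iso:
 assumes X: "chain_complex R X" and inj: "\<And>n. inj_on (e n) (X$$n)"
 shows "cx_iso R X (transport X e) e (\<lambda>n. inv_into (X$$n) (e n))"
proof -
 let ?g = "\<lambda>n. inv_into (X$$n) (e n)" and ?Y = "transport X e"
 have s: "?Y$$n = e n ` X$$n" "\<zero>\<^bsub>?Y$n\<^esub> = e n \<zero>\<^bsub>X$n\<^esub>"
  "u \<oplus>\<^bsub>?Y$n\<^esub> v = e n (?g n u \<oplus>\<^bsub>X$n\<^esub> ?g n v)" "r \<odot>\<^bsub>?Y$n\<^esub> u = e n (r \<odot>\<^bsub>X$n\<^esub> ?g n u)"
  "cx_d ?Y n u = e (n - 1) (cx_d X n (?g n u))" for n u v r by (simp_all add: transport_def Let_def)
 have g: "?g n (e n x) = x" if "x \<in> X$$n" for n x using inv_into_f_f[OF inj that] .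
 have m: "Module.module R (?Y$n)" for n
 proof -
  interpret M: Module.module R "X$n" by (rule cxM[OF X])
  show ?thesis
  proof (rule moduleI)
   show "abelian_group (?Y$n)"
   proof (rule abelian_groupI)
    fix u assume "u \<in> ?Y$$n"
    then obtain x where x: "x \<in> X$$n" "u = e n x" by (auto simp: s)
    thus "\<exists>v\<in>?Y$$n. v \<oplus>\<^bsub>?Y$n\<^esub> u = \<zero>\<^bsub>?Y$n\<^esub>"
     by (intro bexI[of _ "e n (\<ominus>\<^bsub>X$n\<^esub> x)"]) (auto simp: s g M.M.l_neg)
   qed (auto simp: s g M.M.a_ac)
  qed (auto simp: s g M.smult_l_distr M.smult_r_distr M.smult_assoc1 M.R.is_cring)
 qed
 have cl: "cx_d X n x \<in> X$$(n - 1)" if "x \<in> X$$n" for n x by (rule cx_closed[OF X that refl])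
 have z: "\<zero>\<^bsub>X$n\<^esub> \<in> X$$n" for n
  using submodule_zero[OF cyc_sub[OF X]] cyclesD(1) by metis
 have Y: "chain_complex R ?Y"
  unfolding chain_complex_def
 proof (intro conjI allI ballI m)
  fix n
  interpret M: Module.module R "X$n" by (rule cxM[OF X])
  note l = cx_lin[OF X, of n]
  show "lin_map R (?Y$n) (?Y$(n - 1)) (cx_d ?Y n)"
   by (rule lin_mapI) (auto simp: s g cl lin_add[OF l] lin_smult[OF l])
  fix u assume "u \<in> ?Y$$n"
  then obtain x where x: "x \<in> X$$n" "u = e n x" by (auto simp: s)
  have "cx_d X (n - 1) (cx_d X n x) = \<zero>\<^bsub>X$(n - 1 - 1)\<^esub>" using X x(1) unfolding chain_complex_def by blast
  thus "cx_d ?Y (n - 1) (cx_d ?Y n u) = \<zero>\<^bsub>?Y$(n - 1 - 1)\<^esub>"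
   by (simp add: s x g cl)
 qed
 have lc: "\<And>n x y. x \<in> X$$n \<Longrightarrow> y \<in> X$$n \<Longrightarrow> x \<oplus>\<^bsub>X$n\<^esub> y \<in> X$$n"
  "\<And>n r x. r \<in> carrier R \<Longrightarrow> x \<in> X$$n \<Longrightarrow> r \<odot>\<^bsub>X$n\<^esub> x \<in> X$$n"
  using submodule_addI[OF cxM[OF X] Module.module.carrier_is_submodule[OF cxM[OF X]]]
   Module.module.smult_closed[OF cxM[OF X]] by auto
 show ?thesis
  unfolding cx_iso_def chain_map_def
  by (intro conjI allI ballI X Y lin_mapI) (auto simp: s g cl lc)
qed

lemma subcomplex:
 assumes X: "chain_complex R X" and S: "\<And>n. submodule (S n) R (X$n)"
  and d: "\<And>n x. x \<in> S n \<Longrightarrow> cx_d X n x \<in> S (n - 1)"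
 defines "Y \<equiv> X\<lparr>cx_mod := \<lambda>n. (X$n)\<lparr>carrier := S n\<rparr>\<rparr>"
 shows "chain_complex R Y" "chain_map R Y X (\<lambda>n x. x)"
proof -
 have sub: "x \<in> X$$n" if "x \<in> S n" for n x
  using Module.module.submoduleE(1)[OF cxM[OF X] S] that by blast
 show "chain_complex R Y"
  unfolding chain_complex_def
 proof (intro conjI allI ballI)
  fix n
  note l = cx_lin[OF X, of n]
  show "Module.module R (Y$n)"
   unfolding Y_def using submodule.submodule_is_module[OF S cxM[OF X]] by simp
  show "lin_map R (Y$n) (Y$(n - 1)) (cx_d Y n)"
   by (rule lin_mapI) (auto simp: Y_def sub d lin_add[OF l] lin_smult[OF l])
  fix x assume "x \<in> Y$$n"
  thus "cx_d Y (n - 1) (cx_d Y n x) = \<zero>\<^bsub>Y$(n - 1 - 1)\<^esub>"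
   using cx_dd[OF X sub refl] by (simp add: Y_def)
 qed
 show "chain_map R Y X (\<lambda>n x. x)"
  unfolding chain_map_def by (auto simp: Y_def sub intro!: lin_mapI)
qed

section \<open>K-projectivity does not depend on the type of the test complexes\<close>

datatype ('a, 'p) tm = Gen int 'p | Add "('a, 'p) tm" "('a, 'p) tm" | Smul 'a "('a, 'p) tm" | Wit "('a, 'p) tm"

text \<open>A self-delimiting code for the number \<open>k\<close>: the right entry marks its
  end.\<close>

definition pad :: "nat \<Rightarrow> ('a + 'p) list" where
 "pad k = replicate k (Inl undefined) @ [Inr undefined]"

lemma pad_inj: "pad k @ xs = pad l @ ys \<longleftrightarrow> k = l \<and> xs = ys"
proof
 assume "pad k @ xs = pad l @ ys"
 thus "k = l \<and> xs = ys"
 proof (induction k arbitrary: l)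
  case 0 thus ?case by (cases l) (auto simp: pad_def)
 next
  case (Suc k) thus ?case by (cases l) (auto simp: pad_def)
 qed
qed simp

fun enc :: "('a, 'p) tm \<Rightarrow> ('a + 'p) list" where
 "enc (Gen i x) = pad 0 @ pad (if i \<ge> 0 then 0 else 1) @ pad (nat \<bar>i\<bar>) @ [Inr x]"
| "enc (Add s t) = pad 1 @ enc s @ enc t"
| "enc (Smul a s) = pad 2 @ [Inl a] @ enc s"
| "enc (Wit s) = pad 3 @ enc s"

text \<open>With arbitrary tails the statement also says that no code is a proper prefix of another
  one, which the induction over concatenated codes requires.\<close>

lemma enc_inj: "enc s @ xs = enc t @ ys \<Longrightarrow> s = t \<and> xs = ys"
proof (induction s arbitrary: t xs ys)
 case (Gen i x)
 thus ?case by (cases t) (auto simp: pad_inj split: if_splits)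
next
 case (Add s1 s2)
 from Add.prems obtain t1 t2 where t: "t = Add t1 t2" "enc s1 @ enc s2 @ xs = enc t1 @ enc t2 @ ys"
  by (cases t) (auto simp: pad_inj)
 thus ?case using Add.IH(1)[OF t(2)] Add.IH(2)[of xs t2 ys] by auto
next
 case (Smul a s)
 from Smul.prems obtain t' where t: "t = Smul a t'" "enc s @ xs = enc t' @ ys"
  by (cases t) (auto simp: pad_inj)
 show ?case using Smul.IH[OF t(2)] t(1) by simp
next
 case (Wit s)
 from Wit.prems obtain t' where t: "t = Wit t'" "enc s @ xs = enc t' @ ys"
  by (cases t) (auto simp: pad_inj)
 show ?case using Wit.IH[OF t(2)] t(1) by simp
qed

fun tdeg :: "int \<Rightarrow> ('a, 'p) tm \<Rightarrow> int" where
 "tdeg m (Gen i x) = i + m"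
| "tdeg m (Add s t) = tdeg m s"
| "tdeg m (Smul a s) = tdeg m s"
| "tdeg m (Wit s) = tdeg m s + 1"

text \<open>\<open>Wit s\<close> denotes a chosen primitive of the value of \<open>s\<close>, which
  is meaningful only if that value is a cycle. This is demanded by \<open>twf\<close>, as is the
  equality of the degrees of two summands, since \<open>tdeg\<close> looks at the first one.\<close>

fun tev :: "('a, 'y) chain_cx \<Rightarrow> int \<Rightarrow> (int \<Rightarrow> 'p \<Rightarrow> 'y) \<Rightarrow> ('a, 'p) tm \<Rightarrow> 'y" where
 "tev A m \<alpha> (Gen i x) = \<alpha> i x"
| "tev A m \<alpha> (Add s t) = tev A m \<alpha> s \<oplus>\<^bsub>A$(tdeg m s)\<^esub> tev A m \<alpha> t"
| "tev A m \<alpha> (Smul a s) = a \<odot>\<^bsub>A$(tdeg m s)\<^esub> tev A m \<alpha> s"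
| "tev A m \<alpha> (Wit s) = (SOME y. y \<in> A$$(tdeg m s + 1) \<and> cx_d A (tdeg m s + 1) y = tev A m \<alpha> s)"

fun twf :: "('a, 'r) ring_scheme \<Rightarrow> ('a, 'p) chain_cx \<Rightarrow> ('a, 'y) chain_cx \<Rightarrow> int \<Rightarrow> (int \<Rightarrow> 'p \<Rightarrow> 'y) \<Rightarrow> ('a, 'p) tm \<Rightarrow> bool" where
 "twf R P A m \<alpha> (Gen i x) \<longleftrightarrow> x \<in> P$$i"
| "twf R P A m \<alpha> (Add s t) \<longleftrightarrow> twf R P A m \<alpha> s \<and> twf R P A m \<alpha> t \<and> tdeg m s = tdeg m t"
| "twf R P A m \<alpha> (Smul a s) \<longleftrightarrow> a \<in> carrier R \<and> twf R P A m \<alpha> s"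
| "twf R P A m \<alpha> (Wit s) \<longleftrightarrow> twf R P A m \<alpha> s \<and> tev A m \<alpha> s \<in> cycles A (tdeg m s)"

text \<open>A chain map from \<open>P\<close> to an acyclic complex \<open>A\<close> of arbitrary size factors through an acyclic
 subcomplex of \<open>A\<close> that is small: close the image under the module operations and under the choice of
 preimages of cycles. The elements of the closure are the values of the terms above.\<close>

lemma K_projective_hexact:
 fixes P :: "('a, 'p) chain_cx" and A :: "('a, 'y) chain_cx"
 assumes K: "K_projective R P" and A: "chain_complex R A" and ex: "\<And>n. cx_exact A n"
 shows "hexact R P A"
 unfolding hexact_def
proof (intro allI impI)
 fix m \<alpha> assume a: "hcyc R P A m \<alpha>"
 have P: "chain_complex R P" using K unfolding K_projective_def by auto
 let ?ev = "tev A m \<alpha>" and ?wf = "twf R P A m \<alpha>" and ?dg = "tdeg m :: ('a, 'p) tm \<Rightarrow> int"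
 have wit: "?ev (Wit s) \<in> A$$(?dg s + 1) \<and> cx_d A (?dg s + 1) (?ev (Wit s)) = ?ev s"
  if "?ev s \<in> cycles A (?dg s)" for s
 proof -
  have "\<exists>y. y \<in> A$$(?dg s + 1) \<and> cx_d A (?dg s + 1) y = ?ev s"
   using ex[of "?dg s"] that unfolding cx_exact_def by auto
  thus ?thesis unfolding tev.simps by (rule someI_ex)
 qed
 have ec: "?ev t \<in> A$$(?dg t)" if "?wf t" for t
  using that
 proof (induction t)
  case (Gen i x) thus ?case using hcyc_closed[OF a] by simp
 next
  case (Add s t)
  interpret M: Module.module R "A$(?dg t)" by (rule cxM[OF A])
  show ?case using Add by simp
 next
  case (Smul r s)
  interpret M: Module.module R "A$(?dg s)" by (rule cxM[OF A])
  show ?case using Smul by simp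
 next
  case (Wit s) thus ?case using wit[of s] by simp
 qed
 define S where "S n = {y. \<exists>t. ?wf t \<and> ?dg t = n \<and> ?ev t = y}" for n
 have SI: "?wf t \<Longrightarrow> ?dg t = n \<Longrightarrow> ?ev t \<in> S n" for t n unfolding S_def by blast
 have Sadd: "x \<oplus>\<^bsub>A$n\<^esub> y \<in> S n" if xy: "x \<in> S n" "y \<in> S n" for x y n
 proof -
  obtain s t where "?wf s" "?dg s = n" "?ev s = x" "?wf t" "?dg t = n" "?ev t = y" using xy unfolding S_def by blast
  thus ?thesis using SI[of "Add s t" n] by simp
 qed
 have Ssm: "r \<odot>\<^bsub>A$n\<^esub> x \<in> S n" if rx: "r \<in> carrier R" "x \<in> S n" for x r n
 proof -
  obtain s where "?wf s" "?dg s = n" "?ev s = x" using rx(2) unfolding S_def by blast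
  thus ?thesis using SI[of "Smul r s" n] rx(1) by simp
 qed
 have Sc: "S n \<subseteq> A$$n" for n using ec unfolding S_def by auto
 have Sal: "\<alpha> i x \<in> S (i + m)" if "x \<in> P$$i" for i x
  using SI[of "Gen i x" "i + m"] that by simp
 have Sz: "\<zero>\<^bsub>A$n\<^esub> \<in> S n" for n
 proof -
  have "\<zero>\<^bsub>P$(n - m)\<^esub> \<in> P$$(n - m)"
   by (rule cyclesD(1)[OF submodule_zero[OF cyc_sub[OF P]]])
  moreover have "\<alpha> (n - m) \<zero>\<^bsub>P$(n - m)\<^esub> = \<zero>\<^bsub>A$n\<^esub>"
   by (rule lin_zero[OF hcyc_lin[OF a] cxM[OF P] cxM[OF A]]) simp
  ultimately show ?thesis using Sal[of "\<zero>\<^bsub>P$(n - m)\<^esub>" "n - m"] by simp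
 qed
 have Sneg: "\<ominus>\<^bsub>A$n\<^esub> x \<in> S n" if "x \<in> S n" for x n
 proof -
  interpret M: Module.module R "A$n" by (rule cxM[OF A])
  have "\<ominus>\<^bsub>A$n\<^esub> x = (\<ominus>\<^bsub>R\<^esub> \<one>\<^bsub>R\<^esub>) \<odot>\<^bsub>A$n\<^esub> x"
   using minus_one_smult[OF cxM[OF A]] Sc that by blast
  thus ?thesis using Ssm[OF _ that, of "\<ominus>\<^bsub>R\<^esub> \<one>\<^bsub>R\<^esub>"] by simp
 qed
 have Ssub: "submodule (S n) R (A$n)" for n
  by (rule Module.module.submoduleI[OF cxM[OF A]]) (use Sc Sz Sneg Sadd Ssm in auto)
 \<comment> \<open>The closure is stable under the differential: a generator goes to plus or minus
   the image of \<open>cx_d P i x\<close>, and the differential of a witness is the value for which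
   it was chosen.\<close>
 have Sd: "cx_d A n x \<in> S (n - 1)" if "x \<in> S n" for n x
 proof -
  have "cx_d A (?dg t) (?ev t) \<in> S (?dg t - 1)" if "?wf t" for t
   using that
  proof (induction t)
   case (Gen i x)
   have "\<alpha> (i - 1) (cx_d P i x) \<in> S (i - 1 + m)" by (rule Sal[OF cx_closed[OF P _ refl]]) (use Gen in simp)
   hence "\<alpha> (i - 1) (cx_d P i x) \<in> S (i + m - 1)" by (simp add: algebra_simps)
   hence "sg (A$(i + m - 1)) m (\<alpha> (i - 1) (cx_d P i x)) \<in> S (i + m - 1)"
    using Sneg by (simp add: sg_def)
   thus ?case using hcyc_d[OF a _ refl refl refl, of x i] Gen by simp
  next
   case (Add s t)
   have "cx_d A (?dg s) (?ev s \<oplus>\<^bsub>A$(?dg s)\<^esub> ?ev t) =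
     cx_d A (?dg s) (?ev s) \<oplus>\<^bsub>A$(?dg s - 1)\<^esub> cx_d A (?dg s) (?ev t)"
    by (rule lin_add[OF cx_lin[OF A]]) (use Add.prems ec[of s] ec[of t] in auto)
   thus ?case using Add Sadd by simp
  next
   case (Smul r s)
   have "cx_d A (?dg s) (r \<odot>\<^bsub>A$(?dg s)\<^esub> ?ev s) = r \<odot>\<^bsub>A$(?dg s - 1)\<^esub> cx_d A (?dg s) (?ev s)"
    by (rule lin_smult[OF cx_lin[OF A]]) (use Smul.prems ec[of s] in auto)
   thus ?case using Smul Ssm by simp
  next
   case (Wit s)
   thus ?case using wit[of s] SI[of s] by simp
  qed
  thus ?thesis using that unfolding S_def by blast
 qed
 define A' where "A' = A\<lparr>cx_mod := \<lambda>n. (A$n)\<lparr>carrier := S n\<rparr>\<rparr>"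
 have A': "chain_complex R A'" "chain_map R A' A (\<lambda>n x. x)"
  unfolding A'_def by (rule subcomplex[OF A Ssub Sd], assumption)+
 have ex': "cx_exact A' n" for n
  unfolding cx_exact_def
 proof
  fix z assume "z \<in> cycles A' n"
  hence z: "z \<in> S n" "cx_d A n z = \<zero>\<^bsub>A$(n - 1)\<^esub>" by (auto simp: A'_def cycles_def)
  obtain t where t: "?wf t" "?dg t = n" "?ev t = z" using z(1) unfolding S_def by blast
  have c: "?ev t \<in> cycles A (?dg t)" using t z ec[OF t(1)] by (auto simp: cycles_def)
  hence "?ev (Wit t) \<in> S (n + 1)" using t by (intro SI) auto
  thus "\<exists>w\<in>A'$$(n + 1). cx_d A' (n + 1) w = z"
   using wit[OF c] t by (intro bexI[of _ "?ev (Wit t)"]) (auto simp: A'_def)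
 qed
 \<comment> \<open>An element is coded by some term that denotes it in degree \<open>n\<close>; a
   term has one value, so distinct elements get distinct codes.\<close>
 define e :: "int \<Rightarrow> 'y \<Rightarrow> ('a, 'p) univ" where "e n y = enc (SOME t. ?wf t \<and> ?dg t = n \<and> ?ev t = y)" for n y
 have inj: "inj_on (e n) (A'$$n)" for n
 proof (rule inj_onI)
  fix x y assume "x \<in> A'$$n" "y \<in> A'$$n" and eq: "e n x = e n y"
  hence "x \<in> S n" "y \<in> S n" by (simp_all add: A'_def)
  hence "?ev (SOME t. ?wf t \<and> ?dg t = n \<and> ?ev t = x) = x" "?ev (SOME t. ?wf t \<and> ?dg t = n \<and> ?ev t = y) = y"
   unfolding S_def by (metis (mono_tags, lifting) mem_Collect_eq someI_ex)+
  moreover have "(SOME t. ?wf t \<and> ?dg t = n \<and> ?ev t = x) = (SOME t. ?wf t \<and> ?dg t = n \<and> ?ev t = y)"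
   using enc_inj[of _ "[]" _ "[]"] eq unfolding e_def by simp
  ultimately show "x = y" by metis
 qed
 note iso = transport_iso[OF A'(1) inj]
 note i = cx_isoD[OF iso]
 have "acyclic_cx (transport A' e)" using acyclic_cx_iff[OF i(2)] cx_iso_exact[OF iso ex'] by blast
 hence hx: "hexact R P (transport A' e)"
  using K i(2) acyclic_Hom_iff[OF P i(2)] unfolding K_projective_def by blast
 have "hcyc R P A' m \<alpha>"
  unfolding hcyc_def
 proof (intro conjI allI ballI)
  fix i
  note l = hcyc_lin[OF a refl, of i]
  show "lin_map R (P$i) (A'$(i + m)) (\<alpha> i)"
   by (rule lin_mapI) (auto simp: A'_def Sal lin_add[OF l] lin_smult[OF l])
  fix x assume x: "x \<in> P$$i"
  have "\<alpha> (i - 1) (cx_d P i x) \<in> S (i - 1 + m)" by (rule Sal[OF cx_closed[OF P x refl]])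
  hence s: "\<alpha> (i - 1) (cx_d P i x) \<in> A'$$(i + m - 1)" by (simp add: A'_def algebra_simps)
  hence s': "\<alpha> (i - 1) (cx_d P i x) \<in> A$$(i + m - 1)" using cm_closed[OF A'(2)] by blast
  have "sg (A'$(i + m - 1)) m (\<alpha> (i - 1) (cx_d P i x)) = sg (A$(i + m - 1)) m (\<alpha> (i - 1) (cx_d P i x))"
   using lin_sg[OF cm_lin[OF A'(2)] cxM[OF A'(1)] cxM[OF A] s] by simp
  thus "cx_d A' (i + m) (\<alpha> i x) = sg (A'$(i + m - 1)) m (\<alpha> (i - 1) (cx_d P i x))"
   using hcyc_d[OF a x refl refl refl] by (simp add: A'_def)
 qed
 hence "hcyc R P (transport A' e) m (\<lambda>i x. e (i + m) (\<alpha> i x))" by (rule hcyc_post[OF P A'(1) i(2,3)])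
 from hnull_post[OF P i(2) A cm_comp[OF i(4) A'(2)] hexactD[OF hx this]]
 show "hnull R P A m \<alpha>"
 proof (rule hnull_cong)
  fix j x assume "x \<in> P$$j"
  hence "\<alpha> j x \<in> A'$$(j + m)" using Sal by (simp add: A'_def)
  thus "\<alpha> j x = inv_into (A'$$(j + m)) (e (j + m)) (e (j + m) (\<alpha> j x))" by (simp only: i(5))
 qed
qed

section \<open>Homotopy equivalences\<close>

lemma K_projective_complex: "K_projective R P \<Longrightarrow> chain_complex R P"
 unfolding K_projective_def by auto

lemma lift_chain_map:
 assumes P: "chain_complex R P" and Y: "chain_complex R Y" and Z: "chain_complex R Z"
  and q: "quasi_iso R Y Z q" and ex: "hexact R P (cone R Y Z q)" and f: "chain_map R P Z f"
 shows "\<exists>g. chain_map R P Y g \<and> hnull R P Z 0 (\<lambda>i x. q i (g i x) \<ominus>\<^bsub>Z$(i + 0)\<^esub> f i x)"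
proof -
 have qc: "chain_map R Y Z q" using q quasi_iso_iff[OF Y Z] by blast
 show ?thesis
  using lift_cycle[OF Y Z qc P ex f[unfolded cm_hcyc]] by (simp add: cm_hcyc)
qed

lemma lift_quasi_iso:
 assumes P: "chain_complex R P" and Y: "chain_complex R Y" and Z: "chain_complex R Z"
  and q: "quasi_iso R Y Z q" and ex: "hexact R P (cone R Y Z q)" and f: "quasi_iso R P Z f"
 shows "\<exists>g. quasi_iso R P Y g"
proof -
 have "chain_map R P Z f" using f quasi_iso_iff[OF P Z] by blast
 from lift_chain_map[OF P Y Z q ex this]
 obtain g where g: "chain_map R P Y g" "hnull R P Z 0 (\<lambda>i x. q i (g i x) \<ominus>\<^bsub>Z$(i + 0)\<^esub> f i x)" by blast
 hence "quasi_iso R P Y g" by (intro quasi_iso_cancel[OF P Y Z f q])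
 thus ?thesis by blast
qed

definition htpy_inv ::
  "('a, 'r) ring_scheme \<Rightarrow> ('a, 'x) chain_cx \<Rightarrow> ('a, 'y) chain_cx \<Rightarrow> (int \<Rightarrow> 'x \<Rightarrow> 'y) \<Rightarrow> (int \<Rightarrow> 'y \<Rightarrow> 'x) \<Rightarrow> bool" where
 "htpy_inv R X Y f g \<longleftrightarrow> chain_map R X Y f \<and> chain_map R Y X g \<and>
  hnull R X X 0 (\<lambda>i x. g i (f i x) \<ominus>\<^bsub>X$(i + 0)\<^esub> x) \<and>
  hnull R Y Y 0 (\<lambda>i y. f i (g i y) \<ominus>\<^bsub>Y$(i + 0)\<^esub> y)"

text \<open>Lifting the identity of \<open>P\<close> gives \<open>g\<close> with q g homotopic to 1.
  Then q (g q - 1) is null-homotopic, and \<open>lift_null\<close> for maps out of \<open>S\<close>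
  removes the \<open>q\<close> in front. Hence \<open>g\<close> is a left inverse as well.\<close>

lemma htpy_inv_exists:
 assumes S: "chain_complex R S" and P: "chain_complex R P" and q: "quasi_iso R S P q"
  and exS: "hexact R S (cone R S P q)" and exP: "hexact R P (cone R S P q)"
 shows "\<exists>g. htpy_inv R S P q g"
proof -
 have qc: "chain_map R S P q" using q quasi_iso_iff[OF S P] by blast
 obtain g where g: "chain_map R P S g" "hnull R P P 0 (\<lambda>i x. q i (g i x) \<ominus>\<^bsub>P$(i + 0)\<^esub> x)"
  using lift_chain_map[OF P S P q exP cm_id] by blast
 have gq: "chain_map R S S (\<lambda>i x. g i (q i x))" by (rule cm_comp[OF qc g(1)])
 have b: "hcyc R S S 0 (\<lambda>i x. g i (q i x) \<ominus>\<^bsub>S$(i + 0)\<^esub> x)"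
  by (rule hcyc_minus[OF S S]) (use gq cm_id in \<open>simp_all add: cm_hcyc[symmetric]\<close>)
 have n: "hnull R S P 0 (\<lambda>i x. q i (g i (q i x)) \<ominus>\<^bsub>P$(i + 0)\<^esub> q i x)"
  using hnull_pre[OF P P S qc g(2)] .
 have "hnull R S P 0 (\<lambda>i x. q (i + 0) (g i (q i x) \<ominus>\<^bsub>S$(i + 0)\<^esub> x))"
 proof (rule hnull_cong[OF n])
  fix i x assume x: "x \<in> S$$i"
  show "q (i + 0) (g i (q i x) \<ominus>\<^bsub>S$(i + 0)\<^esub> x) = q i (g i (q i x)) \<ominus>\<^bsub>P$(i + 0)\<^esub> q i x"
   using lin_diff[OF cm_lin[OF qc] cxM[OF S] cxM[OF P] cm_closed[OF gq x] x] by simp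
 qed
 from lift_null[OF S P qc S exS b this] show ?thesis using g qc unfolding htpy_inv_def by blast
qed

lemma hcyc_hnull_diff_compose:
 assumes P: "chain_complex R P" and Y: "chain_complex R Y" and n: "hnull R P P 0 (\<lambda>i x. e i x \<ominus>\<^bsub>P$(i + 0)\<^esub> x)"
  and e: "chain_map R P P e" and f: "hcyc R P Y m f"
 shows "hnull R P Y m (\<lambda>i x. f i (e i x) \<ominus>\<^bsub>Y$(i + m)\<^esub> f i x)"
proof -
 obtain h where h: "htpy R P P 0 h (\<lambda>i x. e i x \<ominus>\<^bsub>P$(i + 0)\<^esub> x)" using n unfolding hnull_def by blast
 \<comment> \<open>The homotopy is f h up to sign: moving the differential past \<open>f\<close>,
   which has degree \<open>m\<close>, produces the factor (-1)^m.\<close>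
 have "htpy R P Y m (\<lambda>i x. sg (Y$(i + m + 1)) m (f (i + 1) (h i x))) (\<lambda>i x. f i (e i x) \<ominus>\<^bsub>Y$(i + m)\<^esub> f i x)"
  unfolding htpy_def
 proof (intro conjI allI ballI)
  fix i
  have hl: "lin_map R (P$i) (P$(i + 1)) (h i)" by (rule htpy_lin[OF h]) simp
  have fl: "lin_map R (P$(i + 1)) (Y$(i + m + 1)) (f (i + 1))" by (rule hcyc_lin[OF f]) simp
  show "lin_map R (P$i) (Y$(i + m + 1)) (\<lambda>x. sg (Y$(i + m + 1)) m (f (i + 1) (h i x)))"
   by (rule lin_sg_map[OF lin_comp[OF hl fl] cxM[OF Y]])
  fix x assume x: "x \<in> P$$i"
  interpret Y0: Module.module R "Y$(i + m)" by (rule cxM[OF Y])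
  have c: "i - 1 + m + 1 = i + m" "i - 1 + 1 = i" "i + 1 + m = i + m + 1" by simp_all
  have dx: "cx_d P i x \<in> P$$(i - 1)" by (rule cx_closed[OF P x refl])
  have hx: "h i x \<in> P$$(i + 1)" by (rule lin_closed[OF hl x])
  have hdx: "h (i - 1) (cx_d P i x) \<in> P$$i" by (rule htpy_closed[OF h dx]) simp
  have dhx: "cx_d P (i + 1) (h i x) \<in> P$$i" by (rule cx_closed[OF P hx]) simp
  note fi = hcyc_lin[OF f refl, of i]
  have fhx: "f (i + 1) (h i x) \<in> Y$$(i + m + 1)" by (rule lin_closed[OF fl hx])
  have "f i (e i x) \<ominus>\<^bsub>Y$(i + m)\<^esub> f i x = f i (e i x \<ominus>\<^bsub>P$i\<^esub> x)"
   by (rule lin_diff[OF fi cxM[OF P] cxM[OF Y] cm_closed[OF e x] x, symmetric])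
  also have "\<dots> = f i (cx_d P (i + 1) (h i x) \<oplus>\<^bsub>P$i\<^esub> h (i - 1) (cx_d P i x))"
   using htpy_eq[OF h x, of i "i - 1" "i + 1"] by (simp add: sg_def)
  also have "\<dots> = f i (cx_d P (i + 1) (h i x)) \<oplus>\<^bsub>Y$(i + m)\<^esub> f i (h (i - 1) (cx_d P i x))"
   by (rule lin_add[OF fi dhx hdx])
  also have "f i (cx_d P (i + 1) (h i x)) = cx_d Y (i + m + 1) (sg (Y$(i + m + 1)) m (f (i + 1) (h i x)))"
  proof -
   have k: "f i (cx_d P (i + 1) (h i x)) \<in> Y$$(i + m)" by (rule lin_closed[OF fi dhx])
   have "cx_d Y (i + m + 1) (f (i + 1) (h i x)) = sg (Y$(i + m)) m (f i (cx_d P (i + 1) (h i x)))"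
    by (rule hcyc_d[OF f hx]) auto
   thus ?thesis
    using lin_sg[OF cx_lin'[OF Y] cxM[OF Y] cxM[OF Y] fhx, of "i + m" m] sg_cancel[OF cxM[OF Y] k, of m]
    by simp
  qed
  finally show "f i (e i x) \<ominus>\<^bsub>Y$(i + m)\<^esub> f i x = cx_d Y (i + m + 1) (sg (Y$(i + m + 1)) m (f (i + 1) (h i x)))
    \<oplus>\<^bsub>Y$(i + m)\<^esub> sg (Y$(i + m)) m (sg (Y$(i - 1 + m + 1)) m (f (i - 1 + 1) (h (i - 1) (cx_d P i x))))"
   unfolding c by (simp add: sg_cancel[OF cxM[OF Y] lin_closed[OF fi hdx]])
 qed
 thus ?thesis unfolding hnull_def by blast
qed

section \<open>Homotopy invariance of the Hom complex\<close>

definition hom_post where "hom_post P q = (\<lambda>(n::int) f (i::int). \<lambda>x\<in>P$$i. q (i + n) (f i x))"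
definition hom_pre where "hom_pre P u = (\<lambda>(n::int) f (i::int). \<lambda>x\<in>P$$i. f i (u i x))"

lemma Hom_quasi_isoI:
 assumes P: "chain_complex R P" and Y: "chain_complex R Y" and P': "chain_complex R P'" and Y': "chain_complex R Y'"
  and \<Phi>: "chain_map R (Hom_cx R P Y) (Hom_cx R P' Y') \<Phi>"
  and inj: "\<And>n f. f \<in> (Hom_cx R P Y)$$n \<Longrightarrow> hcyc R P Y n f \<Longrightarrow> hnull R P' Y' n (\<Phi> n f) \<Longrightarrow> hnull R P Y n f"
  and surj: "\<And>n g. g \<in> (Hom_cx R P' Y')$$n \<Longrightarrow> hcyc R P' Y' n g \<Longrightarrow>
   \<exists>f\<in>(Hom_cx R P Y)$$n. hcyc R P Y n f \<and> hnull R P' Y' n (\<lambda>i x. g i x \<ominus>\<^bsub>Y'$(i + n)\<^esub> \<Phi> n f i x)"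
 shows "quasi_iso R (Hom_cx R P Y) (Hom_cx R P' Y') \<Phi>"
proof -
 note H = Hom_chain_complex[OF P Y] and H' = Hom_chain_complex[OF P' Y']
 show ?thesis unfolding quasi_iso_iff[OF H H']
 proof (intro conjI allI ballI impI \<Phi>)
  fix n f assume "f \<in> cycles (Hom_cx R P Y) n" "\<Phi> n f \<in> boundaries (Hom_cx R P' Y') n"
  thus "f \<in> boundaries (Hom_cx R P Y) n" using inj unfolding Hom_cycles[OF P Y] Hom_boundaries[OF P Y] Hom_boundaries[OF P' Y'] by blast
 next
  fix n g assume "g \<in> cycles (Hom_cx R P' Y') n"
  hence g: "g \<in> (Hom_cx R P' Y')$$n" "hcyc R P' Y' n g" unfolding Hom_cycles[OF P' Y'] by auto
  obtain f where f: "f \<in> (Hom_cx R P Y)$$n" "hcyc R P Y n f" "hnull R P' Y' n (\<lambda>i x. g i x \<ominus>\<^bsub>Y'$(i + n)\<^esub> \<Phi> n f i x)"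
   using surj[OF g] by blast
  interpret M: Module.module R "(Hom_cx R P' Y')$n" by (rule cxM[OF H'])
  have ff: "\<Phi> n f \<in> (Hom_cx R P' Y')$$n" by (rule cm_closed[OF \<Phi> f(1)])
  have "(g \<ominus>\<^bsub>(Hom_cx R P' Y')$n\<^esub> \<Phi> n f) i x = g i x \<ominus>\<^bsub>Y'$(i + n)\<^esub> \<Phi> n f i x"
   if x: "x \<in> P'$$i" for i x
  proof -
   interpret N: Module.module R "Y'$(i + n)" by (rule cxM[OF Y'])
   have "g = (g \<ominus>\<^bsub>(Hom_cx R P' Y')$n\<^esub> \<Phi> n f) \<oplus>\<^bsub>(Hom_cx R P' Y')$n\<^esub> \<Phi> n f"
    using g(1) ff by (simp add: M.M.grp_simps M.M.l_neg)
   hence "g i x = (g \<ominus>\<^bsub>(Hom_cx R P' Y')$n\<^esub> \<Phi> n f) i x \<oplus>\<^bsub>Y'$(i + n)\<^esub> \<Phi> n f i x"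
    using Hom_simps(1)[OF P' Y' x] by metis
   moreover have "(g \<ominus>\<^bsub>(Hom_cx R P' Y')$n\<^esub> \<Phi> n f) i x \<in> Y'$$(i + n)"
    by (rule Hom_closed[OF P' Y' _ x refl]) (use g(1) ff in simp)
   moreover have "\<Phi> n f i x \<in> Y'$$(i + n)" by (rule Hom_closed[OF P' Y' ff x refl])
   ultimately show ?thesis by (simp add: N.M.grp_simps)
  qed
  hence "hnull R P' Y' n (g \<ominus>\<^bsub>(Hom_cx R P' Y')$n\<^esub> \<Phi> n f)" by (rule hnull_cong[OF f(3)])
  hence "g \<ominus>\<^bsub>(Hom_cx R P' Y')$n\<^esub> \<Phi> n f \<in> boundaries (Hom_cx R P' Y') n"
   unfolding Hom_boundaries[OF P' Y'] using g(1) ff by simp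
  thus "\<exists>f\<in>cycles (Hom_cx R P Y) n. g \<ominus>\<^bsub>(Hom_cx R P' Y')$n\<^esub> \<Phi> n f \<in> boundaries (Hom_cx R P' Y') n"
   using f Hom_cycles[OF P Y] by blast
 qed
qed

lemma restrict_mem_hcyc:
 assumes P: "chain_complex R P" and Y: "chain_complex R Y" and f: "hcyc R P Y n f"
 shows "(\<lambda>i. \<lambda>x\<in>P$$i. f i x) \<in> (Hom_cx R P Y)$$n"
  "hcyc R P Y n (\<lambda>i. \<lambda>x\<in>P$$i. f i x)"
proof -
 show 1: "(\<lambda>i. \<lambda>x\<in>P$$i. f i x) \<in> (Hom_cx R P Y)$$n"
  by (rule Hom_mem_restrict[OF P Y hcyc_lin[OF f refl]])
 show "hcyc R P Y n (\<lambda>i. \<lambda>x\<in>P$$i. f i x)"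
  using f Hom_lin[OF P Y 1 refl] unfolding hcyc_def by (simp add: cx_closed[OF P])
qed

text \<open>On homology, \<open>lift_null\<close> is injectivity and \<open>lift_cycle\<close> is
  surjectivity.\<close>

lemma hom_post_quasi_iso:
 assumes P: "chain_complex R P" and Y: "chain_complex R Y" and Z: "chain_complex R Z"
  and q: "quasi_iso R Y Z q" and ex: "hexact R P (cone R Y Z q)"
 shows "quasi_iso R (Hom_cx R P Y) (Hom_cx R P Z) (hom_post P q)"
proof (rule Hom_quasi_isoI[OF P Y P Z])
 have qc: "chain_map R Y Z q" using q quasi_iso_iff[OF Y Z] by blast
 have mem: "hom_post P q n f \<in> (Hom_cx R P Z)$$n" if "f \<in> (Hom_cx R P Y)$$n" for n f
  unfolding hom_post_def
  by (rule Hom_mem_restrict[OF P Z lin_comp[OF Hom_lin[OF P Y that refl] cm_lin[OF qc]]])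
 have ap: "hom_post P q n f i x = q (i + n) (f i x)" if "x \<in> P$$i" for n f i x
  using that by (simp add: hom_post_def)
 note YH = Hom_chain_complex[OF P Y] and ZH = Hom_chain_complex[OF P Z]
 show "chain_map R (Hom_cx R P Y) (Hom_cx R P Z) (hom_post P q)"
  unfolding chain_map_def
 proof (intro conjI allI ballI lin_mapI)
  fix n f assume f: "f \<in> (Hom_cx R P Y)$$n"
  interpret MY: Module.module R "(Hom_cx R P Y)$n" by (rule cxM[OF YH])
  interpret MZ: Module.module R "(Hom_cx R P Z)$n" by (rule cxM[OF ZH])
  note l = cm_lin[OF qc] and fc = Hom_closed[OF P Y f _ refl]
  show "hom_post P q n f \<in> (Hom_cx R P Z)$$n" using mem[OF f] .
  show "hom_post P q n (f \<oplus>\<^bsub>(Hom_cx R P Y)$n\<^esub> g) = hom_post P q n f \<oplus>\<^bsub>(Hom_cx R P Z)$n\<^esub> hom_post P q n g"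
   if g: "g \<in> (Hom_cx R P Y)$$n" for g
   by (rule Hom_eqI[OF P Z, of _ n]) (use f g mem in \<open>simp_all add: ap Hom_simps[OF P Y] Hom_simps[OF P Z] lin_add[OF l] fc
    Hom_closed[OF P Y g _ refl]\<close>)
  show "hom_post P q n (r \<odot>\<^bsub>(Hom_cx R P Y)$n\<^esub> f) = r \<odot>\<^bsub>(Hom_cx R P Z)$n\<^esub> hom_post P q n f"
   if r: "r \<in> carrier R" for r
   by (rule Hom_eqI[OF P Z, of _ n]) (use f r mem in \<open>simp_all add: ap Hom_simps[OF P Y] Hom_simps[OF P Z] lin_smult[OF l] fc\<close>)
  show "hom_post P q (n - 1) (cx_d (Hom_cx R P Y) n f) = cx_d (Hom_cx R P Z) n (hom_post P q n f)"
  proof (rule Hom_eqI[OF P Z, of _ "n - 1"])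
   fix i x assume x: "x \<in> P$$i"
   have c: "i + (n - 1) = i + n - 1" "i - 1 + n = i + n - 1" by simp_all
   have dx: "cx_d P i x \<in> P$$(i - 1)" by (rule cx_closed[OF P x refl])
   have e: "f (i - 1) (cx_d P i x) \<in> Y$$(i + n - 1)" by (rule Hom_closed[OF P Y f dx]) simp
   have e': "cx_d Y (i + n) (f i x) \<in> Y$$(i + n - 1)" by (rule cx_closed[OF Y fc[OF x] refl])
   show "hom_post P q (n - 1) (cx_d (Hom_cx R P Y) n f) i x = cx_d (Hom_cx R P Z) n (hom_post P q n f) i x"
    unfolding ap[OF x] Hom_d_apply[OF P Y f x] Hom_d_apply[OF P Z mem[OF f] x] ap[OF dx] c
    using lin_diff[OF l cxM[OF Y] cxM[OF Z] e' sg_closed[OF cxM[OF Y] e]]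
     lin_sg[OF l cxM[OF Y] cxM[OF Z] e] cm_d[OF qc fc[OF x] refl] by simp
  qed (use mem[OF Hom_d_mem[OF P Y f]] Hom_d_mem[OF P Z mem[OF f]] in auto)
 qed
 show "hnull R P Y n f" if "f \<in> (Hom_cx R P Y)$$n" "hcyc R P Y n f" "hnull R P Z n (hom_post P q n f)" for n f
  by (rule lift_null[OF Y Z qc P ex that(2)], rule hnull_cong[OF that(3)]) (simp add: ap)
 show "\<exists>f\<in>(Hom_cx R P Y)$$n. hcyc R P Y n f \<and> hnull R P Z n (\<lambda>i x. g i x \<ominus>\<^bsub>Z$(i + n)\<^esub> hom_post P q n f i x)"
  if g: "g \<in> (Hom_cx R P Z)$$n" "hcyc R P Z n g" for n g
 proof -
  obtain \<beta> where b: "hcyc R P Y n \<beta>" "hnull R P Z n (\<lambda>i x. q (i + n) (\<beta> i x) \<ominus>\<^bsub>Z$(i + n)\<^esub> g i x)"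
   using lift_cycle[OF Y Z qc P ex g(2)] by blast
  show ?thesis
  proof (intro bexI conjI)
   show "hnull R P Z n (\<lambda>i x. g i x \<ominus>\<^bsub>Z$(i + n)\<^esub> hom_post P q n (\<lambda>i. \<lambda>x\<in>P$$i. \<beta> i x) i x)"
    by (rule hnull_cong[OF hnull_sym[OF P Z b(2) hcyc_post[OF P Y Z qc b(1)] g(2)]]) (simp add: ap)
  qed (use restrict_mem_hcyc[OF P Y b(1)] in auto)
 qed
qed

text \<open>Composition with the homotopy inverse \<open>w\<close> is inverse to composition with
  \<open>u\<close> up to homotopy, by \<open>hcyc_hnull_diff_compose\<close> for either composite of
  \<open>u\<close> and \<open>w\<close>.\<close>

lemma hom_pre_quasi_iso:
 assumes P: "chain_complex R P" and F: "chain_complex R F" and Y: "chain_complex R Y" and i: "htpy_inv R P F u w"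
 shows "quasi_iso R (Hom_cx R F Y) (Hom_cx R P Y) (hom_pre P u)"
proof (rule Hom_quasi_isoI[OF F Y P Y])
 have u: "chain_map R P F u" and w: "chain_map R F P w" and wu: "hnull R P P 0 (\<lambda>i x. w i (u i x) \<ominus>\<^bsub>P$(i + 0)\<^esub> x)"
  and uw: "hnull R F F 0 (\<lambda>i y. u i (w i y) \<ominus>\<^bsub>F$(i + 0)\<^esub> y)" using i unfolding htpy_inv_def by auto
 have mem: "hom_pre P u n f \<in> (Hom_cx R P Y)$$n" if "f \<in> (Hom_cx R F Y)$$n" for n f
  unfolding hom_pre_def
  by (rule Hom_mem_restrict[OF P Y lin_comp[OF cm_lin[OF u] Hom_lin[OF F Y that refl]]])
 have ap: "hom_pre P u n f i x = f i (u i x)" if "x \<in> P$$i" for n f i x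
  using that by (simp add: hom_pre_def)
 note uc = cm_closed[OF u]
 note FH = Hom_chain_complex[OF F Y] and PH = Hom_chain_complex[OF P Y]
 show "chain_map R (Hom_cx R F Y) (Hom_cx R P Y) (hom_pre P u)"
  unfolding chain_map_def
 proof (intro conjI allI ballI lin_mapI)
  fix n f assume f: "f \<in> (Hom_cx R F Y)$$n"
  interpret MY: Module.module R "(Hom_cx R F Y)$n" by (rule cxM[OF FH])
  interpret MZ: Module.module R "(Hom_cx R P Y)$n" by (rule cxM[OF PH])
  show "hom_pre P u n f \<in> (Hom_cx R P Y)$$n" using mem[OF f] .
  show "hom_pre P u n (f \<oplus>\<^bsub>(Hom_cx R F Y)$n\<^esub> g) = hom_pre P u n f \<oplus>\<^bsub>(Hom_cx R P Y)$n\<^esub> hom_pre P u n g"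
   if g: "g \<in> (Hom_cx R F Y)$$n" for g
   by (rule Hom_eqI[OF P Y, of _ n]) (use f g mem in \<open>simp_all add: ap Hom_simps[OF P Y] Hom_simps[OF F Y] uc\<close>)
  show "hom_pre P u n (r \<odot>\<^bsub>(Hom_cx R F Y)$n\<^esub> f) = r \<odot>\<^bsub>(Hom_cx R P Y)$n\<^esub> hom_pre P u n f"
   if r: "r \<in> carrier R" for r
   by (rule Hom_eqI[OF P Y, of _ n]) (use f r mem in \<open>simp_all add: ap Hom_simps[OF P Y] Hom_simps[OF F Y] uc\<close>)
  show "hom_pre P u (n - 1) (cx_d (Hom_cx R F Y) n f) = cx_d (Hom_cx R P Y) n (hom_pre P u n f)"
  proof (rule Hom_eqI[OF P Y, of _ "n - 1"])
   fix i x assume x: "x \<in> P$$i"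
   have dx: "cx_d P i x \<in> P$$(i - 1)" by (rule cx_closed[OF P x refl])
   show "hom_pre P u (n - 1) (cx_d (Hom_cx R F Y) n f) i x = cx_d (Hom_cx R P Y) n (hom_pre P u n f) i x"
    unfolding ap[OF x] Hom_d_apply[OF F Y f uc[OF x]] Hom_d_apply[OF P Y mem[OF f] x] ap[OF dx]
    using cm_d[OF u x refl] by simp
  qed (use mem[OF Hom_d_mem[OF F Y f]] Hom_d_mem[OF P Y mem[OF f]] in auto)
 qed
 show "hnull R F Y n f" if f: "f \<in> (Hom_cx R F Y)$$n" "hcyc R F Y n f" "hnull R P Y n (hom_pre P u n f)" for n f
 proof -
  have "hnull R P Y n (\<lambda>i x. f i (u i x))" by (rule hnull_cong[OF f(3)]) (simp add: ap)
  from hnull_pre[OF P Y F w this] have 1: "hnull R F Y n (\<lambda>i x. f i (u i (w i x)))" .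
  have 2: "hnull R F Y n (\<lambda>i x. f i (u i (w i x)) \<ominus>\<^bsub>Y$(i + n)\<^esub> f i x)"
   by (rule hcyc_hnull_diff_compose[OF F Y uw cm_comp[OF w u] f(2)])
  show ?thesis
  proof (rule hnull_cong[OF hnull_minus[OF F Y 1 2]])
   fix i x assume x: "x \<in> F$$i"
   interpret N: Module.module R "Y$(i + n)" by (rule cxM[OF Y])
   have "f i x \<in> Y$$(i + n)" "f i (u i (w i x)) \<in> Y$$(i + n)"
    using hcyc_closed[OF f(2) _ refl] x uc cm_closed[OF w] by blast+
   thus "f i x = f i (u i (w i x)) \<ominus>\<^bsub>Y$(i + n)\<^esub> (f i (u i (w i x)) \<ominus>\<^bsub>Y$(i + n)\<^esub> f i x)"
    by (simp add: N.M.grp_simps)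
  qed
 qed
 show "\<exists>f\<in>(Hom_cx R F Y)$$n. hcyc R F Y n f \<and> hnull R P Y n (\<lambda>i x. g i x \<ominus>\<^bsub>Y$(i + n)\<^esub> hom_pre P u n f i x)"
  if g: "g \<in> (Hom_cx R P Y)$$n" "hcyc R P Y n g" for n g
 proof -
  have b: "hcyc R F Y n (\<lambda>i x. g i (w i x))" by (rule hcyc_pre[OF P Y F w g(2)])
  have "hnull R P Y n (\<lambda>i x. g i (w i (u i x)) \<ominus>\<^bsub>Y$(i + n)\<^esub> g i x)"
   by (rule hcyc_hnull_diff_compose[OF P Y wu cm_comp[OF u w] g(2)])
  from hnull_sym[OF P Y this hcyc_pre[OF F Y P u b] g(2)]
  have s: "hnull R P Y n (\<lambda>i x. g i x \<ominus>\<^bsub>Y$(i + n)\<^esub> g i (w i (u i x)))" .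
  show ?thesis
  proof (intro bexI conjI)
   show "hnull R P Y n (\<lambda>i x. g i x \<ominus>\<^bsub>Y$(i + n)\<^esub> hom_pre P u n (\<lambda>i. \<lambda>x\<in>F$$i. g i (w i x)) i x)"
    by (rule hnull_cong[OF s]) (simp add: ap uc)
  qed (use restrict_mem_hcyc[OF F Y b] in auto)
 qed
qed

context cring
begin

lemma semifree_hexact_cone:
 assumes "free_cx R X B" "lowers R X B ht" "chain_complex R Y" "chain_complex R Z" "quasi_iso R Y Z q"
 shows "hexact R X (cone R Y Z q)"
proof -
 have "chain_map R Y Z q" using assms(5) quasi_iso_iff[OF assms(3,4)] by blast
 thus ?thesis by (intro semifree_hexact[OF assms(1,2)] cone_chain_complex[OF assms(3,4)] cone_exact[OF assms(3,4) _ assms(5)])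
qed

lemma K_projective_hexact_cone:
 assumes "K_projective R P" "chain_complex R Y" "chain_complex R Z" "quasi_iso R Y Z q"
 shows "hexact R P (cone R Y Z q)"
proof -
 have "chain_map R Y Z q" using assms(4) quasi_iso_iff[OF assms(2,3)] by blast
 thus ?thesis by (intro K_projective_hexact[OF assms(1)] cone_chain_complex[OF assms(2,3)] cone_exact[OF assms(2,3) _ assms(4)])
qed

text \<open>The homotopy equivalence between \<open>L\<close> and \<open>P\<close> yields an
  endomorphism of \<open>L\<close> that factors through \<open>P\<close>, hence vanishes above
  \<open>n\<close>, and that is homotopic to the identity. It serves both for minimal models and for
  semi-free resolutions of unbounded complexes.\<close>

lemma semifree_truncated_identity:
 assumes L: "free_cx R L B" "lowers R L B ht" and X: "chain_complex R X" and k: "quasi_iso R L X \<kappa>"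
  and P: "K_projective R P" and XP: "derived_iso R X P" and n: "\<And>v. v > n \<Longrightarrow> zero_module (P$v)"
 shows "\<exists>h. (\<forall>i. lin_map R (Fr R (B i)) (Fr R (B (i + 1))) (h i)) \<and>
  (\<forall>v>n. \<forall>x\<in>Vec R (B v). x = cx_d L (v + 1) (h v x) \<oplus>\<^bsub>Fr R (B v)\<^esub> h (v - 1) (cx_d L v x))"
proof -
 note Lc = fcD(1)[OF L(1)] and Lm = fcD(2)[OF L(1)] and Pc = K_projective_complex[OF P]
 obtain Z :: "('a, ('a, 'd + 'e) univ) chain_cx" and f g where Z: "chain_complex R Z" "quasi_iso R Z X f" "quasi_iso R Z P g"
  using XP unfolding derived_iso_def by blast
 \<comment> \<open>The legs of the roof point away from \<open>Z\<close>. Lifting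
   \<open>\<kappa>\<close> along the leg to \<open>X\<close> replaces the roof by an actual chain
   map from \<open>L\<close> to \<open>P\<close>.\<close>
 obtain t where t: "quasi_iso R L Z t"
  using lift_quasi_iso[OF Lc Z(1) X Z(2) semifree_hexact_cone[OF L Z(1) X Z(2)] k] by blast
 have q: "quasi_iso R L P (\<lambda>n x. g n (t n x))" by (rule quasi_iso_comp[OF Lc Z(1) Pc t Z(3)])
 obtain w where w: "htpy_inv R L P (\<lambda>n x. g n (t n x)) w"
  using htpy_inv_exists[OF Lc Pc q semifree_hexact_cone[OF L Lc Pc q] K_projective_hexact_cone[OF P Lc Pc q]] by blast
 then obtain h where wc: "chain_map R P L w" and qc: "chain_map R L P (\<lambda>n x. g n (t n x))"
  and h: "htpy R L L 0 h (\<lambda>i x. w i (g i (t i x)) \<ominus>\<^bsub>L$(i + 0)\<^esub> x)" unfolding htpy_inv_def hnull_def by auto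
 \<comment> \<open>\<open>h\<close> contracts the endomorphism minus the identity, so its negative
   contracts the identity wherever the endomorphism vanishes.\<close>
 let ?k = "\<lambda>i x. \<ominus>\<^bsub>Fr R (B (i + 1))\<^esub> h i x"
 show ?thesis
 proof (intro exI[of _ ?k] conjI allI impI ballI)
  fix i
  show "lin_map R (Fr R (B i)) (Fr R (B (i + 1))) (?k i)"
   using htpy_lin[OF h, of "i + 1" i] by (intro lin_uminus FrM) (simp add: Lm)
 next
  fix v x assume v: "n < v" and x: "x \<in> Vec R (B v)"
  interpret F: Module.module R "Fr R (B v)" by (rule FrM)
  have x': "x \<in> L$$v" using x Lm by simp
  have z: "g v (t v x) = \<zero>\<^bsub>P$v\<^esub>"
   using n[OF v] cm_closed[OF qc x'] unfolding zero_module_def by auto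
  have "w v (g v (t v x)) = \<zero>\<^bsub>L$v\<^esub>" unfolding z by (rule lin_zero[OF cm_lin[OF wc] cxM[OF Pc] cxM[OF Lc]])
  hence "\<ominus>\<^bsub>Fr R (B v)\<^esub> x = cx_d L (v + 1) (h v x) \<oplus>\<^bsub>Fr R (B v)\<^esub> h (v - 1) (cx_d L v x)"
   using htpy_eq[OF h x', of v "v - 1" "v + 1"] x by (simp add: sg_def Lm a_minus_def)
  hence "x = \<ominus>\<^bsub>Fr R (B v)\<^esub> (cx_d L (v + 1) (h v x) \<oplus>\<^bsub>Fr R (B v)\<^esub> h (v - 1) (cx_d L v x))"
   using x by (metis F.M.minus_minus)
  moreover have hx: "h v x \<in> Vec R (B (v + 1))" using htpy_closed[OF h x', of "v + 1"] by (simp add: Lm)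
  moreover have "cx_d L (v + 1) (h v x) \<in> Vec R (B v)" using lin_closed[OF free_cx_d[OF L(1)] hx] by simp
  moreover have dx: "cx_d L v x \<in> Vec R (B (v - 1))" using lin_closed[OF free_cx_d[OF L(1)] x] by simp
  moreover have "h (v - 1) (cx_d L v x) \<in> Vec R (B v)" using htpy_closed[OF h, of "cx_d L v x" "v - 1" v] dx by (simp add: Lm)
  moreover have "cx_d L (v + 1) (\<ominus>\<^bsub>Fr R (B (v + 1))\<^esub> h v x) = \<ominus>\<^bsub>Fr R (B v)\<^esub> cx_d L (v + 1) (h v x)"
   by (rule lin_inv[OF free_cx_d[OF L(1)] FrM FrM hx]) simp
  ultimately show "x = cx_d L (v + 1) (?k v x) \<oplus>\<^bsub>Fr R (B v)\<^esub> ?k (v - 1) (cx_d L v x)"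
   by (simp add: F.M.minus_add)
 qed
qed

end

section \<open>Noetherian local rings\<close>

locale noeth_cring = cring + assumes noeth: "noetherian_ring R"

locale noeth_local = noeth_cring +
 fixes \<mm> :: "'a set"
 assumes mm_ideal: "ideal \<mm> R" and mm_one: "\<one> \<notin> \<mm>"
  and mm_unit: "\<And>r. r \<in> carrier R \<Longrightarrow> r \<notin> \<mm> \<Longrightarrow> r \<in> Units R"

context cring
begin

lemma ideal_iff: "ideal I R \<longleftrightarrow> I \<subseteq> carrier R \<and> \<zero> \<in> I \<and> (\<forall>x\<in>I. \<forall>y\<in>I. x \<oplus> y \<in> I) \<and> (\<forall>r\<in>carrier R. \<forall>x\<in>I. r \<otimes> x \<in> I)"
proof
 assume "ideal I R"
 then interpret I: ideal I R .
 show "I \<subseteq> carrier R \<and> \<zero> \<in> I \<and> (\<forall>x\<in>I. \<forall>y\<in>I. x \<oplus> y \<in> I) \<and> (\<forall>r\<in>carrier R. \<forall>x\<in>I. r \<otimes> x \<in> I)"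
  by (simp add: I.a_subset I.I_l_closed)
next
 assume i: "I \<subseteq> carrier R \<and> \<zero> \<in> I \<and> (\<forall>x\<in>I. \<forall>y\<in>I. x \<oplus> y \<in> I) \<and> (\<forall>r\<in>carrier R. \<forall>x\<in>I. r \<otimes> x \<in> I)"
 have inv: "\<ominus> x \<in> I" if "x \<in> I" for x
 proof -
  have "(\<ominus> \<one>) \<otimes> x \<in> I" using i that by blast
  moreover have "(\<ominus> \<one>) \<otimes> x = \<ominus> x" using i that by (auto simp: l_minus)
  ultimately show ?thesis by simp
 qed
 show "ideal I R"
 proof (rule idealI[OF ring_axioms])
  show "subgroup I (add_monoid R)"
   using i inv by (intro add.subgroupI) (auto simp: a_inv_def[symmetric])
  show "x \<otimes> a \<in> I" if "a \<in> I" "x \<in> carrier R" for a x using i that by blast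
  thus "a \<otimes> x \<in> I" if "a \<in> I" "x \<in> carrier R" for a x
   using i that m_comm[of a x] by auto
 qed
qed

lemma idp:
 assumes "ideal I R"
 shows "I \<subseteq> carrier R" "\<zero> \<in> I" "\<And>x y. x \<in> I \<Longrightarrow> y \<in> I \<Longrightarrow> x \<oplus> y \<in> I"
  "\<And>r x. r \<in> carrier R \<Longrightarrow> x \<in> I \<Longrightarrow> r \<otimes> x \<in> I" "\<And>x. x \<in> I \<Longrightarrow> \<ominus> x \<in> I"
proof -
 interpret I: ideal I R by fact
 show "I \<subseteq> carrier R" "\<zero> \<in> I" "\<And>x y. x \<in> I \<Longrightarrow> y \<in> I \<Longrightarrow> x \<oplus> y \<in> I"
  "\<And>r x. r \<in> carrier R \<Longrightarrow> x \<in> I \<Longrightarrow> r \<otimes> x \<in> I" "\<And>x. x \<in> I \<Longrightarrow> \<ominus> x \<in> I"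
  by (simp_all add: I.a_subset I.I_l_closed)
qed

end

lemma (in noeth_cring) ex_maximal_ideal_in:
 assumes "\<C> \<noteq> {}" "\<And>I. I \<in> \<C> \<Longrightarrow> ideal I R"
 shows "\<exists>I\<in>\<C>. \<forall>J\<in>\<C>. I \<subseteq> J \<longrightarrow> J = I"
proof (rule subset_Zorn_nonempty[OF assms(1)])
 fix C assume C: "C \<noteq> {}" "subset.chain \<C> C"
 hence "subset.chain {I. ideal I R} C" using assms(2) by (auto simp: subset.chain_def)
 hence "\<Union>C \<in> C" using noetherian_ring.ideal_chain_is_trivial[OF noeth C(1)] by blast
 thus "\<Union>C \<in> \<C>" using C(2) by (auto simp: subset.chain_def)
qed

text \<open>A nonunit generates a proper ideal. If it lay outside the maximal ideal, an ideal
  maximal among the proper ideals containing it would be a second maximal ideal.\<close>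

lemma noeth_local_exists:
 assumes "cring R" "noetherian_ring R" "local_ring R"
 shows "\<exists>\<mm>. noeth_local R \<mm>"
proof -
 interpret noeth_cring R using assms by (auto intro!: noeth_cring.intro noeth_cring_axioms.intro)
 obtain \<mm> where m: "maximalideal \<mm> R" "\<And>J. maximalideal J R \<Longrightarrow> J = \<mm>"
  using assms(3) unfolding local_ring_def by blast
 interpret M: maximalideal \<mm> R by (rule m(1))
 have one: "\<one>\<^bsub>R\<^esub> \<notin> \<mm>" using M.I_notcarr M.one_imp_carrier by blast
 have "r \<in> Units R" if r: "r \<in> carrier R" "r \<notin> \<mm>" for r
 proof (rule ccontr)
  assume nu: "r \<notin> Units R"
  let ?C = "{I. ideal I R \<and> r \<in> I \<and> \<one>\<^bsub>R\<^esub> \<notin> I}"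
  have "\<one>\<^bsub>R\<^esub> \<notin> PIdl\<^bsub>R\<^esub> r"
  proof
   assume "\<one>\<^bsub>R\<^esub> \<in> PIdl\<^bsub>R\<^esub> r"
   then obtain s where "s \<in> carrier R" "\<one>\<^bsub>R\<^esub> = s \<otimes>\<^bsub>R\<^esub> r" unfolding cgenideal_def by auto
   thus False using nu r(1) m_comm unfolding Units_def by auto
  qed
  hence "PIdl\<^bsub>R\<^esub> r \<in> ?C" using cgenideal_ideal cgenideal_self r(1) by auto
  then obtain I where I: "I \<in> ?C" "\<And>J. J \<in> ?C \<Longrightarrow> I \<subseteq> J \<Longrightarrow> J = I"
   using ex_maximal_ideal_in[of ?C] by blast
  have "maximalideal I R"
  proof (rule maximalidealI)
   show "ideal I R" "carrier R \<noteq> I" using I(1) by auto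
   fix J assume J: "ideal J R" "I \<subseteq> J" "J \<subseteq> carrier R"
   show "J = I \<or> J = carrier R"
   proof (cases "\<one>\<^bsub>R\<^esub> \<in> J")
    case True
    thus ?thesis using ideal.one_imp_carrier[OF J(1)] by blast
   next
    case False
    thus ?thesis using I J by blast
   qed
  qed
  thus False using m(2) I(1) r(2) by blast
 qed
 thus ?thesis
  using one M.ideal_axioms noeth_cring_axioms by (intro exI[of _ \<mm>] noeth_local.intro noeth_local_axioms.intro)
qed

context noeth_cring
begin

lemma ideal_generated_finite:
 assumes I: "ideal I R"
 shows "\<exists>A. finite A \<and> A \<subseteq> I \<and> (\<forall>J. ideal J R \<and> A \<subseteq> J \<longrightarrow> I \<subseteq> J)"
proof -
 obtain A where A: "A \<subseteq> carrier R" "finite A" "I = Idl A" using noetherian_ring.finetely_gen[OF noeth I] by blast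
 show ?thesis
 proof (intro exI[of _ A] conjI allI impI)
  show "A \<subseteq> I" using genideal_self[OF A(1)] A(3) by simp
  show "I \<subseteq> J" if "ideal J R \<and> A \<subseteq> J" for J using genideal_minimal[of J A] that A(3) by simp
 qed (rule A(2))
qed

end

section \<open>Submodules of finite free modules\<close>

context cring
begin

lemma submodule_Fr_iff:
 "submodule U R (Fr R B) \<longleftrightarrow> U \<subseteq> Vec R B \<and> \<o> \<in> U \<and> (\<forall>x\<in>U. \<forall>y\<in>U. (\<lambda>b. x b \<oplus> y b) \<in> U) \<and>
  (\<forall>r\<in>carrier R. \<forall>x\<in>U. (\<lambda>b. r \<otimes> x b) \<in> U)"
proof -
 interpret F: Module.module R "Fr R B" by (rule FrM)
 show ?thesis
 proof
  assume "submodule U R (Fr R B)"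
  thus "U \<subseteq> Vec R B \<and> \<o> \<in> U \<and> (\<forall>x\<in>U. \<forall>y\<in>U. (\<lambda>b. x b \<oplus> y b) \<in> U) \<and> (\<forall>r\<in>carrier R. \<forall>x\<in>U. (\<lambda>b. r \<otimes> x b) \<in> U)"
   using F.submoduleE[of U] submodule_zero[of U R "Fr R B"] by (simp add: Fr_simps)
 next
  assume u: "U \<subseteq> Vec R B \<and> \<o> \<in> U \<and> (\<forall>x\<in>U. \<forall>y\<in>U. (\<lambda>b. x b \<oplus> y b) \<in> U) \<and> (\<forall>r\<in>carrier R. \<forall>x\<in>U. (\<lambda>b. r \<otimes> x b) \<in> U)"
  show "submodule U R (Fr R B)"
  proof (rule F.submoduleI)
   fix x assume x: "x \<in> U"
   have "(\<lambda>b. (\<ominus> \<one>) \<otimes> x b) \<in> U" using u x by (meson a_inv_closed one_closed)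
   thus "\<ominus>\<^bsub>Fr R B\<^esub> x \<in> U" using minus_one_smult[OF FrM, of x B] u x by (simp add: Fr_simps subset_iff)
  qed (use u in \<open>auto simp: Fr_simps\<close>)
 qed
qed

lemma image_submodule:
 assumes g: "lin_map R (Fr R B) (Fr R C) g" shows "submodule (g ` (Vec R B)) R (Fr R C)"
 unfolding submodule_Fr_iff
proof (intro conjI ballI)
 show "g ` (Vec R B) \<subseteq> Vec R C" using lin_closed[OF g] by blast
 show "\<o> \<in> g ` (Vec R B)"
  using lin_zero[OF g FrM FrM] Fr_zero by (intro rev_image_eqI[of "\<lambda>_. \<zero>"]) (simp_all add: Fr_simps)
 fix x assume "x \<in> g ` (Vec R B)"
 then obtain a where a: "a \<in> Vec R B" "x = g a" by blast
 show "(\<lambda>b. r \<otimes> x b) \<in> g ` (Vec R B)" if "r \<in> carrier R" for r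
  using lin_smult[OF g that a(1)] Fr_smult[OF that a(1)] a(2) by (intro rev_image_eqI[of "\<lambda>b. r \<otimes> a b"]) (simp_all add: Fr_simps)
 fix y assume "y \<in> g ` (Vec R B)"
 then obtain b where b: "b \<in> Vec R B" "y = g b" by blast
 show "(\<lambda>c. x c \<oplus> y c) \<in> g ` (Vec R B)"
  using lin_add[OF g a(1) b(1)] Fr_add[OF a(1) b(1)] a(2) b(2) by (intro rev_image_eqI[of "\<lambda>c. a c \<oplus> b c"]) (simp_all add: Fr_simps)
qed

end

context noeth_cring
begin

text \<open>Induction on the rank: \<open>U\<close> is generated by lifts of generators of its ideal
  of \<open>b\<close>-coordinates together with generators of the submodule on which this coordinate
  vanishes.\<close>

lemma submodule_Fr_fg:
 assumes "finite B" "submodule U R (Fr R B)"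
 shows "\<exists>S. finite S \<and> S \<subseteq> U \<and> (\<forall>H. submodule H R (Fr R B) \<and> S \<subseteq> H \<longrightarrow> U \<subseteq> H)"
 using assms
proof (induction B arbitrary: U rule: finite_induct)
 case empty
 have z: "x = \<o>" if "x \<in> carrier (Fr R {})" for x using FrD(2)[OF that] by auto
 show ?case
  using empty unfolding submodule_Fr_iff by (intro exI[of _ "{}"]) (auto dest: z)
next
 case (insert b B)
 note U = insert.prems[unfolded submodule_Fr_iff]
 have Uc: "x c \<in> carrier R" if "x \<in> U" for x c
 proof -
  have "x \<in> Vec R (insert b B)" using U that by (auto simp only: subset_iff)
  thus ?thesis by (rule FrD(1))
 qed
 have Uz: "\<o> \<in> U" and Ua: "\<And>x y. x \<in> U \<Longrightarrow> y \<in> U \<Longrightarrow> (\<lambda>b. x b \<oplus> y b) \<in> U"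
  and Us: "\<And>r x. r \<in> carrier R \<Longrightarrow> x \<in> U \<Longrightarrow> (\<lambda>b. r \<otimes> x b) \<in> U" using U by blast+
 let ?I = "{x b | x. x \<in> U}"
 have I: "ideal ?I R"
  unfolding ideal_iff
 proof (intro conjI ballI)
  show "?I \<subseteq> carrier R" using Uc by auto
  show "\<zero> \<in> ?I" using Uz by (intro CollectI exI[of _ "\<lambda>_. \<zero>"]) simp
  show "x \<oplus> y \<in> ?I" if xy: "x \<in> ?I" "y \<in> ?I" for x y
  proof -
   obtain x' y' where "x' \<in> U" "x' b = x" "y' \<in> U" "y' b = y" using xy by blast
   thus ?thesis by (intro CollectI exI[of _ "\<lambda>b. x' b \<oplus> y' b"] conjI Ua) auto
  qed
  show "r \<otimes> x \<in> ?I" if r: "r \<in> carrier R" "x \<in> ?I" for r x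
  proof -
   obtain x' where "x' \<in> U" "x' b = x" using r(2) by blast
   thus ?thesis by (intro CollectI exI[of _ "\<lambda>b. r \<otimes> x' b"] conjI Us r(1)) auto
  qed
 qed
 from ideal_generated_finite[OF I] obtain A where A0: "finite A \<and> A \<subseteq> ?I \<and> (\<forall>J. ideal J R \<and> A \<subseteq> J \<longrightarrow> ?I \<subseteq> J)" ..
 note A = A0[THEN conjunct1] A0[THEN conjunct2, THEN conjunct1] mp[OF spec[OF A0[THEN conjunct2, THEN conjunct2]], OF conjI]
 have "\<forall>a\<in>A. \<exists>x. x \<in> U \<and> x b = a" using A(2) by blast
 then obtain u where u: "\<And>a. a \<in> A \<Longrightarrow> u a \<in> U \<and> u a b = a" by metis
 let ?U' = "{x \<in> U. x b = \<zero>}"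
 have U': "submodule ?U' R (Fr R B)"
  unfolding submodule_Fr_iff
 proof (intro conjI ballI)
  show "?U' \<subseteq> Vec R B"
  proof
   fix x assume x: "x \<in> ?U'"
   hence "x \<in> Vec R (insert b B)" using U by blast
   thus "x \<in> Vec R B" by (rule Fr_mem_supp) (use x FrD(4)[OF \<open>x \<in> Vec R (insert b B)\<close>] in \<open>auto simp: supp_def\<close>)
  qed
 qed (use Uz Ua Us in auto)
 from insert.IH[OF U'] obtain S where S0: "finite S \<and> S \<subseteq> ?U' \<and> (\<forall>H. submodule H R (Fr R B) \<and> S \<subseteq> H \<longrightarrow> ?U' \<subseteq> H)" ..
 note S = S0[THEN conjunct1] S0[THEN conjunct2, THEN conjunct1] mp[OF spec[OF S0[THEN conjunct2, THEN conjunct2]], OF conjI]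
 show ?case
 proof (intro exI[of _ "S \<union> u ` A"] conjI allI impI)
  show "finite (S \<union> u ` A)" "S \<union> u ` A \<subseteq> U" using S A u by auto
  fix H assume H: "submodule H R (Fr R (insert b B)) \<and> S \<union> u ` A \<subseteq> H"
  note H' = conjunct1[OF H, unfolded submodule_Fr_iff]
  have Hz: "\<o> \<in> H" and Ha: "\<And>x y. x \<in> H \<Longrightarrow> y \<in> H \<Longrightarrow> (\<lambda>b. x b \<oplus> y b) \<in> H"
   and Hs: "\<And>r x. r \<in> carrier R \<Longrightarrow> x \<in> H \<Longrightarrow> (\<lambda>b. r \<otimes> x b) \<in> H" using H' by blast+
  have "ideal {x b | x. x \<in> H \<inter> U} R"
   unfolding ideal_iff
  proof (intro conjI ballI)
   show "{x b | x. x \<in> H \<inter> U} \<subseteq> carrier R" using Uc by auto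
   show "\<zero> \<in> {x b | x. x \<in> H \<inter> U}" using Uz Hz by (intro CollectI exI[of _ "\<lambda>_. \<zero>"]) simp
   show "x \<oplus> y \<in> {x b | x. x \<in> H \<inter> U}" if xy: "x \<in> {x b | x. x \<in> H \<inter> U}" "y \<in> {x b | x. x \<in> H \<inter> U}" for x y
   proof -
    obtain x' y' where "x' \<in> H \<inter> U" "x' b = x" "y' \<in> H \<inter> U" "y' b = y" using xy by blast
    thus ?thesis by (intro CollectI exI[of _ "\<lambda>b. x' b \<oplus> y' b"] conjI IntI Ua Ha) auto
   qed
   show "r \<otimes> x \<in> {x b | x. x \<in> H \<inter> U}" if r: "r \<in> carrier R" "x \<in> {x b | x. x \<in> H \<inter> U}" for r x
   proof -
    obtain x' where "x' \<in> H \<inter> U" "x' b = x" using r(2) by blast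
    thus ?thesis by (intro CollectI exI[of _ "\<lambda>b. r \<otimes> x' b"] conjI IntI Us Hs r(1)) auto
   qed
  qed
  moreover have "A \<subseteq> {x b | x. x \<in> H \<inter> U}"
  proof
   fix a assume a: "a \<in> A"
   hence "u a \<in> H" using H by blast
   thus "a \<in> {x b | x. x \<in> H \<inter> U}" using u[OF a] by (intro CollectI exI[of _ "u a"]) simp
  qed
  ultimately have IH: "?I \<subseteq> {x b | x. x \<in> H \<inter> U}" by (rule A(3))
  have "submodule (H \<inter> Vec R B) R (Fr R B)"
   unfolding submodule_Fr_iff using H' Fr_zero Fr_add Fr_smult by auto
  hence U'H: "?U' \<subseteq> H" using S(2) H S(3)[of "H \<inter> Vec R B"] U'[unfolded submodule_Fr_iff] by blast
  show "U \<subseteq> H"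
  proof
   fix x assume x: "x \<in> U"
   then obtain y where y: "y \<in> H" "y \<in> U" "x b = y b" using IH by auto
   have xc: "x c \<in> carrier R" "y c \<in> carrier R" for c using x y(2) Uc by auto
   have my: "(\<lambda>c. (\<ominus> \<one>) \<otimes> y c) \<in> U" using y by (intro Us) auto
   have "(\<lambda>c. x c \<oplus> (\<ominus> \<one>) \<otimes> y c) \<in> U" by (rule Ua[OF x my])
   moreover have "x b \<oplus> (\<ominus> \<one>) \<otimes> y b = \<zero>" using xc y(3) by (simp add: l_minus r_neg)
   ultimately have "(\<lambda>c. x c \<oplus> (\<ominus> \<one>) \<otimes> y c) \<in> H" using U'H by blast
   hence "(\<lambda>c. (x c \<oplus> (\<ominus> \<one>) \<otimes> y c) \<oplus> y c) \<in> H" using y(1) by (rule Ha)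
   moreover have "(\<lambda>c. (x c \<oplus> (\<ominus> \<one>) \<otimes> y c) \<oplus> y c) = x" using xc by (simp add: l_minus a_assoc l_neg)
   ultimately show "x \<in> H" by simp
  qed
 qed
qed

end

section \<open>Minimal free resolutions\<close>

definition minimal_cx :: "('a, 'r) ring_scheme \<Rightarrow> 'a set \<Rightarrow> ('a, 'b \<Rightarrow> 'a) chain_cx \<Rightarrow> (int \<Rightarrow> 'b set) \<Rightarrow> bool" where
 "minimal_cx R \<mm> F B \<longleftrightarrow> (\<forall>n. \<forall>x\<in>Vec R (B n). \<forall>b. cx_d F n x b \<in> \<mm>)"

text \<open>The distance to the lower bound \<open>a\<close> is a height, since the differential
  lowers the degree by one.\<close>

lemma (in cring) bounded_below_lowers:
 assumes F: "free_cx R F B" and b: "\<And>n. n < a \<Longrightarrow> B n = {}"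
 shows "lowers R F B (\<lambda>n b. nat (n - a))"
 unfolding lowers_def
proof (intro allI ballI)
 fix n b c assume "b \<in> B n" and c: "c \<in> supp R (cx_d F n (dl R b))"
 hence "c \<in> B (n - 1)"
  using FrD(4)[OF lin_closed[OF free_cx_d[OF F refl] dl_mem]] by blast
 hence "a \<le> n - 1" using b by (metis empty_iff not_le)
 thus "nat (n - 1 - a) < nat (n - a)" by simp
qed

context noeth_local
begin

context
 fixes M :: "('a, 'm) chain_cx"
 assumes M: "chain_complex R M" and fg: "\<And>n. fin_gen R (homology M n)"
begin

text \<open>A stage of the resolution in degree \<open>n\<close> consists of a finite set
  \<open>J\<close> of indices and a function \<open>g\<close>; the pair \<open>g j\<close> is the
  boundary of the basis element \<open>j\<close> and its image in \<open>M$n\<close>. The maps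
  \<open>rd\<close> and \<open>rph\<close> extend the two components linearly.\<close>

definition rd :: "(nat \<Rightarrow> (nat \<Rightarrow> 'a) \<times> 'm) \<Rightarrow> (nat \<Rightarrow> 'a) \<Rightarrow> nat \<Rightarrow> 'a" where
 "rd g = lin_ext R (Fr R UNIV) (\<lambda>j. fst (g j))"

definition rph :: "int \<Rightarrow> (nat \<Rightarrow> (nat \<Rightarrow> 'a) \<times> 'm) \<Rightarrow> (nat \<Rightarrow> 'a) \<Rightarrow> 'm" where
 "rph n g = lin_ext R (M$n) (\<lambda>j. snd (g j))"

text \<open>Up to sign these are the cycles of degree \<open>n + 1\<close> in the cone of the map
  from the part of the resolution built so far to \<open>M\<close>. Attaching basis elements for
  generators of them kills the kernel on homology in degree \<open>n\<close> and makes the map onto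
  in degree \<open>n + 1\<close> at the same time.\<close>

definition rQ :: "int \<Rightarrow> nat set \<Rightarrow> (nat \<Rightarrow> (nat \<Rightarrow> 'a) \<times> 'm) \<Rightarrow> ((nat \<Rightarrow> 'a) \<times> 'm) set" where
 "rQ n J g = {(z, y). z \<in> Vec R J \<and> rd g z = \<o> \<and> y \<in> M$$(n + 1) \<and> rph n g z = cx_d M (n + 1) y}"

definition rok :: "int \<Rightarrow> nat set \<Rightarrow> (nat \<Rightarrow> (nat \<Rightarrow> 'a) \<times> 'm) \<Rightarrow> bool" where
 "rok n J g \<longleftrightarrow> finite J \<and> (\<forall>j\<in>J. fst (g j) \<in> Vec R UNIV \<and> snd (g j) \<in> M$$n)"

text \<open>Generation is meant modulo the boundaries of \<open>M\<close>: the homology of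
  \<open>M\<close> is finitely generated, its components need not be.\<close>

definition rgen :: "int \<Rightarrow> nat set \<Rightarrow> (nat \<Rightarrow> (nat \<Rightarrow> 'a) \<times> 'm) \<Rightarrow> nat set \<Rightarrow> (nat \<Rightarrow> (nat \<Rightarrow> 'a) \<times> 'm) \<Rightarrow> bool" where
 "rgen n J g J' g' \<longleftrightarrow> finite J' \<and> (\<forall>j\<in>J'. g' j \<in> rQ n J g) \<and>
  (\<forall>z y. (z, y) \<in> rQ n J g \<longrightarrow> (\<exists>r\<in>Vec R J'. rd g' r = z \<and> y \<ominus>\<^bsub>M$(n + 1)\<^esub> rph (n + 1) g' r \<in> boundaries M (n + 1)))"

text \<open>Relations modulo boundaries have coefficients in the maximal ideal. The boundary of any
  element of the next degree is such a relation, which gives the minimality of the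
  differential.\<close>

definition rmin :: "int \<Rightarrow> nat set \<Rightarrow> (nat \<Rightarrow> (nat \<Rightarrow> 'a) \<times> 'm) \<Rightarrow> bool" where
 "rmin n J g \<longleftrightarrow> (\<forall>r\<in>Vec R J. rd g r = \<o> \<and> rph n g r \<in> boundaries M n \<longrightarrow> (\<forall>j. r j \<in> \<mm>))"

lemma rd_lin: "rok n J g \<Longrightarrow> lin_map R (Fr R J) (Fr R UNIV) (rd g)"
 unfolding rd_def rok_def by (intro lin_ext_lin FrM) auto

lemma rph_lin: "rok n J g \<Longrightarrow> lin_map R (Fr R J) (M$n) (rph n g)"
 unfolding rph_def rok_def by (intro lin_ext_lin cxM[OF M]) auto

lemma rgen_ok: "rgen n J g J' g' \<Longrightarrow> rok (n + 1) J' g'"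
 unfolding rok_def rgen_def rQ_def using Fr_mono[of _ R J UNIV] by fastforce

lemma rgen_dl: "rok n J g \<Longrightarrow> j \<in> J \<Longrightarrow> rd g (dl R j) = fst (g j)" "rok n J g \<Longrightarrow> j \<in> J \<Longrightarrow> rph n g (dl R j) = snd (g j)"
 unfolding rd_def rph_def rok_def by (intro lin_ext_dl FrM cxM[OF M]; auto)+

text \<open>Closure of \<open>rQ\<close> under linear combinations is what makes \<open>rd\<close>
  square to zero and \<open>rph\<close> a chain map.\<close>

lemma rQ_closed:
 assumes ok: "rok n J g" and gen: "rok (n + 1) J' g'" "\<And>j. j \<in> J' \<Longrightarrow> g' j \<in> rQ n J g" and r: "r \<in> Vec R J'"
 shows "(rd g' r, rph (n + 1) g' r) \<in> rQ n J g"
proof -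
 note ok' = gen(1) and l = rd_lin[OF ok] rph_lin[OF ok]
 note l' = rd_lin[OF ok'] rph_lin[OF ok']
 have m: "cx_d M (n + 1) (rph (n + 1) g' r) = rph n g (rd g' r) \<and> rd g' r \<in> Vec R J \<and> rd g (rd g' r) = \<o>"
  using r
 proof (induction rule: Fr_induct)
  case zero
  show ?case
   using lin_zero[OF l'(1) FrM FrM] lin_zero[OF l'(2) FrM cxM[OF M]]
    lin_zero[OF l(1) FrM FrM] lin_zero[OF l(2) FrM cxM[OF M]]
    lin_zero[OF cx_lin'[OF M] cxM[OF M] cxM[OF M], of n "n + 1"] Fr_zero by (simp add: Fr_simps)
 next
  case (step f b r)
  have q: "g' b \<in> rQ n J g" by (rule gen(2)[OF step(2)])
  have b: "fst (g' b) \<in> Vec R J" "rd g (fst (g' b)) = \<o>" "snd (g' b) \<in> M$$(n + 1)"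
   "rph n g (fst (g' b)) = cx_d M (n + 1) (snd (g' b))" using q by (auto simp: rQ_def)
  interpret MM: Module.module R "M$(n + 1)" by (rule cxM[OF M])
  interpret FF: Module.module R "Fr R J" by (rule FrM)
  interpret F': Module.module R "Fr R J'" by (rule FrM)
  note dlb = dl_mem[OF step(2)]
  have s: "r \<odot>\<^bsub>Fr R J'\<^esub> dl R b \<in> Vec R J'" using step(3) dlb by simp
  have 1: "rd g' (f \<oplus>\<^bsub>Fr R J'\<^esub> r \<odot>\<^bsub>Fr R J'\<^esub> dl R b) = rd g' f \<oplus>\<^bsub>Fr R J\<^esub> r \<odot>\<^bsub>Fr R J\<^esub> fst (g' b)"
   using lin_add[OF l'(1) step(1) s] lin_smult[OF l'(1) step(3) dlb] rgen_dl(1)[OF ok' step(2)] by (simp add: Fr_simps)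
  have 2: "rph (n + 1) g' (f \<oplus>\<^bsub>Fr R J'\<^esub> r \<odot>\<^bsub>Fr R J'\<^esub> dl R b) = rph (n + 1) g' f \<oplus>\<^bsub>M$(n + 1)\<^esub> r \<odot>\<^bsub>M$(n + 1)\<^esub> snd (g' b)"
   using lin_add[OF l'(2) step(1) s] lin_smult[OF l'(2) step(3) dlb] rgen_dl(2)[OF ok' step(2)] by simp
  have rb: "r \<odot>\<^bsub>Fr R J\<^esub> fst (g' b) \<in> Vec R J" using b step(3) by simp
  have IH: "rd g' f \<in> Vec R J" using step.IH by simp
  have 3: "rd g (rd g' f \<oplus>\<^bsub>Fr R J\<^esub> r \<odot>\<^bsub>Fr R J\<^esub> fst (g' b)) = \<o>"
   using lin_add[OF l(1) IH rb] lin_smult[OF l(1) step(3) b(1)] b step by (simp add: Fr_simps)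
  note ld = cx_lin'[OF M, of n "n + 1", simplified]
  have 4: "cx_d M (n + 1) (rph (n + 1) g' f \<oplus>\<^bsub>M$(n + 1)\<^esub> r \<odot>\<^bsub>M$(n + 1)\<^esub> snd (g' b)) =
    rph n g (rd g' f \<oplus>\<^bsub>Fr R J\<^esub> r \<odot>\<^bsub>Fr R J\<^esub> fst (g' b))"
   using lin_add[OF l(2) IH rb] lin_smult[OF l(2) step(3) b(1)] b step lin_smult[OF ld step(3) b(3)]
    lin_add[OF ld lin_closed[OF l'(2) step(1)], of "r \<odot>\<^bsub>M$(n + 1)\<^esub> snd (g' b)"] by simp
  show ?case unfolding 1 2 using 3 4 IH rb by simp
 qed
 thus ?thesis using lin_closed[OF l'(2) r] by (simp add: rQ_def)
qed

text \<open>There are two kinds of generators: generators \<open>z\<close> of the projection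
  \<open>?K\<close> of \<open>rQ\<close>, a submodule of a finite free module, with partners
  \<open>Y z\<close>, and pairs (0, c) for generators \<open>c\<close> of the homology of
  \<open>M\<close> in degree \<open>n + 1\<close>.\<close>

lemma rgen_exists:
 assumes ok: "rok n J g" shows "\<exists>J' g'. rgen n J g J' g'"
proof -
 have J: "finite J" using ok by (simp add: rok_def)
 note l = rd_lin[OF ok] rph_lin[OF ok]
 let ?K = "{z. \<exists>y. (z, y) \<in> rQ n J g}"
 interpret MM: Module.module R "M$(n + 1)" by (rule cxM[OF M])
 interpret FJ: Module.module R "Fr R J" by (rule FrM)
 note ld = cx_lin'[OF M, of n "n + 1", simplified]
 have z0: "\<o> \<in> ?K"
  using Fr_zero[of J] lin_zero[OF l(1) FrM FrM] lin_zero[OF l(2) FrM cxM[OF M]]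
   lin_zero[OF ld cxM[OF M] cxM[OF M]] by (auto simp: rQ_def Fr_simps intro!: exI[of _ "\<zero>\<^bsub>M$(n + 1)\<^esub>"])
 have K: "submodule ?K R (Fr R J)"
  unfolding submodule_Fr_iff
 proof (intro conjI ballI)
  show "?K \<subseteq> Vec R J" by (auto simp: rQ_def)
  fix x x' assume "x \<in> ?K" "x' \<in> ?K"
  then obtain y y' where xy: "(x, y) \<in> rQ n J g" "(x', y') \<in> rQ n J g" by blast
  hence "(\<lambda>b. x b \<oplus> x' b, y \<oplus>\<^bsub>M$(n + 1)\<^esub> y') \<in> rQ n J g"
   using lin_add[OF l(1), of x x'] lin_add[OF l(2), of x x'] lin_add[OF ld, of y y'] Fr_add[of x J x']
   by (simp add: rQ_def Fr_simps)
  thus "(\<lambda>b. x b \<oplus> x' b) \<in> ?K" by blast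
 next
  fix r x assume r: "r \<in> carrier R" and "x \<in> ?K"
  then obtain y where xy: "(x, y) \<in> rQ n J g" by blast
  hence "(\<lambda>b. r \<otimes> x b, r \<odot>\<^bsub>M$(n + 1)\<^esub> y) \<in> rQ n J g"
   using lin_smult[OF l(1) r, of x] lin_smult[OF l(2) r, of x] lin_smult[OF ld r, of y] Fr_smult[OF r, of x J] r
   by (simp add: rQ_def Fr_simps)
  thus "(\<lambda>b. r \<otimes> x b) \<in> ?K" by blast
 qed (rule z0)
 from submodule_Fr_fg[OF J K] obtain S where S0: "finite S \<and> S \<subseteq> ?K \<and> (\<forall>H. submodule H R (Fr R J) \<and> S \<subseteq> H \<longrightarrow> ?K \<subseteq> H)" ..
 note S = S0[THEN conjunct1] S0[THEN conjunct2, THEN conjunct1] mp[OF spec[OF S0[THEN conjunct2, THEN conjunct2]], OF conjI]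
 from fg[of "n + 1", unfolded fin_gen_homology_iff[OF M]] obtain T where
  T0: "finite T \<and> T \<subseteq> cycles M (n + 1) \<and> (\<forall>H. submodule H R (M$(n + 1)) \<and> T \<subseteq> H \<and> boundaries M (n + 1) \<subseteq> H \<longrightarrow> cycles M (n + 1) \<subseteq> H)" ..
 note T = T0[THEN conjunct1] T0[THEN conjunct2, THEN conjunct1] mp[OF spec[OF T0[THEN conjunct2, THEN conjunct2]], OF conjI, OF _ conjI]
 have "\<forall>z\<in>S. \<exists>y. (z, y) \<in> rQ n J g" using S(2) by blast
 then obtain Y where Y: "\<And>z. z \<in> S \<Longrightarrow> (z, Y z) \<in> rQ n J g" by metis
 let ?G = "(\<lambda>z. (z, Y z)) ` S \<union> Pair \<o> ` T"
 have "finite ?G" using S T by simp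
 \<comment> \<open>Numbering the generators keeps the basis elements in \<open>nat\<close>, so that
   all degrees share one element type.\<close>
 then obtain k and g' :: "nat \<Rightarrow> (nat \<Rightarrow> 'a) \<times> 'm" where g': "?G = g' ` {i. i < k}"
  using finite_imp_nat_seg_image_inj_on[of ?G] by blast
 have GQ: "?G \<subseteq> rQ n J g"
 proof -
  have "(\<o>, c) \<in> rQ n J g" if "c \<in> T" for c
  proof -
   have "c \<in> cycles M (n + 1)" using T(2) that by blast
   thus ?thesis
    using Fr_zero[of J] lin_zero[OF l(1) FrM FrM] lin_zero[OF l(2) FrM cxM[OF M]]
     cyclesD(1)[of c M "n + 1"] cyclesD(2)[of c M "n + 1" n] by (simp add: rQ_def Fr_simps)
  qed
  thus ?thesis using Y by blast
 qed
 let ?J = "{..<k}"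
 have gQ: "g' j \<in> rQ n J g" if "j \<in> ?J" for j using that g' GQ by blast
 have ok': "rok (n + 1) ?J g'"
  unfolding rok_def using gQ Fr_mono[of _ R J UNIV] by (fastforce simp: rQ_def)
 note l' = rd_lin[OF ok'] rph_lin[OF ok'] and cl = rQ_closed[OF ok ok' gQ]
 interpret FK: Module.module R "Fr R ?J" by (rule FrM)
 have "lin_map R (Fr R ?J) (Fr R J) (rd g')" using lin_Fr_target[OF l'(1)] cl by (simp add: rQ_def)
 note H1 = image_submodule[OF this]
 have dlg: "dl R j \<in> Vec R ?J" "rd g' (dl R j) = fst (g' j)" "rph (n + 1) g' (dl R j) = snd (g' j)" if "j < k" for j
  using that dl_mem[of j ?J] rgen_dl[OF ok'] by auto
 have "S \<subseteq> rd g' ` (Vec R ?J)"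
 proof
  fix z assume z: "z \<in> S"
  hence "(z, Y z) \<in> g' ` {i. i < k}" unfolding g'[symmetric] by blast
  then obtain j where j: "j < k" "g' j = (z, Y z)" by (elim imageE) simp
  show "z \<in> rd g' ` (Vec R ?J)" using rev_image_eqI[OF dlg(1)[OF j(1)], of z "rd g'"] dlg(2)[OF j(1)] j(2) by simp
 qed
 with H1 have K1: "?K \<subseteq> rd g' ` (Vec R ?J)" by (rule S(3))
 let ?H2 = "{w \<in> M$$(n + 1). \<exists>r\<in>Vec R ?J. rd g' r = \<o> \<and> w \<ominus>\<^bsub>M$(n + 1)\<^esub> rph (n + 1) g' r \<in> boundaries M (n + 1)}"
 note bs = MM.submoduleE[OF bd_sub[OF M]] and bs0 = submodule_zero[OF bd_sub[OF M, of "n + 1"]]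
 have zz: "rd g' \<o> = \<o>" "rph (n + 1) g' \<o> = \<zero>\<^bsub>M$(n + 1)\<^esub>"
  using lin_zero[OF l'(1) FrM FrM] lin_zero[OF l'(2) FrM cxM[OF M]] by (simp_all add: Fr_simps)
 have "submodule ?H2 R (M$(n + 1))"
 proof (rule MM.submoduleI)
  show "\<zero>\<^bsub>M$(n + 1)\<^esub> \<in> ?H2" using zz Fr_zero bs0 module_diff_zero[OF cxM[OF M]] by fastforce
  have sm: "a \<odot>\<^bsub>M$(n + 1)\<^esub> w \<in> ?H2" if a: "a \<in> carrier R" and w: "w \<in> ?H2" for a w
  proof -
   obtain r where r: "w \<in> M$$(n + 1)" "r \<in> Vec R ?J" "rd g' r = \<o>"
    "w \<ominus>\<^bsub>M$(n + 1)\<^esub> rph (n + 1) g' r \<in> boundaries M (n + 1)" using w by blast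
   have e: "a \<odot>\<^bsub>M$(n + 1)\<^esub> w \<ominus>\<^bsub>M$(n + 1)\<^esub> rph (n + 1) g' (a \<odot>\<^bsub>Fr R ?J\<^esub> r) = a \<odot>\<^bsub>M$(n + 1)\<^esub> (w \<ominus>\<^bsub>M$(n + 1)\<^esub> rph (n + 1) g' r)"
    using lin_smult[OF l'(2) a r(2)] lin_closed[OF l'(2) r(2)] a r(1) by (simp add: a_minus_def MM.smult_r_distr MM.smult_r_minus)
   show ?thesis
    using a r bs(4)[OF a r(4)] lin_smult[OF l'(1) a r(2)]
    by (auto intro!: bexI[of _ "a \<odot>\<^bsub>Fr R ?J\<^esub> r"] simp only: e) (auto simp: Fr_simps)
  qed
  show "a \<odot>\<^bsub>M$(n + 1)\<^esub> w \<in> ?H2" if "a \<in> carrier R" "w \<in> ?H2" for a w by (rule sm[OF that])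
  show "\<ominus>\<^bsub>M$(n + 1)\<^esub> w \<in> ?H2" if "w \<in> ?H2" for w
   using sm[OF _ that, of "\<ominus> \<one>"] that minus_one_smult[OF cxM[OF M], of w] by simp
  show "w \<oplus>\<^bsub>M$(n + 1)\<^esub> w' \<in> ?H2" if w: "w \<in> ?H2" "w' \<in> ?H2" for w w'
  proof -
   obtain r where r: "w \<in> M$$(n + 1)" "r \<in> Vec R ?J" "rd g' r = \<o>"
    "w \<ominus>\<^bsub>M$(n + 1)\<^esub> rph (n + 1) g' r \<in> boundaries M (n + 1)" using w(1) by blast
   obtain r' where r': "w' \<in> M$$(n + 1)" "r' \<in> Vec R ?J" "rd g' r' = \<o>"
    "w' \<ominus>\<^bsub>M$(n + 1)\<^esub> rph (n + 1) g' r' \<in> boundaries M (n + 1)" using w(2) by blast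
   have e: "(w \<oplus>\<^bsub>M$(n + 1)\<^esub> w') \<ominus>\<^bsub>M$(n + 1)\<^esub> rph (n + 1) g' (r \<oplus>\<^bsub>Fr R ?J\<^esub> r') =
    (w \<ominus>\<^bsub>M$(n + 1)\<^esub> rph (n + 1) g' r) \<oplus>\<^bsub>M$(n + 1)\<^esub> (w' \<ominus>\<^bsub>M$(n + 1)\<^esub> rph (n + 1) g' r')"
    using lin_add[OF l'(2) r(2) r'(2)] lin_closed[OF l'(2) r(2)] lin_closed[OF l'(2) r'(2)] r(1) r'(1)
    by (simp add: MM.M.grp_simps)
   show ?thesis
    using r r' bs(5)[OF r(4) r'(4)] lin_add[OF l'(1) r(2) r'(2)]
    by (auto intro!: bexI[of _ "r \<oplus>\<^bsub>Fr R ?J\<^esub> r'"] simp only: e) (auto simp: Fr_simps)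
  qed
 qed auto
 moreover have "T \<subseteq> ?H2"
 proof
  fix c assume c: "c \<in> T"
  hence "(\<o>, c) \<in> g' ` {i. i < k}" unfolding g'[symmetric] by blast
  then obtain j where j: "j < k" "g' j = (\<o>, c)" by (elim imageE) simp
  have cc: "c \<in> M$$(n + 1)" by (rule cyclesD(1)[OF subsetD[OF T(2) c]])
  have "c \<ominus>\<^bsub>M$(n + 1)\<^esub> c = \<zero>\<^bsub>M$(n + 1)\<^esub>" using module_diff_zero_iff[OF cxM[OF M] cc cc] by simp
  thus "c \<in> ?H2" using dlg[OF j(1)] j(2) cc bs0 by (auto intro!: bexI[of _ "dl R j"])
 qed
 moreover have "boundaries M (n + 1) \<subseteq> ?H2"
 proof
  fix w assume "w \<in> boundaries M (n + 1)"
  thus "w \<in> ?H2" using zz Fr_zero[of ?J] bs(1) module_diff_zero[OF cxM[OF M], of w "n + 1"]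
   by (auto intro!: bexI[of _ "\<lambda>_. \<zero>"])
 qed
 ultimately have C2: "cycles M (n + 1) \<subseteq> ?H2" by (rule T(3))
 have "rgen n J g ?J g'"
  unfolding rgen_def
 proof (intro conjI ballI allI impI gQ)
  fix z y assume zy: "(z, y) \<in> rQ n J g"
  then obtain r where r: "r \<in> Vec R ?J" "rd g' r = z" using K1 by blast
  have q: "(z, rph (n + 1) g' r) \<in> rQ n J g" using cl[OF _ r(1)] r(2) by simp
  have yc: "y \<in> M$$(n + 1)" "rph (n + 1) g' r \<in> M$$(n + 1)" using zy q by (auto simp: rQ_def)
  \<comment> \<open>Once \<open>z\<close> is matched, the rest of \<open>y\<close> is a cycle, and
    the generators of the second kind cover it.\<close>
  let ?c = "y \<ominus>\<^bsub>M$(n + 1)\<^esub> rph (n + 1) g' r"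
  have "cx_d M (n + 1) ?c = \<zero>\<^bsub>M$n\<^esub>"
   using lin_diff[OF ld cxM[OF M] cxM[OF M] yc] zy q module_diff_zero_iff[OF cxM[OF M]] lin_closed[OF ld]
   by (auto simp: rQ_def)
  hence "?c \<in> cycles M (n + 1)" using yc by (intro cyclesI) auto
  then obtain s where s: "s \<in> Vec R ?J" "rd g' s = \<o>" "?c \<ominus>\<^bsub>M$(n + 1)\<^esub> rph (n + 1) g' s \<in> boundaries M (n + 1)"
   using C2 by blast
  have 1: "rd g' (r \<oplus>\<^bsub>Fr R ?J\<^esub> s) = z"
   using lin_add[OF l'(1) r(1) s(1)] r(2) s(2) FrD(1)[of z R J] zy by (simp add: Fr_simps rQ_def)
  have 2: "y \<ominus>\<^bsub>M$(n + 1)\<^esub> rph (n + 1) g' (r \<oplus>\<^bsub>Fr R ?J\<^esub> s) = ?c \<ominus>\<^bsub>M$(n + 1)\<^esub> rph (n + 1) g' s"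
   using lin_add[OF l'(2) r(1) s(1)] yc lin_closed[OF l'(2) s(1)] by (simp add: MM.M.grp_simps)
  show "\<exists>r\<in>Vec R ?J. rd g' r = z \<and> y \<ominus>\<^bsub>M$(n + 1)\<^esub> rph (n + 1) g' r \<in> boundaries M (n + 1)"
   using 1 2 s(3) r(1) s(1) by (intro bexI[of _ "r \<oplus>\<^bsub>Fr R ?J\<^esub> s"]) auto
 qed (auto)
 thus ?thesis by blast
qed

text \<open>A generating family of least cardinality is taken. A relation with a unit coefficient
  would express one generator by the others and so give a smaller family.\<close>

lemma rgen_min_exists:
 assumes ok: "rok n J g" shows "\<exists>J' g'. rgen n J g J' g' \<and> rmin (n + 1) J' g'"
proof -
 let ?P = "\<lambda>(J', g'). rgen n J g J' g'"
 obtain p where p: "?P p" "\<And>q. ?P q \<Longrightarrow> card (fst p) \<le> card (fst q)"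
  using rgen_exists[OF ok] ex_has_least_nat[of ?P _ "\<lambda>q. card (fst q)"] by (metis case_prodI)
 obtain J' g' where J': "p = (J', g')" by (cases p)
 have gen: "rgen n J g J' g'" using p J' by simp
 note ok' = rgen_ok[OF gen] and gen' = gen[unfolded rgen_def]
 note l = rd_lin[OF ok'] rph_lin[OF ok']
 have "rmin (n + 1) J' g'"
  unfolding rmin_def
 proof (intro ballI impI allI)
  fix r j assume r: "r \<in> Vec R J'" and z: "rd g' r = \<o> \<and> rph (n + 1) g' r \<in> boundaries M (n + 1)"
  show "r j \<in> \<mm>"
  proof (rule ccontr)
   assume nj: "r j \<notin> \<mm>"
   interpret MM: Module.module R "M$(n + 1)" by (rule cxM[OF M])
   interpret FF: Module.module R "Fr R J'" by (rule FrM)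
   have rj: "r j \<in> Units R" "r j \<in> carrier R" using mm_unit nj FrD(1)[OF r] by auto
   hence inv: "inv r j \<in> carrier R" "inv r j \<otimes> r j = \<one>" by auto
   have j: "j \<in> J'" using nj FrD(2)[OF r] idp(2)[OF mm_ideal] by metis
   have "rgen n J g (J' - {j}) g'"
    unfolding rgen_def
   proof (intro conjI ballI allI impI)
    fix z' y assume zy: "(z', y) \<in> rQ n J g"
    then obtain s where s: "s \<in> Vec R J'" "rd g' s = z'" "y \<ominus>\<^bsub>M$(n + 1)\<^esub> rph (n + 1) g' s \<in> boundaries M (n + 1)"
     using gen' by blast
    have yc: "y \<in> M$$(n + 1)" using zy by (simp add: rQ_def)
    let ?c = "s j \<otimes> inv r j"
    have sj: "s j \<in> carrier R" using FrD(1)[OF s(1)] .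
    have c: "?c \<in> carrier R" using sj inv by simp
    \<comment> \<open>This multiple of the relation cancels coordinate \<open>j\<close> of
      \<open>s\<close> and affects the two components at most by a boundary.\<close>
    let ?t = "s \<ominus>\<^bsub>Fr R J'\<^esub> ?c \<odot>\<^bsub>Fr R J'\<^esub> r"
    have cr: "?c \<odot>\<^bsub>Fr R J'\<^esub> r \<in> Vec R J'" using c r by simp
    have t: "?t \<in> Vec R J'" using s(1) cr by simp
    have "?t j = s j \<ominus> ?c \<otimes> r j" using Fr_minus[OF s(1) cr] by (simp add: Fr_simps)
    also have "\<dots> = \<zero>" using sj inv rj by (simp add: m_assoc a_minus_def r_neg)
    finally have tj: "?t j = \<zero>" .
    have t': "?t \<in> Vec R (J' - {j})"
     by (rule Fr_mem_supp[OF t]) (use FrD(4)[OF t] tj in \<open>auto simp: supp_def\<close>)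
    have zF: "z' \<in> Vec R UNIV" using zy Fr_mono[of z' R J UNIV] by (simp add: rQ_def)
    have 1: "rd g' ?t = z'"
     using lin_diff[OF l(1) FrM FrM s(1) cr] lin_smult[OF l(1) c r] z s(2) c
      Fr_minus[OF zF Fr_zero] FrD(1)[OF zF] by (simp add: Fr_simps a_minus_def)
    have 2: "y \<ominus>\<^bsub>M$(n + 1)\<^esub> rph (n + 1) g' ?t =
      (y \<ominus>\<^bsub>M$(n + 1)\<^esub> rph (n + 1) g' s) \<oplus>\<^bsub>M$(n + 1)\<^esub> ?c \<odot>\<^bsub>M$(n + 1)\<^esub> rph (n + 1) g' r"
     using lin_diff[OF l(2) FrM cxM[OF M] s(1) cr] lin_smult[OF l(2) c r] yc c
      lin_closed[OF l(2) s(1)] lin_closed[OF l(2) r] MM.smult_closed[OF c lin_closed[OF l(2) r]]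
     by (simp add: MM.M.grp_simps)
    have "(y \<ominus>\<^bsub>M$(n + 1)\<^esub> rph (n + 1) g' s) \<oplus>\<^bsub>M$(n + 1)\<^esub> ?c \<odot>\<^bsub>M$(n + 1)\<^esub> rph (n + 1) g' r \<in> boundaries M (n + 1)"
     using s(3) z MM.submoduleE(4,5)[OF bd_sub[OF M]] c by blast
    thus "\<exists>r\<in>Vec R (J' - {j}). rd g' r = z' \<and> y \<ominus>\<^bsub>M$(n + 1)\<^esub> rph (n + 1) g' r \<in> boundaries M (n + 1)"
     using t' 1 2 by (intro bexI[of _ ?t]) auto
   qed (use gen' in auto)
   hence "card J' \<le> card (J' - {j})" using p(2)[of "(J' - {j}, g')"] J' by simp
   thus False using j gen' card_Diff1_less[of J' j] by simp
  qed
 qed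
 thus ?thesis using gen by blast
qed

lemma rzero: "rd g \<o> = \<o>" "rph n g \<o> = \<zero>\<^bsub>M$n\<^esub>"
proof -
 interpret F: Module.module R "Fr R (UNIV :: nat set)" by (rule FrM)
 interpret M: Module.module R "M$n" by (rule cxM[OF M])
 show "rd g \<o> = \<o>" "rph n g \<o> = \<zero>\<^bsub>M$n\<^esub>"
  by (simp_all add: rd_def rph_def lin_ext_def supp_def) (simp add: Fr_simps)
qed

lemma rempty:
 shows "rok n {} g" "rmin n {} g" "cx_exact M (n + 1) \<Longrightarrow> rgen n {} g {} g'"
proof -
 have e: "z = \<o>" if "z \<in> carrier (Fr R {})" for z :: "nat \<Rightarrow> 'a" using FrD(2)[OF that] by auto
 show "rok n {} g" by (simp add: rok_def)
 show "rmin n {} g" using e idp(2)[OF mm_ideal] unfolding rmin_def by auto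
 assume ex: "cx_exact M (n + 1)"
 have "\<exists>r\<in>carrier (Fr R {}). rd g' r = z \<and> y \<ominus>\<^bsub>M$(n + 1)\<^esub> rph (n + 1) g' r \<in> boundaries M (n + 1)" if zy: "(z, y) \<in> rQ n {} g" for z y
 proof (intro bexI[OF _ Fr_zero] conjI)
  have z: "z = \<o>" and y: "y \<in> M$$(n + 1)" using zy e by (auto simp: rQ_def)
  show "rd g' \<o> = z" unfolding z by (rule rzero)
  have "y \<in> cycles M (n + 1)" using zy unfolding z by (intro cyclesI[OF y]) (simp add: rQ_def rzero)
  thus "y \<ominus>\<^bsub>M$(n + 1)\<^esub> rph (n + 1) g' \<o> \<in> boundaries M (n + 1)"
   using ex y unfolding cx_exact_iff[OF M] rzero by (auto simp: module_diff_zero[OF cxM[OF M]])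
 qed
 thus "rgen n {} g {} g'" unfolding rgen_def by blast
qed

lemma minimal_resolution_exists:
 assumes low: "\<And>n. n \<le> a \<Longrightarrow> cx_exact M n"
 shows "\<exists>(F :: ('a, nat \<Rightarrow> 'a) chain_cx) B \<phi>. free_cx R F B \<and> (\<forall>n. finite (B n)) \<and> (\<forall>n\<le>a. B n = {}) \<and>
  minimal_cx R \<mm> F B \<and> quasi_iso R F M \<phi>"
proof -
 let ?P = "\<lambda>k x. rok (a + int k) (fst x) (snd x) \<and> rmin (a + int k) (fst x) (snd x) \<and> (k = 0 \<longrightarrow> fst x = {})"
 let ?Q = "\<lambda>k x y. rgen (a + int k) (fst x) (snd x) (fst y) (snd y)"
 \<comment> \<open>The recursion starts with the empty basis in degree \<open>a\<close>, which is
   admissible because \<open>M\<close> is exact up to this degree.\<close>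
 have base: "\<exists>x. ?P 0 x" using rempty(1,2) by (intro exI[of _ "({}, undefined)"]) simp
 have step: "\<exists>y. ?P (Suc k) y \<and> ?Q k x y" if x: "?P k x" for k x
 proof -
  obtain J g where "rgen (a + int k) (fst x) (snd x) J g" "rmin (a + int k + 1) J g" using rgen_min_exists x by blast
  thus ?thesis using rgen_ok[of "a + int k" "fst x" "snd x" J g] by (intro exI[of _ "(J, g)"]) (simp add: add.assoc add.commute[of 1])
 qed
 from dependent_nat_choice[of ?P ?Q, OF base step] obtain st where st0: "\<forall>k. ?P k (st k) \<and> ?Q k (st k) (st (Suc k))" by (rule exE)
 note st = st0[THEN spec, THEN conjunct1] st0[THEN spec, THEN conjunct2]
 define J g where "J n = (if n < a then {} else fst (st (nat (n - a))))" and "g n = snd (st (nat (n - a)))" for n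
 have Ja: "J n = {}" if "n \<le> a" for n using that st(1)[of 0] by (auto simp: J_def)
 have ok: "rok n (J n) (g n)" and mn: "rmin n (J n) (g n)" for n
  using st(1)[of "nat (n - a)"] rempty(1,2) by (auto simp: J_def g_def)
 have gen: "rgen n (J n) (g n) (J (n + 1)) (g (n + 1))" for n
 proof (cases "a \<le> n")
  case True
  hence "nat (n + 1 - a) = Suc (nat (n - a))" by simp
  thus ?thesis using st(2)[of "nat (n - a)"] True by (simp add: J_def g_def)
 next
  case False
  thus ?thesis using rempty(3)[OF low] by (simp add: Ja)
 qed
 have q: "(rd (g n) x, rph n (g n) x) \<in> rQ (n - 1) (J (n - 1)) (g (n - 1))" if x: "x \<in> Vec R (J n)" for n x
  using rQ_closed[OF ok[of "n - 1"], of "J n" "g n" x] gen[of "n - 1"] ok[of n] x unfolding rgen_def by simp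
 define F :: "('a, nat \<Rightarrow> 'a) chain_cx" where "F = \<lparr>cx_mod = (\<lambda>n. Fr R (J n)), cx_d = (\<lambda>n. rd (g n))\<rparr>"
 define \<phi> where "\<phi> n = rph n (g n)" for n
 have FS: "F$n = Fr R (J n)" "cx_d F n = rd (g n)" for n by (simp_all add: F_def)
 have "lin_map R (Fr R (J n)) (Fr R (J (n - 1))) (rd (g n))" for n
  using lin_Fr_target[OF rd_lin[OF ok]] q[of _ n] by (simp add: rQ_def)
 hence F: "free_cx R F J"
  unfolding free_cx_def chain_complex_def FS using q by (auto simp: FrM Fr_simps rQ_def)
 note Fc = fcD(1)[OF F]
 have ph: "chain_map R F M \<phi>" unfolding chain_map_def FS \<phi>_def using rph_lin[OF ok] q by (auto simp: rQ_def)
 have "finite (J n)" for n using ok[of n] by (simp add: rok_def)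
 moreover have "minimal_cx R \<mm> F J"
  unfolding minimal_cx_def
 proof (intro allI ballI)
  fix n x b assume x: "x \<in> Vec R (J n)"
  have "rph (n - 1) (g (n - 1)) (rd (g n) x) \<in> boundaries M (n - 1)" using q[OF x] by (auto simp: rQ_def boundaries_iff)
  thus "cx_d F n x b \<in> \<mm>" using mn[of "n - 1"] q[OF x] unfolding rmin_def by (auto simp: rQ_def FS)
 qed
 moreover have "quasi_iso R F M \<phi>"
  unfolding quasi_iso_iff[OF Fc M]
 proof (intro conjI allI ballI impI ph)
  fix n z assume z: "z \<in> cycles F n" "\<phi> n z \<in> boundaries M n"
  obtain y where "y \<in> M$$(n + 1)" "\<phi> n z = cx_d M (n + 1) y" using z(2) unfolding boundaries_iff by blast
  hence "(z, y) \<in> rQ n (J n) (g n)" using cyclesD[OF z(1)] by (simp add: rQ_def FS Fr_simps \<phi>_def)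
  thus "z \<in> boundaries F n" using gen[of n] unfolding rgen_def boundaries_iff FS by blast
 next
  fix n y assume y: "y \<in> cycles M n"
  have "(\<o>, y) \<in> rQ (n - 1) (J (n - 1)) (g (n - 1))"
   using cyclesD(1)[OF y] cyclesD(2)[OF y refl] by (simp add: rQ_def rzero Fr_zero)
  hence "\<exists>r\<in>Vec R (J n). rd (g n) r = \<o> \<and> y \<ominus>\<^bsub>M$n\<^esub> rph n (g n) r \<in> boundaries M n"
   using gen[of "n - 1"] unfolding rgen_def by simp
  thus "\<exists>z\<in>cycles F n. y \<ominus>\<^bsub>M$n\<^esub> \<phi> n z \<in> boundaries M n"
   by (auto simp: cycles_def FS Fr_simps \<phi>_def)
 qed
 ultimately show ?thesis using F Ja by blast
qed

end

end

section \<open>Pairings and transposes\<close>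

text \<open>The standard pairing of a vector of finite support with an arbitrary function on the
  basis.\<close>

definition pr :: "('a, 'r) ring_scheme \<Rightarrow> ('b \<Rightarrow> 'a) \<Rightarrow> ('b \<Rightarrow> 'a) \<Rightarrow> 'a" where
 "pr R f g = lin_ext R (Rm R) g f"

text \<open>Hom(L, R) without signs, by transposed matrices. For finite bases the dual of
  \<open>Fr R B\<close> is identified with \<open>Fr R B\<close> itself.\<close>

definition dual_cx :: "('a, 'r) ring_scheme \<Rightarrow> ('a, 'b \<Rightarrow> 'a) chain_cx \<Rightarrow> (int \<Rightarrow> 'b set) \<Rightarrow> ('a, 'b \<Rightarrow> 'a) chain_cx" where
 "dual_cx R L B = \<lparr>cx_mod = (\<lambda>n. Fr R (B (- n))),
  cx_d = (\<lambda>n v b. if b \<in> B (1 - n) then pr R (cx_d L (1 - n) (dl R b)) v else \<zero>\<^bsub>R\<^esub>)\<rparr>"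

context cring
begin

lemma Rm_minus: "x \<in> carrier R \<Longrightarrow> y \<in> carrier R \<Longrightarrow> x \<ominus>\<^bsub>Rm R\<^esub> y = x \<ominus> y"
 using minus_one_smult[OF Rm_module, of y] by (simp add: a_minus_def Rm_simps l_minus)

lemma pr_lin: "g \<in> B \<rightarrow> carrier R \<Longrightarrow> lin_map R (Fr R B) (Rm R) (\<lambda>f. pr R f g)"
 unfolding pr_def using lin_ext_lin[OF Rm_module, of g B] by (simp add: Rm_simps)

lemma pr_dl: "g \<in> B \<rightarrow> carrier R \<Longrightarrow> b \<in> B \<Longrightarrow> pr R (dl R b) g = g b"
 unfolding pr_def using lin_ext_dl[OF Rm_module, of g B b] by (simp add: Rm_simps)

lemma pr_closed: "g \<in> B \<rightarrow> carrier R \<Longrightarrow> f \<in> Vec R B \<Longrightarrow> pr R f g \<in> carrier R"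
 using lin_closed[OF pr_lin] by (fastforce simp: Rm_simps)

lemma Fr_Pi: "f \<in> Vec R B \<Longrightarrow> f \<in> A \<rightarrow> carrier R"
 by (auto dest: FrD(1))

lemma pr_right_add:
 assumes "g \<in> B \<rightarrow> carrier R" "h \<in> B \<rightarrow> carrier R" "f \<in> Vec R B"
 shows "pr R f (\<lambda>b. g b \<oplus> h b) = pr R f g \<oplus> pr R f h"
proof -
 have gh: "(\<lambda>b. g b \<oplus> h b) \<in> B \<rightarrow> carrier R" using assms by auto
 have "lin_map R (Fr R B) (Rm R) (\<lambda>f. pr R f g \<oplus>\<^bsub>Rm R\<^esub> pr R f h)"
  by (intro lin_plus pr_lin assms Rm_module)
 from lin_Fr_eq[OF pr_lin[OF gh] this Rm_module _ assms(3)] show ?thesis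
  using assms gh by (simp add: Rm_simps pr_dl)
qed

lemma pr_right_smult:
 assumes "g \<in> B \<rightarrow> carrier R" "r \<in> carrier R" "f \<in> Vec R B"
 shows "pr R f (\<lambda>b. r \<otimes> g b) = r \<otimes> pr R f g"
proof -
 have gh: "(\<lambda>b. r \<otimes> g b) \<in> B \<rightarrow> carrier R" using assms by auto
 note l = pr_lin[OF assms(1)]
 have "lin_map R (Fr R B) (Rm R) (\<lambda>f. r \<otimes> pr R f g)"
  by (rule lin_mapI) (use lin_closed[OF l] lin_add[OF l] lin_smult[OF l] assms(2) in \<open>auto simp: Rm_simps r_distr m_ac\<close>)
 from lin_Fr_eq[OF pr_lin[OF gh] this Rm_module _ assms(3)] show ?thesis
  using assms gh by (simp add: Rm_simps pr_dl)
qed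

lemma pr_right_dl:
 assumes "f \<in> Vec R B" "b \<in> B" shows "pr R f (dl R b) = f b"
proof -
 have d: "dl R b \<in> B \<rightarrow> carrier R" by (rule Fr_Pi[OF dl_mem[OF assms(2)]])
 have "lin_map R (Fr R B) (Rm R) (\<lambda>f. f b)"
  by (rule lin_mapI) (auto simp: Fr_simps Rm_simps FrD(1))
 from lin_Fr_eq[OF pr_lin[OF d] this Rm_module _ assms(1)] show ?thesis
  using assms d by (simp add: pr_dl) (simp add: dl_def)
qed

lemma pr_lin_right: "f \<in> Vec R B \<Longrightarrow> lin_map R (Fr R B) (Rm R) (\<lambda>g. pr R f g)"
 by (rule lin_mapI)
  (simp_all add: Fr_simps Rm_simps pr_right_add[OF Fr_Pi Fr_Pi] pr_right_smult[OF Fr_Pi] pr_closed[OF Fr_Pi])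

lemma lin_ext_apply:
 assumes K: "\<And>x. x \<in> X \<Longrightarrow> K x \<in> Vec R Y" and f: "f \<in> Vec R X"
 shows "lin_ext R (Fr R Y) K f y = pr R f (\<lambda>x. K x y)"
proof -
 have K': "K \<in> X \<rightarrow> Vec R Y" using K by auto
 have Ky: "(\<lambda>x. K x y) \<in> X \<rightarrow> carrier R" using FrD(1)[OF K] by auto
 note l = lin_ext_lin[OF FrM K']
 have "lin_map R (Fr R X) (Rm R) (\<lambda>f. lin_ext R (Fr R Y) K f y)"
 proof (rule lin_mapI)
  fix f assume f: "f \<in> Vec R X"
  show "lin_ext R (Fr R Y) K f y \<in> carrier (Rm R)" using FrD(1)[OF lin_closed[OF l f]] by (simp add: Rm_simps)
  show "lin_ext R (Fr R Y) K (f \<oplus>\<^bsub>Fr R X\<^esub> g) y = lin_ext R (Fr R Y) K f y \<oplus>\<^bsub>Rm R\<^esub> lin_ext R (Fr R Y) K g y"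
   if g: "g \<in> Vec R X" for g unfolding lin_add[OF l f g] by (simp add: Fr_simps Rm_simps)
  show "lin_ext R (Fr R Y) K (r \<odot>\<^bsub>Fr R X\<^esub> f) y = r \<odot>\<^bsub>Rm R\<^esub> lin_ext R (Fr R Y) K f y"
   if r: "r \<in> carrier R" for r unfolding lin_smult[OF l r f] by (simp add: Fr_simps Rm_simps)
 qed
 from lin_Fr_eq[OF this pr_lin[OF Ky] Rm_module _ f] show ?thesis
  using Ky by (simp add: pr_dl lin_ext_dl[OF FrM K'])
qed

lemma Fr_coeff_induct [consumes 3, case_names zero step]:
 assumes "f \<in> Vec R B" "\<And>b. f b \<in> I" "ideal I R"
  and "P \<o>"
  and "\<And>f b r. f \<in> Vec R B \<Longrightarrow> b \<in> B \<Longrightarrow> r \<in> I \<Longrightarrow> P f \<Longrightarrow> P (f \<oplus>\<^bsub>Fr R B\<^esub> r \<odot>\<^bsub>Fr R B\<^esub> dl R b)"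
 shows "P f"
proof -
 have "(\<forall>b. f b \<in> I) \<longrightarrow> P f"
  using assms(1)
 proof (induction rule: Fr_induct)
  case (step f b r)
  show ?case
  proof
   assume a: "\<forall>c. (f \<oplus>\<^bsub>Fr R B\<^esub> r \<odot>\<^bsub>Fr R B\<^esub> dl R b) c \<in> I"
   have "r \<in> I" using a[rule_format, of b] step by (simp add: Fr_simps dl_def)
   moreover have "f c \<in> I" for c
    using a[rule_format, of c] step idp(2)[OF assms(3)] FrD(1)[OF step(1), of c]
    by (cases "c = b") (simp_all add: Fr_simps dl_def)
   ultimately show "P (f \<oplus>\<^bsub>Fr R B\<^esub> r \<odot>\<^bsub>Fr R B\<^esub> dl R b)" using step assms(5) by blast
  qed
 qed (use assms(4) in simp)
 thus ?thesis using assms(2) by blast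
qed

text \<open>For the maximal ideal as \<open>I\<close>, this carries minimality from a boundary to
  its image under a homotopy.\<close>

lemma lin_coeffs:
 assumes "lin_map R (Fr R B) (Fr R C) \<phi>" "f \<in> Vec R B" "\<And>b. f b \<in> I" "ideal I R"
 shows "\<phi> f c \<in> I"
 using assms(2-4)
proof (induction arbitrary: c rule: Fr_coeff_induct)
 case zero
 show ?case using lin_zero[OF assms(1) FrM FrM] idp(2)[OF assms(4)] by (simp add: Fr_simps)
next
 case (step f b r)
 have r: "r \<in> carrier R" using step(3) idp(1)[OF assms(4)] by blast
 have s: "r \<odot>\<^bsub>Fr R B\<^esub> dl R b \<in> Vec R B" using Fr_smult[OF r dl_mem[OF step(2)]] by (simp add: Fr_simps)
 have pc: "\<phi> (dl R b) c \<in> carrier R" by (rule FrD(1)[OF lin_closed[OF assms(1) dl_mem[OF step(2)]]])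
 hence "\<phi> (dl R b) c \<otimes> r \<in> I" using idp(4)[OF assms(4) pc step(3)] by simp
 thus ?case
  using lin_add[OF assms(1) step(1) s] lin_smult[OF assms(1) r dl_mem[OF step(2)]] step(4) idp(3)[OF assms(4)] r pc
  by (simp add: Fr_simps m_comm)
qed

lemma pr_coeffs:
 assumes "f \<in> Vec R B" "\<And>b. f b \<in> I" "ideal I R" "g \<in> B \<rightarrow> carrier R"
 shows "pr R f g \<in> I"
 using assms(1-3)
proof (induction rule: Fr_coeff_induct)
 case zero
 show ?case using lin_zero[OF pr_lin[OF assms(4)] FrM Rm_module] idp(2)[OF assms(3)] by (simp add: Fr_simps Rm_simps)
next
 case (step f b r)
 have r: "r \<in> carrier R" using step(3) idp(1)[OF assms(3)] by blast
 have s: "r \<odot>\<^bsub>Fr R B\<^esub> dl R b \<in> Vec R B" using Fr_smult[OF r dl_mem[OF step(2)]] by (simp add: Fr_simps)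
 have gb: "g b \<in> carrier R" using assms(4) step(2) by auto
 hence "g b \<otimes> r \<in> I" using idp(4)[OF assms(3) gb step(3)] by simp
 thus ?case
  using lin_add[OF pr_lin[OF assms(4)] step(1) s] lin_smult[OF pr_lin[OF assms(4)] r dl_mem[OF step(2)]] step(4)
   idp(3)[OF assms(3)] r gb pr_dl[OF assms(4) step(2)]
  by (simp add: Rm_simps m_comm)
qed

text \<open>The differential is conjugated by isomorphisms of modules in each degree. Linearity of
  \<open>\<theta>\<close> comes from that of its inverse \<open>\<eta>\<close>.\<close>

lemma free_cx_of_iso:
 assumes X: "chain_complex R X" and tc: "\<And>n x. x \<in> Vec R (B n) \<Longrightarrow> \<theta> n x \<in> X$$n" and e: "\<And>n. lin_map R (X$n) (Fr R (B n)) (\<eta> n)"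
  and te: "\<And>n x. x \<in> X$$n \<Longrightarrow> \<theta> n (\<eta> n x) = x" and et: "\<And>n x. x \<in> Vec R (B n) \<Longrightarrow> \<eta> n (\<theta> n x) = x"
 defines "L \<equiv> \<lparr>cx_mod = (\<lambda>n. Fr R (B n)), cx_d = (\<lambda>n x. \<eta> (n - 1) (cx_d X n (\<theta> n x)))\<rparr>"
 shows "free_cx R L B" "cx_iso R L X \<theta> \<eta>"
proof -
 have t: "lin_map R (Fr R (B n)) (X$n) (\<theta> n)" for n
 proof (rule lin_mapI)
  interpret M: Module.module R "X$n" by (rule cxM[OF X])
  fix x assume x: "x \<in> Vec R (B n)"
  thus "\<theta> n x \<in> X$$n" by (rule tc)
  show "\<theta> n (x \<oplus>\<^bsub>Fr R (B n)\<^esub> y) = \<theta> n x \<oplus>\<^bsub>X$n\<^esub> \<theta> n y" if y: "y \<in> Vec R (B n)" for y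
   using lin_add[OF e tc[OF x] tc[OF y]] te[OF M.M.a_closed[OF tc[OF x] tc[OF y]]] by (simp add: et x y)
  show "\<theta> n (r \<odot>\<^bsub>Fr R (B n)\<^esub> x) = r \<odot>\<^bsub>X$n\<^esub> \<theta> n x" if r: "r \<in> carrier R" for r
   using lin_smult[OF e r tc[OF x]] te[OF M.smult_closed[OF r tc[OF x]]] by (simp add: et x)
 qed
 have L: "L$n = Fr R (B n)" "cx_d L n x = \<eta> (n - 1) (cx_d X n (\<theta> n x))" for n x by (simp_all add: L_def)
 have cl: "cx_d X n (\<theta> n x) \<in> X$$(n - 1)" if "x \<in> Vec R (B n)" for n x
  by (rule cx_closed[OF X lin_closed[OF t that] refl])
 have "chain_complex R L"
  unfolding chain_complex_def L
 proof (intro conjI allI ballI FrM)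
  fix n
  show "lin_map R (Fr R (B n)) (Fr R (B (n - 1))) (\<lambda>x. \<eta> (n - 1) (cx_d X n (\<theta> n x)))"
   by (rule lin_comp[OF lin_comp[OF t cx_lin[OF X]] e])
  fix x assume x: "x \<in> Vec R (B n)"
  show "\<eta> (n - 1 - 1) (cx_d X (n - 1) (\<theta> (n - 1) (\<eta> (n - 1) (cx_d X n (\<theta> n x))))) = \<zero>\<^bsub>Fr R (B (n - 1 - 1))\<^esub>"
   using te[OF cl[OF x]] cx_dd[OF X lin_closed[OF t x] refl, of "n - 1 - 1"] lin_zero[OF e cxM[OF X] FrM, of "n - 1 - 1"]
   by simp
 qed
 thus F: "free_cx R L B" unfolding free_cx_def L by simp
 show "cx_iso R L X \<theta> \<eta>"
  unfolding cx_iso_def chain_map_def L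
  using fcD(1)[OF F] X t e te et te[OF cl] cx_closed[OF X _ refl] by auto
qed

context
 fixes L :: "('a, 'c \<Rightarrow> 'a) chain_cx" and B
 assumes L: "free_cx R L B" and fin: "\<And>n. finite (B n)"
begin

lemma dual_mod: "(dual_cx R L B)$n = Fr R (B (- n))" by (simp add: dual_cx_def)

lemma dual_d_mem: "v \<in> Vec R (B (- n)) \<Longrightarrow> cx_d (dual_cx R L B) n v \<in> Vec R (B (1 - n))"
 using lin_closed[OF free_cx_d[OF L, of "- n" "1 - n"] dl_mem]
 by (auto simp: Fr_fin[OF fin] dual_cx_def intro!: pr_closed[of _ "B (- n)"])

lemma dual_adj:
 assumes "l \<in> Vec R (B (1 - n))" "v \<in> Vec R (B (- n))"
 shows "pr R (cx_d L (1 - n) l) v = pr R l (cx_d (dual_cx R L B) n v)"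
proof -
 note ld = free_cx_d[OF L, of "- n" "1 - n", simplified]
 have 1: "lin_map R (Fr R (B (1 - n))) (Rm R) (\<lambda>l. pr R (cx_d L (1 - n) l) v)"
  by (rule lin_comp[OF ld pr_lin[OF Fr_Pi[OF assms(2)]]])
 have 2: "lin_map R (Fr R (B (1 - n))) (Rm R) (\<lambda>l. pr R l (cx_d (dual_cx R L B) n v))"
  by (rule pr_lin[OF Fr_Pi[OF dual_d_mem[OF assms(2)]]])
 show ?thesis
  by (rule lin_Fr_eq[OF 1 2 Rm_module _ assms(1)])
   (simp add: pr_dl[OF Fr_Pi[OF dual_d_mem[OF assms(2)]]], simp add: dual_cx_def)
qed

lemma dual_free_cx: "free_cx R (dual_cx R L B) (\<lambda>n. B (- n))"
 unfolding free_cx_def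
proof (intro conjI allI dual_mod)
 show "chain_complex R (dual_cx R L B)"
  unfolding chain_complex_def dual_mod
 proof (intro conjI allI ballI FrM)
  fix n :: int
  have c: "- (n - 1) = 1 - n" "- (n - 1 - 1) = 1 - (n - 1)" by simp_all
  note ld = free_cx_d[OF L, of "- n" "1 - n", simplified]
  have cd: "cx_d L (1 - n) (dl R b) \<in> Vec R (B (- n))" if "b \<in> B (1 - n)" for b
   by (rule lin_closed[OF ld dl_mem[OF that]])
  show "lin_map R (Fr R (B (- n))) (Fr R (B (- (n - 1)))) (cx_d (dual_cx R L B) n)"
   unfolding c
  proof (rule lin_mapI)
   fix v assume v: "v \<in> Vec R (B (- n))"
   thus "cx_d (dual_cx R L B) n v \<in> Vec R (B (1 - n))" by (rule dual_d_mem)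
   fix w assume w: "w \<in> Vec R (B (- n))"
   show "cx_d (dual_cx R L B) n (v \<oplus>\<^bsub>Fr R (B (- n))\<^esub> w) = cx_d (dual_cx R L B) n v \<oplus>\<^bsub>Fr R (B (1 - n))\<^esub> cx_d (dual_cx R L B) n w"
    using pr_right_add[OF Fr_Pi[OF v] Fr_Pi[OF w] cd] by (auto simp: dual_cx_def Fr_simps)
  next
   fix r v assume v: "v \<in> Vec R (B (- n))" and r: "r \<in> carrier R"
   show "cx_d (dual_cx R L B) n (r \<odot>\<^bsub>Fr R (B (- n))\<^esub> v) = r \<odot>\<^bsub>Fr R (B (1 - n))\<^esub> cx_d (dual_cx R L B) n v"
    using pr_right_smult[OF Fr_Pi[OF v] r cd] r by (auto simp: dual_cx_def Fr_simps)
  qed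
  fix v assume v: "v \<in> Vec R (B (- n))"
  show "cx_d (dual_cx R L B) (n - 1) (cx_d (dual_cx R L B) n v) = \<zero>\<^bsub>Fr R (B (- (n - 1 - 1)))\<^esub>"
  proof
   fix b
   show "cx_d (dual_cx R L B) (n - 1) (cx_d (dual_cx R L B) n v) b = \<zero>\<^bsub>Fr R (B (- (n - 1 - 1)))\<^esub> b"
   proof (cases "b \<in> B (1 - (n - 1))")
    case True
    have b: "cx_d L (1 - (n - 1)) (dl R b) \<in> Vec R (B (1 - n))"
     by (rule lin_closed[OF free_cx_d[OF L] dl_mem[OF True]]) simp
    have "cx_d (dual_cx R L B) (n - 1) (cx_d (dual_cx R L B) n v) b = pr R (cx_d L (1 - (n - 1)) (dl R b)) (cx_d (dual_cx R L B) n v)"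
     using True by (simp add: dual_cx_def)
    also have "\<dots> = pr R (cx_d L (1 - n) (cx_d L (1 - (n - 1)) (dl R b))) v" by (rule dual_adj[OF b v, symmetric])
    also have "cx_d L (1 - n) (cx_d L (1 - (n - 1)) (dl R b)) = \<zero>\<^bsub>Fr R (B (- n))\<^esub>"
     unfolding fcD(2)[OF L, of "- n", symmetric]
    proof (rule cx_dd[OF fcD(1)[OF L]])
     show "dl R b \<in> L$$(1 - (n - 1))" unfolding fcD(2)[OF L] by (rule dl_mem[OF True])
    qed simp_all
    also have "pr R \<dots> v = \<zero>\<^bsub>Rm R\<^esub>" by (rule lin_zero[OF pr_lin[OF Fr_Pi[OF v]] FrM Rm_module])
    finally show ?thesis by (simp add: Fr_simps Rm_simps)
   qed (simp add: dual_cx_def Fr_simps)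
  qed
 qed
qed

lemma dual_minimal:
 assumes m: "minimal_cx R \<mm> L B" "ideal \<mm> R" shows "minimal_cx R \<mm> (dual_cx R L B) (\<lambda>n. B (- n))"
 unfolding minimal_cx_def
proof (intro allI ballI)
 fix n v b assume v: "v \<in> Vec R (B (- n))"
 show "cx_d (dual_cx R L B) n v b \<in> \<mm>"
 proof (cases "b \<in> B (1 - n)")
  case True
  have d: "cx_d L (1 - n) (dl R b) \<in> Vec R (B (- n))"
   by (rule lin_closed[OF free_cx_d[OF L] dl_mem[OF True]]) simp
  have "pr R (cx_d L (1 - n) (dl R b)) v \<in> \<mm>"
   by (rule pr_coeffs[OF d m(1)[unfolded minimal_cx_def, rule_format, OF dl_mem[OF True]] m(2) Fr_Pi[OF v]])
  thus ?thesis using True by (simp add: dual_cx_def)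
 qed (use idp(2)[OF m(2)] in \<open>simp add: dual_cx_def\<close>)
qed

end

end

section \<open>The complex of homomorphisms between free complexes\<close>

text \<open>Index set of the matrix units: \<open>(i, x, y)\<close> stands for the homomorphism of
  degree \<open>n\<close> that sends the basis element \<open>x\<close> in degree \<open>i\<close>
  to \<open>y\<close> and all other basis elements to 0.\<close>

definition hB :: "(int \<Rightarrow> 'x set) \<Rightarrow> (int \<Rightarrow> 'y set) \<Rightarrow> int \<Rightarrow> (int \<times> 'x \<times> 'y) set" where
 "hB BF BG n = {(i, x, y). x \<in> BF i \<and> y \<in> BG (i + n)}"

definition hth :: "('a, 'r) ring_scheme \<Rightarrow> (int \<Rightarrow> 'x set) \<Rightarrow> (int \<Rightarrow> 'y set) \<Rightarrow> int \<Rightarrow> (int \<times> 'x \<times> 'y \<Rightarrow> 'a) \<Rightarrow> int \<Rightarrow> ('x \<Rightarrow> 'a) \<Rightarrow> 'y \<Rightarrow> 'a" where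
 "hth R BF BG n l = (\<lambda>i. \<lambda>\<xi>\<in>Vec R (BF i). lin_ext R (Fr R (BG (i + n))) (\<lambda>x y. l (i, x, y)) \<xi>)"

definition het :: "('a, 'r) ring_scheme \<Rightarrow> (int \<Rightarrow> 'x set) \<Rightarrow> (int \<Rightarrow> 'y set) \<Rightarrow> int \<Rightarrow> (int \<Rightarrow> ('x \<Rightarrow> 'a) \<Rightarrow> 'y \<Rightarrow> 'a) \<Rightarrow> int \<times> 'x \<times> 'y \<Rightarrow> 'a" where
 "het R BF BG n f = (\<lambda>(i, x, y). if x \<in> BF i \<and> y \<in> BG (i + n) then f i (dl R x) y else \<zero>\<^bsub>R\<^esub>)"

definition hcx :: "('a, 'r) ring_scheme \<Rightarrow> ('a, 'x \<Rightarrow> 'a) chain_cx \<Rightarrow> (int \<Rightarrow> 'x set) \<Rightarrow> ('a, 'y \<Rightarrow> 'a) chain_cx \<Rightarrow> (int \<Rightarrow> 'y set) \<Rightarrow>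
  ('a, int \<times> 'x \<times> 'y \<Rightarrow> 'a) chain_cx" where
 "hcx R F BF G BG = \<lparr>cx_mod = (\<lambda>n. Fr R (hB BF BG n)),
  cx_d = (\<lambda>n l. het R BF BG (n - 1) (cx_d (Hom_cx R F G) n (hth R BF BG n l)))\<rparr>"

context cring
begin

lemma row_mem:
 assumes "l \<in> Vec R (hB BF BG n)" shows "(\<lambda>y. l (i, x, y)) \<in> Vec R (BG (i + n))"
proof -
 have "supp R (\<lambda>y. l (i, x, y)) \<subseteq> (\<lambda>(i, x, y). y) ` supp R l" by (force simp: supp_def)
 hence "finite (supp R (\<lambda>y. l (i, x, y)))" using FrD(3)[OF assms] finite_subset by blast
 moreover have "supp R (\<lambda>y. l (i, x, y)) \<subseteq> BG (i + n)" using FrD(4)[OF assms] by (auto simp: supp_def hB_def)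
 ultimately show ?thesis using FrD(1)[OF assms] by (simp add: Fr_carrier)
qed

lemma col_mem:
 assumes "l \<in> Vec R (hB BF BG n)" shows "(\<lambda>x. l (i, x, y)) \<in> Vec R (BF i)"
proof -
 have "supp R (\<lambda>x. l (i, x, y)) \<subseteq> (\<lambda>(i, x, y). x) ` supp R l" by (force simp: supp_def)
 hence "finite (supp R (\<lambda>x. l (i, x, y)))" using FrD(3)[OF assms] finite_subset by blast
 moreover have "supp R (\<lambda>x. l (i, x, y)) \<subseteq> BF i" using FrD(4)[OF assms] by (auto simp: supp_def hB_def)
 ultimately show ?thesis using FrD(1)[OF assms] by (simp add: Fr_carrier)
qed

lemma row_lin: "lin_map R (Fr R (hB BF BG n)) (Fr R (BG (i + n))) (\<lambda>l y. l (i, x, y))"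
 by (rule lin_mapI) (auto simp: Fr_simps row_mem)

lemma col_lin: "lin_map R (Fr R (hB BF BG n)) (Fr R (BF i)) (\<lambda>l x. l (i, x, y))"
 by (rule lin_mapI) (auto simp: Fr_simps col_mem)

context
 fixes F :: "('a, 'x \<Rightarrow> 'a) chain_cx" and BF and G :: "('a, 'y \<Rightarrow> 'a) chain_cx" and BG
 assumes F: "free_cx R F BF" and G: "free_cx R G BG" and fin: "\<And>n. finite (hB BF BG n)"
begin

lemma hth_apply: "\<xi> \<in> Vec R (BF i) \<Longrightarrow> hth R BF BG n l i \<xi> = lin_ext R (Fr R (BG (i + n))) (\<lambda>x y. l (i, x, y)) \<xi>"
 by (simp add: hth_def)

text \<open>A homomorphism of degree \<open>n\<close> is a family of matrices, one for each
  \<open>i\<close>. Finiteness of \<open>hB BF BG n\<close> turns the product over \<open>i\<close>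
  into a free module with the matrix units as basis.\<close>

lemma hcx_iso: "free_cx R (hcx R F BF G BG) (hB BF BG)"
 "cx_iso R (hcx R F BF G BG) (Hom_cx R F G) (hth R BF BG) (het R BF BG)"
proof -
 note Fc = fcD(1)[OF F] and Fm = fcD(2)[OF F] and Gc = fcD(1)[OF G] and Gm = fcD(2)[OF G]
 have rows: "(\<lambda>x y. l (i, x, y)) \<in> BF i \<rightarrow> Vec R (BG (i + n))" if "l \<in> Vec R (hB BF BG n)" for l i n
  using row_mem[OF that] by auto
 have tc: "hth R BF BG n l \<in> (Hom_cx R F G)$$n" if "l \<in> Vec R (hB BF BG n)" for l n
  using Hom_mem_restrict[OF Fc Gc, of n "\<lambda>i. lin_ext R (Fr R (BG (i + n))) (\<lambda>x y. l (i, x, y))"] lin_ext_lin[OF FrM rows[OF that]]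
  by (simp add: hth_def Fm Gm)
 have fm: "f i \<xi> \<in> Vec R (BG (i + n))" if "f \<in> (Hom_cx R F G)$$n" "\<xi> \<in> Vec R (BF i)" for f n i \<xi>
  using Hom_closed[OF Fc Gc that(1) _ refl] that(2) by (simp add: Fm Gm)
 have em: "het R BF BG n f \<in> Vec R (hB BF BG n)" if "f \<in> (Hom_cx R F G)$$n" for f n
  unfolding Fr_fin[OF fin] using FrD(1)[OF fm[OF that dl_mem]] by (auto simp: het_def hB_def)
 have e: "lin_map R ((Hom_cx R F G)$n) (Fr R (hB BF BG n)) (het R BF BG n)" for n
 proof (rule lin_mapI)
  fix f assume f: "f \<in> (Hom_cx R F G)$$n"
  show "het R BF BG n f \<in> Vec R (hB BF BG n)" by (rule em[OF f])
  have dl: "x \<in> BF i \<Longrightarrow> dl R x \<in> F$$i" for x i using dl_mem by (simp add: Fm)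
  show "het R BF BG n (f \<oplus>\<^bsub>(Hom_cx R F G)$n\<^esub> g) = het R BF BG n f \<oplus>\<^bsub>Fr R (hB BF BG n)\<^esub> het R BF BG n g" for g
   by (auto simp: het_def Hom_simps[OF Fc Gc dl] Fr_simps Gm)
  show "het R BF BG n (r \<odot>\<^bsub>(Hom_cx R F G)$n\<^esub> f) = r \<odot>\<^bsub>Fr R (hB BF BG n)\<^esub> het R BF BG n f" if "r \<in> carrier R" for r
   using that by (auto simp: het_def Hom_simps[OF Fc Gc dl] Fr_simps Gm)
 qed
 have te: "hth R BF BG n (het R BF BG n f) = f" if f: "f \<in> (Hom_cx R F G)$$n" for f n
 proof (rule Hom_eqI[OF Fc Gc tc[OF em[OF f]] f])
  fix i \<xi> assume "\<xi> \<in> F$$i"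
  hence xi: "\<xi> \<in> Vec R (BF i)" by (simp add: Fm)
  have "f i \<xi> = lin_ext R (Fr R (BG (i + n))) (\<lambda>x y. het R BF BG n f (i, x, y)) \<xi>"
  proof (rule lin_ext_unique[OF FrM rows[OF em[OF f]] _ _ xi])
   show "lin_map R (Fr R (BF i)) (Fr R (BG (i + n))) (f i)" using Hom_lin[OF Fc Gc f refl, of i] by (simp add: Fm Gm)
   fix x assume x: "x \<in> BF i"
   show "f i (dl R x) = (\<lambda>y. het R BF BG n f (i, x, y))"
    using x FrD(2)[OF fm[OF f dl_mem[OF x]]] by (auto simp: het_def)
  qed
  thus "hth R BF BG n (het R BF BG n f) i \<xi> = f i \<xi>" using xi by (simp add: hth_apply)
 qed
 have et: "het R BF BG n (hth R BF BG n l) = l" if l: "l \<in> Vec R (hB BF BG n)" for l n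
 proof
  fix b :: "int \<times> 'x \<times> 'y"
  obtain i x y where b: "b = (i, x, y)" by (cases b) auto
  show "het R BF BG n (hth R BF BG n l) b = l b"
   using FrD(2)[OF l, of b] lin_ext_dl[OF FrM rows[OF l], of x i]
   by (auto simp: het_def b hB_def hth_apply[OF dl_mem])
 qed
 from free_cx_of_iso[OF Hom_chain_complex[OF Fc Gc], of "hB BF BG" "hth R BF BG" "het R BF BG", OF tc e te et]
 show "free_cx R (hcx R F BF G BG) (hB BF BG)"
  "cx_iso R (hcx R F BF G BG) (Hom_cx R F G) (hth R BF BG) (het R BF BG)" by (simp_all add: hcx_def)
qed

lemma hcx_d:
 assumes l: "l \<in> Vec R (hB BF BG n)" and b: "(i, x, y) \<in> hB BF BG (n - 1)"
 shows "cx_d (hcx R F BF G BG) n l (i, x, y) = cx_d G (i + n) (\<lambda>y. l (i, x, y)) y \<ominus>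
  (if even n then \<one> else \<ominus> \<one>) \<otimes> pr R (cx_d F i (dl R x)) (\<lambda>x. l (i - 1, x, y))"
proof -
 note Fc = fcD(1)[OF F] and Fm = fcD(2)[OF F] and Gc = fcD(1)[OF G] and Gm = fcD(2)[OF G]
 have x: "x \<in> BF i" and y: "y \<in> BG (i + n - 1)" using b by (auto simp: hB_def algebra_simps)
 have rows: "(\<lambda>x y. l (i, x, y)) \<in> X \<rightarrow> Vec R (BG (i + n))" for X i
  using row_mem[OF l] by auto
 have t: "hth R BF BG n l \<in> (Hom_cx R F G)$$n"
  using cm_closed[OF cx_isoD(3)[OF hcx_iso(2)]] l fcD(2)[OF hcx_iso(1)] by simp
 have dx: "dl R x \<in> F$$i" using dl_mem[OF x] by (simp add: Fm)
 have dFx: "cx_d F i (dl R x) \<in> Vec R (BF (i - 1))" by (rule lin_closed[OF free_cx_d[OF F refl] dl_mem[OF x]])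
 have e1: "hth R BF BG n l i (dl R x) = (\<lambda>y. l (i, x, y))"
  using lin_ext_dl[OF FrM rows x] by (simp add: hth_apply[OF dl_mem[OF x]])
 have m2: "hth R BF BG n l (i - 1) (cx_d F i (dl R x)) \<in> Vec R (BG (i + n - 1))"
  using Hom_closed[OF Fc Gc t, of "cx_d F i (dl R x)" "i - 1" "i + n - 1"] dFx by (simp add: Fm Gm)
 have e2: "hth R BF BG n l (i - 1) (cx_d F i (dl R x)) y = pr R (cx_d F i (dl R x)) (\<lambda>x. l (i - 1, x, y))"
  using lin_ext_apply[OF row_mem[OF l], of "cx_d F i (dl R x)" "BF (i - 1)" "i - 1"] dFx by (simp add: hth_apply)
 have m1: "cx_d G (i + n) (\<lambda>y. l (i, x, y)) \<in> Vec R (BG (i + n - 1))"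
  by (rule lin_closed[OF free_cx_d[OF G refl] row_mem[OF l]])
 have pc: "pr R (cx_d F i (dl R x)) (\<lambda>x. l (i - 1, x, y)) \<in> carrier R"
  using FrD(1)[OF m2, of y] e2 by simp
 have sm: "sg (Fr R (BG (i + n - 1))) n (hth R BF BG n l (i - 1) (cx_d F i (dl R x))) \<in> Vec R (BG (i + n - 1))"
  by (rule sg_closed[OF FrM m2])
 have "cx_d (hcx R F BF G BG) n l (i, x, y) = cx_d (Hom_cx R F G) n (hth R BF BG n l) i (dl R x) y"
  using b by (simp add: hcx_def het_def hB_def)
 also have "\<dots> = cx_d G (i + n) (\<lambda>y. l (i, x, y)) y \<ominus> sg (Fr R (BG (i + n - 1))) n (hth R BF BG n l (i - 1) (cx_d F i (dl R x))) y"
  unfolding Hom_d_apply[OF Fc Gc t dx] e1 Gm Fr_minus[OF m1 sm] ..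
 also have "sg (Fr R (BG (i + n - 1))) n (hth R BF BG n l (i - 1) (cx_d F i (dl R x))) y =
   (if even n then \<one> else \<ominus> \<one>) \<otimes> pr R (cx_d F i (dl R x)) (\<lambda>x. l (i - 1, x, y))"
  using pc by (simp add: sg_def Fr_inv[OF m2] e2 l_minus)
 finally show ?thesis .
qed

lemma hcx_minimal:
 assumes mF: "minimal_cx R \<mm> F BF" and mG: "minimal_cx R \<mm> G BG" and m: "ideal \<mm> R"
 shows "minimal_cx R \<mm> (hcx R F BF G BG) (hB BF BG)"
 unfolding minimal_cx_def
proof (intro allI ballI)
 fix n l and b :: "int \<times> 'x \<times> 'y" assume l: "l \<in> Vec R (hB BF BG n)"
 obtain i x y where b: "b = (i, x, y)" by (cases b) auto
 show "cx_d (hcx R F BF G BG) n l b \<in> \<mm>"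
 proof (cases "b \<in> hB BF BG (n - 1)")
  case True
  hence x: "x \<in> BF i" by (simp add: b hB_def)
  have "cx_d G (i + n) (\<lambda>y. l (i, x, y)) y \<in> \<mm>"
   using mG row_mem[OF l] unfolding minimal_cx_def by blast
  moreover have "pr R (cx_d F i (dl R x)) (\<lambda>x. l (i - 1, x, y)) \<in> \<mm>"
   by (rule pr_coeffs[OF lin_closed[OF free_cx_d[OF F refl] dl_mem[OF x]] _ m Fr_Pi[OF col_mem[OF l]]])
    (rule mF[unfolded minimal_cx_def, rule_format, OF dl_mem[OF x]])
  moreover have "(if even n then \<one> else \<ominus> \<one>) \<in> carrier R" by simp
  ultimately show ?thesis
   unfolding b hcx_d[OF l True[unfolded b]] a_minus_def using idp(3,4,5)[OF m] by blast
 next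
  case False
  thus ?thesis
   using FrD(2)[OF lin_closed[OF free_cx_d[OF hcx_iso(1) refl] l] False] idp(2)[OF m] by simp
 qed
qed

text \<open>Both sides are linear in \<open>v\<close>, so they are compared on matrix units, where
  the formula is \<open>hcx_d\<close> with the two matrix units exchanged.\<close>

lemma dual_hcx_d:
 assumes v: "v \<in> Vec R (hB BF BG (- N))" and b: "(i, x, y) \<in> hB BF BG (1 - N)"
 shows "cx_d (dual_cx R (hcx R F BF G BG) (hB BF BG)) N v (i, x, y) =
  pr R (cx_d G (i + 1 - N) (dl R y)) (\<lambda>y. v (i, x, y)) \<ominus>
  (if even N then \<ominus> \<one> else \<one>) \<otimes> cx_d F (i + 1) (\<lambda>x. v (i + 1, x, y)) x"
proof -
 let ?L = "hcx R F BF G BG" and ?B = "hB BF BG" and ?s = "if even N then \<ominus> \<one> else \<one>"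
 have x: "x \<in> BF i" and y: "y \<in> BG (i + 1 - N)" using b by (auto simp: hB_def algebra_simps)
 have s: "?s \<in> carrier R" by simp
 have cG: "cx_d G (i + 1 - N) (dl R y) \<in> Vec R (BG (i + - N))"
  by (rule lin_closed[OF free_cx_d[OF G] dl_mem[OF y]]) simp
 have cF: "cx_d F (i + 1) w \<in> Vec R (BF i)" if "w \<in> Vec R (BF (i + 1))" for w
  by (rule lin_closed[OF free_cx_d[OF F] that]) simp
 have dLb: "cx_d ?L (1 - N) (dl R (i, x, y)) \<in> Vec R (?B (- N))"
  by (rule lin_closed[OF free_cx_d[OF hcx_iso(1)] dl_mem[OF b]]) simp
 have lhs: "cx_d (dual_cx R ?L ?B) N v (i, x, y) = pr R (cx_d ?L (1 - N) (dl R (i, x, y))) v" for v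
  using b by (simp add: dual_cx_def)
 note fl = free_cx_d[OF F, of i "i + 1", simplified]
 have l1: "lin_map R (Fr R (?B (- N))) (Rm R) (\<lambda>v. pr R (cx_d ?L (1 - N) (dl R (i, x, y))) v)"
  by (rule pr_lin_right[OF dLb])
 have l2: "lin_map R (Fr R (?B (- N))) (Rm R) (\<lambda>v. pr R (cx_d G (i + 1 - N) (dl R y)) (\<lambda>y. v (i, x, y)))"
  by (rule lin_comp[OF row_lin[of BF BG "- N" i x] pr_lin_right[OF cG]])
 have l3: "lin_map R (Fr R (?B (- N))) (Rm R) (\<lambda>v. ?s \<otimes> cx_d F (i + 1) (\<lambda>x. v (i + 1, x, y)) x)"
 proof -
  note l = lin_comp[OF col_lin[of BF BG "- N" "i + 1" y] fl]
  show ?thesis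
  proof (rule lin_mapI)
   fix v assume v: "v \<in> Vec R (?B (- N))"
   note c = FrD(1)[OF lin_closed[OF l v], of x]
   show "?s \<otimes> cx_d F (i + 1) (\<lambda>x. v (i + 1, x, y)) x \<in> carrier (Rm R)" using c by (simp add: Rm_simps)
   show "?s \<otimes> cx_d F (i + 1) (\<lambda>x. (v \<oplus>\<^bsub>Fr R (?B (- N))\<^esub> w) (i + 1, x, y)) x =
     ?s \<otimes> cx_d F (i + 1) (\<lambda>x. v (i + 1, x, y)) x \<oplus>\<^bsub>Rm R\<^esub> ?s \<otimes> cx_d F (i + 1) (\<lambda>x. w (i + 1, x, y)) x"
    if w: "w \<in> Vec R (?B (- N))" for w
    unfolding lin_add[OF l v w] using c FrD(1)[OF lin_closed[OF l w], of x] by (simp add: Fr_simps Rm_simps r_distr minus_add)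
   show "?s \<otimes> cx_d F (i + 1) (\<lambda>x. (r \<odot>\<^bsub>Fr R (?B (- N))\<^esub> v) (i + 1, x, y)) x = r \<odot>\<^bsub>Rm R\<^esub> (?s \<otimes> cx_d F (i + 1) (\<lambda>x. v (i + 1, x, y)) x)"
    if r: "r \<in> carrier R" for r
    unfolding lin_smult[OF l r v] using c r s m_lcomm[OF s r c] by (simp add: Fr_simps Rm_simps)
  qed
 qed
 have z: "f \<o> = \<zero>" if "lin_map R (Fr R B) (Rm R) f" for f and B :: "'z set"
  using lin_zero[OF that FrM Rm_module] by (simp add: Fr_simps Rm_simps)
 have "pr R (cx_d ?L (1 - N) (dl R (i, x, y))) v = pr R (cx_d G (i + 1 - N) (dl R y)) (\<lambda>y. v (i, x, y)) \<ominus>\<^bsub>Rm R\<^esub>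
  ?s \<otimes> cx_d F (i + 1) (\<lambda>x. v (i + 1, x, y)) x"
 proof (rule lin_Fr_eq[OF l1 lin_minus[OF l2 l3 Rm_module] Rm_module _ v])
  fix c assume c: "c \<in> ?B (- N)"
  obtain i0 x0 y0 where c0: "c = (i0, x0, y0)" by (cases c) auto
  have x0: "x0 \<in> BF i0" and y0: "y0 \<in> BG (i0 + - N)" using c by (auto simp: c0 hB_def)
  have c': "(i0, x0, y0) \<in> ?B (1 - N - 1)" using c by (simp add: c0)
  have dF0: "cx_d F i0 (dl R x0) \<in> Vec R (BF (i0 - 1))" by (rule lin_closed[OF free_cx_d[OF F refl] dl_mem[OF x0]])
  have 1: "(\<lambda>y'. dl R (i, x, y) (i0, x0, y')) = (if i0 = i \<and> x0 = x then dl R y else \<o>)"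
   and 2: "(\<lambda>x'. dl R (i, x, y) (i0 - 1, x', y0)) = (if i0 - 1 = i \<and> y0 = y then dl R x else \<o>)"
   and 3: "(\<lambda>y'. dl R (i0, x0, y0) (i, x, y')) = (if i0 = i \<and> x0 = x then dl R y0 else \<o>)"
   and 4: "(\<lambda>x'. dl R (i0, x0, y0) (i + 1, x', y)) = (if i0 = i + 1 \<and> y0 = y then dl R x0 else \<o>)"
   by (auto simp: dl_def)
  have Gz: "cx_d G k \<o> y0 = \<zero>" for k
   using lin_zero[OF free_cx_d[OF G refl] FrM FrM, of k] by (simp add: Fr_simps)
  have Fz: "cx_d F k \<o> x = \<zero>" for k
   using lin_zero[OF free_cx_d[OF F refl] FrM FrM, of k] by (simp add: Fr_simps)
  have A: "cx_d G (i0 + (1 - N)) (\<lambda>y'. dl R (i, x, y) (i0, x0, y')) y0 = pr R (cx_d G (i + 1 - N) (dl R y)) (\<lambda>y'. dl R (i0, x0, y0) (i, x, y'))"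
  proof (cases "i0 = i \<and> x0 = x")
   case True
   thus ?thesis unfolding 1 3 using pr_right_dl[OF cG, of y0] y0 by (simp add: algebra_simps)
  next
   case False
   thus ?thesis unfolding 1 3 if_not_P[OF False] using Gz z[OF pr_lin_right[OF cG]] by simp
  qed
  have Bq: "pr R (cx_d F i0 (dl R x0)) (\<lambda>x'. dl R (i, x, y) (i0 - 1, x', y0)) = cx_d F (i + 1) (\<lambda>x'. dl R (i0, x0, y0) (i + 1, x', y)) x"
  proof (cases "i0 - 1 = i \<and> y0 = y")
   case True
   thus ?thesis unfolding 2 4 using pr_right_dl[OF dF0, of x] x by auto
  next
   case False
   hence "\<not> (i0 = i + 1 \<and> y0 = y)" by auto
   thus ?thesis unfolding 2 4 using False Fz z[OF pr_lin_right[OF dF0]] by (simp only: if_False)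
  qed
  have "pr R (cx_d ?L (1 - N) (dl R (i, x, y))) (dl R c) = cx_d ?L (1 - N) (dl R (i, x, y)) c"
   by (rule pr_right_dl[OF dLb c])
  also have "\<dots> = cx_d G (i0 + (1 - N)) (\<lambda>y'. dl R (i, x, y) (i0, x0, y')) y0 \<ominus>
    (if even (1 - N) then \<one> else \<ominus> \<one>) \<otimes> pr R (cx_d F i0 (dl R x0)) (\<lambda>x'. dl R (i, x, y) (i0 - 1, x', y0))"
   unfolding c0 by (rule hcx_d[OF dl_mem[OF b] c'])
  also have "\<dots> = pr R (cx_d G (i + 1 - N) (dl R y)) (\<lambda>y'. dl R c (i, x, y')) \<ominus> ?s \<otimes> cx_d F (i + 1) (\<lambda>x'. dl R c (i + 1, x', y)) x"
   unfolding A Bq c0 by simp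
  finally show "pr R (cx_d ?L (1 - N) (dl R (i, x, y))) (dl R c) = pr R (cx_d G (i + 1 - N) (dl R y)) (\<lambda>y'. dl R c (i, x, y')) \<ominus>\<^bsub>Rm R\<^esub>
    ?s \<otimes> cx_d F (i + 1) (\<lambda>x'. dl R c (i + 1, x', y)) x"
   using Rm_minus[OF lin_closed[OF l2 dl_mem[OF c], unfolded Rm_simps] lin_closed[OF l3 dl_mem[OF c], unfolded Rm_simps]] by simp
 qed
 thus ?thesis unfolding lhs
  using Rm_minus[OF lin_closed[OF l2 v, unfolded Rm_simps] lin_closed[OF l3 v, unfolded Rm_simps]] by simp
qed

text \<open>For finite bases the dual of Hom(F, G) is Hom(G, F) up to signs. A cycle of degree
  \<open>N\<close> becomes a homogeneous map from \<open>G\<close> to \<open>F\<close>. As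
  \<open>G\<close> starts in degree \<open>g0\<close>, it meets \<open>F\<close> only in degrees
  from \<open>N + g0\<close> on, where \<open>F\<close> is exact, and \<open>semifree_hnull\<close>
  contracts it.\<close>

lemma dual_hcx_exact:
 assumes lo: "\<And>j. j < g0 \<Longrightarrow> BG j = {}" and ex: "\<And>i. N + g0 \<le> i \<Longrightarrow> cx_exact F i"
 shows "cx_exact (dual_cx R (hcx R F BF G BG) (hB BF BG)) N"
proof -
 let ?V = "dual_cx R (hcx R F BF G BG) (hB BF BG)" and ?B = "hB BF BG"
 note Vf = dual_free_cx[OF hcx_iso(1) fin]
 note Vm = fcD(2)[OF Vf] and Fm = fcD(2)[OF F] and Gm = fcD(2)[OF G]
 have Vd: "lin_map R (Fr R (?B (- (N + 1)))) (Fr R (?B (- N))) (cx_d ?V (N + 1))" by (rule free_cx_d[OF Vf]) simp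
 \<comment> \<open>The sign (-1)^j in source degree \<open>j\<close> converts the differential of
   the dual into that of Hom(G, F).\<close>
 define e where "e j = (if even j then \<one> else \<ominus> \<one>)" for j :: int
 have ec: "e j \<in> carrier R" for j by (simp add: e_def)
 show ?thesis unfolding cx_exact_def
 proof
  fix v assume "v \<in> cycles ?V N"
  hence v: "v \<in> Vec R (?B (- N))" "cx_d ?V N v = \<o>"
   using cyclesD[of v ?V N] by (auto simp: Vm Fr_simps)
  have col: "(\<lambda>x. e j \<otimes> v (j + N, x, y)) \<in> Vec R (BF (j + N))" for j y
   by (rule Fr_smult[OF ec col_mem[OF v(1)]])
  have vc: "v b \<in> carrier R" for b by (rule FrD(1)[OF v(1)])
  define \<alpha> where "\<alpha> j = lin_ext R (Fr R (BF (j + N))) (\<lambda>y x. e j \<otimes> v (j + N, x, y))" for j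
  have al: "lin_map R (Fr R (BG j)) (Fr R (BF (j + N))) (\<alpha> j)" for j
   unfolding \<alpha>_def using col by (intro lin_ext_lin FrM) auto
  have ad: "\<alpha> j (dl R y) = (\<lambda>x. e j \<otimes> v (j + N, x, y))" if "y \<in> BG j" for j y
   unfolding \<alpha>_def using col that by (intro lin_ext_dl[OF FrM]) auto
  have aa: "\<alpha> j f x = e j \<otimes> pr R f (\<lambda>y. v (j + N, x, y))" if f: "f \<in> Vec R (BG j)" for j f x
   unfolding \<alpha>_def lin_ext_apply[OF col f] by (rule pr_right_smult[OF _ ec f]) (use vc in auto)
  have "hcyc R G F N \<alpha>"
   unfolding hcyc_def Gm Fm
  proof (intro conjI allI ballI al)
   fix j f assume f: "f \<in> Vec R (BG j)"
   have ix: "j - 1 + N = j + N - 1" by simp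
   have al': "lin_map R (Fr R (BG (j - 1))) (Fr R (BF (j + N - 1))) (\<alpha> (j - 1))" using al[of "j - 1"] unfolding ix .
   note dl' = lin_comp[OF free_cx_d[OF G refl] al']
   show "cx_d F (j + N) (\<alpha> j f) = sg (Fr R (BF (j + N - 1))) N (\<alpha> (j - 1) (cx_d G j f))"
   proof (rule lin_Fr_eq[OF lin_comp[OF al free_cx_d[OF F refl]] lin_sg_map[OF dl' FrM] FrM _ f])
    fix y assume y: "y \<in> BG j"
    have dy: "cx_d G j (dl R y) \<in> Vec R (BG (j - 1))" by (rule lin_closed[OF free_cx_d[OF G refl] dl_mem[OF y]])
    note ay = lin_closed[OF dl' dl_mem[OF y]]
    have dc: "cx_d F (j + N) (\<lambda>x. v (j + N, x, y)) \<in> Vec R (BF (j + N - 1))"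
     by (rule lin_closed[OF free_cx_d[OF F refl] col_mem[OF v(1)]])
    have l: "cx_d F (j + N) (\<alpha> j (dl R y)) = (\<lambda>x. e j \<otimes> cx_d F (j + N) (\<lambda>x. v (j + N, x, y)) x)"
     using lin_smult[OF free_cx_d[OF F refl] ec col_mem[OF v(1)], of "j + N" j y] unfolding ad[OF y] by (simp add: Fr_simps)
    show "cx_d F (j + N) (\<alpha> j (dl R y)) = sg (Fr R (BF (j + N - 1))) N (\<alpha> (j - 1) (cx_d G j (dl R y)))"
    proof
     fix x
     show "cx_d F (j + N) (\<alpha> j (dl R y)) x = sg (Fr R (BF (j + N - 1))) N (\<alpha> (j - 1) (cx_d G j (dl R y))) x"
     proof (cases "x \<in> BF (j + N - 1)")
      case True
      hence b: "(j + N - 1, x, y) \<in> ?B (1 - N)" using y by (simp add: hB_def)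
      let ?p = "pr R (cx_d G j (dl R y)) (\<lambda>y. v (j + N - 1, x, y))" and ?f = "cx_d F (j + N) (\<lambda>x. v (j + N, x, y)) x"
      have k: "?p \<in> carrier R" "?f \<in> carrier R" using pr_closed[OF _ dy] vc FrD(1)[OF dc] by (auto simp: Pi_def)
      have "?p \<ominus> (if even N then \<ominus> \<one> else \<one>) \<otimes> ?f = \<zero>" using dual_hcx_d[OF v(1) b] v(2) by simp
      hence "?p = (if even N then \<ominus> \<one> else \<one>) \<otimes> ?f" using k by (simp add: r_right_minus_eq)
      thus ?thesis unfolding l sg_def using k aa[OF dy, of x] by (auto simp: ix Fr_inv[OF ay] e_def l_minus)
     next
      case False
      thus ?thesis using FrD(2)[OF dc] FrD(2)[OF sg_closed[OF FrM ay]] ec by (simp add: l)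
     qed
    qed
   qed
  qed
  moreover have "cx_exact F (j + N)" if "BG j \<noteq> {}" for j using ex lo that by (metis add.commute add_le_cancel_left not_le)
  ultimately obtain h where h: "htpy R G F N h \<alpha>"
   using semifree_hnull[OF G bounded_below_lowers[OF G lo] fcD(1)[OF F]] unfolding hnull_def by blast
  have hl: "lin_map R (Fr R (BG j)) (Fr R (BF (j + N + 1))) (h j)" for j using htpy_lin[OF h refl, of j] by (simp add: Fm Gm)
  define g where "g j y = (if y \<in> BG j then h j (dl R y) else \<o>)" for j y
  have gm: "g j y \<in> Vec R (BF (j + N + 1))" for j y by (simp add: g_def Fr_zero lin_closed[OF hl dl_mem])
  have hg: "h j f x = pr R f (\<lambda>y. g j y x)" if f: "f \<in> Vec R (BG j)" for j f x
  proof -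
   have "h j f = lin_ext R (Fr R (BF (j + N + 1))) (g j) f"
    using gm by (intro lin_ext_unique[OF FrM _ hl _ f]) (blast, simp add: g_def)
   thus ?thesis using lin_ext_apply[OF gm f] by simp
  qed
  \<comment> \<open>The transposed homotopy in source degree \<open>i - N - 1\<close>. Its sign
    undoes \<open>e\<close>, so that \<open>dual_hcx_d\<close> returns \<open>v\<close>.\<close>
  define w where "w = (\<lambda>(i, x, y). \<ominus> e (i - 1) \<otimes> g (i - N - 1) y x)"
  have gc: "g j y x \<in> carrier R" for j y x by (rule FrD(1)[OF gm])
  have w: "w \<in> Vec R (?B (- (N + 1)))"
   unfolding Fr_fin[OF fin]
  proof (intro conjI allI impI)
   fix b :: "int \<times> 'x \<times> 'y"
   obtain i x y where b: "b = (i, x, y)" by (cases b) auto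
   show "w b \<in> carrier R" using gc ec by (simp add: w_def b)
   have ix: "i + - (N + 1) = i - N - 1" by simp
   have "b \<in> ?B (- (N + 1)) \<longleftrightarrow> x \<in> BF i \<and> y \<in> BG (i - N - 1)"
    by (simp only: b hB_def mem_Collect_eq prod.case ix)
   moreover assume "b \<notin> ?B (- (N + 1))"
   ultimately have "g (i - N - 1) y x = \<zero>" using FrD(2)[OF gm, of x "i - N - 1" y] by (auto simp: g_def)
   thus "w b = \<zero>" using ec by (simp add: w_def b)
  qed
  have "cx_d ?V (N + 1) w b = v b" for b
  proof (cases "b \<in> ?B (- N)")
   case True
   obtain i x y where b: "b = (i, x, y)" by (cases b) auto
   have xy: "x \<in> BF i" "y \<in> BG (i - N)" using True by (auto simp: b hB_def)
   let ?dG = "cx_d G (i - N) (dl R y)"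
   have dG: "?dG \<in> Vec R (BG (i - N - 1))" by (rule lin_closed[OF free_cx_d[OF G refl] dl_mem[OF xy(2)]])
   note hm = lin_closed[OF hl dl_mem[OF xy(2)], simplified]
   have dF: "cx_d F (i + 1) (h (i - N) (dl R y)) \<in> Vec R (BF i)" by (rule lin_closed[OF free_cx_d[OF F] hm]) simp
   have 1: "pr R ?dG (\<lambda>y. w (i, x, y)) = \<ominus> e (i - 1) \<otimes> h (i - N - 1) ?dG x"
    unfolding hg[OF dG] w_def using pr_right_smult[OF _ _ dG, of "\<lambda>y. g (i - N - 1) y x" "\<ominus> e (i - 1)"] gc ec by (simp add: Pi_def)
   have "(\<lambda>x. w (i + 1, x, y)) = (\<lambda>x. \<ominus> e i \<otimes> h (i - N) (dl R y) x)" using xy(2) by (simp add: w_def g_def)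
   hence 2: "cx_d F (i + 1) (\<lambda>x. w (i + 1, x, y)) x = \<ominus> e i \<otimes> cx_d F (i + 1) (h (i - N) (dl R y)) x"
    using lin_smult[OF free_cx_d[OF F refl] _ hm, of "\<ominus> e i"] ec by (simp add: Fr_simps)
   have hd: "h (i - N - 1) ?dG \<in> Vec R (BF i)" using lin_closed[OF hl dG] by simp
   have "e (i - N) \<otimes> v (i, x, y) = \<alpha> (i - N) (dl R y) x" using ad[OF xy(2)] by simp
   also have "\<dots> = cx_d F (i + 1) (h (i - N) (dl R y)) x \<oplus> sg (Fr R (BF i)) N (h (i - N - 1) ?dG) x"
    using htpy_eq[OF h, of "dl R y" "i - N" i "i - N - 1" "i + 1"] dl_mem[OF xy(2)] by (simp add: Gm Fm Fr_simps)
   finally have "e (i - N) \<otimes> (e (i - N) \<otimes> v (i, x, y)) = e (i - N) \<otimes> (cx_d F (i + 1) (h (i - N) (dl R y)) x \<oplus> sg (Fr R (BF i)) N (h (i - N - 1) ?dG) x)"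
    by simp
   moreover have "e (i - N) \<otimes> (e (i - N) \<otimes> v (i, x, y)) = v (i, x, y)" using vc by (simp add: e_def l_minus r_minus)
   moreover have "(i, x, y) \<in> ?B (1 - (N + 1))" using True by (simp add: b)
   ultimately show ?thesis
    using dual_hcx_d[OF w, of i x y] 1 2 FrD(1)[OF dF, of x] FrD(1)[OF hd, of x]
    by (auto simp: b sg_def Fr_inv[OF hd] e_def a_minus_def l_minus r_minus r_distr minus_add a_comm)
  qed (use FrD(2)[OF v(1)] FrD(2)[OF lin_closed[OF Vd w]] in simp)
  thus "\<exists>w\<in>?V$$(N + 1). cx_d ?V (N + 1) w = v"
   using w by (intro bexI[of _ w]) (auto simp: Vm)
 qed
qed

end

end

section \<open>Prime avoidance\<close>

text \<open>The ideal J : t, that is, the annihilator of the class of \<open>t\<close> in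
  R/J.\<close>

definition colon :: "('a, 'r) ring_scheme \<Rightarrow> 'a set \<Rightarrow> 'a \<Rightarrow> 'a set" where
 "colon R J t = {r \<in> carrier R. t \<otimes>\<^bsub>R\<^esub> r \<in> J}"

text \<open>The ideal J + tR. With J : t it forms the exact sequence 0 -> R/(J : t) -> R/J -> R/(J +
  tR) -> 0, whose first map is multiplication by \<open>t\<close>.\<close>

definition isum :: "('a, 'r) ring_scheme \<Rightarrow> 'a set \<Rightarrow> 'a \<Rightarrow> 'a set" where
 "isum R J t = {i \<oplus>\<^bsub>R\<^esub> t \<otimes>\<^bsub>R\<^esub> r | i r. i \<in> J \<and> r \<in> carrier R}"

definition prim :: "('a, 'r) ring_scheme \<Rightarrow> 'a set \<Rightarrow> bool" where
 "prim R Q \<longleftrightarrow> ideal Q R \<and> \<one>\<^bsub>R\<^esub> \<notin> Q \<and> (\<forall>a\<in>carrier R. \<forall>b\<in>carrier R. a \<otimes>\<^bsub>R\<^esub> b \<in> Q \<longrightarrow> a \<in> Q \<or> b \<in> Q)"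

context cring
begin

lemma colon_ideal: assumes J: "ideal J R" and t: "t \<in> carrier R" shows "ideal (colon R J t) R"
 unfolding ideal_iff
proof (intro conjI ballI)
 show "colon R J t \<subseteq> carrier R" by (auto simp: colon_def)
 show "\<zero> \<in> colon R J t" using idp(2)[OF J] t by (simp add: colon_def)
 show "x \<oplus> y \<in> colon R J t" if "x \<in> colon R J t" "y \<in> colon R J t" for x y
  using that t idp(3)[OF J] by (simp add: colon_def r_distr)
 show "r \<otimes> x \<in> colon R J t" if "r \<in> carrier R" "x \<in> colon R J t" for r x
  using that t idp(4)[OF J, of r "t \<otimes> x"] by (simp add: colon_def m_lcomm)
qed

lemma colon_superset: assumes J: "ideal J R" and t: "t \<in> carrier R" shows "J \<subseteq> colon R J t"
 using idp(1,4)[OF J] t by (auto simp: colon_def)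

lemma isum_ideal: assumes J: "ideal J R" and t: "t \<in> carrier R" shows "ideal (isum R J t) R"
 unfolding ideal_iff
proof (intro conjI ballI)
 note j = idp[OF J]
 have jc: "i \<in> carrier R" if "i \<in> J" for i using that j(1) by blast
 show "isum R J t \<subseteq> carrier R" using jc t by (auto simp: isum_def)
 show "\<zero> \<in> isum R J t" using j(2) t unfolding isum_def by (intro CollectI exI[of _ \<zero>]) simp
 show "x \<oplus> y \<in> isum R J t" if xy: "x \<in> isum R J t" "y \<in> isum R J t" for x y
 proof -
  obtain i r i' r' where h: "i \<in> J" "r \<in> carrier R" "x = i \<oplus> t \<otimes> r" "i' \<in> J" "r' \<in> carrier R" "y = i' \<oplus> t \<otimes> r'"
   using xy unfolding isum_def by blast
  have "x \<oplus> y = (i \<oplus> i') \<oplus> t \<otimes> (r \<oplus> r')" using h jc t by (simp add: r_distr a_ac)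
  thus ?thesis using h j(3) unfolding isum_def by blast
 qed
 show "s \<otimes> x \<in> isum R J t" if sx: "s \<in> carrier R" "x \<in> isum R J t" for s x
 proof -
  obtain i r where h: "i \<in> J" "r \<in> carrier R" "x = i \<oplus> t \<otimes> r" using sx(2) unfolding isum_def by blast
  have "s \<otimes> x = s \<otimes> i \<oplus> t \<otimes> (s \<otimes> r)" using h jc t sx(1) by (simp add: r_distr m_lcomm)
  thus ?thesis using h j(4) sx(1) unfolding isum_def by blast
 qed
qed

lemma isum_superset: assumes J: "ideal J R" and t: "t \<in> carrier R" shows "J \<subseteq> isum R J t" "t \<in> isum R J t"
proof -
 show "J \<subseteq> isum R J t"
 proof
  fix i assume i: "i \<in> J"
  hence "i = i \<oplus> t \<otimes> \<zero>" using idp(1)[OF J] t by auto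
  thus "i \<in> isum R J t" using i unfolding isum_def by blast
 qed
 have "t = \<zero> \<oplus> t \<otimes> \<one>" using t by simp
 thus "t \<in> isum R J t" using idp(2)[OF J] unfolding isum_def by blast
qed

lemma isum_subset: "ideal p R \<Longrightarrow> J \<subseteq> p \<Longrightarrow> t \<in> p \<Longrightarrow> isum R J t \<subseteq> p"
proof -
 assume p: "ideal p R" "J \<subseteq> p" "t \<in> p"
 have "t \<otimes> r \<in> p" if "r \<in> carrier R" for r
  using idp(4)[OF p(1) that p(3)] m_comm that idp(1)[OF p(1)] p(3) by (metis subsetD)
 thus ?thesis using p(2) idp(3)[OF p(1)] by (auto simp: isum_def)
qed

lemma primD: "prim R Q \<Longrightarrow> ideal Q R" "prim R Q \<Longrightarrow> \<one> \<notin> Q"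
 "prim R Q \<Longrightarrow> a \<in> carrier R \<Longrightarrow> b \<in> carrier R \<Longrightarrow> a \<otimes> b \<in> Q \<Longrightarrow> a \<in> Q \<or> b \<in> Q"
 by (auto simp: prim_def)

text \<open>Each ideal contributes an element outside \<open>Q\<close>; their product lies in all
  the ideals and, since \<open>Q\<close> is prime, not in \<open>Q\<close>.\<close>

lemma prim_inter:
 assumes Q: "prim R Q" and fin: "finite \<Q>" and id: "\<And>I. I \<in> \<Q> \<Longrightarrow> ideal I R \<and> \<not> I \<subseteq> Q"
 shows "\<exists>r\<in>carrier R. r \<notin> Q \<and> (\<forall>I\<in>\<Q>. r \<in> I)"
 using fin id
proof (induction rule: finite_induct)
 case empty
 thus ?case using primD(2)[OF Q] by auto
next
 case (insert I \<Q>)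
 then obtain r where r: "r \<in> carrier R" "r \<notin> Q" "\<forall>I\<in>\<Q>. r \<in> I" by auto
 have I: "ideal I R" "\<not> I \<subseteq> Q" using insert.prems by auto
 then obtain s where s: "s \<in> I" "s \<notin> Q" by blast
 have sc: "s \<in> carrier R" using idp(1)[OF I(1)] s by blast
 have "s \<otimes> r \<in> J" if J: "J \<in> \<Q>" for J
 proof -
  have "ideal J R" using insert.prems J by auto
  thus ?thesis by (rule idp(4)[OF _ sc]) (use r J in auto)
 qed
 moreover have "s \<otimes> r \<in> I" using idp(4)[OF I(1) r(1) s(1)] sc r(1) by (simp add: m_comm)
 moreover have "s \<otimes> r \<notin> Q" using primD(3)[OF Q sc r(1)] r(2) s(2) by blast
 ultimately show ?case using sc r(1) by (intro bexI[of _ "s \<otimes> r"]) auto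
qed

text \<open>If the element found for the smaller family falls into the new prime \<open>Q\<close>,
  it is corrected by an element of \<open>p\<close> that lies in all the other primes but not in
  \<open>Q\<close>. Incomparability of the primes guarantees that \<open>prim_inter\<close> supplies
  one.\<close>

lemma prime_avoidance:
 assumes p: "ideal p R" and fin: "finite \<Q>" and pr: "\<And>Q. Q \<in> \<Q> \<Longrightarrow> prim R Q \<and> \<not> p \<subseteq> Q"
  and anti: "\<And>Q Q'. Q \<in> \<Q> \<Longrightarrow> Q' \<in> \<Q> \<Longrightarrow> Q \<subseteq> Q' \<Longrightarrow> Q = Q'"
 shows "\<exists>x\<in>p. \<forall>Q\<in>\<Q>. x \<notin> Q"
 using fin pr anti
proof (induction rule: finite_induct)
 case empty
 thus ?case using idp(2)[OF p] by blast
next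
 case (insert Q \<Q>)
 obtain x where x: "x \<in> p" "\<forall>Q\<in>\<Q>. x \<notin> Q"
  using insert.IH insert.prems by (metis insertCI)
 show ?case
 proof (cases "x \<in> Q")
  case True
  have Q: "prim R Q" using insert.prems(1) by auto
  have "\<exists>r\<in>carrier R. r \<notin> Q \<and> (\<forall>I\<in>insert p \<Q>. r \<in> I)"
  proof (rule prim_inter[OF Q])
   show "finite (insert p \<Q>)" using insert.hyps by simp
   fix I assume I: "I \<in> insert p \<Q>"
   show "ideal I R \<and> \<not> I \<subseteq> Q"
   proof (cases "I = p")
    case False
    hence "I \<in> \<Q>" using I by simp
    thus ?thesis using insert.prems(1)[of I] insert.prems(2)[of I Q] insert.hyps(2) primD(1) by auto
   qed (use p insert.prems(1)[of Q] in auto)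
  qed
  then obtain y where y: "y \<in> carrier R" "y \<notin> Q" "y \<in> p" "\<forall>I\<in>\<Q>. y \<in> I" by auto
  have xc: "x \<in> carrier R" using idp(1)[OF p] x by blast
  have e1: "(x \<oplus> y) \<oplus> \<ominus> x = y" "(x \<oplus> y) \<oplus> \<ominus> y = x" using xc y(1) by (simp_all add: a_ac grp_simps)
  have "x \<oplus> y \<notin> Q"
  proof
   assume "x \<oplus> y \<in> Q"
   hence "(x \<oplus> y) \<oplus> \<ominus> x \<in> Q" using idp(3,5)[OF primD(1)[OF Q]] True by blast
   thus False using e1 y by simp
  qed
  moreover have "x \<oplus> y \<notin> Q'" if "Q' \<in> \<Q>" for Q'
  proof
   assume a: "x \<oplus> y \<in> Q'"
   have "ideal Q' R" using insert.prems(1)[of Q'] that primD(1) by auto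
   hence "(x \<oplus> y) \<oplus> \<ominus> y \<in> Q'" using idp(3,5)[of Q'] a y(4) that by blast
   thus False using e1 x that by simp
  qed
  ultimately show ?thesis using idp(3)[OF p x(1) y(3)] by blast
 qed (use x in blast)
qed

end

context noeth_cring
begin

lemma ex_maximal_ideal_pred:
 assumes "P I0" and "\<And>I. P I \<Longrightarrow> ideal I R"
 obtains I where "P I" "\<And>K. P K \<Longrightarrow> I \<subseteq> K \<Longrightarrow> K = I"
proof -
 have "{I. P I} \<noteq> {}" "\<And>I. I \<in> {I. P I} \<Longrightarrow> ideal I R" using assms by auto
 from ex_maximal_ideal_in[OF this] show ?thesis using that by auto
qed

text \<open>The ideals \<open>J : t\<close> that are maximal among those with \<open>t \<notin> J\<close> are prime, and there are only
 finitely many of them because the ideal generated by \<open>J\<close> and all such \<open>t\<close> is finitely generated.\<close>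

lemma zero_divisors_annihilated:
 assumes J: "ideal J R" and p: "ideal p R" and zd: "\<And>x. x \<in> p \<Longrightarrow> \<exists>t\<in>carrier R. t \<notin> J \<and> t \<otimes> x \<in> J"
 shows "\<exists>t\<in>carrier R. t \<notin> J \<and> p \<subseteq> colon R J t"
proof (rule ccontr)
 assume "\<not> ?thesis"
 hence np: "\<not> p \<subseteq> colon R J t" if "t \<in> carrier R" "t \<notin> J" for t using that by blast
 define T where "T = {t \<in> carrier R. t \<notin> J \<and> (\<forall>s\<in>carrier R. s \<notin> J \<and> colon R J t \<subseteq> colon R J s \<longrightarrow> colon R J s = colon R J t)}"
 have TD: "t \<in> carrier R" "t \<notin> J" if "t \<in> T" for t using that by (auto simp: T_def)
 have Tmax: "colon R J s = colon R J t" if "t \<in> T" "s \<in> carrier R" "s \<notin> J" "colon R J t \<subseteq> colon R J s" for s t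
  using that by (simp add: T_def)
 have ex: "\<exists>s\<in>T. colon R J t \<subseteq> colon R J s" if t: "t \<in> carrier R" "t \<notin> J" for t
 proof -
  let ?C = "{colon R J s | s. s \<in> carrier R \<and> s \<notin> J \<and> colon R J t \<subseteq> colon R J s}"
  have "?C \<noteq> {}" using t by blast
  then obtain I where I: "I \<in> ?C" "\<forall>K\<in>?C. I \<subseteq> K \<longrightarrow> K = I"
   using ex_maximal_ideal_in[of ?C] colon_ideal[OF J] by blast
  then obtain s where s: "s \<in> carrier R" "s \<notin> J" "colon R J t \<subseteq> colon R J s" "I = colon R J s" by blast
  have "colon R J u = colon R J s" if "u \<in> carrier R" "u \<notin> J" "colon R J s \<subseteq> colon R J u" for u
  proof -
   have "colon R J u \<in> ?C" using that s(3) by blast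
   thus ?thesis using I(2) that(3) s(4) by blast
  qed
  hence "s \<in> T" using s(1,2) by (simp add: T_def)
  thus ?thesis using s(3) by blast
 qed
 have prT: "prim R (colon R J t)" if t: "t \<in> T" for t
  unfolding prim_def
 proof (intro conjI ballI impI)
  note tc = TD[OF t]
  show "ideal (colon R J t) R" by (rule colon_ideal[OF J tc(1)])
  show "\<one> \<notin> colon R J t" using tc by (simp add: colon_def)
  fix a b assume ab: "a \<in> carrier R" "b \<in> carrier R" "a \<otimes> b \<in> colon R J t"
  show "a \<in> colon R J t \<or> b \<in> colon R J t"
  proof (cases "t \<otimes> a \<in> J")
   case False
   have "colon R J t \<subseteq> colon R J (t \<otimes> a)"
   proof
    fix r assume r: "r \<in> colon R J t"
    hence rc: "r \<in> carrier R" "t \<otimes> r \<in> J" by (auto simp: colon_def)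
    have "t \<otimes> a \<otimes> r = a \<otimes> (t \<otimes> r)" using tc ab rc by (simp add: m_ac)
    thus "r \<in> colon R J (t \<otimes> a)" using idp(4)[OF J ab(1) rc(2)] rc(1) by (simp add: colon_def)
   qed
   moreover have "t \<otimes> a \<in> carrier R" using tc ab by simp
   ultimately have "colon R J (t \<otimes> a) = colon R J t" using Tmax[OF t] False by simp
   moreover have "b \<in> colon R J (t \<otimes> a)" using ab tc by (simp add: colon_def m_assoc)
   ultimately show ?thesis by simp
  qed (use ab in \<open>simp add: colon_def\<close>)
 qed
 \<comment> \<open>A maximal member of this family contains all of \<open>T\<close>, although it is
   generated by \<open>J\<close> and finitely many of its elements.\<close>
 let ?D = "{Idl (J \<union> T0) | T0. finite T0 \<and> T0 \<subseteq> T}"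
 have sub: "J \<union> T0 \<subseteq> carrier R" if "T0 \<subseteq> T" for T0 using idp(1)[OF J] that TD(1) by blast
 have D0: "Idl (J \<union> {}) \<in> ?D" by blast
 have D1: "ideal I R" if I: "I \<in> ?D" for I
 proof -
  obtain T0 where "T0 \<subseteq> T" "I = Idl (J \<union> T0)" using I by blast
  thus ?thesis using genideal_ideal[OF sub] by simp
 qed
 obtain I where I: "I \<in> ?D" "\<And>K. K \<in> ?D \<Longrightarrow> I \<subseteq> K \<Longrightarrow> K = I"
  using ex_maximal_ideal_pred[of "\<lambda>I. I \<in> ?D", OF D0 D1] by auto
 then obtain T0 where T0: "finite T0" "T0 \<subseteq> T" "I = Idl (J \<union> T0)" by blast
 have TI: "t \<in> Idl (J \<union> T0)" if t: "t \<in> T" for t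
 proof -
  have s: "insert t T0 \<subseteq> T" using t T0(2) by blast
  have m: "J \<union> insert t T0 \<subseteq> Idl (J \<union> insert t T0)" by (rule genideal_self[OF sub[OF s]])
  have "Idl (J \<union> insert t T0) \<in> ?D" using s T0(1) by blast
  moreover have "I \<subseteq> Idl (J \<union> insert t T0)"
   unfolding T0(3) by (rule genideal_minimal[OF genideal_ideal[OF sub[OF s]]]) (use m in blast)
  ultimately have "Idl (J \<union> insert t T0) = I" using I(2) by blast
  thus ?thesis using m T0(3) by blast
 qed
 have fin: "\<exists>t0\<in>T0. colon R J t = colon R J t0" if t: "t \<in> T" for t
 proof (rule ccontr)
  assume a: "\<not> ?thesis"
  have "\<not> colon R J t0 \<subseteq> colon R J t" if t0: "t0 \<in> T0" for t0
  proof
   assume "colon R J t0 \<subseteq> colon R J t"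
   moreover have "t0 \<in> T" using t0 T0(2) by blast
   ultimately have "colon R J t = colon R J t0" using Tmax TD[OF t] by blast
   thus False using a t0 by blast
  qed
  moreover have "ideal (colon R J t0) R" if "t0 \<in> T0" for t0 by (rule colon_ideal[OF J]) (use that T0(2) TD(1) in blast)
  ultimately have "\<exists>r\<in>carrier R. r \<notin> colon R J t \<and> (\<forall>I\<in>colon R J ` T0. r \<in> I)"
   by (intro prim_inter[OF prT[OF t]]) (use T0(1) in auto)
  then obtain r where r: "r \<in> carrier R" "r \<notin> colon R J t" "\<And>t0. t0 \<in> T0 \<Longrightarrow> r \<in> colon R J t0" by blast
  \<comment> \<open>\<open>r\<close> multiplies \<open>J\<close> and \<open>T0\<close> into
    \<open>J\<close>, hence also the ideal that they generate, and this ideal contains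
    \<open>t\<close>. So \<open>r\<close> lies in \<open>colon R J t\<close>, contrary to its
    choice.\<close>
  have "J \<union> T0 \<subseteq> colon R J r"
  proof -
   have "t0 \<in> colon R J r" if "t0 \<in> T0" for t0
   proof -
    have "t0 \<in> carrier R" using that T0(2) TD(1) by blast
    thus ?thesis using r(3)[OF that] r(1) by (simp add: colon_def m_comm)
   qed
   thus ?thesis using colon_superset[OF J r(1)] by blast
  qed
  hence "Idl (J \<union> T0) \<subseteq> colon R J r" by (rule genideal_minimal[OF colon_ideal[OF J r(1)]])
  hence "t \<in> colon R J r" using TI[OF t] by blast
  hence "r \<in> colon R J t" using r(1) by (simp add: colon_def m_comm)
  thus False using r(2) by simp
 qed
 let ?Q = "colon R J ` T0"
 \<comment> \<open>These finitely many primes contain all zero divisors modulo \<open>J\<close>.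
   Since \<open>p\<close> lies in none of them, some \<open>x\<close> in \<open>p\<close> avoids
   them all, against \<open>zd\<close>.\<close>
 have "\<exists>x\<in>p. \<forall>Q\<in>?Q. x \<notin> Q"
 proof (rule prime_avoidance[OF p])
  show "finite ?Q" using T0(1) by simp
  show "prim R Q \<and> \<not> p \<subseteq> Q" if q: "Q \<in> ?Q" for Q
  proof -
   obtain t where t: "t \<in> T" "Q = colon R J t" using q T0(2) by blast
   thus ?thesis using prT[OF t(1)] np[OF TD[OF t(1)]] by simp
  qed
  show "Q = Q'" if q: "Q \<in> ?Q" "Q' \<in> ?Q" "Q \<subseteq> Q'" for Q Q'
  proof -
   obtain t t' where t: "t \<in> T" "Q = colon R J t" "t' \<in> T" "Q' = colon R J t'" using q(1,2) T0(2) by blast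
   show ?thesis using Tmax[OF t(1) TD[OF t(3)]] q(3) unfolding t(2,4) by simp
  qed
 qed
 then obtain x where x: "x \<in> p" "\<And>t0. t0 \<in> T0 \<Longrightarrow> x \<notin> colon R J t0" by blast
 obtain t where t: "t \<in> carrier R" "t \<notin> J" "t \<otimes> x \<in> J" using zd[OF x(1)] by blast
 have "x \<in> colon R J t" using t x(1) idp(1)[OF p] by (auto simp: colon_def)
 moreover obtain s where s: "s \<in> T" "colon R J t \<subseteq> colon R J s" using ex[OF t(1,2)] by blast
 moreover obtain t0 where "t0 \<in> T0" "colon R J s = colon R J t0" using fin[OF s(1)] by blast
 ultimately show False using x(2) by blast
qed

end

section \<open>Acyclic complexes of free modules that are bounded above\<close>

text \<open>\<open>tnull R C B S v I\<close>: every class in degree \<open>v\<close> of the homology of \<open>C \<otimes> R/I\<close> is killed by an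
 element of \<open>S\<close>.\<close>

definition tnull :: "('a, 'r) ring_scheme \<Rightarrow> ('a, 'b \<Rightarrow> 'a) chain_cx \<Rightarrow> (int \<Rightarrow> 'b set) \<Rightarrow> 'a set \<Rightarrow> int \<Rightarrow> 'a set \<Rightarrow> bool" where
 "tnull R C B S v I \<longleftrightarrow> (\<forall>z\<in>Vec R (B v). (\<forall>b. cx_d C v z b \<in> I) \<longrightarrow>
  (\<exists>y\<in>S. \<exists>w\<in>Vec R (B (v + 1)). \<forall>b. y \<otimes>\<^bsub>R\<^esub> z b \<ominus>\<^bsub>R\<^esub> cx_d C (v + 1) w b \<in> I))"

context cring
begin

lemma isum_decompose:
 assumes J: "ideal J R" and t: "t \<in> carrier R" and z: "z \<in> Vec R B" "\<And>b. z b \<in> isum R J t"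
 shows "\<exists>i\<in>Vec R B. \<exists>c\<in>Vec R B. (\<forall>b. i b \<in> J) \<and> z = (\<lambda>b. i b \<oplus> t \<otimes> c b)"
proof -
 have "\<exists>u. fst u \<in> J \<and> snd u \<in> carrier R \<and> z b = fst u \<oplus> t \<otimes> snd u" for b
  using z(2)[of b] unfolding isum_def by auto
 then obtain u where u: "\<And>b. fst (u b) \<in> J" "\<And>b. snd (u b) \<in> carrier R" "\<And>b. z b = fst (u b) \<oplus> t \<otimes> snd (u b)" by metis
 \<comment> \<open>Where \<open>z\<close> vanishes both coefficients are set to zero; otherwise the
   choice could have infinite support.\<close>
 let ?i = "\<lambda>b. if z b = \<zero> then \<zero> else fst (u b)" and ?c = "\<lambda>b. if z b = \<zero> then \<zero> else snd (u b)"
 have uc: "fst (u b) \<in> carrier R" for b using u(1) idp(1)[OF J] by blast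
 have fs: "finite (supp R f) \<and> supp R f \<subseteq> B" if "\<And>b. z b = \<zero> \<Longrightarrow> f b = \<zero>" for f
 proof -
  have "supp R f \<subseteq> supp R z" using that by (auto simp: supp_def)
  thus ?thesis using FrD(3,4)[OF z(1)] finite_subset by blast
 qed
 have m: "?i \<in> Vec R B" "?c \<in> Vec R B" using fs[of ?i] fs[of ?c] uc u(2) by (auto simp: Fr_carrier)
 moreover have "z = (\<lambda>b. ?i b \<oplus> t \<otimes> ?c b)"
 proof
  fix b show "z b = ?i b \<oplus> t \<otimes> ?c b" using u(3)[of b] t by auto
 qed
 moreover have "\<forall>b. ?i b \<in> J" using u(1) idp(2)[OF J] by auto
 ultimately have "(\<forall>b. ?i b \<in> J) \<and> z = (\<lambda>b. ?i b \<oplus> t \<otimes> ?c b)" by blast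
 thus ?thesis using m by (intro bexI)
qed

context
 fixes C :: "('a, 'c \<Rightarrow> 'a) chain_cx" and B
 assumes C: "free_cx R C B"
begin

lemma fd_closed: "z \<in> Vec R (B v) \<Longrightarrow> m = v - 1 \<Longrightarrow> cx_d C v z \<in> Vec R (B m)"
 using lin_closed[OF free_cx_d[OF C]] by blast

lemma fd_add: "z \<in> Vec R (B v) \<Longrightarrow> w \<in> Vec R (B v) \<Longrightarrow> cx_d C v (\<lambda>b. z b \<oplus> w b) = (\<lambda>b. cx_d C v z b \<oplus> cx_d C v w b)"
 using lin_add[OF free_cx_d[OF C refl]] by (simp add: Fr_simps)

lemma fd_smult: "r \<in> carrier R \<Longrightarrow> z \<in> Vec R (B v) \<Longrightarrow> cx_d C v (\<lambda>b. r \<otimes> z b) = (\<lambda>b. r \<otimes> cx_d C v z b)"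
 using lin_smult[OF free_cx_d[OF C refl]] by (simp add: Fr_simps)

lemma fd_minus:
 assumes "z \<in> Vec R (B v)" "w \<in> Vec R (B v)"
 shows "cx_d C v (\<lambda>b. z b \<ominus> w b) = (\<lambda>b. cx_d C v z b \<ominus> cx_d C v w b)"
 using lin_diff[OF free_cx_d[OF C refl] FrM FrM assms] Fr_minus[OF assms]
  Fr_minus[OF fd_closed[OF assms(1) refl] fd_closed[OF assms(2) refl]] by simp

lemma fd_d: "z \<in> Vec R (B v) \<Longrightarrow> m = v - 1 \<Longrightarrow> cx_d C m (cx_d C v z) = \<o>"
 using cx_dd[OF fcD(1)[OF C], of z v m "v - 2"] fcD(2)[OF C] by (simp add: Fr_simps)

lemma fd_coeffs: "z \<in> Vec R (B v) \<Longrightarrow> (\<And>b. z b \<in> I) \<Longrightarrow> ideal I R \<Longrightarrow> cx_d C v z b \<in> I"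
 by (rule lin_coeffs[OF free_cx_d[OF C refl]])

text \<open>In the sequence 0 -> R/(I : a) -> R/I -> R/(I + aR) -> 0, a class of the middle homology
  is moved by \<open>y\<close> into the image of the left one and is killed there by
  \<open>y'\<close>; the product kills it.\<close>

lemma tnull_extension:
 assumes I: "ideal I R" and a: "a \<in> carrier R" and S: "S \<subseteq> carrier R" "\<And>x y. x \<in> S \<Longrightarrow> y \<in> S \<Longrightarrow> x \<otimes> y \<in> S"
  and n1: "tnull R C B S v (colon R I a)" and n2: "tnull R C B S v (isum R I a)"
 shows "tnull R C B S v I"
 unfolding tnull_def
proof (intro ballI impI)
 fix z assume z: "z \<in> Vec R (B v)" and dz: "\<forall>b. cx_d C v z b \<in> I"
 note i = idp[OF I]
 have "\<forall>b. cx_d C v z b \<in> isum R I a" using dz isum_superset(1)[OF I a] by blast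
 then obtain y w where y: "y \<in> S" and w: "w \<in> Vec R (B (v + 1))" and yw: "\<forall>b. y \<otimes> z b \<ominus> cx_d C (v + 1) w b \<in> isum R I a"
  using n2 z unfolding tnull_def by blast
 have yc: "y \<in> carrier R" using y S by blast
 have yz: "(\<lambda>b. y \<otimes> z b) \<in> Vec R (B v)" by (rule Fr_smult[OF yc z])
 have dw: "cx_d C (v + 1) w \<in> Vec R (B v)" by (rule fd_closed[OF w]) simp
 have t: "(\<lambda>b. y \<otimes> z b \<ominus> cx_d C (v + 1) w b) \<in> Vec R (B v)" by (rule Fr_minus_mem[OF yz dw])
 obtain i1 c where i1: "i1 \<in> Vec R (B v)" "\<And>b. i1 b \<in> I" and c: "c \<in> Vec R (B v)"
  and e: "(\<lambda>b. y \<otimes> z b \<ominus> cx_d C (v + 1) w b) = (\<lambda>b. i1 b \<oplus> a \<otimes> c b)"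
  using isum_decompose[OF I a t] yw by blast
 have ac: "(\<lambda>b. a \<otimes> c b) \<in> Vec R (B v)" by (rule Fr_smult[OF a c])
 \<comment> \<open>a c agrees modulo \<open>I\<close> with y z minus a boundary, so \<open>c\<close>
   is a cycle modulo I : a.\<close>
 have "cx_d C v c b \<in> colon R I a" for b
 proof -
  have "cx_d C v (\<lambda>b. y \<otimes> z b \<ominus> cx_d C (v + 1) w b) b = cx_d C v (\<lambda>b. i1 b \<oplus> a \<otimes> c b) b" by (simp only: e)
  hence "y \<otimes> cx_d C v z b \<ominus> \<zero> = cx_d C v i1 b \<oplus> a \<otimes> cx_d C v c b"
   unfolding fd_minus[OF yz dw] fd_add[OF i1(1) ac] fd_smult[OF yc z] fd_smult[OF a c] using fd_d[OF w, of v] by simp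
  moreover have cc: "cx_d C v z b \<in> carrier R" "cx_d C v i1 b \<in> carrier R" "cx_d C v c b \<in> carrier R"
   using FrD(1)[OF fd_closed[OF z refl]] FrD(1)[OF fd_closed[OF i1(1) refl]] FrD(1)[OF fd_closed[OF c refl]] by auto
  ultimately have "a \<otimes> cx_d C v c b = y \<otimes> cx_d C v z b \<oplus> \<ominus> cx_d C v i1 b"
   using yc a by (simp add: a_minus_def grp_simps)
  moreover have "y \<otimes> cx_d C v z b \<oplus> \<ominus> cx_d C v i1 b \<in> I"
   by (intro i(3,4,5) yc dz[rule_format] fd_coeffs[OF i1 I])
  ultimately show ?thesis using cc by (simp add: colon_def)
 qed
 then obtain y' w' where y': "y' \<in> S" and w': "w' \<in> Vec R (B (v + 1))" and yw': "\<And>b. y' \<otimes> c b \<ominus> cx_d C (v + 1) w' b \<in> colon R I a"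
  using n1 c unfolding tnull_def by blast
 have y'c: "y' \<in> carrier R" using y' S by blast
 have dw': "cx_d C (v + 1) w' \<in> Vec R (B v)" by (rule fd_closed[OF w']) simp
 \<comment> \<open>The primitive found modulo I + aR, multiplied by \<open>y'\<close>, plus the
   image of the one found modulo I : a under multiplication by \<open>a\<close>.\<close>
 let ?w = "\<lambda>b. y' \<otimes> w b \<oplus> a \<otimes> w' b"
 have wm: "?w \<in> Vec R (B (v + 1))" by (intro Fr_add Fr_smult w w' a y'c)
 have "(y' \<otimes> y) \<otimes> z b \<ominus> cx_d C (v + 1) ?w b \<in> I" for b
 proof -
  have d: "cx_d C (v + 1) ?w b = y' \<otimes> cx_d C (v + 1) w b \<oplus> a \<otimes> cx_d C (v + 1) w' b"
   by (simp add: fd_add[OF Fr_smult[OF y'c w] Fr_smult[OF a w']] fd_smult[OF y'c w] fd_smult[OF a w'])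
  have k: "cx_d C (v + 1) w b \<in> carrier R" "cx_d C (v + 1) w' b \<in> carrier R" "z b \<in> carrier R" "i1 b \<in> carrier R" "c b \<in> carrier R"
   using FrD(1)[OF dw] FrD(1)[OF dw'] FrD(1)[OF z] FrD(1)[OF i1(1)] FrD(1)[OF c] by auto
  have e': "y \<otimes> z b \<ominus> cx_d C (v + 1) w b = i1 b \<oplus> a \<otimes> c b" using fun_cong[OF e, of b] .
  have "(y' \<otimes> y) \<otimes> z b \<ominus> cx_d C (v + 1) ?w b = y' \<otimes> (y \<otimes> z b \<ominus> cx_d C (v + 1) w b) \<ominus> a \<otimes> cx_d C (v + 1) w' b"
   unfolding d using k a yc y'c by (simp add: a_minus_def r_distr m_assoc r_minus minus_add a_ac)
  also have "\<dots> = y' \<otimes> i1 b \<oplus> a \<otimes> (y' \<otimes> c b \<ominus> cx_d C (v + 1) w' b)"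
   unfolding e' using k a yc y'c by (simp add: a_minus_def r_distr m_lcomm r_minus a_ac)
  also have "\<dots> \<in> I" using yw'[of b] by (intro i(3)[OF i(4)[OF y'c i1(2)]]) (simp add: colon_def)
  finally show ?thesis .
 qed
 thus "\<exists>y\<in>S. \<exists>w\<in>Vec R (B (v + 1)). \<forall>b. y \<otimes> z b \<ominus> cx_d C (v + 1) w b \<in> I"
  using wm S(2)[OF y' y] by blast
qed

text \<open>Left exactness of the top homology applied to the embedding of \<open>R/(J : t)\<close> into \<open>R/J\<close> given by \<open>t\<close>.\<close>

lemma colon_left_exact:
 assumes J: "ideal J R" and t: "t \<in> carrier R" and n: "tnull R C B {\<one>} (v + 1) (isum R J t)"
  and z: "z \<in> Vec R (B v)" and w: "w \<in> Vec R (B (v + 1))" and e: "\<And>b. t \<otimes> z b \<ominus> cx_d C (v + 1) w b \<in> J"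
 shows "\<exists>c\<in>Vec R (B (v + 1)). \<forall>b. z b \<ominus> cx_d C (v + 1) c b \<in> colon R J t"
proof -
 note j = idp[OF J]
 have dw: "cx_d C (v + 1) w \<in> Vec R (B v)" by (rule fd_closed[OF w]) simp
 have zc: "z b \<in> carrier R" and dwc: "cx_d C (v + 1) w b \<in> carrier R" for b
  using FrD(1)[OF z] FrD(1)[OF dw] by auto
 \<comment> \<open>\<open>w\<close> is a cycle modulo J + tR and hence a boundary there. So it is t
   c up to a boundary and an element with coefficients in \<open>J\<close>, and \<open>c\<close> is
   the quotient that is sought.\<close>
 have "cx_d C (v + 1) w b \<in> isum R J t" for b
 proof -
  have "cx_d C (v + 1) w b = \<ominus> (t \<otimes> z b \<ominus> cx_d C (v + 1) w b) \<oplus> t \<otimes> z b"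
   using zc[of b] dwc[of b] t by (simp add: grp_simps)
  thus ?thesis using j(5)[OF e[of b]] zc[of b] unfolding isum_def by blast
 qed
 then obtain w1 where w1: "w1 \<in> Vec R (B (v + 1 + 1))" "\<And>b. \<one> \<otimes> w b \<ominus> cx_d C (v + 1 + 1) w1 b \<in> isum R J t"
  using n w unfolding tnull_def by blast
 have dw1: "cx_d C (v + 1 + 1) w1 \<in> Vec R (B (v + 1))" by (rule fd_closed[OF w1(1)]) simp
 have w': "(\<lambda>b. w b \<ominus> cx_d C (v + 1 + 1) w1 b) \<in> Vec R (B (v + 1))" by (rule Fr_minus_mem[OF w dw1])
 have "\<And>b. w b \<ominus> cx_d C (v + 1 + 1) w1 b \<in> isum R J t" using w1(2) FrD(1)[OF w] by simp
 then obtain i1 c where i1: "i1 \<in> Vec R (B (v + 1))" "\<And>b. i1 b \<in> J" and c: "c \<in> Vec R (B (v + 1))"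
  and e1: "(\<lambda>b. w b \<ominus> cx_d C (v + 1 + 1) w1 b) = (\<lambda>b. i1 b \<oplus> t \<otimes> c b)"
  using isum_decompose[OF J t w'] by blast
 have "t \<otimes> (z b \<ominus> cx_d C (v + 1) c b) \<in> J" for b
 proof -
  have "cx_d C (v + 1) (\<lambda>b. w b \<ominus> cx_d C (v + 1 + 1) w1 b) b = cx_d C (v + 1) (\<lambda>b. i1 b \<oplus> t \<otimes> c b) b" by (simp only: e1)
  hence q: "cx_d C (v + 1) w b \<ominus> \<zero> = cx_d C (v + 1) i1 b \<oplus> t \<otimes> cx_d C (v + 1) c b"
   unfolding fd_minus[OF w dw1] fd_add[OF i1(1) Fr_smult[OF t c]] fd_smult[OF t c] using fd_d[OF w1(1), of "v + 1"] by simp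
  have cc: "cx_d C (v + 1) i1 b \<in> carrier R" "cx_d C (v + 1) c b \<in> carrier R"
   using FrD(1)[OF fd_closed[OF i1(1) refl]] FrD(1)[OF fd_closed[OF c refl]] by auto
  have q': "cx_d C (v + 1) w b = cx_d C (v + 1) i1 b \<oplus> t \<otimes> cx_d C (v + 1) c b" using q dwc[of b] by (simp add: a_minus_def)
  have "t \<otimes> (z b \<ominus> cx_d C (v + 1) c b) = (t \<otimes> z b \<ominus> cx_d C (v + 1) w b) \<oplus> cx_d C (v + 1) i1 b"
   unfolding q' using zc[of b] cc t by (simp add: r_distr r_minus grp_simps)
  thus ?thesis using j(3)[OF e fd_coeffs[OF i1 J]] by simp
 qed
 moreover have "z b \<ominus> cx_d C (v + 1) c b \<in> carrier R" for b
  using zc FrD(1)[OF fd_closed[OF c refl]] by simp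
 ultimately show ?thesis using c by (auto simp: colon_def)
qed

text \<open>By \<open>reg\<close>, multiplication by \<open>x\<close> is injective on R/J. In the
  long exact sequence the homology modulo J + xR in degree \<open>v\<close> lies between that of C
  \<otimes> R/J in degrees \<open>v\<close> and \<open>v - 1\<close>, hence the assumption on all
  degrees.\<close>

lemma tnull_regular:
 assumes J: "ideal J R" and x: "x \<in> carrier R" and S: "S \<subseteq> carrier R" "\<And>x y. x \<in> S \<Longrightarrow> y \<in> S \<Longrightarrow> x \<otimes> y \<in> S"
  and reg: "colon R J x = J" and n: "\<And>u. tnull R C B S u J"
 shows "tnull R C B S v (isum R J x)"
 unfolding tnull_def
proof (intro ballI impI)
 fix z assume z: "z \<in> Vec R (B v)" and dz: "\<forall>b. cx_d C v z b \<in> isum R J x"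
 note j = idp[OF J]
 have dzm: "cx_d C v z \<in> Vec R (B (v - 1))" by (rule fd_closed[OF z refl])
 obtain i c where i: "i \<in> Vec R (B (v - 1))" "\<And>b. i b \<in> J" and c: "c \<in> Vec R (B (v - 1))"
  and e: "cx_d C v z = (\<lambda>b. i b \<oplus> x \<otimes> c b)"
  using isum_decompose[OF J x dzm] dz by blast
 have "cx_d C (v - 1) c b \<in> J" for b
 proof -
  have "cx_d C (v - 1) (\<lambda>b. i b \<oplus> x \<otimes> c b) b = \<zero>" using fd_d[OF z refl] by (simp add: e[symmetric])
  hence q: "cx_d C (v - 1) i b \<oplus> x \<otimes> cx_d C (v - 1) c b = \<zero>"
   unfolding fd_add[OF i(1) Fr_smult[OF x c]] fd_smult[OF x c] .
  have cc: "cx_d C (v - 1) i b \<in> carrier R" "cx_d C (v - 1) c b \<in> carrier R"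
   using FrD(1)[OF fd_closed[OF i(1) refl]] FrD(1)[OF fd_closed[OF c refl]] by auto
  have "x \<otimes> cx_d C (v - 1) c b = \<ominus> cx_d C (v - 1) i b \<oplus> (cx_d C (v - 1) i b \<oplus> x \<otimes> cx_d C (v - 1) c b)"
   using cc x by (simp add: grp_simps r_neg1)
  hence "x \<otimes> cx_d C (v - 1) c b = \<ominus> cx_d C (v - 1) i b" using q cc by simp
  hence "x \<otimes> cx_d C (v - 1) c b \<in> J" using j(5)[OF fd_coeffs[OF i J]] by simp
  hence "cx_d C (v - 1) c b \<in> colon R J x" using cc by (simp add: colon_def)
  thus ?thesis by (simp add: reg)
 qed
 then obtain y w where y: "y \<in> S" and w: "w \<in> Vec R (B v)" and yw: "\<And>b. y \<otimes> c b \<ominus> cx_d C v w b \<in> J"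
  using n[of "v - 1"] c unfolding tnull_def by (metis diff_add_cancel)
 have yc: "y \<in> carrier R" using y S by blast
 \<comment> \<open>The boundary of \<open>z\<close> is x c modulo \<open>J\<close>, and y c is the
   boundary of \<open>w\<close> modulo \<open>J\<close>; so subtracting x w from y z leaves a cycle
   modulo \<open>J\<close>.\<close>
 let ?t = "\<lambda>b. y \<otimes> z b \<ominus> x \<otimes> w b"
 have t: "?t \<in> Vec R (B v)" by (intro Fr_minus_mem Fr_smult z w x yc)
 have "cx_d C v ?t b \<in> J" for b
 proof -
  have k: "i b \<in> carrier R" "c b \<in> carrier R" "cx_d C v w b \<in> carrier R"
   using FrD(1)[OF i(1)] FrD(1)[OF c] FrD(1)[OF fd_closed[OF w refl]] by auto
  have "cx_d C v ?t b = y \<otimes> (i b \<oplus> x \<otimes> c b) \<ominus> x \<otimes> cx_d C v w b"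
   by (simp add: fd_minus[OF Fr_smult[OF yc z] Fr_smult[OF x w]] fd_smult[OF yc z] fd_smult[OF x w] e)
  also have "\<dots> = y \<otimes> i b \<oplus> x \<otimes> (y \<otimes> c b \<ominus> cx_d C v w b)"
   using k x yc by (simp add: r_distr r_minus m_lcomm grp_simps)
  also have "\<dots> \<in> J" by (intro j(3,4) yc x i(2) yw)
  finally show ?thesis .
 qed
 then obtain y' w' where y': "y' \<in> S" and w': "w' \<in> Vec R (B (v + 1))" and yw': "\<And>b. y' \<otimes> ?t b \<ominus> cx_d C (v + 1) w' b \<in> J"
  using n[of v] t unfolding tnull_def by blast
 have y'c: "y' \<in> carrier R" using y' S by blast
 have "(y' \<otimes> y) \<otimes> z b \<ominus> cx_d C (v + 1) w' b \<in> isum R J x" for b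
 proof -
  have dw': "cx_d C (v + 1) w' \<in> Vec R (B v)" by (rule fd_closed[OF w']) simp
  have k: "z b \<in> carrier R" "w b \<in> carrier R" "cx_d C (v + 1) w' b \<in> carrier R"
   using FrD(1)[OF z] FrD(1)[OF w] FrD(1)[OF dw'] by auto
  have "(y' \<otimes> y) \<otimes> z b \<ominus> cx_d C (v + 1) w' b = (y' \<otimes> ?t b \<ominus> cx_d C (v + 1) w' b) \<oplus> x \<otimes> (y' \<otimes> w b)"
   using k x yc y'c by (simp add: r_distr r_minus m_lcomm m_assoc grp_simps)
  thus ?thesis using yw'[of b] k y'c unfolding isum_def by blast
 qed
 thus "\<exists>y\<in>S. \<exists>w\<in>Vec R (B (v + 1)). \<forall>b. y \<otimes> z b \<ominus> cx_d C (v + 1) w b \<in> isum R J x"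
  using w' S(2)[OF y' y] by blast
qed

text \<open>The new ideal is the kernel of the map from R to the localisation of R/J at
  \<open>S\<close>. The boundary of \<open>z\<close> has finitely many nonzero coefficients, so a
  single element of \<open>S\<close> carries all of them into \<open>J\<close>.\<close>

lemma tnull_saturate:
 assumes J: "ideal J R" and S: "S \<subseteq> carrier R" "\<one> \<in> S" "\<And>x y. x \<in> S \<Longrightarrow> y \<in> S \<Longrightarrow> x \<otimes> y \<in> S"
  and n: "tnull R C B S v J"
 shows "tnull R C B S v {r \<in> carrier R. \<exists>y\<in>S. y \<otimes> r \<in> J}"
 unfolding tnull_def
proof (intro ballI impI)
 fix z assume z: "z \<in> Vec R (B v)" and dz: "\<forall>b. cx_d C v z b \<in> {r \<in> carrier R. \<exists>y\<in>S. y \<otimes> r \<in> J}"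
 note j = idp[OF J]
 have dzm: "cx_d C v z \<in> Vec R (B (v - 1))" by (rule fd_closed[OF z refl])
 have "\<exists>y\<in>S. \<forall>b\<in>A. y \<otimes> cx_d C v z b \<in> J" if "finite A" for A
  using that
 proof (induction rule: finite_induct)
  case (insert a A)
  then obtain y where y: "y \<in> S" "\<forall>b\<in>A. y \<otimes> cx_d C v z b \<in> J" by blast
  obtain y' where y': "y' \<in> S" "y' \<otimes> cx_d C v z a \<in> J" using dz by blast
  have c: "y \<in> carrier R" "y' \<in> carrier R" using y y' S by auto
  have k: "cx_d C v z b \<in> carrier R" for b using FrD(1)[OF dzm] .
  have "(y' \<otimes> y) \<otimes> cx_d C v z b \<in> J" if "b \<in> insert a A" for b
  proof (cases "b = a")
   case True
   have "(y' \<otimes> y) \<otimes> cx_d C v z b = y \<otimes> (y' \<otimes> cx_d C v z a)" using c k True by (simp add: m_ac)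
   thus ?thesis using j(4)[OF c(1) y'(2)] by simp
  next
   case False
   hence "y \<otimes> cx_d C v z b \<in> J" using that y by simp
   from j(4)[OF c(2) this] show ?thesis using c k by (simp add: m_assoc)
  qed
  thus ?case using S(3)[OF y'(1) y(1)] by blast
 qed (use S(2) in blast)
 from this[OF FrD(3)[OF dzm]] obtain y where y: "y \<in> S" "\<And>b. b \<in> supp R (cx_d C v z) \<Longrightarrow> y \<otimes> cx_d C v z b \<in> J" by blast
 have yc: "y \<in> carrier R" using y S by blast
 have "cx_d C v (\<lambda>b. y \<otimes> z b) b \<in> J" for b
  using y(2)[of b] yc j(2) by (cases "b \<in> supp R (cx_d C v z)") (simp_all add: fd_smult[OF yc z] supp_def)
 then obtain y' w where y': "y' \<in> S" and w: "w \<in> Vec R (B (v + 1))" and yw: "\<And>b. y' \<otimes> (y \<otimes> z b) \<ominus> cx_d C (v + 1) w b \<in> J"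
  using n Fr_smult[OF yc z] unfolding tnull_def by blast
 have y'c: "y' \<in> carrier R" using y' S by blast
 have "(y' \<otimes> y) \<otimes> z b \<ominus> cx_d C (v + 1) w b \<in> {r \<in> carrier R. \<exists>y\<in>S. y \<otimes> r \<in> J}" for b
 proof -
  have "(y' \<otimes> y) \<otimes> z b \<ominus> cx_d C (v + 1) w b \<in> J" using yw[of b] yc y'c FrD(1)[OF z, of b] by (simp add: m_assoc)
  thus ?thesis using j(1) S(2) by (auto intro!: bexI[of _ \<one>])
 qed
 thus "\<exists>y\<in>S. \<exists>w\<in>Vec R (B (v + 1)). \<forall>b. y \<otimes> z b \<ominus> cx_d C (v + 1) w b \<in> {r \<in> carrier R. \<exists>y\<in>S. y \<otimes> r \<in> J}"
  using w S(3)[OF y' y(1)] by blast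
qed

lemma tnull_zero:
 assumes "cx_exact C v" "\<one> \<in> S" shows "tnull R C B S v {\<zero>}"
 unfolding tnull_def
proof (intro ballI impI)
 fix z assume z: "z \<in> Vec R (B v)" and dz: "\<forall>b. cx_d C v z b \<in> {\<zero>}"
 have "cx_d C v z = \<o>" using dz by auto
 then obtain w where w: "w \<in> Vec R (B (v + 1))" "cx_d C (v + 1) w = z"
  using cx_exactD[OF assms(1), of z "v + 1"] z by (auto simp: fcD(2)[OF C] Fr_simps)
 hence "\<one> \<otimes> z b \<ominus> cx_d C (v + 1) w b \<in> {\<zero>}" for b using FrD(1)[OF z, of b] by (simp add: a_minus_def r_neg)
 thus "\<exists>y\<in>S. \<exists>w\<in>Vec R (B (v + 1)). \<forall>b. y \<otimes> z b \<ominus> cx_d C (v + 1) w b \<in> {\<zero>}"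
  using assms(2) w(1) by blast
qed

end

end

context noeth_cring
begin

text \<open>Let \<open>v\<close> be the largest degree and \<open>p\<close> a maximal ideal such that the homology of \<open>C \<otimes> R/p\<close> in
 degree \<open>v\<close> is nonzero. Then \<open>p\<close> is prime and this homology is a torsion-free module over \<open>R/p\<close>. A maximal
 ideal \<open>J \<subseteq> p\<close> for which all homology of \<open>C \<otimes> R/J\<close> is torsion with respect to the complement of \<open>p\<close> has \<open>p\<close> as
 an associated prime; hence \<open>R/p\<close> embeds in \<open>R/J\<close> and the homology in degree \<open>v\<close> vanishes after all.\<close>

lemma acyclic_bounded_above_pure:
 assumes C: "free_cx R C B" and ex: "\<And>v. cx_exact C v"
  and bd: "\<And>v I. v > n \<Longrightarrow> ideal I R \<Longrightarrow> tnull R C B {\<one>} v I" and I: "ideal I R"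
 shows "tnull R C B {\<one>} v I"
proof (rule ccontr)
 assume neg: "\<not> tnull R C B {\<one>} v I"
 let ?bad = "\<lambda>k. \<exists>I. ideal I R \<and> \<not> tnull R C B {\<one>} (n - int k) I"
 have vn: "v \<le> n" using bd[OF _ I] neg by (meson not_le)
 hence "?bad (nat (n - v))" using neg I by auto
 hence k: "?bad (LEAST k. ?bad k)" by (rule LeastI)
 \<comment> \<open>The largest degree in which C \<otimes> R/I has homology for some ideal I;
   \<open>top\<close> is the vanishing above it.\<close>
 define v0 where "v0 = n - int (LEAST k. ?bad k)"
 have top: "tnull R C B {\<one>} u I" if "v0 < u" "ideal I R" for u I
 proof (cases "u > n")
  case False
  hence u: "u = n - int (nat (n - u))" by simp
  have "nat (n - u) < (LEAST k. ?bad k)" using that(1) False by (auto simp: v0_def)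
  hence "\<not> ?bad (nat (n - u))" by (rule not_less_Least)
  thus ?thesis using u that(2) by auto
 qed (use bd that in blast)
 let ?C = "{I. ideal I R \<and> \<not> tnull R C B {\<one>} v0 I}"
 have "?C \<noteq> {}" using k by (auto simp: v0_def)
 then obtain p where p: "ideal p R" "\<not> tnull R C B {\<one>} v0 p" "\<And>K. ideal K R \<Longrightarrow> p \<subseteq> K \<Longrightarrow> K \<noteq> p \<Longrightarrow> tnull R C B {\<one>} v0 K"
  using ex_maximal_ideal_in[of ?C] by blast
 have one: "{\<one>} \<subseteq> carrier R" "\<And>x y. x \<in> {\<one>} \<Longrightarrow> y \<in> {\<one>} \<Longrightarrow> x \<otimes> y \<in> {\<one>}" by auto
 have prime: "prim R p"
  unfolding prim_def
 proof (intro conjI ballI impI p(1))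
  show "\<one> \<notin> p"
  proof
   assume "\<one> \<in> p"
   hence pR: "p = carrier R" using ideal.one_imp_carrier[OF p(1)] by blast
   have "tnull R C B {\<one>} v0 p"
    unfolding tnull_def pR
   proof (intro ballI impI)
    fix z assume z: "z \<in> Vec R (B v0)"
    have "\<one> \<otimes> z b \<ominus> cx_d C (v0 + 1) \<o> b \<in> carrier R" for b
     using FrD(1)[OF z, of b] FrD(1)[OF fd_closed[OF C Fr_zero refl], of "v0 + 1" b] by simp
    thus "\<exists>y\<in>{\<one>}. \<exists>w\<in>Vec R (B (v0 + 1)). \<forall>b. y \<otimes> z b \<ominus> cx_d C (v0 + 1) w b \<in> carrier R"
     using Fr_zero[of "B (v0 + 1)"] by blast
   qed
   thus False using p(2) by simp
  qed
  fix a b assume ab: "a \<in> carrier R" "b \<in> carrier R" "a \<otimes> b \<in> p"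
  show "a \<in> p \<or> b \<in> p"
  proof (rule ccontr)
   assume n: "\<not> (a \<in> p \<or> b \<in> p)"
   \<comment> \<open>R/p would be an extension of the quotients by two strictly larger ideals, for
     which the homology vanishes by the choice of \<open>p\<close>.\<close>
   have "b \<in> colon R p a" using ab by (simp add: colon_def)
   hence 1: "tnull R C B {\<one>} v0 (colon R p a)"
    using n colon_superset[OF p(1) ab(1)] by (intro p(3) colon_ideal p(1) ab(1)) auto
   have 2: "tnull R C B {\<one>} v0 (isum R p a)"
    using n isum_superset[OF p(1) ab(1)] by (intro p(3) isum_ideal p(1) ab(1)) auto
   show False using tnull_extension[OF C p(1) ab(1) one 1 2] p(2) by blast
  qed
 qed
 let ?S = "carrier R - p"
 have S: "?S \<subseteq> carrier R" "\<one> \<in> ?S" "\<And>x y. x \<in> ?S \<Longrightarrow> y \<in> ?S \<Longrightarrow> x \<otimes> y \<in> ?S"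
  using primD[OF prime] by auto
 \<comment> \<open>Vanishing after localisation at \<open>p\<close>, phrased without fractions. The
   zero ideal belongs to the family because \<open>C\<close> is exact.\<close>
 let ?J = "{J. ideal J R \<and> J \<subseteq> p \<and> (\<forall>u. tnull R C B ?S u J)}"
 have J0: "{\<zero>} \<in> ?J" using zeroideal tnull_zero[OF C ex S(2)] idp(2)[OF p(1)] by auto
 have J1: "ideal K R" if "K \<in> ?J" for K using that by simp
 obtain J where J': "J \<in> ?J" and Jm: "\<And>K. K \<in> ?J \<Longrightarrow> J \<subseteq> K \<Longrightarrow> K = J"
  using ex_maximal_ideal_pred[of "\<lambda>I. I \<in> ?J", OF J0 J1] by auto
 have J: "ideal J R" "J \<subseteq> p" "\<And>u. tnull R C B ?S u J" using J' by simp_all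
 have Jmax: "K = J" if "ideal K R" "K \<subseteq> p" "\<And>u. tnull R C B ?S u K" "J \<subseteq> K" for K
  using Jm[of K] that by simp
 have "\<exists>t\<in>carrier R. t \<notin> J \<and> t \<otimes> x \<in> J" if x: "x \<in> p" for x
 proof -
  have xc: "x \<in> carrier R" using x idp(1)[OF p(1)] by blast
  show ?thesis
  proof (cases "x \<in> J")
   case True
   have "\<one> \<notin> J" using J(2) primD(2)[OF prime] by blast
   thus ?thesis using True xc by (intro bexI[of _ \<one>]) auto
  next
   case False
   \<comment> \<open>If \<open>x\<close> were regular modulo \<open>J\<close>, then J + xR would be
     a larger member of the family.\<close>
   have "colon R J x \<noteq> J"
   proof
    assume reg: "colon R J x = J"
    have "isum R J x = J"
     by (rule Jmax[OF isum_ideal[OF J(1) xc] isum_subset[OF p(1) J(2) x] tnull_regular[OF C J(1) xc S(1,3) reg J(3)] isum_superset(1)[OF J(1) xc]])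
    thus False using False isum_superset(2)[OF J(1) xc] by blast
   qed
   then obtain t where "t \<in> colon R J x" "t \<notin> J" using colon_superset[OF J(1) xc] by blast
   thus ?thesis using xc by (auto simp: colon_def m_comm)
  qed
 qed
 then obtain t where t: "t \<in> carrier R" "t \<notin> J" "p \<subseteq> colon R J t"
  using zero_divisors_annihilated[OF J(1) p(1)] by blast
 let ?K = "{r \<in> carrier R. \<exists>y\<in>?S. y \<otimes> r \<in> J}"
 have K: "ideal ?K R"
  unfolding ideal_iff
 proof (intro conjI ballI)
  note j = idp[OF J(1)]
  show "\<zero> \<in> ?K" using S(2) j(2) by auto
  show "x \<oplus> y \<in> ?K" if xy: "x \<in> ?K" "y \<in> ?K" for x y
  proof -
   obtain s s' where s: "s \<in> ?S" "s \<otimes> x \<in> J" "s' \<in> ?S" "s' \<otimes> y \<in> J" using xy by blast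
   have c: "s \<in> carrier R" "s' \<in> carrier R" "x \<in> carrier R" "y \<in> carrier R" using s xy by auto
   have "(s \<otimes> s') \<otimes> (x \<oplus> y) = s' \<otimes> (s \<otimes> x) \<oplus> s \<otimes> (s' \<otimes> y)" using c by (simp add: r_distr m_ac)
   hence "(s \<otimes> s') \<otimes> (x \<oplus> y) \<in> J" using j(3,4) s c by simp
   thus ?thesis using S(3)[OF s(1,3)] c by blast
  qed
  show "r \<otimes> x \<in> ?K" if rx: "r \<in> carrier R" "x \<in> ?K" for r x
  proof -
   obtain s where s: "s \<in> ?S" "s \<otimes> x \<in> J" using rx by blast
   have "s \<otimes> (r \<otimes> x) = r \<otimes> (s \<otimes> x)" using s rx by (simp add: m_lcomm)
   hence "s \<otimes> (r \<otimes> x) \<in> J" using j(4)[OF rx(1) s(2)] by simp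
   thus ?thesis using s(1) rx by blast
  qed
 qed auto
 \<comment> \<open>The saturation of \<open>J\<close> with respect to the complement of
   \<open>p\<close> is again in the family, so \<open>J\<close> is saturated. This forces the
   annihilator of \<open>t\<close> into \<open>p\<close>.\<close>
 have KJ: "?K = J"
 proof (rule Jmax[OF K _ tnull_saturate[OF C J(1) S J(3)]])
  show "?K \<subseteq> p" using primD(3)[OF prime] J(2) by blast
  show "J \<subseteq> ?K" using S(2) idp(1)[OF J(1)] by (auto intro!: bexI[of _ \<one>])
 qed
 have "x \<in> p" if x: "x \<in> colon R J t" for x
 proof (rule ccontr)
  assume "x \<notin> p"
  moreover have "x \<in> carrier R" "x \<otimes> t \<in> J" using x t(1) by (auto simp: colon_def m_comm)
  ultimately have "t \<in> ?K" using t(1) by blast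
  thus False using t(2) unfolding KJ by simp
 qed
 hence "colon R J t \<subseteq> p" by blast
 hence cp: "colon R J t = p" using t(3) by blast
 have "tnull R C B {\<one>} v0 p"
  unfolding tnull_def
 proof (intro ballI impI)
  fix z assume z: "z \<in> Vec R (B v0)" and dz: "\<forall>b. cx_d C v0 z b \<in> p"
  have tz: "(\<lambda>b. t \<otimes> z b) \<in> Vec R (B v0)" by (rule Fr_smult[OF t(1) z])
  have "cx_d C v0 (\<lambda>b. t \<otimes> z b) b \<in> J" for b
   using dz cp by (simp add: fd_smult[OF C t(1) z]) (auto simp: colon_def)
  then obtain y w where y: "y \<in> ?S" and w: "w \<in> Vec R (B (v0 + 1))" and e: "\<And>b. y \<otimes> (t \<otimes> z b) \<ominus> cx_d C (v0 + 1) w b \<in> J"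
   using J(3)[of v0] tz unfolding tnull_def by blast
  have yc: "y \<in> carrier R" "y \<notin> p" using y by auto
  have yz: "(\<lambda>b. y \<otimes> z b) \<in> Vec R (B v0)" by (rule Fr_smult[OF yc(1) z])
  have "t \<otimes> (y \<otimes> z b) \<ominus> cx_d C (v0 + 1) w b \<in> J" for b using e[of b] t(1) yc(1) FrD(1)[OF z, of b] by (simp add: m_lcomm)
  \<comment> \<open>y t z is a boundary modulo \<open>J\<close>. Left exactness in the top degree is
    applied twice: first to divide by \<open>t\<close>, then by \<open>y\<close>, which is regular
    modulo \<open>p\<close>.\<close>
  from colon_left_exact[OF C J(1) t(1) top[OF _ isum_ideal[OF J(1) t(1)]] yz w this]
  obtain c where c: "c \<in> Vec R (B (v0 + 1))" "\<And>b. y \<otimes> z b \<ominus> cx_d C (v0 + 1) c b \<in> p" unfolding cp by auto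
  from colon_left_exact[OF C p(1) yc(1) top[OF _ isum_ideal[OF p(1) yc(1)]] z c]
  obtain c' where c': "c' \<in> Vec R (B (v0 + 1))" "\<And>b. z b \<ominus> cx_d C (v0 + 1) c' b \<in> colon R p y" by auto
  have "colon R p y \<subseteq> p" using primD(3)[OF prime yc(1)] yc(2) by (auto simp: colon_def)
  hence "\<one> \<otimes> z b \<ominus> cx_d C (v0 + 1) c' b \<in> p" for b using c'(2)[of b] FrD(1)[OF z, of b] by auto
  thus "\<exists>y\<in>{\<one>}. \<exists>w\<in>Vec R (B (v0 + 1)). \<forall>b. y \<otimes> z b \<ominus> cx_d C (v0 + 1) w b \<in> p"
   using c'(1) by blast
 qed
 thus False using p(2) by simp
qed

end

section \<open>Matrices with rows in a submodule\<close>

text \<open>An element of \<open>Fr R B \<otimes> Fr R \<beta>\<close> with \<open>\<beta>\<close> finite is a matrix \<open>m\<close> with columns \<open>m y\<close> in \<open>Fr R B\<close>;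
 it belongs to \<open>Fr R B \<otimes> W\<close> for a submodule \<open>W\<close> of \<open>Fr R \<beta>\<close> iff its rows lie in \<open>W\<close>.\<close>

definition mat :: "('a, 'r) ring_scheme \<Rightarrow> 'b set \<Rightarrow> ('y \<Rightarrow> 'a) set \<Rightarrow> ('y \<Rightarrow> 'b \<Rightarrow> 'a) set" where
 "mat R B W = {m. (\<forall>y. m y \<in> Vec R B) \<and> (\<forall>b. (\<lambda>y. m y b) \<in> W)}"

lemma matD: "m \<in> mat R B W \<Longrightarrow> m y \<in> Vec R B" "m \<in> mat R B W \<Longrightarrow> (\<lambda>y. m y b) \<in> W"
 by (auto simp: mat_def)

context cring
begin

lemma sub_FrD:
 assumes "submodule W R (Fr R \<beta>)"
 shows "W \<subseteq> Vec R \<beta>" "\<o> \<in> W" "x \<in> W \<Longrightarrow> y \<in> W \<Longrightarrow> (\<lambda>b. x b \<oplus> y b) \<in> W"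
  "r \<in> carrier R \<Longrightarrow> x \<in> W \<Longrightarrow> (\<lambda>b. r \<otimes> x b) \<in> W" "x \<in> W \<Longrightarrow> y \<in> W \<Longrightarrow> (\<lambda>b. x b \<ominus> y b) \<in> W"
proof -
 note s = assms[unfolded submodule_Fr_iff]
 show "W \<subseteq> Vec R \<beta>" "\<o> \<in> W" using s by auto
 show a: "(\<lambda>b. x b \<oplus> y b) \<in> W" if "x \<in> W" "y \<in> W" for x y using s that by auto
 show m: "(\<lambda>b. r \<otimes> x b) \<in> W" if "r \<in> carrier R" "x \<in> W" for r x using s that by auto
 assume x: "x \<in> W" and y: "y \<in> W"
 have "x \<in> Vec R \<beta>" "y \<in> Vec R \<beta>" using s x y by auto
 hence c: "x b \<in> carrier R" "y b \<in> carrier R" for b by (simp_all add: FrD(1))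
 have "(\<lambda>b. x b \<ominus> y b) = (\<lambda>b. x b \<oplus> \<ominus> \<one> \<otimes> y b)" using c by (simp add: a_minus_def l_minus)
 thus "(\<lambda>b. x b \<ominus> y b) \<in> W" using a[OF x m[OF _ y, of "\<ominus> \<one>"]] by simp
qed

text \<open>An element of Fr R B \<otimes> W is the finite sum, over its nonzero rows
  \<open>u\<close>, of the tensors of \<open>u\<close> with the corresponding basis vectors.\<close>

lemma mat_induct [consumes 3, case_names zero step]:
 assumes m: "m \<in> mat R B W" and fin: "finite \<beta>" and W: "submodule W R (Fr R \<beta>)"
  and zero: "P (\<lambda>_ _. \<zero>)"
  and step: "\<And>m a u. m \<in> mat R B W \<Longrightarrow> a \<in> B \<Longrightarrow> u \<in> W \<Longrightarrow> P m \<Longrightarrow> P (\<lambda>y b. m y b \<oplus> u y \<otimes> dl R a b)"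
 shows "P m"
proof -
 note w = sub_FrD[OF W]
 let ?A = "\<Union>y\<in>\<beta>. supp R (m y)"
 have main: "P m" if "finite A" "A \<subseteq> B" "m \<in> mat R B W" "\<And>y b. b \<notin> A \<Longrightarrow> m y b = \<zero>" for A m
  using that
 proof (induction arbitrary: m rule: finite_induct)
  case empty
  hence "m = (\<lambda>_ _. \<zero>)" by auto
  thus ?case using zero by simp
 next
  case (insert a A)
  let ?m = "\<lambda>y b. if b = a then \<zero> else m y b" and ?u = "\<lambda>y. m y a"
  have "?m y \<in> Vec R B" for y
  proof -
   have "supp R (?m y) \<subseteq> supp R (m y)" by (auto simp: supp_def)
   thus ?thesis using matD(1)[OF insert.prems(2), of y] finite_subset unfolding Fr_carrier by fastforce
  qed
  moreover have "(\<lambda>y. ?m y b) \<in> W" for b using w(2) matD(2)[OF insert.prems(2), of b] by (cases "b = a") simp_all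
  ultimately have mm: "?m \<in> mat R B W" by (simp add: mat_def)
  have u: "?u \<in> W" by (rule matD(2)[OF insert.prems(2)])
  have "P ?m" by (rule insert.IH[OF _ mm]) (use insert.prems in auto)
  from step[OF mm _ u this, of a] have "P (\<lambda>y b. ?m y b \<oplus> m y a \<otimes> dl R a b)" using insert.prems(1) by simp
  moreover have "(\<lambda>y b. ?m y b \<oplus> m y a \<otimes> dl R a b) = m"
   using FrD(1)[OF matD(1)[OF insert.prems(2)]] by (intro ext) (auto simp: dl_def)
  ultimately show ?case by simp
 qed
 have f1: "finite ?A" using fin FrD(3)[OF matD(1)[OF m]] by blast
 have f2: "?A \<subseteq> B" using FrD(4)[OF matD(1)[OF m]] by blast
 have f3: "m y b = \<zero>" if b: "b \<notin> ?A" for y b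
 proof (cases "y \<in> \<beta>")
  case False
  have "(\<lambda>y. m y b) \<in> Vec R \<beta>" using matD(2)[OF m] w(1) by blast
  from FrD(2)[OF this False] show ?thesis by simp
 qed (use b in \<open>auto simp: supp_def\<close>)
 show ?thesis by (rule main[OF f1 f2 m f3])
qed

lemma mat_step:
 assumes \<phi>: "lin_map R (Fr R B) (Fr R B') \<phi>" and m: "m \<in> mat R B W" and a: "a \<in> B" and u: "u \<in> W" and W: "W \<subseteq> Vec R \<beta>"
 shows "\<phi> (\<lambda>b. m y b \<oplus> u y \<otimes> dl R a b) c = \<phi> (m y) c \<oplus> \<phi> (dl R a) c \<otimes> u y" "\<phi> (dl R a) c \<in> carrier R" "u y \<in> carrier R" "\<phi> (m y) c \<in> carrier R"
proof -
 show uc: "u y \<in> carrier R" by (rule FrD(1)[OF subsetD[OF W u]])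
 show pc: "\<phi> (dl R a) c \<in> carrier R" by (rule FrD(1)[OF lin_closed[OF \<phi> dl_mem[OF a]]])
 show "\<phi> (m y) c \<in> carrier R" by (rule FrD(1)[OF lin_closed[OF \<phi> matD(1)[OF m]]])
 show "\<phi> (\<lambda>b. m y b \<oplus> u y \<otimes> dl R a b) c = \<phi> (m y) c \<oplus> \<phi> (dl R a) c \<otimes> u y"
  using lin_add[OF \<phi> matD(1)[OF m] Fr_smult[OF uc dl_mem[OF a]]] lin_smult[OF \<phi> uc dl_mem[OF a]] uc pc
  by (simp add: Fr_simps m_comm)
qed

lemma mat_lin:
 assumes m: "m \<in> mat R B W" and fin: "finite \<beta>" and W: "submodule W R (Fr R \<beta>)" and \<phi>: "lin_map R (Fr R B) (Fr R B') \<phi>"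
 shows "(\<lambda>y. \<phi> (m y)) \<in> mat R B' W"
proof -
 note w = sub_FrD[OF W]
 have "\<forall>c. (\<lambda>y. \<phi> (m y) c) \<in> W"
  using m fin W
 proof (induction rule: mat_induct)
  case zero
  show ?case using lin_zero[OF \<phi> FrM FrM] w(2) by (simp add: Fr_simps)
 next
  case (step m a u)
  show ?case
   unfolding mat_step(1)[OF \<phi> step(1,2,3) w(1)]
   by (intro allI w(3) w(4) mat_step(2)[OF \<phi> step(1,2,3) w(1)] step(3) step(4)[rule_format])
 qed
 thus ?thesis using lin_closed[OF \<phi> matD(1)[OF m]] unfolding mat_def by blast
qed

lemma mat_right_mem:
 assumes m: "m \<in> mat R B (Vec R \<beta>)" and fin: "finite \<beta>" and g: "lin_map R (Fr R \<beta>) (Fr R \<beta>') g"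
 shows "(\<lambda>y b. g (\<lambda>y. m y b) y) \<in> mat R B (Vec R \<beta>')"
proof -
 have rows: "g (\<lambda>y. m y b) \<in> Vec R \<beta>'" for b by (rule lin_closed[OF g matD(2)[OF m]])
 have "(\<lambda>b. g (\<lambda>y. m y b) y) \<in> Vec R B" for y
 proof -
  let ?A = "\<Union>y\<in>\<beta>. supp R (m y)"
  have "g (\<lambda>y. m y b) y = \<zero>" if "b \<notin> ?A" for b
  proof -
   have "(\<lambda>y. m y b) = \<zero>\<^bsub>Fr R \<beta>\<^esub>"
    using that FrD(2)[OF matD(2)[OF m]] by (auto simp: Fr_simps supp_def)
   thus ?thesis using lin_zero[OF g FrM FrM] by (simp add: Fr_simps)
  qed
  hence "supp R (\<lambda>b. g (\<lambda>y. m y b) y) \<subseteq> ?A" by (auto simp: supp_def)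
  moreover have "finite ?A" using fin FrD(3)[OF matD(1)[OF m]] by blast
  moreover have "?A \<subseteq> B" using FrD(4)[OF matD(1)[OF m]] by blast
  ultimately show ?thesis using FrD(1)[OF rows] finite_subset unfolding Fr_carrier by blast
 qed
 thus ?thesis using rows by (simp add: mat_def)
qed

lemma Fr_submodule_self: "submodule (Vec R \<beta>) R (Fr R \<beta>)"
 unfolding submodule_Fr_iff by (auto intro: Fr_zero Fr_add Fr_smult)

text \<open>This is (\<phi> \<otimes> 1)(1 \<otimes> g) = (1 \<otimes> g)(\<phi> \<otimes> 1),
  checked on the tensors of \<open>mat_induct\<close>.\<close>

lemma mat_commute:
 assumes m: "m \<in> mat R B (Vec R \<beta>)" and fin: "finite \<beta>" and g: "lin_map R (Fr R \<beta>) (Fr R \<beta>') g"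
  and \<phi>: "lin_map R (Fr R B) (Fr R B') \<phi>"
 shows "\<phi> (\<lambda>b. g (\<lambda>y. m y b) y') c = g (\<lambda>y. \<phi> (m y) c) y'"
proof -
 have z: "g \<o> = \<o>" "\<phi> \<o> = \<o>"
  using lin_zero[OF g FrM FrM] lin_zero[OF \<phi> FrM FrM] by (simp_all add: Fr_simps)
 show ?thesis
  using m fin Fr_submodule_self
 proof (induction rule: mat_induct)
  case zero
  show ?case by (simp add: z)
 next
  case (step m a u)
  note ms = mat_step[OF \<phi> step(1,2,3) subset_refl]
  have gl: "g (\<lambda>y. f y \<oplus> r \<otimes> u y) y' = g f y' \<oplus> r \<otimes> g u y'" if "f \<in> Vec R \<beta>" "r \<in> carrier R" for f r
   using lin_add[OF g that(1) Fr_smult[OF that(2) step(3)]] lin_smult[OF g that(2) step(3)] by (simp add: Fr_simps)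
  have dc: "dl R a b \<in> carrier R" for b by (rule FrD(1)[OF dl_mem[OF step(2)]])
  have gu: "g u y' \<in> carrier R" by (rule FrD(1)[OF lin_closed[OF g step(3)]])
  have rm: "(\<lambda>y. \<phi> (m y) c) \<in> Vec R \<beta>" by (rule matD(2)[OF mat_lin[OF step(1) fin Fr_submodule_self \<phi>]])
  note mr = mat_right_mem[OF step(1) fin g]
  have "(\<lambda>b. g (\<lambda>y. m y b \<oplus> u y \<otimes> dl R a b) y') = (\<lambda>b. g (\<lambda>y. m y b) y' \<oplus> g u y' \<otimes> dl R a b)"
   using gl[OF matD(2)[OF step(1)] dc] dc ms(3) gu by (intro ext) (simp add: m_comm)
  hence "\<phi> (\<lambda>b. g (\<lambda>y. m y b \<oplus> u y \<otimes> dl R a b) y') c = \<phi> (\<lambda>b. g (\<lambda>y. m y b) y') c \<oplus> \<phi> (dl R a) c \<otimes> g u y'"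
   using mat_step(1)[OF \<phi> mr step(2) lin_closed[OF g step(3)] subset_refl] by simp
  also have "\<dots> = g (\<lambda>y. \<phi> (m y) c \<oplus> \<phi> (dl R a) c \<otimes> u y) y'" unfolding gl[OF rm ms(2)] step(4) ..
  finally show ?case unfolding ms(1) .
 qed
qed

text \<open>Tensoring with a free module preserves surjections: rows are lifted one at a time.
  Lifting zero rows to zero keeps the supports finite and lets the heights decrease in
  \<open>zigzag_exists\<close>.\<close>

lemma mat_right_lift:
 assumes m: "m \<in> mat R B (g ` (Vec R \<beta>'))" and fin: "finite \<beta>" "finite \<beta>'" and g: "lin_map R (Fr R \<beta>') (Fr R \<beta>) g"
 shows "\<exists>m'\<in>mat R B (Vec R \<beta>'). (\<forall>b. g (\<lambda>y. m' y b) = (\<lambda>y. m y b)) \<and> (\<forall>b. (\<forall>y. m y b = \<zero>) \<longrightarrow> (\<forall>y. m' y b = \<zero>))"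
proof -
 have "\<exists>u\<in>Vec R \<beta>'. g u = (\<lambda>y. m y b) \<and> ((\<forall>y. m y b = \<zero>) \<longrightarrow> (\<forall>y. u y = \<zero>))" for b
 proof (cases "\<forall>y. m y b = \<zero>")
  case True
  thus ?thesis using lin_zero[OF g FrM FrM] Fr_zero by (intro bexI[of _ "\<lambda>_. \<zero>"]) (auto simp: Fr_simps)
 next
  case False
  have "(\<lambda>y. m y b) \<in> g ` (Vec R \<beta>')" by (rule matD(2)[OF m])
  then obtain u where "u \<in> Vec R \<beta>'" "(\<lambda>y. m y b) = g u" ..
  thus ?thesis using False by metis
 qed
 then obtain u where u: "\<And>b. u b \<in> Vec R \<beta>'" "\<And>b. g (u b) = (\<lambda>y. m y b)" "\<And>b y. \<forall>y. m y b = \<zero> \<Longrightarrow> u b y = \<zero>" by metis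
 have gi: "g ` (Vec R \<beta>') \<subseteq> Vec R \<beta>" using lin_closed[OF g] by blast
 have "(\<lambda>b. u b y) \<in> Vec R B" for y
 proof -
  let ?A = "\<Union>y\<in>\<beta>. supp R (m y)"
  have "u b y = \<zero>" if b: "b \<notin> ?A" for b
  proof (rule u(3), rule allI)
   fix y
   have "(\<lambda>y. m y b) \<in> Vec R \<beta>" using matD(2)[OF m] gi by blast
   thus "m y b = \<zero>" using b FrD(2)[of "\<lambda>y. m y b" R \<beta> y] by (cases "y \<in> \<beta>") (auto simp: supp_def)
  qed
  hence "supp R (\<lambda>b. u b y) \<subseteq> ?A" by (auto simp: supp_def)
  moreover have "finite ?A" using fin(1) FrD(3)[OF matD(1)[OF m]] by blast
  moreover have "?A \<subseteq> B" using FrD(4)[OF matD(1)[OF m]] by blast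
  ultimately show ?thesis using FrD(1)[OF u(1)] finite_subset unfolding Fr_carrier by blast
 qed
 hence "(\<lambda>y b. u b y) \<in> mat R B (Vec R \<beta>')" using u(1) by (simp add: mat_def)
 thus ?thesis using u(2,3) by (intro bexI[of _ "\<lambda>y b. u b y"]) auto
qed

text \<open>The homology of \<open>C \<otimes> Fr R \<beta> / U\<close> is built from that of the complexes \<open>C \<otimes> R / I\<close>, where \<open>I\<close> runs through
 the ideals of leading coefficients of \<open>U\<close>.\<close>

lemma pure_submodule:
 assumes C: "free_cx R C B" and t: "\<And>I. ideal I R \<Longrightarrow> tnull R C B {\<one>} v I" and fin: "finite \<beta>"
  and U: "submodule U R (Fr R \<beta>)" and z: "z \<in> mat R (B v) (Vec R \<beta>)"
  and dz: "\<And>b. (\<lambda>y. cx_d C v (z y) b) \<in> U"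
 shows "\<exists>w\<in>mat R (B (v + 1)) (Vec R \<beta>). \<forall>b. (\<lambda>y. z y b \<ominus> cx_d C (v + 1) (w y) b) \<in> U"
 using fin U z dz
proof (induction arbitrary: U z rule: finite_induct)
 case empty
 have z0: "z y b = \<zero>" for y b using FrD(2)[OF matD(2)[OF empty(2)]] by auto
 have "(\<lambda>_ _. \<zero>) \<in> mat R (B (v + 1)) (carrier (Fr R {}))" by (simp add: mat_def Fr_zero)
 moreover have "cx_d C (v + 1) \<o> = \<o>"
  using lin_zero[OF free_cx_d[OF C refl] FrM FrM] by (simp add: Fr_simps)
 ultimately show ?case using sub_FrD(2)[OF empty(1)] z0 by (intro bexI[of _ "\<lambda>_ _. \<zero>"]) (auto simp: a_minus_def)
next
 case (insert x0 \<beta>)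
 note u = sub_FrD[OF insert.prems(1)]
 have uc: "f y \<in> carrier R" if "f \<in> U" for f y by (rule FrD(1)[OF subsetD[OF u(1) that]])
 \<comment> \<open>Column \<open>x0\<close> of the matrix is a cycle modulo the ideal of
   \<open>x0\<close>-coordinates of \<open>U\<close>, to which \<open>t\<close> applies.\<close>
 let ?I = "(\<lambda>f. f x0) ` U"
 have I: "ideal ?I R"
  unfolding ideal_iff
 proof (intro conjI ballI)
  show "?I \<subseteq> carrier R" using uc by auto
  show "\<zero> \<in> ?I" using u(2) by (auto intro: rev_image_eqI)
  show "x \<oplus> y \<in> ?I" if xy: "x \<in> ?I" "y \<in> ?I" for x y
  proof -
   obtain f g where fg: "f \<in> U" "g \<in> U" "x = f x0" "y = g x0" using xy by blast
   show ?thesis using u(3)[OF fg(1,2)] fg by (auto intro: rev_image_eqI)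
  qed
  show "r \<otimes> x \<in> ?I" if rx: "r \<in> carrier R" "x \<in> ?I" for r x
  proof -
   obtain f where f: "f \<in> U" "x = f x0" using rx by blast
   show ?thesis using u(4)[OF rx(1) f(1)] f by (auto intro: rev_image_eqI)
  qed
 qed
 have zm: "z y \<in> Vec R (B v)" for y by (rule matD(1)[OF insert.prems(2)])
 have zr: "(\<lambda>y. z y b) \<in> Vec R (insert x0 \<beta>)" for b by (rule matD(2)[OF insert.prems(2)])
 have "\<forall>b. cx_d C v (z x0) b \<in> ?I" using insert.prems(3) by (auto intro: rev_image_eqI)
 then obtain w0 where w0: "w0 \<in> Vec R (B (v + 1))" and e0: "\<And>b. \<one> \<otimes> z x0 b \<ominus> cx_d C (v + 1) w0 b \<in> ?I"
  using t[OF I] zm[of x0] unfolding tnull_def by blast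
 have dw0: "cx_d C (v + 1) w0 \<in> Vec R (B v)" by (rule fd_closed[OF C w0]) simp
 let ?e = "\<lambda>b. z x0 b \<ominus> cx_d C (v + 1) w0 b"
 have em: "?e \<in> Vec R (B v)" by (rule Fr_minus_mem[OF zm dw0])
 have "\<exists>f\<in>U. ?e b = f x0 \<and> (?e b = \<zero> \<longrightarrow> (\<forall>y. f y = \<zero>))" for b
 proof (cases "?e b = \<zero>")
  case True
  thus ?thesis using u(2) by (intro bexI[of _ "\<lambda>_. \<zero>"]) auto
 next
  case False
  have "?e b \<in> ?I" using e0[of b] FrD(1)[OF zm] by simp
  then obtain f where "f \<in> U" "?e b = f x0" by blast
  thus ?thesis using False by blast
 qed
 then obtain f where f: "\<And>b. f b \<in> U" "\<And>b. ?e b = f b x0" "\<And>b y. ?e b = \<zero> \<Longrightarrow> f b y = \<zero>" by metis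
 have fm: "(\<lambda>b. f b y) \<in> Vec R (B v)" for y
 proof -
  have "supp R (\<lambda>b. f b y) \<subseteq> supp R ?e" using f(3) by (auto simp: supp_def)
  thus ?thesis using em uc[OF f(1)] finite_subset unfolding Fr_carrier by (metis subset_trans)
 qed
 hence fU: "(\<lambda>y b. f b y) \<in> mat R (B v) U" using f(1) by (simp add: mat_def)
 have fin: "finite (insert x0 \<beta>)" using insert.hyps by simp
 note dfU = mat_lin[OF fU fin insert.prems(1) free_cx_d[OF C refl]]
 \<comment> \<open>Subtracting the rows \<open>f b\<close>, which lie in \<open>U\<close>, turns
   column \<open>x0\<close> into the boundary of \<open>w0\<close>. It can then be replaced by zero,
   and the other columns fall under the induction hypothesis.\<close>
 let ?z = "\<lambda>y. if y = x0 then \<o> else (\<lambda>b. z y b \<ominus> f b y)"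
 have frow: "f b \<in> Vec R (insert x0 \<beta>)" for b using f(1) u(1) by blast
 have zf: "(\<lambda>b. z y b \<ominus> f b y) \<in> Vec R (B v)" for y by (rule Fr_minus_mem[OF zm fm])
 have dz0: "cx_d C v \<o> = \<o>"
  using lin_zero[OF free_cx_d[OF C refl] FrM FrM] by (simp add: Fr_simps)
 have "(\<lambda>b. z x0 b \<ominus> f b x0) = cx_d C (v + 1) w0"
  using FrD(1)[OF zm] FrD(1)[OF dw0] by (intro ext) (simp add: f(2)[symmetric] a_minus_def minus_add grp_simps)
 hence d0: "cx_d C v (\<lambda>b. z x0 b \<ominus> f b x0) = \<o>" using fd_d[OF C w0] by simp
 have dz': "cx_d C v (?z y) b = cx_d C v (z y) b \<ominus> cx_d C v (\<lambda>b. f b y) b" for y b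
 proof -
  have "cx_d C v (?z y) = cx_d C v (\<lambda>b. z y b \<ominus> f b y)" using d0 dz0 by (cases "y = x0") simp_all
  thus ?thesis using fd_minus[OF C zm fm] by simp
 qed
 let ?U = "{f \<in> U. f x0 = \<zero>}"
 have Fr': "g \<in> Vec R \<beta>" if "g \<in> Vec R (insert x0 \<beta>)" "g x0 = \<zero>" for g
  by (rule Fr_mem_supp[OF that(1)]) (use that FrD(4)[OF that(1)] in \<open>auto simp: supp_def\<close>)
 have U': "submodule ?U R (Fr R \<beta>)"
  unfolding submodule_Fr_iff using Fr' u by auto
 have "(\<lambda>y. ?z y b) \<in> Vec R \<beta>" for b
 proof (rule Fr')
  show "(\<lambda>y. ?z y b) \<in> Vec R (insert x0 \<beta>)"
  proof (rule iffD2[OF Fr_fin[OF fin]], intro conjI allI impI)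
   fix y show "?z y b \<in> carrier R" using FrD(1)[OF zf] by simp
   assume "y \<notin> insert x0 \<beta>"
   thus "?z y b = \<zero>" using FrD(2)[OF zr] FrD(2)[OF frow] by (simp add: a_minus_def)
  qed
 qed simp
 hence zmat: "?z \<in> mat R (B v) (Vec R \<beta>)" using zf Fr_zero by (auto simp: mat_def)
 have "(\<lambda>y. cx_d C v (?z y) b) \<in> ?U" for b
 proof -
  have "(\<lambda>y. cx_d C v (?z y) b) \<in> U" unfolding dz' by (rule u(5)[OF insert.prems(3) matD(2)[OF dfU]])
  moreover have "cx_d C v (?z x0) b = \<zero>" using dz0 by simp
  ultimately show ?thesis by blast
 qed
 from insert.IH[OF U' zmat this] obtain w where w: "w \<in> mat R (B (v + 1)) (Vec R \<beta>)"
  and wU: "\<And>b. (\<lambda>y. ?z y b \<ominus> cx_d C (v + 1) (w y) b) \<in> ?U" by blast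
 have wx0: "w x0 = \<o>" using FrD(2)[OF matD(2)[OF w]] insert.hyps(2) by (intro ext) simp
 have dw: "cx_d C (v + 1) (w y) \<in> Vec R (B v)" for y by (rule fd_closed[OF C matD(1)[OF w]]) simp
 let ?w = "w(x0 := w0)"
 have "?w \<in> mat R (B (v + 1)) (Vec R (insert x0 \<beta>))"
 proof -
  have "(\<lambda>y. ?w y b) \<in> Vec R (insert x0 \<beta>)" for b
   unfolding Fr_fin[OF fin] using matD(2)[OF w, of b] FrD(1)[OF w0]
   by (auto simp: Fr_fin[OF insert.hyps(1)])
  thus ?thesis using matD(1)[OF w] w0 unfolding mat_def by auto
 qed
 moreover have "(\<lambda>y. z y b \<ominus> cx_d C (v + 1) (?w y) b) \<in> U" for b
 proof -
  have "(\<lambda>y. (?z y b \<ominus> cx_d C (v + 1) (w y) b) \<oplus> f b y) \<in> U" using u(3)[OF _ f(1)] wU[of b] by blast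
  moreover have "(?z y b \<ominus> cx_d C (v + 1) (w y) b) \<oplus> f b y = z y b \<ominus> cx_d C (v + 1) (?w y) b" for y
  proof (cases "y = x0")
   case True
   have "cx_d C (v + 1) (w x0) = \<o>"
    unfolding wx0 using lin_zero[OF free_cx_d[OF C refl] FrM FrM] by (simp add: Fr_simps)
   moreover have "\<zero> \<ominus> \<zero> = \<zero>" by (simp add: a_minus_def)
   ultimately show ?thesis using True uc[OF f(1)[of b], of x0] f(2)[of b] by simp
  next
   case False
   thus ?thesis using FrD(1)[OF zm, of y b] FrD(1)[OF dw, of y b] uc[OF f(1)[of b], of y]
    by (simp add: grp_simps)
  qed
  ultimately show ?thesis by simp
 qed
 ultimately show ?case by blast
qed

end

section \<open>Semi-free resolutions of unbounded complexes\<close>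

text \<open>The basis elements are trees: \<open>Nd z l\<close> stands for a generator that is mapped to \<open>z\<close> and whose
 boundary is the linear combination \<open>l\<close> of earlier generators.\<close>

datatype ('a, 'z) tree = Nd (lab: 'z) (chl: "(('a, 'z) tree \<times> 'a) list")

text \<open>A tree stores a linear combination of trees as a list, since a function on trees would
  be a negative occurrence of the type.\<close>

definition comb :: "('a, 'r) ring_scheme \<Rightarrow> ('t \<times> 'a) list \<Rightarrow> 't \<Rightarrow> 'a" where
 "comb R l t = (case map_of l t of None \<Rightarrow> \<zero>\<^bsub>R\<^esub> | Some r \<Rightarrow> r)"

inductive tbas :: "('a, 'r) ring_scheme \<Rightarrow> ('a, 'z) chain_cx \<Rightarrow> int \<Rightarrow> ('a, 'z) tree \<Rightarrow> bool"
 for R :: "('a, 'r) ring_scheme" and Z :: "('a, 'z) chain_cx" where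
 Nd: "z \<in> Z$$n \<Longrightarrow> (\<forall>p\<in>set l. tbas R Z (n - 1) (fst p) \<and> snd p \<in> carrier R) \<Longrightarrow>
  lin_ext R (Fr R UNIV) (\<lambda>t. comb R (chl t)) (comb R l) = (\<lambda>_. \<zero>\<^bsub>R\<^esub>) \<Longrightarrow>
  cx_d Z n z = lin_ext R (Z$(n - 1)) lab (comb R l) \<Longrightarrow> tbas R Z n (Nd z l)"

definition tree_cx :: "('a, 'r) ring_scheme \<Rightarrow> ('a, 'z) chain_cx \<Rightarrow> ('a, ('a, 'z) tree \<Rightarrow> 'a) chain_cx" where
 "tree_cx R Z = \<lparr>cx_mod = (\<lambda>n. Fr R (Collect (tbas R Z n))), cx_d = (\<lambda>n. lin_ext R (Fr R UNIV) (\<lambda>t. comb R (chl t)))\<rparr>"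

text \<open>The generators in the boundary of a tree are among its children, so the size of a tree
  is a height in the sense of \<open>lowers\<close>.\<close>

lemma tree_height: "map_of l t = Some r \<Longrightarrow> size t < size (Nd z l)"
proof -
 assume "map_of l t = Some r"
 hence "(t, r) \<in> set l" by (rule map_of_SomeD)
 hence "size t \<le> size_list (size_prod size (\<lambda>_. 0)) l"
  using size_list_estimation'[of "(t, r)" l "size t" "size_prod size (\<lambda>_. 0)"] by simp
 thus ?thesis by simp
qed

lemma comb_list: "finite (supp R f) \<Longrightarrow> \<exists>l. set l = (\<lambda>t. (t, f t)) ` supp R f \<and> comb R l = f"
proof -
 assume "finite (supp R f)"
 then obtain ts where ts: "set ts = supp R f" using finite_list by blast
 have "comb R (map (\<lambda>t. (t, f t)) ts) = f"
  using ts by (intro ext) (auto simp: comb_def map_of_map_restrict supp_def restrict_map_def)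
 thus ?thesis using ts by (intro exI[of _ "map (\<lambda>t. (t, f t)) ts"]) simp
qed

context cring
begin

context
 fixes Z :: "('a, 'z) chain_cx"
 assumes Z: "chain_complex R Z"
begin

lemma tbasD:
 assumes "tbas R Z n t"
 shows "lab t \<in> Z$$n" "comb R (chl t) \<in> Vec R (Collect (tbas R Z (n - 1)))"
  "lin_ext R (Fr R UNIV) (\<lambda>t. comb R (chl t)) (comb R (chl t)) = \<o>"
  "cx_d Z n (lab t) = lin_ext R (Z$(n - 1)) lab (comb R (chl t))"
  "\<And>s. s \<in> supp R (comb R (chl t)) \<Longrightarrow> size s < size t"
proof -
 have all: "lab t \<in> Z$$n \<and> comb R (chl t) \<in> Vec R (Collect (tbas R Z (n - 1))) \<and>
  lin_ext R (Fr R UNIV) (\<lambda>t. comb R (chl t)) (comb R (chl t)) = \<o> \<and>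
  cx_d Z n (lab t) = lin_ext R (Z$(n - 1)) lab (comb R (chl t)) \<and> (\<forall>s. s \<in> supp R (comb R (chl t)) \<longrightarrow> size s < size t)"
  using assms
 proof cases
 case (Nd z l)
 have "comb R l s \<in> carrier R \<and> (comb R l s \<noteq> \<zero> \<longrightarrow> tbas R Z (n - 1) s \<and> s \<in> fst ` set l \<and> size s < size t)" for s
 proof (cases "map_of l s")
  case (Some r)
  hence "(s, r) \<in> set l" by (rule map_of_SomeD)
  thus ?thesis using Nd(3) Some tree_height[OF Some, of z] Nd(1) by (force simp: comb_def)
 qed (simp add: comb_def)
 hence "\<forall>s. comb R l s \<in> carrier R" "supp R (comb R l) \<subseteq> Collect (tbas R Z (n - 1))" "supp R (comb R l) \<subseteq> fst ` set l"
  and s: "\<forall>s. s \<in> supp R (comb R l) \<longrightarrow> size s < size t"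
  by (auto simp: supp_def)
 hence "comb R l \<in> Vec R (Collect (tbas R Z (n - 1)))"
  using finite_subset[of "supp R (comb R l)" "fst ` set l"] by (simp add: Fr_carrier)
 thus ?thesis using Nd s by simp
 qed
 thus "lab t \<in> Z$$n" "comb R (chl t) \<in> Vec R (Collect (tbas R Z (n - 1)))"
  "lin_ext R (Fr R UNIV) (\<lambda>t. comb R (chl t)) (comb R (chl t)) = \<o>"
  "cx_d Z n (lab t) = lin_ext R (Z$(n - 1)) lab (comb R (chl t))"
  "\<And>s. s \<in> supp R (comb R (chl t)) \<Longrightarrow> size s < size t" by auto
qed

lemma tree_d: "lin_map R (Fr R (Collect (tbas R Z n))) (Fr R (Collect (tbas R Z (n - 1)))) (cx_d (tree_cx R Z) n)"
 "t \<in> Collect (tbas R Z n) \<Longrightarrow> cx_d (tree_cx R Z) n (dl R t) = comb R (chl t)"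
proof -
 let ?g = "\<lambda>t. comb R (chl t)" and ?B = "Collect (tbas R Z (n - 1))"
 have g: "?g \<in> Collect (tbas R Z n) \<rightarrow> Vec R ?B" using tbasD(2) by auto
 hence g': "?g \<in> Collect (tbas R Z n) \<rightarrow> Vec R UNIV" using Fr_mono[of _ R ?B UNIV] by auto
 have l: "lin_map R (Fr R (Collect (tbas R Z n))) (Fr R UNIV) (lin_ext R (Fr R ?B) ?g)"
  by (rule lin_Fr_target[OF lin_comp[OF lin_ext_lin[OF FrM g]]])
   (use Fr_mono[OF lin_closed[OF lin_ext_lin[OF FrM g]]] in \<open>auto simp: lin_map_def Fr_simps\<close>)
 have "lin_ext R (Fr R UNIV) ?g x = lin_ext R (Fr R ?B) ?g x" if "x \<in> Vec R (Collect (tbas R Z n))" for x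
  by (rule lin_ext_unique[OF FrM g' l _ that, symmetric]) (rule lin_ext_dl[OF FrM g])
 hence "lin_ext R (Fr R UNIV) ?g x \<in> Vec R ?B" if "x \<in> Vec R (Collect (tbas R Z n))" for x
  using lin_closed[OF lin_ext_lin[OF FrM g] that] that by simp
 thus "lin_map R (Fr R (Collect (tbas R Z n))) (Fr R ?B) (cx_d (tree_cx R Z) n)"
  using lin_Fr_target[OF lin_ext_lin[OF FrM g']] by (simp add: tree_cx_def)
 show "t \<in> Collect (tbas R Z n) \<Longrightarrow> cx_d (tree_cx R Z) n (dl R t) = comb R (chl t)"
  using lin_ext_dl[OF FrM g'] by (simp add: tree_cx_def)
qed

lemma tree_free_cx: "free_cx R (tree_cx R Z) (\<lambda>n. Collect (tbas R Z n))"
proof -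
 have m: "(tree_cx R Z)$n = Fr R (Collect (tbas R Z n))" for n by (simp add: tree_cx_def)
 have "chain_complex R (tree_cx R Z)"
  unfolding chain_complex_def m
 proof (intro conjI allI ballI FrM tree_d(1))
  fix n x assume x: "x \<in> Vec R (Collect (tbas R Z n))"
  show "cx_d (tree_cx R Z) (n - 1) (cx_d (tree_cx R Z) n x) = \<zero>\<^bsub>Fr R (Collect (tbas R Z (n - 1 - 1)))\<^esub>"
  proof (rule lin_Fr_eq[OF lin_comp[OF tree_d(1) tree_d(1)] lin_zero_map[OF FrM] FrM _ x])
   fix t assume t: "t \<in> Collect (tbas R Z n)"
   show "cx_d (tree_cx R Z) (n - 1) (cx_d (tree_cx R Z) n (dl R t)) = \<zero>\<^bsub>Fr R (Collect (tbas R Z (n - 1 - 1)))\<^esub>"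
    unfolding tree_d(2)[OF t] using tbasD(3)[of n t] t by (simp add: tree_cx_def Fr_simps)
  qed
 qed
 thus ?thesis by (simp add: free_cx_def m)
qed

lemma tree_lowers: "lowers R (tree_cx R Z) (\<lambda>n. Collect (tbas R Z n)) (\<lambda>n. size)"
 unfolding lowers_def using tree_d(2) tbasD(5) by auto

text \<open>Every admissible generator is present. A cycle \<open>y\<close> of \<open>Z\<close> is
  the image of the generator \<open>Nd y []\<close>. A cycle \<open>f\<close> whose image is the
  boundary of \<open>w\<close> is the boundary of the generator \<open>Nd w l\<close>, where
  \<open>l\<close> lists \<open>f\<close>.\<close>

lemma tree_quasi_iso: "quasi_iso R (tree_cx R Z) Z (\<lambda>n. lin_ext R (Z$n) lab)"
proof -
 let ?S = "tree_cx R Z" and ?B = "\<lambda>n. Collect (tbas R Z n)" and ?k = "\<lambda>n. lin_ext R (Z$n) lab"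
 note Sc = fcD(1)[OF tree_free_cx] and Sm = fcD(2)[OF tree_free_cx]
 have g: "lab \<in> ?B n \<rightarrow> Z$$n" for n using tbasD(1) by auto
 note kl = lin_ext_lin[OF cxM[OF Z] g] and kd = lin_ext_dl[OF cxM[OF Z] g]
 have cm: "chain_map R ?S Z ?k"
  unfolding chain_map_def Sm
 proof (intro conjI allI ballI kl)
  fix n x assume x: "x \<in> Vec R (?B n)"
  show "?k (n - 1) (cx_d ?S n x) = cx_d Z n (?k n x)"
  proof (rule lin_Fr_eq[OF lin_comp[OF tree_d(1) kl] lin_comp[OF kl cx_lin[OF Z]] cxM[OF Z] _ x])
   show "?k (n - 1) (cx_d ?S n (dl R t)) = cx_d Z n (?k n (dl R t))" if t: "t \<in> ?B n" for t
    unfolding tree_d(2)[OF t] kd[OF t] using tbasD(4)[of n t] t by simp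
  qed
 qed
 show ?thesis
  unfolding quasi_iso_iff[OF Sc Z]
 proof (intro conjI allI ballI impI cm)
  fix n f assume f: "f \<in> cycles ?S n" and kf: "?k n f \<in> boundaries Z n"
  have fm: "f \<in> Vec R (?B n)" using cyclesD(1)[OF f] by (simp add: Sm)
  have df: "cx_d ?S n f = \<o>" using cyclesD(2)[OF f refl] by (simp add: Sm Fr_simps)
  obtain w where w: "w \<in> Z$$(n + 1)" "?k n f = cx_d Z (n + 1) w" using kf unfolding boundaries_iff by blast
  obtain l where l: "set l = (\<lambda>t. (t, f t)) ` supp R f" "comb R l = f" using comb_list[OF FrD(3)[OF fm]] by blast
  have "tbas R Z (n + 1) (Nd w l)"
  proof (rule tbas.Nd[OF w(1)])
   show "\<forall>p\<in>set l. tbas R Z (n + 1 - 1) (fst p) \<and> snd p \<in> carrier R"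
    using FrD(1,4)[OF fm] by (auto simp: l(1))
   show "lin_ext R (Fr R UNIV) (\<lambda>t. comb R (chl t)) (comb R l) = \<o>" using df by (simp add: l(2) tree_cx_def)
   show "cx_d Z (n + 1) w = lin_ext R (Z$(n + 1 - 1)) lab (comb R l)" by (simp add: l(2) w(2)[symmetric])
  qed
  hence t: "Nd w l \<in> ?B (n + 1)" by simp
  have "f = cx_d ?S (n + 1) (dl R (Nd w l))" unfolding tree_d(2)[OF t] by (simp add: l(2))
  thus "f \<in> boundaries ?S n" using dl_mem[OF t] unfolding boundaries_iff Sm by blast
 next
  fix n y assume y: "y \<in> cycles Z n"
  note yc = cyclesD(1)[OF y]
  have c0: "comb R ([] :: (('a, 'z) tree \<times> 'a) list) = \<o>" by (auto simp: comb_def)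
  have z0: "lin_ext R M g \<o> = \<zero>\<^bsub>M\<^esub>" if "Module.module R M" for M :: "('a, 'x) module" and g :: "'t \<Rightarrow> 'x"
  proof -
   interpret M: Module.module R M by (rule that)
   show ?thesis by (simp add: lin_ext_def supp_def)
  qed
  have "tbas R Z n (Nd y [])"
   by (rule tbas.Nd[OF yc]) (simp_all add: c0 z0[OF FrM] z0[OF cxM[OF Z]] cyclesD(2)[OF y] Fr_simps)
  hence t: "Nd y [] \<in> ?B n" by simp
  have d: "dl R (Nd y []) \<in> cycles ?S n"
   by (rule cyclesI) (use dl_mem[OF t] tree_d(2)[OF t] c0 in \<open>auto simp: Sm Fr_simps\<close>)
  have "y \<ominus>\<^bsub>Z$n\<^esub> ?k n (dl R (Nd y [] :: ('a, 'z) tree)) = \<zero>\<^bsub>Z$n\<^esub>"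
   unfolding kd[OF t] using module_diff_zero_iff[OF cxM[OF Z]] yc by simp
  thus "\<exists>z\<in>cycles ?S n. y \<ominus>\<^bsub>Z$n\<^esub> ?k n z \<in> boundaries Z n"
   using d submodule_zero[OF bd_sub[OF Z]] by metis
 qed
qed

end

lemma semifree_resolution_exists:
 fixes Z :: "('a, 'z) chain_cx"
 assumes "chain_complex R Z"
 shows "\<exists>(S :: ('a, ('a, 'z) tree \<Rightarrow> 'a) chain_cx) B ht \<kappa>. free_cx R S B \<and> lowers R S B ht \<and> quasi_iso R S Z \<kappa>"
 using tree_free_cx[OF assms] tree_lowers[OF assms] tree_quasi_iso[OF assms] by blast

end

section \<open>Bounding a complex whose dual is exact in high degrees\<close>

context cring
begin

lemma pr_sym:
 assumes f: "f \<in> Vec R B" and g: "g \<in> Vec R B" shows "pr R f g = pr R g f"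
 by (rule lin_Fr_eq[OF pr_lin_right[OF f] pr_lin[OF Fr_Pi[OF f]] Rm_module _ g])
  (simp add: pr_right_dl[OF f] pr_dl[OF Fr_Pi[OF f]])

text \<open>Both summands lie in the maximal ideal. Consequently dh + hd on a minimal complex never
  fixes a basis vector, which is how minimality is used throughout.\<close>

lemma not_one_if_minimal:
 assumes m: "ideal \<mm> R" "\<one> \<notin> \<mm>" and h: "lin_map R (Fr R B') (Fr R B) h"
  and u: "u \<in> \<mm>" and v: "v \<in> Vec R B'" "\<And>b. v b \<in> \<mm>"
 shows "u \<oplus> h v b \<noteq> \<one>"
 using idp(3)[OF m(1) u lin_coeffs[OF h v m(1), of b]] m(2) by auto

lemma lin_into_submodule:
 assumes g: "lin_map R (Fr R B) (Fr R C) g" and U: "submodule U R (Fr R C)" and b: "\<And>b. b \<in> B \<Longrightarrow> g (dl R b) \<in> U"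
  and x: "x \<in> Vec R B"
 shows "g x \<in> U"
 using x
proof (induction rule: Fr_induct)
 case zero
 show ?case using lin_zero[OF g FrM FrM] sub_FrD(2)[OF U] by (simp add: Fr_simps)
next
 case (step f c r)
 have s: "r \<odot>\<^bsub>Fr R B\<^esub> dl R c \<in> Vec R B" using Fr_smult[OF step(3) dl_mem[OF step(2)]] by (simp add: Fr_simps)
 show ?case
  using sub_FrD(3)[OF U step.IH sub_FrD(4)[OF U step(3) b[OF step(2)]]] lin_add[OF g step(1) s] lin_smult[OF g step(3) dl_mem[OF step(2)]]
  by (simp add: Fr_simps)
qed

text \<open>The matrices \<open>\<sigma> k\<close> define a chain endomorphism \<open>\<psi> \<sigma>\<close> of the complex \<open>W\<close>, which is homotopic to the
 identity and vanishes in high degrees because the heights of the basis elements that occur in \<open>\<sigma> k\<close> decrease.\<close>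

context
 fixes W :: "nat \<Rightarrow> 'w set" and D :: "nat \<Rightarrow> ('w \<Rightarrow> 'a) \<Rightarrow> 'w \<Rightarrow> 'a" and E :: "nat \<Rightarrow> ('w \<Rightarrow> 'a) \<Rightarrow> 'w \<Rightarrow> 'a"
  and T :: "nat \<Rightarrow> 't set" and e :: "nat \<Rightarrow> ('t \<Rightarrow> 'a) \<Rightarrow> 't \<Rightarrow> 'a" and \<psi> :: "nat \<Rightarrow> ('t \<Rightarrow> 'a) \<Rightarrow> 'w \<Rightarrow> 'a" and ht :: "nat \<Rightarrow> 't \<Rightarrow> nat"
 assumes fin: "\<And>k. finite (W k)"
  and Dl: "\<And>k. lin_map R (Fr R (W (Suc k))) (Fr R (W k)) (D k)"
  and ad: "\<And>k l v. l \<in> Vec R (W k) \<Longrightarrow> v \<in> Vec R (W (Suc k)) \<Longrightarrow> pr R (E k l) v = pr R l (D k v)"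
  and Ec: "\<And>k l. l \<in> Vec R (W k) \<Longrightarrow> E k l \<in> Vec R (W (Suc k))"
  and ex: "\<And>k v. v \<in> Vec R (W (Suc k)) \<Longrightarrow> D k v = \<o> \<Longrightarrow> v \<in> D (Suc k) ` (Vec R (W (Suc (Suc k))))"
  and DD: "\<And>k v. v \<in> Vec R (W (Suc (Suc k))) \<Longrightarrow> D k (D (Suc k) v) = \<o>"
  and el: "\<And>k. lin_map R (Fr R (T k)) (Fr R (T (Suc k))) (e k)"
  and ee: "\<And>k x. x \<in> Vec R (T k) \<Longrightarrow> e (Suc k) (e k x) = \<o>"
  and pl: "\<And>k. lin_map R (Fr R (T k)) (Fr R (W k)) (\<psi> k)"
  and pe: "\<And>k x. x \<in> Vec R (T k) \<Longrightarrow> \<psi> (Suc k) (e k x) = E k (\<psi> k x)"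
  and ht: "\<And>k b c. b \<in> T k \<Longrightarrow> e k (dl R b) c \<noteq> \<zero> \<Longrightarrow> ht (Suc k) c < ht k b"
begin

text \<open>Since e(e \<sigma>) = 0, exactness of \<open>W\<close> allows the lifting of e \<sigma>
  along \<open>D\<close> to be repeated. A nonzero row of the next matrix arises from a nonzero row
  of greater height, so the process ends.\<close>

lemma zigzag_exists:
 assumes s: "\<sigma>0 \<in> mat R (T 0) (Vec R (W 0))" "\<And>b. (\<lambda>y. e 0 (\<sigma>0 y) b) \<in> D 0 ` (Vec R (W (Suc 0)))"
 shows "\<exists>\<sigma> H. \<sigma> 0 = \<sigma>0 \<and> (\<forall>k. \<sigma> k \<in> mat R (T k) (Vec R (W k))) \<and>
  (\<forall>k b. D k (\<lambda>y. \<sigma> (Suc k) y b) = (\<lambda>y. e k (\<sigma> k y) b)) \<and> (\<forall>k\<ge>H. \<forall>y b. \<sigma> k y b = \<zero>)"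
proof -
 let ?A = "\<Union>y\<in>W 0. supp R (\<sigma>0 y)"
 have "finite ?A" using fin FrD(3)[OF matD(1)[OF s(1)]] by blast
 then obtain H where H: "\<And>b. b \<in> ?A \<Longrightarrow> ht 0 b < H" using finite_nat_set_iff_bounded[of "ht 0 ` ?A"] by blast
 \<comment> \<open>The bound \<open>ht k b + k < H\<close> on nonzero rows leaves none of them once
   \<open>k\<close> reaches \<open>H\<close>.\<close>
 let ?P = "\<lambda>k \<sigma>. \<sigma> \<in> mat R (T k) (Vec R (W k)) \<and> (\<forall>b. (\<lambda>y. e k (\<sigma> y) b) \<in> D k ` (Vec R (W (Suc k)))) \<and>
  (\<forall>y b. \<sigma> y b \<noteq> \<zero> \<longrightarrow> ht k b + k < H) \<and> (k = 0 \<longrightarrow> \<sigma> = \<sigma>0)"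
 let ?Q = "\<lambda>k \<sigma> \<sigma>'. \<forall>b. D k (\<lambda>y. \<sigma>' y b) = (\<lambda>y. e k (\<sigma> y) b)"
 have base: "\<exists>\<sigma>. ?P 0 \<sigma>"
 proof (intro exI[of _ \<sigma>0] conjI allI impI)
  fix y b assume a: "\<sigma>0 y b \<noteq> \<zero>"
  hence "y \<in> W 0" using FrD(2)[OF matD(2)[OF s(1)], of y] by blast
  thus "ht 0 b + 0 < H" using H[of b] a by (auto simp: supp_def)
 qed (use s in auto)
 have step: "\<exists>\<sigma>'. ?P (Suc k) \<sigma>' \<and> ?Q k \<sigma> \<sigma>'" if P: "?P k \<sigma>" for k \<sigma>
 proof -
  have m: "\<sigma> \<in> mat R (T k) (Vec R (W k))" and r: "\<And>b. (\<lambda>y. e k (\<sigma> y) b) \<in> D k ` (Vec R (W (Suc k)))"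
   and hh: "\<And>y b. \<sigma> y b \<noteq> \<zero> \<Longrightarrow> ht k b + k < H" using P by auto
  have em: "(\<lambda>y. e k (\<sigma> y)) \<in> mat R (T (Suc k)) (D k ` (Vec R (W (Suc k))))"
   using r lin_closed[OF el matD(1)[OF m]] by (auto simp: mat_def)
  from mat_right_lift[OF em fin fin Dl] obtain \<sigma>' where s': "\<sigma>' \<in> mat R (T (Suc k)) (Vec R (W (Suc k)))"
   and Q: "\<And>b. D k (\<lambda>y. \<sigma>' y b) = (\<lambda>y. e k (\<sigma> y) b)" and z: "\<And>b y. \<forall>y. e k (\<sigma> y) b = \<zero> \<Longrightarrow> \<sigma>' y b = \<zero>" by blast
  have "(\<lambda>y. e (Suc k) (\<sigma>' y) c) \<in> D (Suc k) ` (Vec R (W (Suc (Suc k))))" for c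
  proof (rule ex)
   show "(\<lambda>y. e (Suc k) (\<sigma>' y) c) \<in> Vec R (W (Suc k))" by (rule matD(2)[OF mat_lin[OF s' fin Fr_submodule_self el]])
   show "D k (\<lambda>y. e (Suc k) (\<sigma>' y) c) = \<o>"
   proof
    fix y'
    have "D k (\<lambda>y. e (Suc k) (\<sigma>' y) c) y' = e (Suc k) (\<lambda>b. D k (\<lambda>y. \<sigma>' y b) y') c" by (rule mat_commute[OF s' fin Dl el, symmetric])
    also have "\<dots> = e (Suc k) (e k (\<sigma> y')) c" by (simp add: Q)
    also have "\<dots> = \<zero>" using ee[OF matD(1)[OF m]] by simp
    finally show "D k (\<lambda>y. e (Suc k) (\<sigma>' y) c) y' = \<zero>" .
   qed
  qed
  moreover have "ht (Suc k) b + Suc k < H" if nz: "\<sigma>' y b \<noteq> \<zero>" for y b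
  proof -
   obtain y' where y': "e k (\<sigma> y') b \<noteq> \<zero>" using z nz by blast
   obtain c where c: "c \<in> supp R (\<sigma> y')" "e k (dl R c) b \<noteq> \<zero>" using supp_lin_map[OF el matD(1)[OF m] y'] by blast
   have "c \<in> T k" using FrD(4)[OF matD(1)[OF m]] c(1) by blast
   thus ?thesis using ht[OF _ c(2)] hh[of y' c] c(1) by (auto simp: supp_def)
  qed
  ultimately show ?thesis using s' Q by (intro exI[of _ \<sigma>']) auto
 qed
 from dependent_nat_choice[of ?P ?Q, OF base step]
 obtain \<sigma> where S: "\<forall>k. ?P k (\<sigma> k) \<and> ?Q k (\<sigma> k) (\<sigma> (Suc k))" by (rule exE)
 have P: "?P k (\<sigma> k)" and Q: "?Q k (\<sigma> k) (\<sigma> (Suc k))" for k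
  using S[THEN spec, of k] by (rule conjunct1, rule conjunct2)
 have "\<sigma> k y b = \<zero>" if k: "H \<le> k" for k y b
 proof (rule ccontr)
  assume "\<sigma> k y b \<noteq> \<zero>"
  with P[of k] have "ht k b + k < H" by blast
  thus False using k by simp
 qed
 moreover have "\<sigma> 0 = \<sigma>0" using P[of 0] by simp
 moreover have "\<sigma> k \<in> mat R (T k) (Vec R (W k))" for k using P[of k] by simp
 ultimately show ?thesis using Q by (intro exI[of _ \<sigma>] exI[of _ H]) simp
qed

text \<open>A homotopy from the identity to \<psi> \<sigma> is built degree by degree:
  \<open>rows\<close> supplies the first step, exactness of \<open>W\<close> all others. Where
  \<sigma> vanishes, the identity equals Dg + gD, which minimality forbids on a basis
  vector.\<close>

lemma zigzag_vanishing:
 fixes D' E' and W' :: "'w set"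
 assumes s: "\<sigma>0 \<in> mat R (T 0) (Vec R (W 0))" "\<And>b. (\<lambda>y. e 0 (\<sigma>0 y) b) \<in> D 0 ` (Vec R (W (Suc 0)))"
  and D'l: "lin_map R (Fr R (W 0)) (Fr R W') D'"
  and ad': "\<And>l v. l \<in> Vec R W' \<Longrightarrow> v \<in> Vec R (W 0) \<Longrightarrow> pr R (E' l) v = pr R l (D' v)"
  and E'c: "\<And>l. l \<in> Vec R W' \<Longrightarrow> E' l \<in> Vec R (W 0)"
  and D'D: "\<And>v. v \<in> Vec R (W (Suc 0)) \<Longrightarrow> D' (D 0 v) = \<o>"
  and la: "\<mu> \<in> mat R W' (Vec R (W 0))"
  and rows: "\<And>b. b \<in> W 0 \<Longrightarrow> (\<lambda>y. dl R b y \<ominus> (E' (\<mu> y) b \<oplus> \<psi> 0 (\<sigma>0 y) b)) \<in> D 0 ` (Vec R (W (Suc 0)))"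
  and m: "ideal \<mm> R" "\<one> \<notin> \<mm>" and min: "\<And>k v b. v \<in> Vec R (W (Suc k)) \<Longrightarrow> D k v b \<in> \<mm>"
 shows "\<exists>H. \<forall>k\<ge>H. W k = {}"
proof -
 obtain \<sigma> H where s0: "\<sigma> 0 = \<sigma>0" and sm: "\<And>k. \<sigma> k \<in> mat R (T k) (Vec R (W k))"
  and sd: "\<And>k b. D k (\<lambda>y. \<sigma> (Suc k) y b) = (\<lambda>y. e k (\<sigma> k y) b)" and sH: "\<And>k y b. H \<le> k \<Longrightarrow> \<sigma> k y b = \<zero>"
  using zigzag_exists[OF s] by blast
 \<comment> \<open>The transposed matrix of \<psi> \<sigma>; the adjunction \<open>ad\<close> makes
   it commute with \<open>D\<close>.\<close>
 define f where "f k = lin_ext R (Fr R (W k)) (\<lambda>b y. \<psi> k (\<sigma> k y) b)" for k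
 have rm: "(\<lambda>y. \<psi> k (\<sigma> k y) b) \<in> Vec R (W k)" for k b
  by (rule matD(2)[OF mat_lin[OF sm fin Fr_submodule_self pl]])
 hence rm': "(\<lambda>b y. \<psi> k (\<sigma> k y) b) \<in> W k \<rightarrow> Vec R (W k)" for k by simp
 have fl: "lin_map R (Fr R (W k)) (Fr R (W k)) (f k)" for k
  unfolding f_def by (rule lin_ext_lin[OF FrM rm'])
 have fd: "f k (dl R b) = (\<lambda>y. \<psi> k (\<sigma> k y) b)" if "b \<in> W k" for b k
  unfolding f_def by (rule lin_ext_dl[OF FrM rm' that])
 have fa: "f k x y = pr R x (\<psi> k (\<sigma> k y))" if "x \<in> Vec R (W k)" for k x y
  unfolding f_def by (rule lin_ext_apply[OF rm that])
 have fD: "D k (f (Suc k) x) = f k (D k x)" if x: "x \<in> Vec R (W (Suc k))" for k x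
 proof (rule lin_Fr_eq[OF lin_comp[OF fl Dl] lin_comp[OF Dl fl] FrM _ x])
  fix c assume c: "c \<in> W (Suc k)"
  show "D k (f (Suc k) (dl R c)) = f k (D k (dl R c))"
  proof
   fix y
   have p: "\<psi> k (\<sigma> k y) \<in> Vec R (W k)" by (rule lin_closed[OF pl matD(1)[OF sm]])
   have "D k (f (Suc k) (dl R c)) y = \<psi> (Suc k) (\<lambda>b. D k (\<lambda>y. \<sigma> (Suc k) y b) y) c"
    unfolding fd[OF c] by (rule mat_commute[OF sm fin Dl pl, symmetric])
   also have "\<dots> = E k (\<psi> k (\<sigma> k y)) c" by (simp add: sd pe[OF matD(1)[OF sm]])
   also have "\<dots> = pr R (\<psi> k (\<sigma> k y)) (D k (dl R c))"
    using ad[OF p dl_mem[OF c]] pr_right_dl[OF Ec[OF p] c] by simp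
   also have "\<dots> = f k (D k (dl R c)) y"
    using fa[OF lin_closed[OF Dl dl_mem[OF c]]] pr_sym[OF p lin_closed[OF Dl dl_mem[OF c]]] by simp
   finally show "D k (f (Suc k) (dl R c)) y = f k (D k (dl R c)) y" .
  qed
 qed
 \<comment> \<open>\<open>V\<close> and \<open>\<Delta>\<close> put the module on \<open>W'\<close>
   in front of the one on \<open>W 0\<close>, so that the homotopy with index \<open>k\<close> goes
   from \<open>V k\<close> to \<open>W k\<close>, also for \<open>k = 0\<close>.\<close>
 define V where "V k = (case k of 0 \<Rightarrow> W' | Suc j \<Rightarrow> W j)" for k
 define \<Delta> where "\<Delta> k = (case k of 0 \<Rightarrow> D' | Suc j \<Rightarrow> D j)" for k
 have V: "V (Suc k) = W k" and \<Delta>: "\<Delta> (Suc k) = D k" for k by (simp_all add: V_def \<Delta>_def)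
 have \<Delta>l: "lin_map R (Fr R (W k)) (Fr R (V k)) (\<Delta> k)" for k
  by (cases k) (simp_all add: V_def \<Delta>_def D'l Dl)
 have \<Delta>D: "\<Delta> k (D k v) = \<o>" if "v \<in> Vec R (W (Suc k))" for k v
  using that by (cases k) (simp_all add: V_def \<Delta>_def D'D DD)
 let ?r = "\<lambda>k g x. (x \<ominus>\<^bsub>Fr R (W k)\<^esub> f k x) \<ominus>\<^bsub>Fr R (W k)\<^esub> g (\<Delta> k x)"
 let ?P = "\<lambda>k g. lin_map R (Fr R (V k)) (Fr R (W k)) g \<and> (\<forall>x\<in>Vec R (W k). ?r k g x \<in> D k ` (Vec R (W (Suc k))))"
 let ?Q = "\<lambda>k g g'. \<forall>x\<in>Vec R (W k). D k (g' x) = ?r k g x"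
 have rl: "lin_map R (Fr R (W k)) (Fr R (W k)) (?r k g)" if "lin_map R (Fr R (V k)) (Fr R (W k)) g" for k g
  by (intro lin_minus FrM lin_id fl lin_comp[OF \<Delta>l that])
 have ra: "?r k g x y = (x y \<ominus> f k x y) \<ominus> g (\<Delta> k x) y" if g: "lin_map R (Fr R (V k)) (Fr R (W k)) g" and x: "x \<in> Vec R (W k)" for k g x y
 proof -
  have "?r k g x = (\<lambda>y. (x \<ominus>\<^bsub>Fr R (W k)\<^esub> f k x) y \<ominus> g (\<Delta> k x) y)"
   by (rule Fr_minus) (use Fr_minus_mem[OF x lin_closed[OF fl x]] Fr_minus[OF x lin_closed[OF fl x]]
     lin_closed[OF g lin_closed[OF \<Delta>l x]] in simp_all)
  thus ?thesis using Fr_minus[OF x lin_closed[OF fl x]] by simp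
 qed
 \<comment> \<open>The transposed matrix of \<open>\<mu>\<close> is the first component of the
   homotopy.\<close>
 let ?g0 = "lin_ext R (Fr R (W 0)) (\<lambda>b y. \<mu> y b)"
 have g0: "lin_map R (Fr R W') (Fr R (W 0)) ?g0" using matD(2)[OF la] by (intro lin_ext_lin FrM) auto
 have base: "\<exists>g. ?P 0 g"
 proof (intro exI[of _ ?g0] conjI ballI)
  show g0': "lin_map R (Fr R (V 0)) (Fr R (W 0)) ?g0" using g0 by (simp add: V_def)
  fix x assume x: "x \<in> Vec R (W 0)"
  show "?r 0 ?g0 x \<in> D 0 ` (Vec R (W (Suc 0)))"
  proof (rule lin_into_submodule[OF rl[OF g0'] image_submodule[OF Dl] _ x])
   fix b assume b: "b \<in> W 0"
   have "?r 0 ?g0 (dl R b) = (\<lambda>y. dl R b y \<ominus> (E' (\<mu> y) b \<oplus> \<psi> 0 (\<sigma>0 y) b))"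
   proof
    fix y
    have ly: "\<mu> y \<in> Vec R W'" by (rule matD(1)[OF la])
    have Db: "D' (dl R b) \<in> Vec R W'" by (rule lin_closed[OF D'l dl_mem[OF b]])
    have "?g0 (D' (dl R b)) y = pr R (D' (dl R b)) (\<mu> y)" using lin_ext_apply[OF matD(2)[OF la] Db] by simp
    also have "\<dots> = E' (\<mu> y) b"
     using pr_sym[OF ly Db] ad'[OF ly dl_mem[OF b]] pr_right_dl[OF E'c[OF ly] b] by simp
    finally have "?g0 (D' (dl R b)) y = E' (\<mu> y) b" .
    hence "?r 0 ?g0 (dl R b) y = (dl R b y \<ominus> \<psi> 0 (\<sigma>0 y) b) \<ominus> E' (\<mu> y) b"
     unfolding ra[OF g0' dl_mem[OF b]] using fd[OF b] s0 by (simp add: \<Delta>_def)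
    thus "?r 0 ?g0 (dl R b) y = dl R b y \<ominus> (E' (\<mu> y) b \<oplus> \<psi> 0 (\<sigma>0 y) b)"
     using FrD(1)[OF dl_mem[OF b], of y] FrD(1)[OF E'c[OF ly], of b] FrD(1)[OF rm[of 0 b], of y] s0
     by (simp add: a_minus_def minus_add a_ac)
   qed
   thus "?r 0 ?g0 (dl R b) \<in> D 0 ` (Vec R (W (Suc 0)))" using rows[OF b] by simp
  qed
 qed
 have step: "\<exists>g'. ?P (Suc k) g' \<and> ?Q k g g'" if P: "?P k g" for k g
 proof -
  have gl: "lin_map R (Fr R (V k)) (Fr R (W k)) g" and gr: "\<And>x. x \<in> Vec R (W k) \<Longrightarrow> ?r k g x \<in> D k ` (Vec R (W (Suc k)))" using P by auto
  have "\<forall>b\<in>W k. \<exists>u. u \<in> Vec R (W (Suc k)) \<and> D k u = ?r k g (dl R b)"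
  proof
   fix b assume "b \<in> W k"
   from gr[OF dl_mem[OF this]] obtain u where "?r k g (dl R b) = D k u" "u \<in> Vec R (W (Suc k))" ..
   thus "\<exists>u. u \<in> Vec R (W (Suc k)) \<and> D k u = ?r k g (dl R b)" by metis
  qed
  then obtain u where u: "\<And>b. b \<in> W k \<Longrightarrow> u b \<in> Vec R (W (Suc k))" "\<And>b. b \<in> W k \<Longrightarrow> D k (u b) = ?r k g (dl R b)"
   using bchoice[of "W k" "\<lambda>b u. u \<in> Vec R (W (Suc k)) \<and> D k u = ?r k g (dl R b)"] by blast
  let ?g = "lin_ext R (Fr R (W (Suc k))) u"
  have u': "u \<in> W k \<rightarrow> Vec R (W (Suc k))" using u(1) by auto
  note g'l = lin_ext_lin[OF FrM u']
  have Q: "D k (?g x) = ?r k g x" if x: "x \<in> Vec R (W k)" for x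
   by (rule lin_Fr_eq[OF lin_comp[OF g'l Dl] rl[OF gl] FrM _ x]) (simp add: lin_ext_dl[OF FrM u'] u(2))
  have g'V: "lin_map R (Fr R (V (Suc k))) (Fr R (W (Suc k))) ?g" using g'l by (simp add: V)
  have "?r (Suc k) ?g x \<in> D (Suc k) ` (Vec R (W (Suc (Suc k))))" if x: "x \<in> Vec R (W (Suc k))" for x
  proof (rule ex)
   have c: "f (Suc k) x \<in> Vec R (W (Suc k))" "D k x \<in> Vec R (W k)" "?g (D k x) \<in> Vec R (W (Suc k))"
    by (rule lin_closed[OF fl x], rule lin_closed[OF Dl x], rule lin_closed[OF g'l lin_closed[OF Dl x]])
   interpret F: Module.module R "Fr R (W (Suc k))" by (rule FrM)
   interpret F0: Module.module R "Fr R (W k)" by (rule FrM)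
   show "?r (Suc k) ?g x \<in> Vec R (W (Suc k))" by (rule lin_closed[OF rl[OF g'V] x])
   have gz: "g (\<Delta> k (D k x)) = \<zero>\<^bsub>Fr R (W k)\<^esub>"
    unfolding \<Delta>D[OF x] using lin_zero[OF gl FrM FrM] by (simp add: Fr_simps)
   have fc: "f k (D k x) \<in> Vec R (W k)" by (rule lin_closed[OF fl c(2)])
   have "D k (?r (Suc k) ?g x) = (D k x \<ominus>\<^bsub>Fr R (W k)\<^esub> f k (D k x)) \<ominus>\<^bsub>Fr R (W k)\<^esub> D k (?g (D k x))"
    using c x by (simp add: \<Delta> lin_diff[OF Dl FrM FrM] fD)
   also have "D k (?g (D k x)) = (D k x \<ominus>\<^bsub>Fr R (W k)\<^esub> f k (D k x)) \<ominus>\<^bsub>Fr R (W k)\<^esub> \<zero>\<^bsub>Fr R (W k)\<^esub>" unfolding Q[OF c(2)] gz ..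
   also have "\<dots> = D k x \<ominus>\<^bsub>Fr R (W k)\<^esub> f k (D k x)" using c(2) fc by (simp add: module_diff_zero[OF FrM])
   also have "(D k x \<ominus>\<^bsub>Fr R (W k)\<^esub> f k (D k x)) \<ominus>\<^bsub>Fr R (W k)\<^esub> (D k x \<ominus>\<^bsub>Fr R (W k)\<^esub> f k (D k x)) = \<o>"
    using module_diff_zero_iff[OF FrM, of "D k x \<ominus>\<^bsub>Fr R (W k)\<^esub> f k (D k x)" "W k" "D k x \<ominus>\<^bsub>Fr R (W k)\<^esub> f k (D k x)"] c(2) fc
    by (simp add: Fr_simps)
   finally show "D k (?r (Suc k) ?g x) = \<o>" .
  qed
  thus ?thesis using Q g'V by (intro exI[of _ ?g]) blast
 qed
 from dependent_nat_choice[of ?P ?Q, OF base step]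
 obtain g where S: "\<forall>k. ?P k (g k) \<and> ?Q k (g k) (g (Suc k))" by (rule exE)
 have P: "?P k (g k)" and Q: "?Q k (g k) (g (Suc k))" for k
  using S[THEN spec, of k] by (rule conjunct1, rule conjunct2)
 have "W (Suc k) = {}" if k: "H \<le> k" for k
 proof (rule ccontr)
  assume "W (Suc k) \<noteq> {}"
  then obtain b where b: "b \<in> W (Suc k)" by blast
  let ?x = "dl R b"
  note x = dl_mem[OF b]
  have gl: "lin_map R (Fr R (V (Suc k))) (Fr R (W (Suc k))) (g (Suc k))" "lin_map R (Fr R (V (Suc (Suc k)))) (Fr R (W (Suc (Suc k)))) (g (Suc (Suc k)))"
   using P[of "Suc k"] P[of "Suc (Suc k)"] by blast+
  have "\<sigma> (Suc k) y = \<o>" for y using sH[of "Suc k"] k by (intro ext) simp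
  hence "f (Suc k) ?x = \<o>"
   unfolding fd[OF b] using lin_zero[OF pl FrM FrM] by (simp add: Fr_simps)
  hence e: "D (Suc k) (g (Suc (Suc k)) ?x) b = (?x b \<ominus> \<zero>) \<ominus> g (Suc k) (D k ?x) b"
   using Q[of "Suc k"] x ra[OF gl(1) x, of b] by (simp add: \<Delta>)
  have gm: "g (Suc (Suc k)) ?x \<in> Vec R (W (Suc (Suc k)))" using lin_closed[OF gl(2), of ?x] x by (simp add: V)
  have gV: "lin_map R (Fr R (W k)) (Fr R (W (Suc k))) (g (Suc k))" using gl(1) by (simp add: V)
  have Dm: "D k ?x \<in> Vec R (W k)" by (rule lin_closed[OF Dl x])
  have c: "?x b \<in> carrier R" "g (Suc k) (D k ?x) b \<in> carrier R" using FrD(1)[OF x] FrD(1)[OF lin_closed[OF gV Dm]] by auto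
  have "?x b = D (Suc k) (g (Suc (Suc k)) ?x) b \<oplus> g (Suc k) (D k ?x) b"
   unfolding e using c by (simp add: a_minus_def grp_simps)
  hence "D (Suc k) (g (Suc (Suc k)) ?x) b \<oplus> g (Suc k) (D k ?x) b = \<one>" by (simp add: dl_def)
  moreover have "D (Suc k) (g (Suc (Suc k)) ?x) b \<oplus> g (Suc k) (D k ?x) b \<noteq> \<one>"
   by (rule not_one_if_minimal[OF m gV min[OF gm] Dm min[OF x]])
  ultimately show False by blast
 qed
 hence "W k = {}" if "Suc H \<le> k" for k using that by (cases k) auto
 thus ?thesis by blast
qed

end

end

section \<open>The mapping cone of free complexes in coordinates\<close>

definition fcB :: "(int \<Rightarrow> 'x set) \<Rightarrow> (int \<Rightarrow> 'y set) \<Rightarrow> int \<Rightarrow> ('x + 'y) set" where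
 "fcB BX BY n = Inl ` BX (n - 1) \<union> Inr ` BY n"

definition fcone :: "('a, 'r) ring_scheme \<Rightarrow> ('a, 'x \<Rightarrow> 'a) chain_cx \<Rightarrow> (int \<Rightarrow> 'x set) \<Rightarrow> ('a, 'y \<Rightarrow> 'a) chain_cx \<Rightarrow> (int \<Rightarrow> 'y set) \<Rightarrow>
  (int \<Rightarrow> ('x \<Rightarrow> 'a) \<Rightarrow> 'y \<Rightarrow> 'a) \<Rightarrow> ('a, 'x + 'y \<Rightarrow> 'a) chain_cx" where
 "fcone R X BX Y BY q = \<lparr>cx_mod = (\<lambda>n. Fr R (fcB BX BY n)),
  cx_d = (\<lambda>n f. (\<lambda>u. case_sum (fst u) (snd u)) (cx_d (cone R X Y q) n ((\<lambda>b. f (Inl b)), (\<lambda>b. f (Inr b)))))\<rparr>"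

context cring
begin

lemma fcB_mem:
 assumes f: "f \<in> Vec R (fcB BX BY n)"
 shows "(\<lambda>b. f (Inl b)) \<in> Vec R (BX (n - 1))" "(\<lambda>b. f (Inr b)) \<in> Vec R (BY n)"
proof -
 note c = FrD(1)[OF f] and s = FrD(4)[OF f] and fin = FrD(3)[OF f]
 have 1: "supp R (\<lambda>b. f (Inl b)) = Inl -` supp R f" "supp R (\<lambda>b. f (Inr b)) = Inr -` supp R f" by (auto simp: supp_def)
 have 2: "Inl -` supp R f \<subseteq> BX (n - 1)" "Inr -` supp R f \<subseteq> BY n" using s by (auto simp: fcB_def)
 have 3: "finite (Inl -` supp R f)" "finite (Inr -` supp R f)" using fin by (auto intro: finite_vimageI)
 show "(\<lambda>b. f (Inl b)) \<in> Vec R (BX (n - 1))" "(\<lambda>b. f (Inr b)) \<in> Vec R (BY n)"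
  unfolding Fr_carrier 1 using c 2 3 by auto
qed

lemma fcB_case:
 assumes f: "f \<in> Vec R (BX (n - 1))" and g: "g \<in> Vec R (BY n)"
 shows "case_sum f g \<in> Vec R (fcB BX BY n)"
proof -
 have "supp R (case_sum f g) = Inl ` supp R f \<union> Inr ` supp R g"
 proof (rule Set.set_eqI)
  show "x \<in> supp R (case_sum f g) \<longleftrightarrow> x \<in> Inl ` supp R f \<union> Inr ` supp R g" for x
   by (cases x) (auto simp: supp_def)
 qed
 thus ?thesis using FrD[OF f] FrD[OF g] by (auto simp: Fr_carrier fcB_def split: sum.splits)
qed

context
 fixes X :: "('a, 'x \<Rightarrow> 'a) chain_cx" and BX and Y :: "('a, 'y \<Rightarrow> 'a) chain_cx" and BY and q
 assumes X: "free_cx R X BX" and Y: "free_cx R Y BY" and q: "chain_map R X Y q"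
begin

lemma fcone_iso:
 "free_cx R (fcone R X BX Y BY q) (fcB BX BY)"
 "\<exists>\<theta> \<eta>. cx_iso R (fcone R X BX Y BY q) (cone R X Y q) \<theta> \<eta>"
proof -
 note Xc = fcD(1)[OF X] and Yc = fcD(1)[OF Y] and Xm = fcD(2)[OF X] and Ym = fcD(2)[OF Y]
 note cs = cone_simps[OF Xc Yc q]
 let ?\<theta> = "\<lambda>(n::int) f. ((\<lambda>b. f (Inl b)), (\<lambda>b. f (Inr b)))" and ?\<eta> = "\<lambda>(n::int) u. case_sum (fst u) (snd u)"
 have e: "lin_map R ((cone R X Y q)$n) (Fr R (fcB BX BY n)) (?\<eta> n)" for n
 proof (rule lin_mapI)
  fix u assume u: "u \<in> (cone R X Y q)$$n"
  show "?\<eta> n u \<in> Vec R (fcB BX BY n)" by (rule fcB_case) (use u in \<open>auto simp: cs Xm Ym\<close>)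
  show "?\<eta> n (u \<oplus>\<^bsub>(cone R X Y q)$n\<^esub> v) = ?\<eta> n u \<oplus>\<^bsub>Fr R (fcB BX BY n)\<^esub> ?\<eta> n v" for v
   by (rule ext) (auto simp: cs Xm Ym Fr_simps split: sum.splits)
  show "?\<eta> n (r \<odot>\<^bsub>(cone R X Y q)$n\<^esub> u) = r \<odot>\<^bsub>Fr R (fcB BX BY n)\<^esub> ?\<eta> n u" for r
   by (rule ext) (auto simp: cs Xm Ym Fr_simps split: sum.splits)
 qed
 have t: "?\<theta> n x \<in> (cone R X Y q)$$n" if "x \<in> Vec R (fcB BX BY n)" for n x
  using fcB_mem[OF that] by (simp add: cs Xm Ym)
 note * = free_cx_of_iso[OF cone_chain_complex[OF Xc Yc q], of "fcB BX BY" ?\<theta> ?\<eta>, OF t e]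
 show "free_cx R (fcone R X BX Y BY q) (fcB BX BY)"
  unfolding fcone_def by (rule *(1)) (auto intro!: ext split: sum.splits)
 have "cx_iso R (fcone R X BX Y BY q) (cone R X Y q) ?\<theta> ?\<eta>"
  unfolding fcone_def by (rule *(2)) (auto intro!: ext split: sum.splits)
 thus "\<exists>\<theta> \<eta>. cx_iso R (fcone R X BX Y BY q) (cone R X Y q) \<theta> \<eta>" by blast
qed

lemma fcone_exact:
 assumes "quasi_iso R X Y q" shows "cx_exact (fcone R X BX Y BY q) n"
proof -
 obtain \<theta> \<eta> where i: "cx_iso R (fcone R X BX Y BY q) (cone R X Y q) \<theta> \<eta>" using fcone_iso(2) by blast
 show ?thesis
  by (rule cx_iso_exact[OF cx_iso_sym[OF i] cone_exact[OF fcD(1)[OF X] fcD(1)[OF Y] q assms]])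
qed

lemma fcone_d:
 assumes f: "f \<in> Vec R (fcB BX BY n)"
 shows "cx_d (fcone R X BX Y BY q) n f (Inl b) = \<ominus> cx_d X (n - 1) (\<lambda>b. f (Inl b)) b"
  "cx_d (fcone R X BX Y BY q) n f (Inr c) = cx_d Y n (\<lambda>b. f (Inr b)) c \<oplus> q (n - 1) (\<lambda>b. f (Inl b)) c"
proof -
 have "cx_d X (n - 1) (\<lambda>b. f (Inl b)) \<in> Vec R (BX (n - 2))"
  by (rule lin_closed[OF free_cx_d[OF X] fcB_mem(1)[OF f]]) simp
 thus "cx_d (fcone R X BX Y BY q) n f (Inl b) = \<ominus> cx_d X (n - 1) (\<lambda>b. f (Inl b)) b"
  by (simp add: fcone_def cone_simps[OF fcD(1)[OF X] fcD(1)[OF Y] q] fcD(2)[OF X] Fr_inv)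
 show "cx_d (fcone R X BX Y BY q) n f (Inr c) = cx_d Y n (\<lambda>b. f (Inr b)) c \<oplus> q (n - 1) (\<lambda>b. f (Inl b)) c"
  by (simp add: fcone_def cone_simps[OF fcD(1)[OF X] fcD(1)[OF Y] q] fcD(2)[OF Y] Fr_simps)
qed

text \<open>Where \<open>Y\<close> has no basis, an element of the cone is an element x of
  \<open>X\<close> in degree \<open>v - 1\<close>. If dx has coefficients in \<open>I\<close>, so
  has h d x, and x is congruent to d h x. The shift in the cone turns the bound \<open>n\<close>
  into \<open>n + 1\<close>.\<close>

lemma fcone_tnull_high:
 assumes h: "\<And>i. lin_map R (Fr R (BX i)) (Fr R (BX (i + 1))) (h i)"
  and hh: "\<And>v x. n < v \<Longrightarrow> x \<in> Vec R (BX v) \<Longrightarrow> x = cx_d X (v + 1) (h v x) \<oplus>\<^bsub>Fr R (BX v)\<^esub> h (v - 1) (cx_d X v x)"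
  and e: "BY v = {}" and v: "n + 1 < v" and I: "ideal I R"
 shows "tnull R (fcone R X BX Y BY q) (fcB BX BY) {\<one>} v I"
 unfolding tnull_def
proof (intro ballI impI)
 let ?C = "fcone R X BX Y BY q" and ?B = "fcB BX BY"
 fix z assume z: "z \<in> Vec R (?B v)" and dz: "\<forall>b. cx_d ?C v z b \<in> I"
 let ?x = "\<lambda>b. z (Inl b)"
 note x = fcB_mem(1)[OF z]
 have hx: "h (v - 1) ?x \<in> Vec R (BX v)" using lin_closed[OF h x] by simp
 have dx: "cx_d X (v - 1) ?x \<in> Vec R (BX (v - 2))" by (rule lin_closed[OF free_cx_d[OF X] x]) simp
 have dhx: "cx_d X v (h (v - 1) ?x) \<in> Vec R (BX (v - 1))" by (rule lin_closed[OF free_cx_d[OF X refl] hx])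
 have h2: "lin_map R (Fr R (BX (v - 2))) (Fr R (BX (v - 1))) (h (v - 2))" using h[of "v - 2"] by simp
 have "cx_d X (v - 1) ?x b \<in> I" for b
  using idp(5)[OF I dz[rule_format, of "Inl b"]] FrD(1)[OF dx, of b] by (simp add: fcone_d[OF z])
 hence hI: "h (v - 2) (cx_d X (v - 1) ?x) b \<in> I" for b by (rule lin_coeffs[OF h2 dx _ I])
 have xe: "?x b = cx_d X v (h (v - 1) ?x) b \<oplus> h (v - 2) (cx_d X (v - 1) ?x) b" for b
 proof -
  have "?x = cx_d X (v - 1 + 1) (h (v - 1) ?x) \<oplus>\<^bsub>Fr R (BX (v - 1))\<^esub> h (v - 1 - 1) (cx_d X (v - 1) ?x)"
   by (rule hh[OF _ x]) (use v in simp)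
  from fun_cong[OF this, of b] show ?thesis by (simp add: Fr_simps)
 qed
 \<comment> \<open>The sign cancels the minus sign with which the differential of \<open>X\<close>
   occurs in the cone.\<close>
 let ?w = "case_sum (\<lambda>b. \<ominus> h (v - 1) ?x b) \<o>"
 have w: "?w \<in> Vec R (?B (v + 1))" by (rule fcB_case) (use Fr_inv_mem[OF hx] Fr_zero in simp_all)
 have dneg: "cx_d X v (\<lambda>b. \<ominus> h (v - 1) ?x b) = (\<lambda>b. \<ominus> cx_d X v (h (v - 1) ?x) b)"
  using lin_inv[OF free_cx_d[OF X refl] FrM FrM hx] Fr_inv[OF hx] Fr_inv[OF dhx] by simp
 have dw: "cx_d ?C (v + 1) ?w \<in> Vec R (?B v)" by (rule lin_closed[OF free_cx_d[OF fcone_iso(1)] w]) simp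
 have "\<one> \<otimes> z c \<ominus> cx_d ?C (v + 1) ?w c \<in> I" for c
 proof (cases c)
  case (Inl b)
  have k: "cx_d X v (h (v - 1) ?x) b \<in> carrier R" "h (v - 2) (cx_d X (v - 1) ?x) b \<in> carrier R"
   using FrD(1)[OF dhx] idp(1)[OF I] hI by blast+
  have "\<one> \<otimes> z c \<ominus> cx_d ?C (v + 1) ?w c = h (v - 2) (cx_d X (v - 1) ?x) b"
   using k xe[of b] Inl by (simp add: fcone_d[OF w] dneg grp_simps)
  thus ?thesis using hI by simp
 next
  case (Inr b)
  hence "c \<notin> ?B v" using e by (auto simp: fcB_def)
  hence "\<one> \<otimes> z c \<ominus> cx_d ?C (v + 1) ?w c = \<zero>" using FrD(2)[OF z] FrD(2)[OF dw] by (simp add: a_minus_def)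
  thus ?thesis using idp(2)[OF I] by simp
 qed
 thus "\<exists>y\<in>{\<one>}. \<exists>w\<in>Vec R (?B (v + 1)). \<forall>b. y \<otimes> z b \<ominus> cx_d ?C (v + 1) w b \<in> I"
  using w by blast
qed

end

end

text \<open>The identity of the dual in degree \<open>s\<close> is a cycle of the cone tensored with
  the cokernel of the differential into that degree. A primitive provides the initial matrices
  \<open>\<sigma>\<close> and \<open>\<mu>\<close> of \<open>zigzag_vanishing\<close>.\<close>

lemma (in noeth_local) dual_exact_bounded:
 fixes L :: "('a, 'w \<Rightarrow> 'a) chain_cx" and S :: "('a, 't \<Rightarrow> 'a) chain_cx"
 assumes L: "free_cx R L B" and fin: "\<And>n. finite (B n)" and min: "minimal_cx R \<mm> L B"
  and top: "\<And>n. l < n \<Longrightarrow> B n = {}" and ex: "\<And>i. s < i \<Longrightarrow> cx_exact (dual_cx R L B) i"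
  and S: "free_cx R S BS" "lowers R S BS ht" and \<psi>: "quasi_iso R S L \<psi>"
  and h: "\<And>i. lin_map R (Fr R (BS i)) (Fr R (BS (i + 1))) (h i)"
  and hh: "\<And>v x. n < v \<Longrightarrow> x \<in> Vec R (BS v) \<Longrightarrow> x = cx_d S (v + 1) (h v x) \<oplus>\<^bsub>Fr R (BS v)\<^esub> h (v - 1) (cx_d S v x)"
 shows "\<exists>k. \<forall>i>k. B (- i) = {}"
proof -
 let ?V = "dual_cx R L B" and ?C = "fcone R S BS L B \<psi>" and ?BC = "fcB BS B"
 note Lc = fcD(1)[OF L] and Lm = fcD(2)[OF L] and Sc = fcD(1)[OF S(1)] and Sm = fcD(2)[OF S(1)]
 note V = dual_free_cx[OF L fin]
 note Vc = fcD(1)[OF V] and Vm = fcD(2)[OF V]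
 have cm: "chain_map R S L \<psi>" using \<psi> quasi_iso_iff[OF Sc Lc] by blast
 note C = fcone_iso(1)[OF S(1) L cm]
 have tn: "tnull R ?C ?BC {\<one>} v I" if "ideal I R" for v I
 proof (rule acyclic_bounded_above_pure[OF C fcone_exact[OF S(1) L cm \<psi>] _ that])
  \<comment> \<open>Above degree \<open>l\<close> only \<open>S\<close> contributes to the cone, and
    above \<open>n + 1\<close> it is contracted by \<open>h\<close>.\<close>
  fix u J assume u: "max l (n + 1) < u" and J: "ideal J R"
  show "tnull R ?C ?BC {\<one>} u J"
   by (rule fcone_tnull_high[OF S(1) L cm h hh top _ J]) (use u in auto)
 qed
 \<comment> \<open>Degree \<open>s + k\<close> of the dual is paired with degree
   \<open>- (s + k)\<close> of \<open>L\<close>, so \<open>L\<close> and \<open>S\<close> are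
   traversed downwards while the dual is traversed upwards.\<close>
 define W where "W k = B (- (s + int k))" for k
 define D where "D k = cx_d ?V (s + int k + 1)" for k
 define E where "E k = cx_d L (- (s + int k))" for k
 define T where "T k = BS (- (s + int k))" for k
 define e where "e k = cx_d S (- (s + int k))" for k
 define p where "p k = \<psi> (- (s + int k))" for k
 have ix: "- (s + int (Suc k)) = - (s + int k) - 1" "- (s + int k + 1) = - (s + int k) - 1" "1 - (s + int k + 1) = - (s + int k)"
  "s + int (Suc k) = s + int k + 1" for k by simp_all
 have WS: "W (Suc k) = B (- (s + int k) - 1)" and TS: "T (Suc k) = BS (- (s + int k) - 1)" for k
  unfolding W_def T_def ix by (rule refl)+
 have WV: "W k = B (- (s + int k))" "W (Suc k) = B (- (s + int k + 1))" for k unfolding WS ix by (simp_all add: W_def)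
 have finW: "finite (W k)" for k by (simp add: W_def fin)
 have Dl: "lin_map R (Fr R (W (Suc k))) (Fr R (W k)) (D k)" for k
  unfolding D_def WV(2) unfolding WV(1) by (rule free_cx_d[OF V]) simp
 have El: "lin_map R (Fr R (W k)) (Fr R (W (Suc k))) (E k)" for k
  unfolding E_def WS unfolding W_def by (rule free_cx_d[OF L refl])
 have el: "lin_map R (Fr R (T k)) (Fr R (T (Suc k))) (e k)" for k
  unfolding e_def TS unfolding T_def by (rule free_cx_d[OF S(1) refl])
 have pl: "lin_map R (Fr R (T k)) (Fr R (W k)) (p k)" for k
  unfolding p_def T_def W_def using cm_lin[OF cm, of "- (s + int k)"] by (simp only: Sm Lm)
 have ad: "pr R (E k a) v = pr R a (D k v)" if "a \<in> Vec R (W k)" "v \<in> Vec R (W (Suc k))" for k a v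
  using dual_adj[OF L fin, of a "s + int k + 1" v] that unfolding E_def D_def WV(2) ix(3) unfolding WV(1) by simp
 have DD: "D k (D (Suc k) v) = \<o>" if "v \<in> Vec R (W (Suc (Suc k)))" for k v
  using fd_d[OF V, of v "s + int (Suc k) + 1" "s + int k + 1"] that unfolding D_def WV(2) by simp
 have exW: "v \<in> D (Suc k) ` (Vec R (W (Suc (Suc k))))" if v: "v \<in> Vec R (W (Suc k))" "D k v = \<o>" for k v
 proof -
  have "\<exists>w\<in>?V$$(s + int (Suc k) + 1). cx_d ?V (s + int (Suc k) + 1) w = v"
  proof (rule cx_exactD[OF ex])
   show "s < s + int k + 1" by simp
   show "v \<in> ?V$$(s + int k + 1)" using v(1) unfolding Vm WV(2) .
   show "cx_d ?V (s + int k + 1) v = \<zero>\<^bsub>?V$(s + int k + 1 - 1)\<^esub>" using v(2) by (simp add: D_def Vm Fr_simps)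
  qed simp
  then obtain w where "w \<in> ?V$$(s + int (Suc k) + 1)" "cx_d ?V (s + int (Suc k) + 1) w = v" ..
  thus ?thesis unfolding D_def Vm WV(2) by blast
 qed
 have ee: "e (Suc k) (e k x) = \<o>" if "x \<in> Vec R (T k)" for k x
  using fd_d[OF S(1), of x "- (s + int k)" "- (s + int k) - 1"] that unfolding e_def T_def ix(1) by simp
 have pe: "p (Suc k) (e k x) = E k (p k x)" if "x \<in> Vec R (T k)" for k x
  using cm_d[OF cm, of x "- (s + int k)" "- (s + int k) - 1"] that unfolding e_def E_def T_def p_def ix(1) by (simp add: Sm)
 have htT: "ht (- (s + int (Suc k))) c < ht (- (s + int k)) b" if "b \<in> T k" "e k (dl R b) c \<noteq> \<zero>" for k b c
  using S(2) that unfolding lowers_def e_def T_def ix(1) by (auto simp: supp_def)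
 let ?U = "D 0 ` (Vec R (W (Suc 0)))"
 note U = image_submodule[OF Dl[of 0]]
 note u = sub_FrD[OF U]
 have W0: "W 0 = B (- s)" by (simp add: W_def)
 have T0: "T 0 = BS (- s)" by (simp add: T_def)
 \<comment> \<open>The identity matrix, placed in the component of the cone that belongs to
   \<open>L\<close>.\<close>
 define z where "z y = (if y \<in> W 0 then dl R (Inr y :: 't + 'w) else \<o>)" for y
 have zm: "z y \<in> Vec R (?BC (- s))" for y
  unfolding z_def using dl_mem[of "Inr y" "?BC (- s)"] Fr_zero by (auto simp: fcB_def W0)
 have zl: "(\<lambda>b. z y (Inl b)) = \<o>" and zr: "(\<lambda>b. z y (Inr b)) = (if y \<in> W 0 then dl R y else \<o>)" for y
  by (auto simp: z_def dl_def)
 have zrow: "(\<lambda>y. z y (Inr b)) = (if b \<in> W 0 then dl R b else \<o>)" for b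
  by (auto simp: z_def dl_def)
 have zmat: "z \<in> mat R (?BC (- s)) (Vec R (W 0))"
 proof -
  have "(\<lambda>y. z y c) \<in> Vec R (W 0)" for c
  proof (cases c)
   case (Inl b)
   hence "(\<lambda>y. z y c) = \<o>" using fun_cong[OF zl] by simp
   thus ?thesis using Fr_zero by simp
  next
   case (Inr b)
   thus ?thesis using zrow[of b] dl_mem[of b "W 0"] Fr_zero by (auto split: if_splits)
  qed
  thus ?thesis using zm by (simp add: mat_def)
 qed
 have S0: "cx_d S m \<o> = \<o>" and P0: "\<psi> m \<o> = \<o>" and L0: "cx_d L m \<o> = \<o>" for m
  using lin_zero[OF free_cx_d[OF S(1) refl] FrM FrM] lin_zero[OF free_cx_d[OF L refl] FrM FrM]
   lin_zero[OF cm_lin[OF cm] cxM[OF Sc] cxM[OF Lc]] by (simp_all add: Fr_simps Sm Lm)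
 \<comment> \<open>By adjunction row \<open>b\<close> of the boundary is
   \<open>D 0 (dl R b)\<close>, an element of \<open>?U\<close>; the component in \<open>S\<close>
   is zero.\<close>
 have dz: "(\<lambda>y. cx_d ?C (- s) (z y) c) \<in> ?U" for c
 proof (cases c)
  case (Inl b)
  hence "(\<lambda>y. cx_d ?C (- s) (z y) c) = \<o>"
   by (simp add: fcone_d[OF S(1) L cm zm] zl S0)
  thus ?thesis using u(2) by simp
 next
  case (Inr b)
  have Ec: "E 0 (dl R y) \<in> Vec R (W (Suc 0))" if "y \<in> W 0" for y by (rule lin_closed[OF El dl_mem[OF that]])
  have r: "(\<lambda>y. cx_d ?C (- s) (z y) c) = (\<lambda>y. if y \<in> W 0 then E 0 (dl R y) b else \<zero>)"
  proof
   fix y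
   have "cx_d ?C (- s) (z y) c = cx_d L (- s) (\<lambda>b. z y (Inr b)) b \<oplus> \<zero>"
    using Inr by (simp add: fcone_d[OF S(1) L cm zm] zl P0)
   thus "cx_d ?C (- s) (z y) c = (if y \<in> W 0 then E 0 (dl R y) b else \<zero>)"
    using FrD(1)[OF Ec] by (simp add: zr L0 E_def)
  qed
  show ?thesis
  proof (cases "b \<in> W (Suc 0)")
   case True
   have "(\<lambda>y. if y \<in> W 0 then E 0 (dl R y) b else \<zero>) = D 0 (dl R b)"
   proof
    fix y
    note Db = lin_closed[OF Dl dl_mem[OF True]]
    show "(if y \<in> W 0 then E 0 (dl R y) b else \<zero>) = D 0 (dl R b) y"
    proof (cases "y \<in> W 0")
     case y: True
     have "E 0 (dl R y) b = pr R (E 0 (dl R y)) (dl R b)" using pr_right_dl[OF Ec[OF y] True] by simp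
     also have "\<dots> = pr R (dl R y) (D 0 (dl R b))" by (rule ad[OF dl_mem[OF y] dl_mem[OF True]])
     also have "\<dots> = D 0 (dl R b) y" by (rule pr_dl[OF Fr_Pi[OF Db] y])
     finally show ?thesis using y by simp
    qed (use FrD(2)[OF Db] in simp)
   qed
   thus ?thesis unfolding r using dl_mem[OF True] by blast
  next
   case False
   hence "(\<lambda>y. if y \<in> W 0 then E 0 (dl R y) b else \<zero>) = \<o>" using FrD(2)[OF Ec] by auto
   thus ?thesis unfolding r using u(2) by simp
  qed
 qed
 \<comment> \<open>The primitive modulo \<open>?U\<close>. Its components in \<open>S\<close> and in
   \<open>L\<close> become \<open>\<sigma>\<close> and \<open>\<mu>\<close>.\<close>
 obtain w where w: "w \<in> mat R (?BC (- s + 1)) (Vec R (W 0))" and wU: "\<And>b. (\<lambda>y. z y b \<ominus> cx_d ?C (- s + 1) (w y) b) \<in> ?U"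
  using pure_submodule[OF C tn finW U zmat dz] by blast
 define \<sigma> where "\<sigma> y = (\<lambda>b. w y (Inl b))" for y
 define \<mu> where "\<mu> y = (\<lambda>b. w y (Inr b))" for y
 have sm: "\<sigma> y \<in> Vec R (T 0)" and mm: "\<mu> y \<in> Vec R (B (1 - s))" for y
  unfolding \<sigma>_def \<mu>_def T0 using fcB_mem[OF matD(1)[OF w]] by (simp_all add: add.commute)
 have rowW: "(\<lambda>y. w y c) \<in> Vec R (W 0)" for c by (rule matD(2)[OF w])
 have smat: "\<sigma> \<in> mat R (T 0) (Vec R (W 0))" "\<mu> \<in> mat R (B (1 - s)) (Vec R (W 0))"
  using sm mm rowW by (auto simp: mat_def) (simp_all add: \<sigma>_def \<mu>_def)
 have d1: "cx_d ?C (- s + 1) (w y) (Inl b) = \<ominus> e 0 (\<sigma> y) b"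
  "cx_d ?C (- s + 1) (w y) (Inr c) = cx_d L (1 - s) (\<mu> y) c \<oplus> p 0 (\<sigma> y) c" for y b c
  unfolding fcone_d[OF S(1) L cm matD(1)[OF w]] by (simp_all add: e_def \<sigma>_def \<mu>_def p_def)
 have eU: "(\<lambda>y. e 0 (\<sigma> y) b) \<in> ?U" for b
 proof -
  have "e 0 (\<sigma> y) b \<in> carrier R" for y by (rule FrD(1)[OF lin_closed[OF el sm]])
  thus ?thesis using wU[of "Inl b"] unfolding d1 by (simp add: fun_cong[OF zl] a_minus_def)
 qed
 have rows: "(\<lambda>y. dl R b y \<ominus> (cx_d L (1 - s) (\<mu> y) b \<oplus> p 0 (\<sigma> y) b)) \<in> ?U" if "b \<in> W 0" for b
  using wU[of "Inr b"] fun_cong[OF zrow[of b]] that unfolding d1 by simp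
 have D'l: "lin_map R (Fr R (W 0)) (Fr R (B (1 - s))) (cx_d ?V s)"
  using free_cx_d[OF V, of "s - 1" s] by (simp add: W0)
 have ad': "pr R (cx_d L (1 - s) a) v = pr R a (cx_d ?V s v)" if "a \<in> Vec R (B (1 - s))" "v \<in> Vec R (W 0)" for a v
  using dual_adj[OF L fin, of a s v] that by (simp add: W0)
 have E'c: "cx_d L (1 - s) a \<in> Vec R (W 0)" if "a \<in> Vec R (B (1 - s))" for a
  unfolding W0 by (rule lin_closed[OF free_cx_d[OF L] that]) simp
 have D'D: "cx_d ?V s (D 0 v) = \<o>" if "v \<in> Vec R (W (Suc 0))" for v
  using fd_d[OF V, of v "s + 1" s] that by (simp add: D_def W_def)
 have minD: "D k v b \<in> \<mm>" if "v \<in> Vec R (W (Suc k))" for k v b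
  using dual_minimal[OF L fin min mm_ideal] that unfolding minimal_cx_def D_def WV(2) by blast
 have "\<exists>H. \<forall>k\<ge>H. W k = {}"
  by (rule zigzag_vanishing[where W = W and D = D and E = E and T = T and e = e and \<psi> = p and
     ht = "\<lambda>k. ht (- (s + int k))" and D' = "cx_d ?V s" and E' = "cx_d L (1 - s)",
     OF finW Dl ad lin_closed[OF El] exW DD el ee pl pe htT smat(1) eU D'l ad' E'c D'D smat(2) rows mm_ideal mm_one minD])
 then obtain H where H: "\<And>k. H \<le> k \<Longrightarrow> W k = {}" by blast
 have "B (- i) = {}" if "s + int H < i" for i
  using H[of "nat (i - s)"] that by (simp add: W_def)
 thus ?thesis by blast
qed

section \<open>Copies of free complexes\<close>

context cring
begin

lemma projective_iso:
 fixes M :: "('a, 'x) module"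
 assumes M: "Module.module R M" and e: "lin_map R (Fr R B) M e" and g: "lin_map R M (Fr R B) g"
  and eg: "\<And>x. x \<in> carrier M \<Longrightarrow> e (g x) = x"
 shows "projective R M"
 unfolding projective_def
proof (intro conjI allI impI M)
 fix A :: "('a, ('a, 'x) univ) module" and C :: "('a, ('a, 'x) univ) module" and h f
 assume a: "Module.module R A \<and> Module.module R C \<and> lin_map R A C h \<and> h ` carrier A = carrier C \<and> lin_map R M C f"
 hence A: "Module.module R A" and C: "Module.module R C" and h: "lin_map R A C h" and f: "lin_map R M C f" and s: "h ` carrier A = carrier C"
  by auto
 have "\<exists>y. y \<in> carrier A \<and> h y = f (e (dl R b))" if "b \<in> B" for b
 proof -
  have "f (e (dl R b)) \<in> h ` carrier A" unfolding s by (rule lin_closed[OF f lin_closed[OF e dl_mem[OF that]]])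
  thus ?thesis by (metis imageE)
 qed
 then obtain y where y: "\<And>b. b \<in> B \<Longrightarrow> y b \<in> carrier A" "\<And>b. b \<in> B \<Longrightarrow> h (y b) = f (e (dl R b))" by metis
 have y': "y \<in> B \<rightarrow> carrier A" using y(1) by auto
 note l = lin_ext_lin[OF A y']
 have "h (lin_ext R A y x) = f (e x)" if "x \<in> Vec R B" for x
  by (rule lin_Fr_eq[OF lin_comp[OF l h] lin_comp[OF e f] C _ that]) (simp add: lin_ext_dl[OF A y'] y(2))
 hence "h (lin_ext R A y (g x)) = f x" if "x \<in> carrier M" for x
  using that eg lin_closed[OF g that] by simp
 thus "\<exists>k. lin_map R M A k \<and> (\<forall>x\<in>carrier M. h (k x) = f x)"
  using lin_comp[OF g l] by blast
qed

lemma fin_gen_free_iso: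
 assumes one: "\<one> \<noteq> \<zero>" and fin: "finite B" and M: "Module.module R M" and e: "lin_map R (Fr R B) M e" and g: "lin_map R M (Fr R B) g"
  and eg: "\<And>x. x \<in> carrier M \<Longrightarrow> e (g x) = x" and ge: "\<And>x. x \<in> Vec R B \<Longrightarrow> g (e x) = x"
 shows "fin_gen_free R M"
 unfolding fin_gen_free_def
proof (intro conjI M exI ballI)
 interpret M: Module.module R M by (rule M)
 let ?h = "\<lambda>b. e (dl R b)"
 let ?B = "?h ` B"
 have h: "?h \<in> B \<rightarrow> carrier M" using lin_closed[OF e dl_mem] by auto
 \<comment> \<open>Distinct basis vectors stay distinct because 1 is not 0; so their images form an
   honest basis set.\<close>
 have inj: "inj_on ?h B"
 proof
  fix b c assume bc: "b \<in> B" "c \<in> B" "?h b = ?h c"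
  have "dl R b = dl R c" using arg_cong[OF bc(3), of g] unfolding ge[OF dl_mem[OF bc(1)]] ge[OF dl_mem[OF bc(2)]] .
  hence "dl R b b = dl R c b" by simp
  thus "b = c" using one by (simp add: dl_def split: if_splits)
 qed
 show "finite ?B" using fin by simp
 show "?B \<subseteq> carrier M" using h by auto
 fix x assume x: "x \<in> carrier M"
 have sum: "(\<Oplus>\<^bsub>M\<^esub>b\<in>?B. c b \<odot>\<^bsub>M\<^esub> b) = e (\<lambda>b. if b \<in> B then c (?h b) else \<zero>)" if c: "c \<in> ?B \<rightarrow>\<^sub>E carrier R" for c
 proof -
  let ?f = "\<lambda>b. if b \<in> B then c (?h b) else \<zero>"
  have cc: "c (?h b) \<in> carrier R" if "b \<in> B" for b using c that by blast
  have f: "?f \<in> Vec R B" using cc by (simp add: Fr_fin[OF fin])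
  have "(\<Oplus>\<^bsub>M\<^esub>b\<in>?B. c b \<odot>\<^bsub>M\<^esub> b) = (\<Oplus>\<^bsub>M\<^esub>b\<in>B. c (?h b) \<odot>\<^bsub>M\<^esub> ?h b)"
   by (rule M.M.finsum_reindex[OF _ inj]) (use cc h in auto)
  also have "\<dots> = (\<Oplus>\<^bsub>M\<^esub>b\<in>B. ?f b \<odot>\<^bsub>M\<^esub> ?h b)"
   by (rule M.M.finsum_cong') (use cc h in auto)
  also have "\<dots> = lin_ext R M ?h ?f"
   by (rule lin_ext_superset[OF M h f fin, symmetric]) (auto simp: supp_def)
  also have "\<dots> = e ?f" by (rule lin_ext_unique[OF M h e refl f, symmetric])
  finally show ?thesis .
 qed
 define c0 where "c0 = restrict (\<lambda>y. g x (inv_into B ?h y)) ?B"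
 have gx: "g x \<in> Vec R B" by (rule lin_closed[OF g x])
 have c0: "c0 \<in> ?B \<rightarrow>\<^sub>E carrier R" using FrD(1)[OF gx] by (simp add: c0_def)
 have c0h: "c0 (?h b) = g x b" if "b \<in> B" for b using that inv_into_f_f[OF inj that] by (simp add: c0_def)
 show "\<exists>!c. c \<in> ?B \<rightarrow>\<^sub>E carrier R \<and> x = (\<Oplus>\<^bsub>M\<^esub>b\<in>?B. c b \<odot>\<^bsub>M\<^esub> b)"
 proof (intro ex1I conjI)
  show "c0 \<in> ?B \<rightarrow>\<^sub>E carrier R" by (rule c0)
  have "(\<lambda>b. if b \<in> B then c0 (?h b) else \<zero>) = g x" using c0h FrD(2)[OF gx] by auto
  thus "x = (\<Oplus>\<^bsub>M\<^esub>b\<in>?B. c0 b \<odot>\<^bsub>M\<^esub> b)" unfolding sum[OF c0] using eg[OF x] by simp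
  fix c assume c: "c \<in> ?B \<rightarrow>\<^sub>E carrier R \<and> x = (\<Oplus>\<^bsub>M\<^esub>b\<in>?B. c b \<odot>\<^bsub>M\<^esub> b)"
  let ?f = "\<lambda>b. if b \<in> B then c (?h b) else \<zero>"
  have cc: "c (?h b) \<in> carrier R" if "b \<in> B" for b using c that by blast
  hence f: "?f \<in> Vec R B" by (simp add: Fr_fin[OF fin])
  have "x = e ?f" using c sum[of c] by simp
  hence "g x = ?f" using ge[OF f] by simp
  hence "c y = c0 y" if "y \<in> ?B" for y using that c0h by auto
  thus "c = c0" using c c0 by (intro extensionalityI[of c ?B]) (auto simp: PiE_def)
 qed
qed

text \<open>The elements of a basis of \<open>M\<close> index the coordinates. A zero module gets
  the empty basis, so that boundedness survives the passage to coordinates.\<close>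

lemma fin_gen_free_coordinates:
 fixes M :: "('a, 'x) module"
 assumes one: "\<one> \<noteq> \<zero>" and "fin_gen_free R M"
 shows "\<exists>B \<theta> \<eta>. finite (B :: 'x set) \<and> (\<forall>x\<in>Vec R B. \<theta> x \<in> carrier M) \<and> lin_map R M (Fr R B) \<eta> \<and>
  (\<forall>x\<in>carrier M. \<theta> (\<eta> x) = x) \<and> (\<forall>x\<in>Vec R B. \<eta> (\<theta> x) = x) \<and> (zero_module M \<longrightarrow> B = {})"
proof -
 note f = assms(2)[unfolded fin_gen_free_def]
 note M = conjunct1[OF f]
 from conjunct2[OF f] obtain B where B': "finite B \<and> B \<subseteq> carrier M \<and>
  (\<forall>x\<in>carrier M. \<exists>!c. c \<in> B \<rightarrow>\<^sub>E carrier R \<and> x = (\<Oplus>\<^bsub>M\<^esub>b\<in>B. c b \<odot>\<^bsub>M\<^esub> b))" ..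
 note B = conjunct1[OF B'] conjunct1[OF conjunct2[OF B']] and u = conjunct2[OF conjunct2[OF B'], rule_format]
 interpret M: Module.module R M by (rule M)
 have id: "(\<lambda>b. b) \<in> B \<rightarrow> carrier M" using B(2) by auto
 let ?t = "lin_ext R M (\<lambda>b. b)"
 note tl = lin_ext_lin[OF M id]
 have ts: "?t f = (\<Oplus>\<^bsub>M\<^esub>b\<in>B. f b \<odot>\<^bsub>M\<^esub> b)" if "f \<in> Vec R B" for f
  by (rule lin_ext_superset[OF M id that B(1)]) (use FrD(4)[OF that] in auto)
 have rs: "(\<Oplus>\<^bsub>M\<^esub>b\<in>B. restrict f B b \<odot>\<^bsub>M\<^esub> b) = (\<Oplus>\<^bsub>M\<^esub>b\<in>B. f b \<odot>\<^bsub>M\<^esub> b)" if "f \<in> B \<rightarrow> carrier R" for f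
  by (rule M.M.finsum_cong') (use that B(2) in auto)
 have tinj: "f = f'" if f: "f \<in> Vec R B" "f' \<in> Vec R B" "?t f = ?t f'" for f f'
 proof -
  have r: "restrict f B \<in> B \<rightarrow>\<^sub>E carrier R" "restrict f' B \<in> B \<rightarrow>\<^sub>E carrier R" using FrD(1)[OF f(1)] FrD(1)[OF f(2)] by auto
  have "?t f = (\<Oplus>\<^bsub>M\<^esub>b\<in>B. restrict f B b \<odot>\<^bsub>M\<^esub> b)" "?t f = (\<Oplus>\<^bsub>M\<^esub>b\<in>B. restrict f' B b \<odot>\<^bsub>M\<^esub> b)"
   using ts[OF f(1)] ts[OF f(2)] f(3) rs[OF Fr_Pi[OF f(1)]] rs[OF Fr_Pi[OF f(2)]] by simp_all
  hence e: "restrict f B = restrict f' B" using u[OF lin_closed[OF tl f(1)]] r by blast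
  show ?thesis
  proof
   fix b show "f b = f' b"
    using fun_cong[OF e, of b] FrD(2)[OF f(1), of b] FrD(2)[OF f(2), of b] by (cases "b \<in> B") simp_all
  qed
 qed
 have "\<exists>f. f \<in> Vec R B \<and> ?t f = x" if x: "x \<in> carrier M" for x
 proof -
  obtain c where c: "c \<in> B \<rightarrow>\<^sub>E carrier R" "x = (\<Oplus>\<^bsub>M\<^esub>b\<in>B. c b \<odot>\<^bsub>M\<^esub> b)" using u[OF x] by blast
  let ?f = "\<lambda>b. if b \<in> B then c b else \<zero>"
  have cc: "c b \<in> carrier R" if "b \<in> B" for b using c(1) that by blast
  hence f: "?f \<in> Vec R B" by (simp add: Fr_fin[OF B(1)])
  have "?t ?f = x" unfolding ts[OF f] c(2) by (rule M.M.finsum_cong') (use cc B(2) in auto)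
  thus ?thesis using f by blast
 qed
 then obtain g where g: "\<And>x. x \<in> carrier M \<Longrightarrow> g x \<in> Vec R B" "\<And>x. x \<in> carrier M \<Longrightarrow> ?t (g x) = x" by metis
 interpret F: Module.module R "Fr R B" by (rule FrM)
 have gt: "g (?t f) = f" if "f \<in> Vec R B" for f
  by (rule tinj) (use g that lin_closed[OF tl that] in auto)
 have gl: "lin_map R M (Fr R B) g"
 proof (rule lin_mapI)
  fix x assume x: "x \<in> carrier M"
  show "g x \<in> Vec R B" by (rule g(1)[OF x])
  show "g (x \<oplus>\<^bsub>M\<^esub> y) = g x \<oplus>\<^bsub>Fr R B\<^esub> g y" if y: "y \<in> carrier M" for y
   using gt[OF F.M.a_closed[OF g(1)[OF x] g(1)[OF y]]] lin_add[OF tl g(1)[OF x] g(1)[OF y]] g(2) x y by simp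
  show "g (r \<odot>\<^bsub>M\<^esub> x) = r \<odot>\<^bsub>Fr R B\<^esub> g x" if r: "r \<in> carrier R" for r
   using gt[OF F.smult_closed[OF r g(1)[OF x]]] lin_smult[OF tl r g(1)[OF x]] g(2) x by simp
 qed
 have "B = {}" if z: "zero_module M"
 proof (rule ccontr)
  assume "B \<noteq> {}"
  then obtain b where b: "b \<in> B" by blast
  have t0: "?t \<zero>\<^bsub>Fr R B\<^esub> = \<zero>\<^bsub>M\<^esub>" by (rule lin_zero[OF tl FrM M])
  have "?t (dl R b) = \<zero>\<^bsub>M\<^esub>" using lin_closed[OF tl dl_mem[OF b]] z unfolding zero_module_def by blast
  hence "dl R b = \<zero>\<^bsub>Fr R B\<^esub>" using tinj[OF dl_mem[OF b], of "\<zero>\<^bsub>Fr R B\<^esub>"] t0 by simp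
  hence "dl R b b = \<zero>" by (simp add: Fr_simps)
  thus False using one by (simp add: dl_def)
 qed
 thus ?thesis
  using B(1) lin_closed[OF tl] gl g(2) gt by (intro exI[of _ B] exI[of _ ?t] exI[of _ g]) simp
qed

text \<open>A vector over a finite basis is determined by the list of its coefficients. Hence a free
  complex with basis elements of any type has a copy in each of the types that the definitions
  prescribe.\<close>

lemma free_copy:
 assumes L: "free_cx R L B" and fin: "\<And>n. finite (B n)"
 shows "\<exists>(P :: ('a, ('a, 'x) univ) chain_cx) e g. cx_iso R L P e g"
proof -
 have "\<forall>n. \<exists>xs. set xs = B n" using fin finite_list by blast
 then obtain xs where xs: "\<And>n. set (xs n) = B n" by metis
 let ?e = "\<lambda>n f. map (\<lambda>b. Inl (f b) :: 'a + 'x) (xs n)"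
 have "inj_on (?e n) (L$$n)" for n
 proof
  fix f g assume f: "f \<in> L$$n" and g: "g \<in> L$$n" and e: "?e n f = ?e n g"
  have fg: "f \<in> Vec R (B n)" "g \<in> Vec R (B n)" using f g fcD(2)[OF L] by auto
  have "f b = g b" if "b \<in> B n" for b using e that xs[of n] by auto
  thus "f = g" using FrD(2)[OF fg(1)] FrD(2)[OF fg(2)] by (metis ext)
 qed
 from transport_iso[OF fcD(1)[OF L] this] show ?thesis by blast
qed

lemma copy_semi_projective:
 assumes L: "free_cx R L B" and ht: "lowers R L B ht" and i: "cx_iso R L P e g"
 shows "semi_projective R P"
proof -
 note i' = cx_isoD[OF i]
 have "projective R (P$n)" for n
  by (rule projective_iso[of _ "B n" "e n" "g n"])
   (use cxM[OF i'(2)] cm_lin[OF i'(3)] cm_lin[OF i'(4)] i'(6) fcD(2)[OF L] in auto)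
 moreover have "K_projective R P"
  unfolding K_projective_def
  using i'(2) cx_iso_hexact[OF i _ semifree_hexact[OF L ht]] acyclic_Hom_iff[OF i'(2)] acyclic_cx_iff by blast
 ultimately show ?thesis by (simp add: semi_projective_def)
qed

text \<open>The apex of the roof must live in the type attached to \<open>X\<close> and
  \<open>P\<close> together, so a further copy of \<open>L\<close> takes its place.\<close>

lemma copy_derived_iso:
 fixes X :: "('a, 'x) chain_cx" and P :: "('a, 'p) chain_cx"
 assumes L: "free_cx R L B" and fin: "\<And>n. finite (B n)" and X: "chain_complex R X" and q: "quasi_iso R L X q" and i: "cx_iso R L P e g"
 shows "derived_iso R X P"
proof -
 obtain Z :: "('a, ('a, 'x + 'p) univ) chain_cx" and e' g' where Z: "cx_iso R L Z e' g'" using free_copy[OF L fin] by blast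
 note i' = cx_isoD[OF i] and Z' = cx_isoD[OF Z]
 have "quasi_iso R Z X (\<lambda>n x. q n (g' n x))" by (rule quasi_iso_comp[OF Z'(2,1) X cx_iso_quasi_iso[OF cx_iso_sym[OF Z]] q])
 moreover have "quasi_iso R Z P (\<lambda>n x. e n (g' n x))"
  by (rule quasi_iso_comp[OF Z'(2,1) i'(2) cx_iso_quasi_iso[OF cx_iso_sym[OF Z]] cx_iso_quasi_iso[OF i]])
 ultimately show ?thesis using Z'(2) unfolding derived_iso_def by blast
qed

lemma copy_zero_module:
 assumes L: "free_cx R L B" and i: "cx_iso R L P e g" and B: "B v = {}" shows "zero_module (P$v)"
proof -
 note i' = cx_isoD[OF i]
 interpret M: Module.module R "P$v" by (rule cxM[OF i'(2)])
 have "x = \<zero>\<^bsub>P$v\<^esub>" if x: "x \<in> P$$v" for x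
 proof -
  have "g v x \<in> carrier (Fr R {})" using cm_closed[OF i'(4) x] by (simp add: fcD(2)[OF L] B)
  hence "g v x = \<zero>\<^bsub>L$v\<^esub>" using FrD(2) by (force simp: fcD(2)[OF L] Fr_simps)
  thus ?thesis using i'(6)[OF x] lin_zero[OF cm_lin[OF i'(3)] cxM[OF i'(1)] cxM[OF i'(2)]] by metis
 qed
 thus ?thesis by (auto simp: zero_module_def)
qed

end

section \<open>Projective dimension and perfection in terms of minimal complexes\<close>

text \<open>Boundedness below makes the minimal complex semi-free
  (\<open>bounded_below_lowers\<close>). If only \<open>N\<close> is known to be perfect, the Hom
  complex may fail to be a model in this sense.\<close>

definition min_model :: "('a, 'r) ring_scheme \<Rightarrow> 'a set \<Rightarrow> ('a, 'l \<Rightarrow> 'a) chain_cx \<Rightarrow> (int \<Rightarrow> 'l set) \<Rightarrow> ('a, 'x) chain_cx \<Rightarrow>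
  (int \<Rightarrow> ('l \<Rightarrow> 'a) \<Rightarrow> 'x) \<Rightarrow> bool" where
 "min_model R \<mm> L B X \<kappa> \<longleftrightarrow> free_cx R L B \<and> (\<forall>n. finite (B n)) \<and> minimal_cx R \<mm> L B \<and> (\<exists>a. \<forall>n<a. B n = {}) \<and>
  chain_complex R X \<and> quasi_iso R L X \<kappa>"

lemma mmD:
 assumes "min_model R \<mm> L B X \<kappa>"
 shows "free_cx R L B" "finite (B n)" "minimal_cx R \<mm> L B" "\<exists>a. \<forall>n<a. B n = {}" "chain_complex R X" "quasi_iso R L X \<kappa>"
 using assms by (auto simp: min_model_def)

lemma quasi_iso_exact_iff:
 assumes X: "chain_complex R X" and Y: "chain_complex R Y" and q: "quasi_iso R X Y q"
 shows "cx_exact X n \<longleftrightarrow> cx_exact Y n"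
proof -
 note q' = q[unfolded quasi_iso_iff[OF X Y]]
 note cm = conjunct1[OF q'] and inj = conjunct1[OF conjunct2[OF q'], rule_format] and surj = conjunct2[OF conjunct2[OF q'], rule_format]
 show ?thesis
  unfolding cx_exact_iff[OF X] cx_exact_iff[OF Y]
 proof (intro iffI subsetI)
  fix z assume s: "cycles Y n \<subseteq> boundaries Y n" and z: "z \<in> cycles X n"
  have "q n z \<in> boundaries Y n" by (rule subsetD[OF s cm_cycles[OF X Y cm z]])
  thus "z \<in> boundaries X n" by (rule inj[OF z])
 next
  fix y assume s: "cycles X n \<subseteq> boundaries X n" and y: "y \<in> cycles Y n"
  interpret M: Module.module R "Y$n" by (rule cxM[OF Y])
  obtain z where z: "z \<in> cycles X n" "y \<ominus>\<^bsub>Y$n\<^esub> q n z \<in> boundaries Y n" using surj[OF y] ..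
  have qz: "q n z \<in> boundaries Y n" by (rule cm_boundaries[OF cm subsetD[OF s z(1)]])
  have c: "q n z \<in> Y$$n" "y \<in> Y$$n" using cm_closed[OF cm cyclesD(1)[OF z(1)]] cyclesD(1)[OF y] by auto
  have "(y \<ominus>\<^bsub>Y$n\<^esub> q n z) \<oplus>\<^bsub>Y$n\<^esub> q n z \<in> boundaries Y n"
   by (rule submodule_addI[OF cxM[OF Y] bd_sub[OF Y] z(2) qz])
  moreover have "(y \<ominus>\<^bsub>Y$n\<^esub> q n z) \<oplus>\<^bsub>Y$n\<^esub> q n z = y" using c by (simp add: M.M.grp_simps M.M.l_neg)
  ultimately show "y \<in> boundaries Y n" by simp
 qed
qed

lemma quasi_iso_fin_gen:
 assumes X: "chain_complex R X" and Y: "chain_complex R Y" and q: "quasi_iso R X Y q" and fg: "fin_gen R (homology X n)"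
 shows "fin_gen R (homology Y n)"
proof -
 note q' = q[unfolded quasi_iso_iff[OF X Y]]
 note cm = conjunct1[OF q'] and surj = conjunct2[OF conjunct2[OF q'], rule_format]
 interpret M: Module.module R "X$n" by (rule cxM[OF X])
 interpret N: Module.module R "Y$n" by (rule cxM[OF Y])
 from fg[unfolded fin_gen_homology_iff[OF X]] obtain S where S0: "finite S \<and> S \<subseteq> cycles X n \<and>
   (\<forall>H. submodule H R (X$n) \<and> S \<subseteq> H \<and> boundaries X n \<subseteq> H \<longrightarrow> cycles X n \<subseteq> H)" ..
 note S = conjunct1[OF S0] conjunct1[OF conjunct2[OF S0]] and SH = conjunct2[OF conjunct2[OF S0], rule_format]
 note ql = cm_lin[OF cm, of n]
 show ?thesis
  unfolding fin_gen_homology_iff[OF Y]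
 proof (intro exI[of _ "q n ` S"] conjI allI impI)
  show "finite (q n ` S)" using S(1) by simp
  show "q n ` S \<subseteq> cycles Y n" using S(2) cm_cycles[OF X Y cm] by blast
  fix H assume H0: "submodule H R (Y$n) \<and> q n ` S \<subseteq> H \<and> boundaries Y n \<subseteq> H"
  note H = conjunct1[OF H0] conjunct1[OF conjunct2[OF H0]] conjunct2[OF conjunct2[OF H0]]
  note Hs = N.submoduleE[OF H(1)]
  let ?H = "{z \<in> X$$n. q n z \<in> H}"
  have "submodule ?H R (X$n)"
  proof (rule M.submoduleI)
   show "\<zero>\<^bsub>X$n\<^esub> \<in> ?H"
    using lin_zero[OF ql cxM[OF X] cxM[OF Y]] submodule_zero[OF H(1)] by simp
   show "\<ominus>\<^bsub>X$n\<^esub> a \<in> ?H" if "a \<in> ?H" for a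
    using that lin_inv[OF ql cxM[OF X] cxM[OF Y]] Hs(3) by simp
   show "a \<oplus>\<^bsub>X$n\<^esub> b \<in> ?H" if "a \<in> ?H" "b \<in> ?H" for a b
    using that lin_add[OF ql] Hs(5) by simp
   show "r \<odot>\<^bsub>X$n\<^esub> a \<in> ?H" if "r \<in> carrier R" "a \<in> ?H" for r a
    using that lin_smult[OF ql] Hs(4) by simp
  qed auto
  moreover have "S \<subseteq> ?H" using cyclesD(1)[OF subsetD[OF S(2)]] H(2) by blast
  moreover have "boundaries X n \<subseteq> ?H"
   using cm_boundaries[OF cm] H(3) M.submoduleE(1)[OF bd_sub[OF X]] by blast
  ultimately have HH: "cycles X n \<subseteq> ?H" by (intro SH conjI)
  show "cycles Y n \<subseteq> H"
  proof
   fix y assume y: "y \<in> cycles Y n"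
   obtain z where z: "z \<in> cycles X n" "y \<ominus>\<^bsub>Y$n\<^esub> q n z \<in> boundaries Y n" using surj[OF y] ..
   have qz: "q n z \<in> H" using HH z(1) by blast
   have c: "q n z \<in> Y$$n" "y \<in> Y$$n" using cm_closed[OF cm cyclesD(1)[OF z(1)]] cyclesD(1)[OF y] by auto
   have "(y \<ominus>\<^bsub>Y$n\<^esub> q n z) \<oplus>\<^bsub>Y$n\<^esub> q n z \<in> H"
    by (rule submodule_addI[OF cxM[OF Y] H(1) subsetD[OF H(3) z(2)] qz])
   moreover have "(y \<ominus>\<^bsub>Y$n\<^esub> q n z) \<oplus>\<^bsub>Y$n\<^esub> q n z = y" using c by (simp add: N.M.grp_simps N.M.l_neg)
   ultimately show "y \<in> H" by simp
  qed
 qed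
qed

lemma free_cx_exact_empty:
 assumes "cring R" "free_cx R L B" "B n = {}" shows "cx_exact L n"
proof -
 interpret cring R by (rule assms(1))
 note L = assms(2)
 have "z \<in> boundaries L n" if "z \<in> cycles L n" for z
 proof -
  have z: "z \<in> carrier (Fr R {})" using cyclesD(1)[OF that] by (simp add: fcD(2)[OF L] assms(3))
  have "z = \<zero>\<^bsub>L$n\<^esub>" using FrD(2)[OF z] by (auto simp: fcD(2)[OF L] Fr_simps)
  thus ?thesis using submodule_zero[OF bd_sub[OF fcD(1)[OF L]]] by simp
 qed
 thus ?thesis unfolding cx_exact_iff[OF fcD(1)[OF L]] by blast
qed

context noeth_local
begin

lemma one_not_zero: "\<one> \<noteq> \<zero>"
 using mm_one idp(2)[OF mm_ideal] by metis

context
 fixes L :: "('a, 'l \<Rightarrow> 'a) chain_cx" and B and X :: "('a, 'x) chain_cx" and \<kappa>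
 assumes m: "min_model R \<mm> L B X \<kappa>"
begin

lemma model_lowers: "\<exists>ht. lowers R L B ht"
proof -
 obtain a where "\<forall>n<a. B n = {}" using mmD(4)[OF m] ..
 thus ?thesis using bounded_below_lowers[OF mmD(1)[OF m], of a] by blast
qed

text \<open>Above \<open>n\<close> the identity of \<open>L\<close> has the form dh + hd, which
  minimality excludes on a basis vector.\<close>

lemma model_bound:
 assumes P: "K_projective R P" "derived_iso R X P" "\<And>v. n < v \<Longrightarrow> zero_module (P$v)" and v: "n < v"
 shows "B v = {}"
proof (rule ccontr)
 assume "B v \<noteq> {}"
 then obtain b where b: "b \<in> B v" by blast
 note L = mmD(1)[OF m]
 obtain ht where ht: "lowers R L B ht" using model_lowers ..
 obtain h where h: "(\<forall>i. lin_map R (Fr R (B i)) (Fr R (B (i + 1))) (h i)) \<and>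
  (\<forall>v>n. \<forall>x\<in>Vec R (B v). x = cx_d L (v + 1) (h v x) \<oplus>\<^bsub>Fr R (B v)\<^esub> h (v - 1) (cx_d L v x))"
  using semifree_truncated_identity[OF L ht mmD(5,6)[OF m] P] ..
 let ?x = "dl R b"
 note x = dl_mem[OF b]
 have hx: "h v ?x \<in> Vec R (B (v + 1))" by (rule lin_closed[OF conjunct1[OF h, rule_format] x])
 have dx: "cx_d L v ?x \<in> Vec R (B (v - 1))" by (rule lin_closed[OF free_cx_d[OF L refl] x])
 have hl: "lin_map R (Fr R (B (v - 1))) (Fr R (B v)) (h (v - 1))" using conjunct1[OF h, rule_format, of "v - 1"] by simp
 have mi: "cx_d L n y c \<in> \<mm>" if "y \<in> Vec R (B n)" for n y c
  using mmD(3)[OF m] that unfolding minimal_cx_def by blast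
 have e: "?x = cx_d L (v + 1) (h v ?x) \<oplus>\<^bsub>Fr R (B v)\<^esub> h (v - 1) (cx_d L v ?x)"
  using conjunct2[OF h] v x by blast
 have "cx_d L (v + 1) (h v ?x) b \<oplus> h (v - 1) (cx_d L v ?x) b = \<one>"
  using fun_cong[OF e, of b] by (simp add: Fr_simps dl_def)
 moreover have "cx_d L (v + 1) (h v ?x) b \<oplus> h (v - 1) (cx_d L v ?x) b \<noteq> \<one>"
  by (rule not_one_if_minimal[OF mm_ideal mm_one hl mi[OF hx] dx mi[OF x]])
 ultimately show False by blast
qed

lemma model_copy:
 "\<exists>P :: ('a, ('a, 'x) univ) chain_cx. semi_projective R P \<and> derived_iso R X P \<and> (\<forall>v. B v = {} \<longrightarrow> zero_module (P$v)) \<and>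
  (\<forall>v. fin_gen_free R (P$v)) \<and> (\<exists>f. quasi_iso R P X f)"
proof -
 note L = mmD(1)[OF m] and fin = mmD(2)[OF m] and X = mmD(5)[OF m] and k = mmD(6)[OF m]
 obtain ht where ht: "lowers R L B ht" using model_lowers ..
 obtain P :: "('a, ('a, 'x) univ) chain_cx" and e g where i: "cx_iso R L P e g" using free_copy[OF L fin] by blast
 note i' = cx_isoD[OF i]
 have "fin_gen_free R (P$v)" for v
  by (rule fin_gen_free_iso[OF one_not_zero fin[of v], of _ "e v" "g v"])
   (use cxM[OF i'(2)] cm_lin[OF i'(3)] cm_lin[OF i'(4)] i'(5,6) fcD(2)[OF L] in auto)
 moreover have "quasi_iso R P X (\<lambda>n x. \<kappa> n (g n x))"
  by (rule quasi_iso_comp[OF i'(2,1) X cx_iso_quasi_iso[OF cx_iso_sym[OF i]] k])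
 ultimately show ?thesis
  using copy_semi_projective[OF L ht i] copy_derived_iso[OF L fin X k i] copy_zero_module[OF L i] by blast
qed

text \<open>By \<open>model_bound\<close> no semi-projective complex does better than the minimal
  one, and the copy of the latter attains the bound.\<close>

lemma model_pd: "pd R X = Inf {ereal (real_of_int n) | n. \<forall>v>n. B v = {}}"
proof -
 have "(\<exists>P :: ('a, ('a, 'x) univ) chain_cx. semi_projective R P \<and> derived_iso R X P \<and> (\<forall>v>n. zero_module (P$v))) \<longleftrightarrow> (\<forall>v>n. B v = {})" for n
 proof
  assume "\<exists>P :: ('a, ('a, 'x) univ) chain_cx. semi_projective R P \<and> derived_iso R X P \<and> (\<forall>v>n. zero_module (P$v))"
  then obtain P :: "('a, ('a, 'x) univ) chain_cx" where P: "semi_projective R P" "derived_iso R X P" "\<forall>v>n. zero_module (P$v)" by blast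
  show "\<forall>v>n. B v = {}" using model_bound[of P n] P unfolding semi_projective_def by blast
 next
  assume b: "\<forall>v>n. B v = {}"
  obtain P :: "('a, ('a, 'x) univ) chain_cx" where P: "semi_projective R P" "derived_iso R X P" "\<forall>v. B v = {} \<longrightarrow> zero_module (P$v)"
   using model_copy by blast
  show "\<exists>P :: ('a, ('a, 'x) univ) chain_cx. semi_projective R P \<and> derived_iso R X P \<and> (\<forall>v>n. zero_module (P$v))"
   using P b by blast
 qed
 thus ?thesis by (simp add: pd_def)
qed

text \<open>A bounded complex of finitely generated free modules is isomorphic to one in coordinates
  and therefore semi-projective, so \<open>model_bound\<close> applies to it.\<close>

lemma model_perfect_bounded:
 assumes "perfect R X" shows "\<exists>n. \<forall>v>n. B v = {}"
proof -
 from conjunct2[OF assms[unfolded perfect_def]] obtain F :: "('a, ('a, 'x) univ) chain_cx" where F: "chain_complex R F \<and>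
    (\<forall>n. fin_gen_free R (F$n)) \<and> (\<exists>a b. \<forall>n. n < a \<or> b < n \<longrightarrow> zero_module (F$n)) \<and> derived_iso R X F" ..
 then obtain a b where ab: "\<And>n. n < a \<or> b < n \<Longrightarrow> zero_module (F$n)" by blast
 have Fc: "chain_complex R F" and Ff: "\<And>n. fin_gen_free R (F$n)" and XF: "derived_iso R X F" using F by blast+
 let ?P = "\<lambda>n C \<theta> \<eta>. finite (C :: ('a, 'x) univ set) \<and> (\<forall>x\<in>Vec R C. \<theta> x \<in> F$$n) \<and> lin_map R (F$n) (Fr R C) \<eta> \<and>
  (\<forall>x\<in>F$$n. \<theta> (\<eta> x) = x) \<and> (\<forall>x\<in>Vec R C. \<eta> (\<theta> x) = x) \<and> (zero_module (F$n) \<longrightarrow> C = {})"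
 have "\<forall>n. \<exists>C \<theta> \<eta>. ?P n C \<theta> \<eta>" using fin_gen_free_coordinates[OF one_not_zero Ff] by (rule allI)
 from choice[OF this] obtain C where "\<forall>n. \<exists>\<theta> \<eta>. ?P n (C n) \<theta> \<eta>" ..
 from choice[OF this] obtain \<theta> where "\<forall>n. \<exists>\<eta>. ?P n (C n) (\<theta> n) \<eta>" ..
 from choice[OF this] obtain \<eta> where C: "\<forall>n. ?P n (C n) (\<theta> n) (\<eta> n)" ..
 let ?L = "\<lparr>cx_mod = (\<lambda>n. Fr R (C n)), cx_d = (\<lambda>n x. \<eta> (n - 1) (cx_d F n (\<theta> n x)))\<rparr>"
 have L: "free_cx R ?L C" and i: "cx_iso R ?L F \<theta> \<eta>"
  by (rule free_cx_of_iso[OF Fc]; use C in simp)+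
 have "C n = {}" if "n < a" for n using ab[of n] that C by blast
 hence "semi_projective R F" using copy_semi_projective[OF L bounded_below_lowers[OF L] i] by blast
 thus ?thesis using model_bound[OF _ XF, of b] ab unfolding semi_projective_def by blast
qed

lemma model_exact_iff: "zero_module (homology X v) \<longleftrightarrow> cx_exact L v"
 using zero_homology_iff[OF mmD(5)[OF m]] quasi_iso_exact_iff[OF fcD(1)[OF mmD(1)[OF m]] mmD(5,6)[OF m]] by blast

lemma model_Dfb:
 assumes "\<forall>v>n. B v = {}" shows "Dfb R X"
proof -
 note L = mmD(1)[OF m] and fin = mmD(2)[OF m] and X = mmD(5)[OF m]
 obtain a where a: "\<forall>n<a. B n = {}" using mmD(4)[OF m] ..
 have "fin_gen R (homology X v)" for v
 proof (rule quasi_iso_fin_gen[OF fcD(1)[OF L] X mmD(6)[OF m]])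
  have "submodule (cycles L v) R (Fr R (B v))" using cyc_sub[OF fcD(1)[OF L], of v] by (simp add: fcD(2)[OF L])
  from submodule_Fr_fg[OF fin this]
  obtain S where S: "finite S \<and> S \<subseteq> cycles L v \<and> (\<forall>H. submodule H R (Fr R (B v)) \<and> S \<subseteq> H \<longrightarrow> cycles L v \<subseteq> H)" ..
  thus "fin_gen R (homology L v)"
   unfolding fin_gen_homology_iff[OF fcD(1)[OF L]] fcD(2)[OF L] by (intro exI[of _ S]) simp
 qed
 moreover have "zero_module (homology X v)" if "v < a \<or> n < v" for v
 proof -
  have "B v = {}" using that a assms by blast
  thus ?thesis unfolding model_exact_iff by (rule free_cx_exact_empty[OF is_cring L])
 qed
 ultimately show ?thesis using X unfolding Dfb_def by blast
qed

lemma model_perfect: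
 assumes n: "\<forall>v>n. B v = {}" shows "perfect R X"
proof -
 obtain a where a: "\<forall>n<a. B n = {}" using mmD(4)[OF m] ..
 obtain P :: "('a, ('a, 'x) univ) chain_cx" where P: "semi_projective R P" "derived_iso R X P"
   "\<forall>v. B v = {} \<longrightarrow> zero_module (P$v)" "\<forall>v. fin_gen_free R (P$v)"
  using model_copy by blast
 have "chain_complex R P" using P(1) K_projective_complex unfolding semi_projective_def by blast
 moreover have "\<forall>v. v < a \<or> n < v \<longrightarrow> zero_module (P$v)" using P(3) a n by blast
 ultimately show ?thesis using model_Dfb[OF n] P(2,4) unfolding perfect_def by blast
qed

text \<open>In the lowest nonzero degree everything is a cycle, while boundaries have coefficients
  in the maximal ideal. A basis vector therefore represents a nonzero class.\<close>

lemma model_hinf: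
 assumes i: "B i \<noteq> {}" "\<forall>v<i. B v = {}" shows "hinf X = ereal (real_of_int i)"
proof -
 note L = mmD(1)[OF m]
 obtain b where b: "b \<in> B i" using i(1) by blast
 have "\<not> cx_exact L i"
 proof
  assume ex: "cx_exact L i"
  have dm: "cx_d L i (dl R b) \<in> Vec R (B (i - 1))" by (rule lin_closed[OF free_cx_d[OF L refl] dl_mem[OF b]])
  have "B (i - 1) = {}" using i(2) by simp
  hence "cx_d L i (dl R b) = \<zero>\<^bsub>L$(i - 1)\<^esub>" using FrD(2)[OF dm] by (auto simp: fcD(2)[OF L] Fr_simps)
  hence "\<exists>w\<in>L$$(i + 1). cx_d L (i + 1) w = dl R b"
   by (intro cx_exactD[OF ex]) (simp_all add: fcD(2)[OF L] dl_mem[OF b])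
  then obtain w where w: "w \<in> Vec R (B (i + 1))" "cx_d L (i + 1) w = dl R b" unfolding fcD(2)[OF L] ..
  have "cx_d L (i + 1) w b \<in> \<mm>" using mmD(3)[OF m] w(1) unfolding minimal_cx_def by blast
  thus False using mm_one by (simp add: w(2) dl_def)
 qed
 moreover have "cx_exact L v" if "v < i" for v by (rule free_cx_exact_empty[OF is_cring L]) (use that i(2) in blast)
 ultimately show ?thesis
  unfolding hinf_def model_exact_iff
  by (intro antisym Inf_lower Inf_greatest) (auto, meson not_le)
qed

lemma model_nonempty:
 assumes "\<not> acyclic_cx X" shows "\<exists>v. B v \<noteq> {}"
 using assms free_cx_exact_empty[OF is_cring mmD(1)[OF m]] unfolding acyclic_cx_def model_exact_iff by blast

lemma model_pd_max:
 assumes "B n \<noteq> {}" "\<forall>v>n. B v = {}" shows "pd R X = ereal (real_of_int n)"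
 unfolding model_pd
proof (intro antisym Inf_lower Inf_greatest)
 show "ereal (real_of_int n) \<in> {ereal (real_of_int n) | n. \<forall>v>n. B v = {}}" using assms(2) by blast
 fix e assume "e \<in> {ereal (real_of_int n) | n. \<forall>v>n. B v = {}}"
 then obtain k where k: "e = ereal (real_of_int k)" "\<forall>v>k. B v = {}" by blast
 hence "n \<le> k" using assms(1) not_le by blast
 thus "ereal (real_of_int n) \<le> e" by (simp add: k(1))
qed

lemma model_min: "\<exists>v. B v \<noteq> {} \<Longrightarrow> \<exists>i. B i \<noteq> {} \<and> (\<forall>v<i. B v = {})"
proof -
 assume "\<exists>v. B v \<noteq> {}"
 then obtain v where v: "B v \<noteq> {}" ..
 obtain a where a: "\<forall>n<a. B n = {}" using mmD(4)[OF m] ..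
 have av: "a \<le> v" using a v not_le by blast
 let ?k = "LEAST k. B (a + int k) \<noteq> {}"
 have "B (a + int (nat (v - a))) \<noteq> {}" using v av by simp
 hence 1: "B (a + int ?k) \<noteq> {}" by (rule LeastI)
 have "B u = {}" if "u < a + int ?k" for u
 proof (cases "u < a")
  case False
  hence "nat (u - a) < ?k" "a + int (nat (u - a)) = u" using that by linarith+
  thus ?thesis using not_less_Least[of "nat (u - a)" "\<lambda>k. B (a + int k) \<noteq> {}"] by simp
 qed (use a in simp)
 thus ?thesis using 1 by blast
qed

lemma model_max:
 assumes "\<exists>v. B v \<noteq> {}" and n: "\<forall>v>n. B v = {}" shows "\<exists>i. B i \<noteq> {} \<and> (\<forall>v>i. B v = {})"
proof -
 obtain v where v: "B v \<noteq> {}" using assms(1) ..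
 have nv: "v \<le> n" using n v not_le by blast
 let ?k = "LEAST k. B (n - int k) \<noteq> {}"
 have "B (n - int (nat (n - v))) \<noteq> {}" using v nv by simp
 hence 1: "B (n - int ?k) \<noteq> {}" by (rule LeastI)
 have "B u = {}" if "n - int ?k < u" for u
 proof (cases "n < u")
  case False
  hence "nat (n - u) < ?k" "n - int (nat (n - u)) = u" using that by linarith+
  thus ?thesis using not_less_Least[of "nat (n - u)" "\<lambda>k. B (n - int k) \<noteq> {}"] by simp
 qed (use n in simp)
 thus ?thesis using 1 by blast
qed

end

section \<open>Minimal models of the given complexes and of RHom\<close>

lemma model_exists:
 assumes "Dfb R X"
 shows "\<exists>(F :: ('a, nat \<Rightarrow> 'a) chain_cx) B \<kappa>. min_model R \<mm> F B X \<kappa>"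
proof -
 obtain a b where X: "chain_complex R X" "\<And>n. fin_gen R (homology X n)" and ab: "\<And>n. n < a \<or> b < n \<Longrightarrow> zero_module (homology X n)"
  using assms unfolding Dfb_def by blast
 have "cx_exact X n" if "n \<le> a - 1" for n using ab[of n] that zero_homology_iff[OF X(1)] by auto
 from minimal_resolution_exists[OF X this] obtain F :: "('a, nat \<Rightarrow> 'a) chain_cx" and B \<phi> where
  "free_cx R F B \<and> (\<forall>n. finite (B n)) \<and> (\<forall>n\<le>a - 1. B n = {}) \<and> minimal_cx R \<mm> F B \<and> quasi_iso R F X \<phi>" by blast
 hence "min_model R \<mm> F B X \<phi>" unfolding min_model_def using X(1) by (auto intro!: exI[of _ a])
 thus ?thesis by blast
qed

text \<open>The map is the composite Hom(F, G) -> Hom(F, N) -> Hom(P, N), where P is the resolution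
  chosen in \<open>RHom\<close>. The first arrow uses that \<open>F\<close> is semi-free, the second
  that F and P are homotopy equivalent. Unbounded \<open>F\<close> is covered as long as every
  \<open>hB BF BG n\<close> is finite.\<close>

lemma RHom_model:
 fixes M :: "('a, 'm) chain_cx" and N :: "('a, 'n) chain_cx"
 assumes F: "min_model R \<mm> F BF M \<phi>" and G: "min_model R \<mm> G BG N \<gamma>" and fin: "\<And>n. finite (hB BF BG n)"
 shows "chain_complex R (RHom R M N) \<and> (\<exists>\<kappa>. quasi_iso R (hcx R F BF G BG) (RHom R M N) \<kappa>)"
proof -
 note Ff = mmD(1)[OF F] and Gf = mmD(1)[OF G]
 note Fc = fcD(1)[OF Ff] and Gc = fcD(1)[OF Gf] and M = mmD(5)[OF F] and N = mmD(5)[OF G]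
 let ?P = "semiproj_resolution R M"
 have "\<exists>P :: ('a, ('a, 'm) univ) chain_cx. semi_projective R P \<and> (\<exists>f. quasi_iso R P M f)" using model_copy[OF F] by blast
 from someI_ex[OF this] have P: "semi_projective R ?P" "\<exists>f. quasi_iso R ?P M f" unfolding semiproj_resolution_def by blast+
 then obtain f where f: "quasi_iso R ?P M f" by blast
 have K: "K_projective R ?P" using P(1) unfolding semi_projective_def by blast
 note Pc = K_projective_complex[OF K]
 obtain ht where ht: "lowers R F BF ht" using model_lowers[OF F] ..
 obtain u where u: "quasi_iso R ?P F u"
  using lift_quasi_iso[OF Pc Fc M mmD(6)[OF F] K_projective_hexact_cone[OF K Fc M mmD(6)[OF F]] f] ..
 obtain w where w: "htpy_inv R ?P F u w"
  using htpy_inv_exists[OF Pc Fc u K_projective_hexact_cone[OF K Pc Fc u] semifree_hexact_cone[OF Ff ht Pc Fc u]] ..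
 note H1 = hcx_iso[OF Ff Gf fin]
 note q1 = cx_iso_quasi_iso[OF H1(2)]
 note q2 = hom_post_quasi_iso[OF Fc Gc N mmD(6)[OF G] semifree_hexact_cone[OF Ff ht Gc N mmD(6)[OF G]]]
 note q3 = hom_pre_quasi_iso[OF Pc Fc N w]
 note L = fcD(1)[OF H1(1)]
 note q12 = quasi_iso_comp[OF L Hom_chain_complex[OF Fc Gc] Hom_chain_complex[OF Fc N] q1 q2]
 note q123 = quasi_iso_comp[OF L Hom_chain_complex[OF Fc N] Hom_chain_complex[OF Pc N] q12 q3]
 show ?thesis unfolding RHom_def using q123 Hom_chain_complex[OF Pc N] by blast
qed

lemma hB_finite:
 assumes fF: "\<And>n. finite (BF n)" and fG: "\<And>n. finite (BG n)" and I: "finite I" "\<And>i. i \<notin> I \<Longrightarrow> BF i = {} \<or> BG (i + n) = {}"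
 shows "finite (hB BF BG n)"
proof -
 have "hB BF BG n \<subseteq> (\<Union>i\<in>I. {i} \<times> BF i \<times> BG (i + n))" using I(2) by (auto simp: hB_def)
 moreover have "finite (\<Union>i\<in>I. {i} \<times> BF i \<times> BG (i + n))" using I(1) fF fG by blast
 ultimately show ?thesis by (rule finite_subset)
qed

lemma RHom_min_model:
 assumes F: "min_model R \<mm> F BF M \<phi>" and G: "min_model R \<mm> G BG N \<gamma>" and f: "\<forall>v>f1. BF v = {}"
 shows "(\<forall>n. finite (hB BF BG n)) \<and> (\<exists>\<kappa>. min_model R \<mm> (hcx R F BF G BG) (hB BF BG) (RHom R M N) \<kappa>)"
proof -
 obtain f0 where f0: "\<forall>n<f0. BF n = {}" using mmD(4)[OF F] ..
 obtain g0 where g0: "\<forall>n<g0. BG n = {}" using mmD(4)[OF G] ..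
 have fin: "finite (hB BF BG n)" for n
  by (rule hB_finite[OF mmD(2)[OF F] mmD(2)[OF G], of "{f0..f1}"]) (use f f0 in \<open>auto simp: not_le\<close>)
 \<comment> \<open>A matrix unit leads from a degree at most \<open>f1\<close> to a degree at least
   \<open>g0\<close>.\<close>
 have low: "\<forall>n<g0 - f1. hB BF BG n = {}"
 proof (intro allI impI)
  fix n assume n: "n < g0 - f1"
  have "BF i = {} \<or> BG (i + n) = {}" for i
  proof (cases "f1 < i")
   case False
   hence "i + n < g0" using n by linarith
   thus ?thesis using g0 by blast
  qed (use f in blast)
  thus "hB BF BG n = {}" by (fastforce simp: hB_def)
 qed
 obtain \<kappa> where k: "quasi_iso R (hcx R F BF G BG) (RHom R M N) \<kappa>" and c: "chain_complex R (RHom R M N)"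
  using RHom_model[OF F G fin] by blast
 have "min_model R \<mm> (hcx R F BF G BG) (hB BF BG) (RHom R M N) \<kappa>"
  unfolding min_model_def
  using hcx_iso(1)[OF mmD(1)[OF F] mmD(1)[OF G] fin] fin low c k
   hcx_minimal[OF mmD(1)[OF F] mmD(1)[OF G] fin mmD(3)[OF F] mmD(3)[OF G] mm_ideal] by blast
 thus ?thesis using fin by blast
qed

text \<open>Here boundedness of the resolution of \<open>M\<close> is the conclusion. The Hom
  complex has finite bases and vanishes above \<open>g1 - f0\<close>, its dual is exact above
  \<open>b - g0\<close>, and \<open>dual_exact_bounded\<close> yields the missing lower
  bound.\<close>

lemma RHom_bounded:
 fixes M :: "('a, 'x) chain_cx" and N :: "('a, 'y) chain_cx" and F :: "('a, 'f \<Rightarrow> 'a) chain_cx" and G :: "('a, 'g \<Rightarrow> 'a) chain_cx"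
 assumes F: "min_model R \<mm> F BF M \<phi>" and G: "min_model R \<mm> G BG N \<gamma>" and M: "Dfb R M"
  and ne: "\<exists>v. BG v \<noteq> {}" and g: "\<forall>v>g1. BG v = {}" and pd: "pd R (RHom R M N) < \<infinity>"
 shows "\<exists>n. \<forall>v>n. BF v = {}"
proof -
 note Ff = mmD(1)[OF F] and Gf = mmD(1)[OF G]
 obtain f0 where f0: "\<forall>n<f0. BF n = {}" using mmD(4)[OF F] ..
 obtain g0 where g0: "\<forall>n<g0. BG n = {}" using mmD(4)[OF G] ..
 have fin: "finite (hB BF BG n)" for n
  by (rule hB_finite[OF mmD(2)[OF F] mmD(2)[OF G], of "{f0..g1 - n}"]) (use g f0 in \<open>auto simp: not_le\<close>)
 let ?L = "hcx R F BF G BG" and ?B = "hB BF BG"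
 note L = hcx_iso(1)[OF Ff Gf fin]
 have top: "?B n = {}" if "g1 - f0 < n" for n
 proof -
  have "BF i = {} \<or> BG (i + n) = {}" for i
  proof (cases "i < f0")
   case False
   hence "g1 < i + n" using that by linarith
   thus ?thesis using g by blast
  qed (use f0 in blast)
  thus ?thesis by (fastforce simp: hB_def)
 qed
 obtain \<kappa> where k: "quasi_iso R ?L (RHom R M N) \<kappa>" and c: "chain_complex R (RHom R M N)"
  using RHom_model[OF F G fin] by blast
 from pd have "{ereal (real_of_int n) | n. \<exists>P :: ('a, ('a, int \<Rightarrow> ('a, 'x) univ \<Rightarrow> 'y) univ) chain_cx.
    semi_projective R P \<and> derived_iso R (RHom R M N) P \<and> (\<forall>v>n. zero_module (P$v))} \<noteq> {}"
  unfolding pd_def by (metis (no_types, lifting) Inf_empty less_irrefl top_ereal_def)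
 then obtain n and P :: "('a, ('a, int \<Rightarrow> ('a, 'x) univ \<Rightarrow> 'y) univ) chain_cx" where
  P: "semi_projective R P" "derived_iso R (RHom R M N) P" "\<And>v. n < v \<Longrightarrow> zero_module (P$v)" by blast
 have KP: "K_projective R P" using P(1) unfolding semi_projective_def by blast
 note Lc = fcD(1)[OF L]
 \<comment> \<open>The Hom complex may be unbounded below; the truncated identity is therefore
   obtained on a semi-free resolution of it.\<close>
 obtain S :: "('a, ('a, int \<times> 'f \<times> 'g \<Rightarrow> 'a) tree \<Rightarrow> 'a) chain_cx" and BS ht \<psi> where
  S: "free_cx R S BS" "lowers R S BS ht" "quasi_iso R S ?L \<psi>"
  using semifree_resolution_exists[OF Lc] by blast
 note Sk = quasi_iso_comp[OF fcD(1)[OF S(1)] Lc c S(3) k]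
 obtain h where h: "(\<forall>i. lin_map R (Fr R (BS i)) (Fr R (BS (i + 1))) (h i)) \<and>
  (\<forall>v>n. \<forall>x\<in>Vec R (BS v). x = cx_d S (v + 1) (h v x) \<oplus>\<^bsub>Fr R (BS v)\<^esub> h (v - 1) (cx_d S v x))"
  using semifree_truncated_identity[OF S(1,2) c Sk KP P(2,3)] ..
 obtain a b where ab: "\<And>n. n < a \<or> b < n \<Longrightarrow> zero_module (homology M n)" using M unfolding Dfb_def by blast
 have ex: "cx_exact (dual_cx R ?L ?B) i" if "b - g0 < i" for i
 proof (rule dual_hcx_exact[OF Ff Gf fin])
  show "BG j = {}" if "j < g0" for j using g0 that by blast
  show "cx_exact F j" if "i + g0 \<le> j" for j
   using ab[of j] that \<open>b - g0 < i\<close> model_exact_iff[OF F, of j] by simp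
 qed
 obtain k where k: "\<forall>i>k. ?B (- i) = {}"
  using dual_exact_bounded[OF L fin hcx_minimal[OF Ff Gf fin mmD(3)[OF F] mmD(3)[OF G] mm_ideal] top ex S
   conjunct1[OF h, rule_format] conjunct2[OF h, rule_format]] by blast
 \<comment> \<open>With a fixed basis element of \<open>G\<close> in degree \<open>j\<close>, a
   basis element of \<open>F\<close> in degree \<open>v\<close> gives a matrix unit of degree
   \<open>j - v\<close>. A lower bound for these degrees bounds \<open>F\<close> above.\<close>
 obtain j y where y: "y \<in> BG j" using ne by blast
 have "BF v = {}" if v: "k + j < v" for v
 proof (rule ccontr)
  assume "BF v \<noteq> {}"
  then obtain x where x: "x \<in> BF v" by blast
  hence "(v, x, y) \<in> ?B (- (v - j))" using y by (simp add: hB_def)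
  moreover have "?B (- (v - j)) = {}" using k v by (intro k[rule_format]) simp
  ultimately show False by blast
 qed
 thus ?thesis by blast
qed

end

theorem theorem3p2:
  fixes R :: "('a, 'r) ring_scheme"
    and M :: "('a, 'm) chain_cx"
    and N :: "('a, 'n) chain_cx"
  assumes "cring R" and "noetherian_ring R" and "local_ring R"
    and "Dfb R M" and "\<not> acyclic_cx M"
    and "Dfb R N" and "\<not> acyclic_cx N"
    and two_of_three:
      "(perfect R M \<and> perfect R N) \<or>
       (perfect R M \<and> pd R (RHom R M N) < \<infinity>) \<or>
       (perfect R N \<and> pd R (RHom R M N) < \<infinity>)"
  shows "perfect R M \<and> perfect R N \<and> pd R (RHom R M N) < \<infinity> \<and>
         perfect R (RHom R M N) \<and>
         pd R (RHom R M N) = pd R N - hinf M"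
proof -
 obtain \<mm> where "noeth_local R \<mm>" using noeth_local_exists assms(1-3) by blast
 then interpret noeth_local R \<mm> .
 obtain F :: "('a, nat \<Rightarrow> 'a) chain_cx" and BF \<phi> where F: "min_model R \<mm> F BF M \<phi>" using model_exists[OF assms(4)] by blast
 obtain G :: "('a, nat \<Rightarrow> 'a) chain_cx" and BG \<gamma> where G: "min_model R \<mm> G BG N \<gamma>" using model_exists[OF assms(6)] by blast
 note neF = model_nonempty[OF F assms(5)] and neG = model_nonempty[OF G assms(7)]
 have "(\<exists>n. \<forall>v>n. BF v = {}) \<and> (\<exists>n. \<forall>v>n. BG v = {})"
  using two_of_three
 proof (elim disjE conjE)
  assume "perfect R M" "perfect R N"
  thus ?thesis using model_perfect_bounded[OF F] model_perfect_bounded[OF G] by blast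
 next
  assume p: "perfect R M" and pd: "pd R (RHom R M N) < \<infinity>"
  obtain f1 where f1: "\<forall>v>f1. BF v = {}" using model_perfect_bounded[OF F p] ..
  obtain \<kappa> where k: "min_model R \<mm> (hcx R F BF G BG) (hB BF BG) (RHom R M N) \<kappa>" using RHom_min_model[OF F G f1] by blast
  \<comment> \<open>\<open>F\<close> is bounded, so the Hom complex is a minimal model and its top
    degree is finite. Matrix units starting at a fixed basis element of \<open>F\<close> then bound
    \<open>G\<close>.\<close>
  have "{ereal (real_of_int n) | n. \<forall>v>n. hB BF BG v = {}} \<noteq> {}"
   using pd unfolding model_pd[OF k] by (metis (no_types, lifting) Inf_empty less_irrefl top_ereal_def)
  then obtain n where n: "\<forall>v>n. hB BF BG v = {}" by blast
  obtain i x where x: "x \<in> BF i" using neF by blast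
  have "BG v = {}" if v: "n + i < v" for v
  proof (rule ccontr)
   assume "BG v \<noteq> {}"
   then obtain y where "y \<in> BG v" by blast
   hence "(i, x, y) \<in> hB BF BG (v - i)" using x by (simp add: hB_def)
   thus False using n v by auto
  qed
  thus ?thesis using f1 by blast
 next
  assume p: "perfect R N" and pd: "pd R (RHom R M N) < \<infinity>"
  obtain g1 where g1: "\<forall>v>g1. BG v = {}" using model_perfect_bounded[OF G p] ..
  show ?thesis using RHom_bounded[OF F G assms(4) neG g1 pd] g1 by blast
 qed
 then obtain f1 g1 where f1: "\<forall>v>f1. BF v = {}" and g1: "\<forall>v>g1. BG v = {}" by blast
 obtain i where i: "BF i \<noteq> {}" "\<forall>v<i. BF v = {}" using model_min[OF F neF] by blast
 obtain j where j: "BG j \<noteq> {}" "\<forall>v>j. BG v = {}" using model_max[OF G neG g1] by blast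
 obtain \<kappa> where k: "min_model R \<mm> (hcx R F BF G BG) (hB BF BG) (RHom R M N) \<kappa>" using RHom_min_model[OF F G f1] by blast
 \<comment> \<open>The top degree is reached by matrix units from the lowest degree \<open>i\<close>
   of \<open>F\<close> to the highest degree \<open>j\<close> of \<open>G\<close>. These numbers are
   \<open>hinf M\<close> and \<open>pd R N\<close>, whence the formula.\<close>
 have ne: "hB BF BG (j - i) \<noteq> {}"
 proof -
  obtain x y where "x \<in> BF i" "y \<in> BG j" using i(1) j(1) by blast
  hence "(i, x, y) \<in> hB BF BG (j - i)" by (simp add: hB_def)
  thus ?thesis by blast
 qed
 have top: "\<forall>v>j - i. hB BF BG v = {}"
 proof (intro allI impI)
  fix v assume v: "j - i < v"
  have "BF l = {} \<or> BG (l + v) = {}" for l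
  proof (cases "l < i")
   case False
   hence "j < l + v" using v by linarith
   thus ?thesis using j(2) by blast
  qed (use i(2) in blast)
  thus "hB BF BG v = {}" by (fastforce simp: hB_def)
 qed
 have "pd R (RHom R M N) = ereal (real_of_int (j - i))" by (rule model_pd_max[OF k ne top])
 moreover have "pd R N = ereal (real_of_int j)" by (rule model_pd_max[OF G j])
 moreover have "hinf M = ereal (real_of_int i)" by (rule model_hinf[OF F i])
 ultimately show ?thesis
  using model_perfect[OF F f1] model_perfect[OF G g1] model_perfect[OF k top] by simp
qed

end
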